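(* For arbitrary $i\in\{1,2,\dots,N\}$, the operator $\mathcal T^V(\boldsymbol u,\boldsymbol v;w):\mathcal F_{\boldsymbol u}\to\mathcal F_{\boldsymbol v}$ satisfies $$\Big(1-\frac wz\Big)X^{(i)}(z)\,\mathcal T^V(\boldsymbol u,\boldsymbol v;w)=\gamma^{-i}\Big(1-\gamma^{2i}\frac wz\Big)\mathcal T^V(\boldsymbol u,\boldsymbol v;w)\,X^{(i)}(z).$$
   Context: Parameters: $N\ge1$; $q,t\in\mathbb C^*$ with $|q|<1$, $q^{n/2}t^{m/2}\neq1$ for all integers $(n,m)\ne(0,0)$, and $|t^{-1}|<|q^{N-2}|$; $\gamma=(t/q)^{1/2}$. For a partition $\lambda$: $\lambda'$ is the transpose, $n(\lambda)=\sum_i(i-1)\lambda_i$, $c_\lambda=\prod_{(i,j)\in\lambda}(1-q^{\lambda_i-j}t^{\lambda'_j-i+1})$, $c'_\lambda=\prod_{(i,j)\in\lambda}(1-q^{\lambda_i-j+1}t^{\lambda'_j-i})$, $f_\lambda=(-1)^{|\lambda|}q^{n(\lambda')+|\lambda|/2}t^{-n(\lambda)-|\lambda|/2}$. Single Fock space $\mathcal F$: Heisenberg generators $a_n$ ($n\ne0$), $[a_m,a_n]=m\frac{1-q^{|m|}}{1-t^{|m|}}\delta_{m+n,0}$, vacuum $|0\rangle$ ($a_n|0\rangle=0$, $n>0$), dual vacuum $\langle0|$ ($\langle0|a_n=0$, $n<0$), $\langle0|0\rangle=1$. $\eta(z)=\exp(\sum_{n>0}\frac{1-t^{-n}}na_{-n}z^n)\exp(-\sum_{n>0}\frac{1-t^n}na_nz^{-n})$,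 $\xi(z)=\exp(-\sum_{n>0}\frac{1-t^{-n}}n\gamma^na_{-n}z^n)\exp(\sum_{n>0}\frac{1-t^n}n\gamma^na_nz^{-n})$. $\Phi_\emptyset(v)=\exp(-\sum_{n>0}\frac1n\frac1{1-q^n}a_{-n}v^n)\exp(-\sum_{n>0}\frac1n\frac{q^n}{1-q^n}a_nv^{-n})$, $\Phi^*_\emptyset(u)=\exp(\sum_{n>0}\frac1n\frac1{1-q^n}\gamma^na_{-n}u^n)\exp(\sum_{n>0}\frac1n\frac{q^n}{1-q^n}\gamma^na_nu^{-n})$. $\widehat\Phi_\lambda(v)=:\Phi_\emptyset(v)\prod_{(i,j)\in\lambda}\eta(q^{j-1}t^{-i+1}v):$, $\widehat\Phi^*_\lambda(u)=:\Phi^*_\emptyset(u)\prod_{(i,j)\in\lambda}\xi(q^{j-1}t^{-i+1}u):$ (normal ordered). $\Phi_\lambda[u,v]=u^{|\lambda|}f_\lambda^{-1}\frac{q^{n(\lambda')}}{c_\lambda}\widehat\Phi_\lambda(v)$, $\Phi^*_\lambda[u,v]=(q^{-1}u)^{-|\lambda|}\frac{q^{n(\lambda')}}{c_\lambda}\widehat\Phi^*_\lambda(v)$. Products of such operators are evaluated by normal ordering (with the scalar contraction factors continued meromorphically). Spectral parameters: $\boldsymbol u=(u_1,\dots,u_N)$, $\boldsymbol v=(v_1,\dots,v_N)$, $w$ nonzero and generic; $w_1=w$, $w'_i=\frac{u_i}{v_i}w_i$ ($1\le i\le N$), $w_{i+1}=w'_i$ ($1\le i\le N-1$). $N$-fold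 Fock spaces: $\mathcal F_{\boldsymbol u}=\mathcal F^{\otimes N}$ (carrying parameters $\boldsymbol u$), $a^{(i)}_n$ acts as $a_n$ on the $i$-th factor, $|\boldsymbol0\rangle=|0\rangle^{\otimes N}$, $\langle\boldsymbol0|=\langle0|^{\otimes N}$. $\mathcal T^V(\boldsymbol u,\boldsymbol v;w):\mathcal F_{\boldsymbol u}\to\mathcal F_{\boldsymbol v}$ is $T/\langle\boldsymbol0|T|\boldsymbol0\rangle$ with $T=\sum_{\nu^{(1)},\dots,\nu^{(N-1)}}\prod_{i=1}^{N-1}\frac{c_{\nu^{(i)}}}{c'_{\nu^{(i)}}}\;\Phi^*_{\nu^{(1)}}[v_1,w'_1]\Phi_\emptyset[u_1,w_1]\otimes\Phi^*_{\nu^{(2)}}[v_2,w'_2]\Phi_{\nu^{(1)}}[u_2,w_2]\otimes\cdots\otimes\Phi^*_\emptyset[v_N,w'_N]\Phi_{\nu^{(N-1)}}[u_N,w_N]$, sum over all partitions $\nu^{(i)}$ (understood matrix-element-wise as a power series in the $u_{i+1}/v_i$). Currents: on $\mathcal F_{\boldsymbol u}$, $\Lambda^{(i)}(z)=\exp(\sum_{n>0}\frac{1-t^{-n}}{n}(1-\gamma^{2n})\sum_{j<i}\gamma^{(j-1)n}a^{(j)}_{-n}z^n)\exp(\sum_{n>0}\frac{1-t^{-n}}{n}\gamma^{(i-1)n}a^{(i)}_{-n}z^n)\exp(-\sum_{n>0}\frac{1-t^n}{n}\gamma^{-(i-1)n}a^{(i)}_nz^{-n})$ and $X^{(k)}(z)=\sum_{1\le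 j_1<\dots<j_k\le N}u_{j_1}\cdots u_{j_k}:\Lambda^{(j_1)}(z)\Lambda^{(j_2)}((q/t)z)\cdots\Lambda^{(j_k)}((q/t)^{k-1}z):$. In the relation, $X^{(i)}$ to the left of $\mathcal T^V$ is taken with parameters $\boldsymbol v$, to the right with $\boldsymbol u$. *)

theory Defs
  imports
    "HOL-Complex_Analysis.Complex_Analysis"
    "HOL-Library.Multiset"
    "HOL-Library.Groups_Big_Fun"
    "HOL-Computational_Algebra.Formal_Power_Series"
begin

section \<open>Partitions\<close>

definition is_partition :: "nat list \<Rightarrow> bool" where
  "is_partition lam \<longleftrightarrow> sorted_wrt (\<ge>) lam \<and> 0 \<notin> set lam"

text \<open>Parts are numbered from 1: \<open>part lam i\<close> is $\lambda_i$, and it vanishes beyond the length.\<close>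

definition part :: "nat list \<Rightarrow> nat \<Rightarrow> nat" where
  "part lam i = (if 1 \<le> i \<and> i \<le> length lam then lam ! (i - 1) else 0)"

definition transp :: "nat list \<Rightarrow> nat list" where
  "transp lam = map (\<lambda>j. length (filter (\<lambda>p. j \<le> p) lam)) [1..<Suc (part lam 1)]"

definition boxes :: "nat list \<Rightarrow> (nat \<times> nat) set" where
  "boxes lam = {(i, j). 1 \<le> i \<and> i \<le> length lam \<and> 1 \<le> j \<and> j \<le> part lam i}"

definition n_stat :: "nat list \<Rightarrow> nat" where
  "n_stat lam = (\<Sum>i = 1..length lam. (i - 1) * part lam i)"


section \<open>Fock spaces and normal-ordered exponentials\<close>

text \<open>
  \<open>'k\<close> is the type of labels of creation/annihilation pairs: \<open>nat\<close> (label \<open>n\<close> for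
  $a_{-n}, a_n$, $n > 0$) for $\mathcal F$ and \<open>nat \<times> nat\<close> (label \<open>(i, n)\<close> for
  $a^{(i)}_{-n}, a^{(i)}_n$) for $\mathcal F^{\otimes N}$.
  The multiset \<open>{#k1, ..., kr#}\<close> stands for the basis vector
  $a_{-k_1} \cdots a_{-k_r} |0\rangle$, so the vacuum is \<open>{#}\<close>.  A state is given by its
  coefficients in this basis; infinitely many may be nonzero, since creation exponentials
  lead out of the finite combinations.
\<close>

type_synonym 'k state = "'k multiset \<Rightarrow> complex"

definition ket :: "'k multiset \<Rightarrow> 'k state" where
  "ket M = (\<lambda>K. if K = M then 1 else 0)"

definition creat :: "'k \<Rightarrow> 'k state \<Rightarrow> 'k state" where
  "creat k \<psi> = (\<lambda>M. if k \<in># M then \<psi> (M - {#k#}) else 0)"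

text \<open>\<open>\<kappa> k\<close> is the value of the commutator of annihilator and creator with label \<open>k\<close>;
  annihilation acts as \<open>\<kappa> k\<close> times the derivative with respect to the creator.\<close>

definition annih :: "('k \<Rightarrow> complex) \<Rightarrow> 'k \<Rightarrow> 'k state \<Rightarrow> 'k state" where
  "annih \<kappa> k \<psi> = (\<lambda>M. \<kappa> k * of_nat (Suc (count M k)) * \<psi> (add_mset k M))"

lemma annih_ket_vacuum: "annih \<kappa> k (ket {#}) = (\<lambda>_. 0)"
  by (simp add: annih_def ket_def fun_eq_iff)

lemma creat_ket: "creat k (ket M) = ket (add_mset k M)"
  by (auto simp: creat_def ket_def fun_eq_iff)

lemma heisenberg_creat: "creat k (creat l \<psi>) = creat l (creat k \<psi>)"
  by (cases "k = l") (auto simp: creat_def fun_eq_iff in_diff_count add_mset_commute)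

lemma heisenberg_annih: "annih \<kappa> k (annih \<kappa> l \<psi>) = annih \<kappa> l (annih \<kappa> k \<psi>)"
  by (cases "k = l") (auto simp: annih_def fun_eq_iff add_mset_commute)

lemma heisenberg_commutator:
  "annih \<kappa> k (creat l \<psi>) M - creat l (annih \<kappa> k \<psi>) M = (if k = l then \<kappa> k else 0) * \<psi> M"
proof (cases "k = l")
  case True
  show ?thesis
  proof (cases "l \<in># M")
    case in_M: True
    then obtain M' where "M = add_mset l M'" by (meson mset_add)
    then show ?thesis using True by (simp add: annih_def creat_def algebra_simps)
  next
    case False
    moreover from this have "count M l = 0" by (simp add: not_in_iff)
    ultimately show ?thesis using True by (simp add: annih_def creat_def)
  qed
next
  case False
  then show ?thesis by (auto simp: annih_def creat_def)
qed

text \<open>\<open>Sum_any\<close> sums the finitely many nonzero terms.  All its uses below have finite support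
  when the operators are applied to finite combinations of basis vectors.\<close>

definition exp_op :: "('k state \<Rightarrow> 'k state) \<Rightarrow> 'k state \<Rightarrow> 'k state" where
  "exp_op S \<psi> = (\<lambda>M. Sum_any (\<lambda>r::nat. (S ^^ r) \<psi> M / fact r))"

text \<open>The matrix element between $\langle M|$ (coefficient functional) and $|M'\rangle$ of
  $\exp(\sum_k A_k a_{-k}) \exp(\sum_k B_k a_k)$.\<close>

definition vop :: "('k \<Rightarrow> complex) \<Rightarrow> ('k \<Rightarrow> complex) \<Rightarrow> ('k \<Rightarrow> complex) \<Rightarrow>
    'k multiset \<Rightarrow> 'k multiset \<Rightarrow> complex" where
  "vop \<kappa> A B M M' =
     exp_op (\<lambda>\<psi> K. Sum_any (\<lambda>k. A k * creat k \<psi> K))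
       (exp_op (\<lambda>\<psi> K. Sum_any (\<lambda>k. B k * annih \<kappa> k \<psi> K)) (ket M')) M"

text \<open>\<open>Vertex A B\<close> represents the family
  $V(z) = \exp(\sum_{n>0} A_n z^n a_{-n}) \exp(\sum_{n>0} B_n z^{-n} a_n)$ on $\mathcal F$.
  The normal-ordered product of such families adds the coefficient sequences.\<close>

datatype vertex = Vertex (cre: "nat \<Rightarrow> complex") (ann: "nat \<Rightarrow> complex")

text \<open>\<open>dress E V X\<close> is $:E(z) \prod_{b \in X} V(\rho_b z):$.\<close>

definition dress :: "vertex \<Rightarrow> vertex \<Rightarrow> ('b \<Rightarrow> complex) \<Rightarrow> 'b set \<Rightarrow> vertex" where
  "dress E V \<rho> X = Vertex
     (\<lambda>n. cre E n + (\<Sum>b\<in>X. cre V n * \<rho> b ^ n))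
     (\<lambda>n. ann E n + (\<Sum>b\<in>X. ann V n / \<rho> b ^ n))"

text \<open>
  $\exp(\sum_{n>0} c_n x^n)$, continued meromorphically from a neighbourhood of $x = 0$ to
  the plane.  By the identity theorem there is at most one such continuation.

  The factors needed below always have one if $|t| \neq 1$, in particular if $N \ge 2$.
  The value 1 only concerns $N = 1$, $|t| = 1$: there the only contraction is a common
  scalar factor of the whole operator, which the normalisation by the vacuum expectation
  value removes.
\<close>

definition is_mero_cont :: "(nat \<Rightarrow> complex) \<Rightarrow> (complex \<Rightarrow> complex) \<Rightarrow> bool" where
  "is_mero_cont c F \<longleftrightarrow> F nicely_meromorphic_on UNIV \<and>
     (\<forall>\<^sub>F x in nhds 0. \<exists>s. (\<lambda>n. c (Suc n) * x ^ Suc n) sums s \<and> F x = exp s)"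

definition mero_exp :: "(nat \<Rightarrow> complex) \<Rightarrow> complex \<Rightarrow> complex" where
  "mero_exp c x = (if \<exists>F. is_mero_cont c F then (SOME F. is_mero_cont c F) x else 1)"


section \<open>Basis and matrix products on the N-fold Fock space\<close>

definition fock_basis :: "nat \<Rightarrow> (nat \<times> nat) multiset set" where
  "fock_basis N = {M. set_mset M \<subseteq> {1..N} \<times> {1..}}"

definition tensor_comp :: "nat \<Rightarrow> (nat \<times> nat) multiset \<Rightarrow> nat multiset" where
  "tensor_comp i M = image_mset snd (filter_mset (\<lambda>k. fst k = i) M)"

text \<open>Matrices of operators on $\mathcal F^{\otimes N}$ with entries in the power series in the
  bookkeeping variable $h$ explained below.\<close>

type_synonym fock_mat = "(nat \<times> nat) multiset \<Rightarrow> (nat \<times> nat) multiset \<Rightarrow> complex fps"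

text \<open>If one factor is a mode of a current, it is homogeneous for the weight $\sum n$, so
  only finitely many \<open>K\<close> contribute.\<close>

definition mat_comp :: "nat \<Rightarrow> fock_mat \<Rightarrow> fock_mat \<Rightarrow> fock_mat" where
  "mat_comp N P Q = (\<lambda>M M'. \<Sum>K \<in> {K \<in> fock_basis N. P M K * Q K M' \<noteq> 0}. P M K * Q K M')"

text \<open>A formal series $D(z) = \sum_{n \in \int} D_n z^{-n}$ of operators is represented by
  $n \mapsto D_n$.  This is $(1 - c/z) D(z)$.\<close>

definition one_minus_over_z :: "complex \<Rightarrow> (int \<Rightarrow> fock_mat) \<Rightarrow> int \<Rightarrow> fock_mat" where
  "one_minus_over_z c D = (\<lambda>n M M'. D n M M' - fps_const c * D (n - 1) M M')"


section \<open>The operators depending on q and t\<close>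

text \<open>\<open>qh\<close> and \<open>th\<close> are the chosen square roots $q^{1/2}$, $t^{1/2}$.\<close>

locale qt_setup =
  fixes q t qh th :: complex
begin

definition gam :: complex where
  "gam = th / qh"

definition c_fac :: "nat list \<Rightarrow> complex" where
  "c_fac lam = (\<Prod>(i, j)\<in>boxes lam.
     1 - q ^ (part lam i - j) * t ^ (part (transp lam) j - i + 1))"

definition c'_fac :: "nat list \<Rightarrow> complex" where
  "c'_fac lam = (\<Prod>(i, j)\<in>boxes lam.
     1 - q ^ (part lam i - j + 1) * t ^ (part (transp lam) j - i))"

definition f_fac :: "nat list \<Rightarrow> complex" where
  "f_fac lam = (-1) ^ sum_list lam *
     (q ^ n_stat (transp lam) * qh ^ sum_list lam) / (t ^ n_stat lam * th ^ sum_list lam)"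

definition kap :: "nat \<Rightarrow> complex" where
  "kap n = of_nat n * (1 - q ^ n) / (1 - t ^ n)"

definition eta :: vertex where
  "eta = Vertex (\<lambda>n. (1 - inverse t ^ n) / of_nat n)
                (\<lambda>n. - ((1 - t ^ n) / of_nat n))"

definition xi :: vertex where
  "xi = Vertex (\<lambda>n. - ((1 - inverse t ^ n) / of_nat n * gam ^ n))
               (\<lambda>n. (1 - t ^ n) / of_nat n * gam ^ n)"

definition Phi0 :: vertex where
  "Phi0 = Vertex (\<lambda>n. - (1 / of_nat n * (1 / (1 - q ^ n))))
                 (\<lambda>n. - (1 / of_nat n * (q ^ n / (1 - q ^ n))))"

definition PhiS0 :: vertex where
  "PhiS0 = Vertex (\<lambda>n. 1 / of_nat n * (1 / (1 - q ^ n)) * gam ^ n)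
                  (\<lambda>n. 1 / of_nat n * (q ^ n / (1 - q ^ n)) * gam ^ n)"

definition box_par :: "nat \<times> nat \<Rightarrow> complex" where
  "box_par = (\<lambda>(i, j). q ^ (j - 1) * inverse t ^ (i - 1))"

definition Phi_hat :: "nat list \<Rightarrow> vertex" where
  "Phi_hat lam = dress Phi0 eta box_par (boxes lam)"

definition PhiS_hat :: "nat list \<Rightarrow> vertex" where
  "PhiS_hat lam = dress PhiS0 xi box_par (boxes lam)"

definition Phi_coef :: "nat list \<Rightarrow> complex \<Rightarrow> complex" where
  "Phi_coef lam u = u ^ sum_list lam * inverse (f_fac lam) * (q ^ n_stat (transp lam) / c_fac lam)"

definition PhiS_coef :: "nat list \<Rightarrow> complex \<Rightarrow> complex" where
  "PhiS_coef lam u = inverse (inverse q * u) ^ sum_list lam * (q ^ n_stat (transp lam) / c_fac lam)"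

text \<open>
  Matrix elements of $V(x) W(y)$ on $\mathcal F$: moving the annihilators of $V(x)$ past the
  creators of $W(y)$ gives the contraction factor
  $\exp(\sum_{n>0} B^V_n A^W_n \kappa_n (y/x)^n)$ in front of $:V(x) W(y):$.
\<close>

definition vertex_prod :: "vertex \<Rightarrow> complex \<Rightarrow> vertex \<Rightarrow> complex \<Rightarrow>
    nat multiset \<Rightarrow> nat multiset \<Rightarrow> complex" where
  "vertex_prod V x W y M M' =
     mero_exp (\<lambda>n. ann V n * cre W n * kap n) (y / x) *
     vop kap (\<lambda>n. cre V n * x ^ n + cre W n * y ^ n)
             (\<lambda>n. ann V n / x ^ n + ann W n / y ^ n) M M'"

text \<open>$\Phi^*_\mu[v, w'] \, \Phi_\lambda[u, w]$\<close>

definition PhiS_Phi :: "nat list \<Rightarrow> complex \<Rightarrow> complex \<Rightarrow> nat list \<Rightarrow> complex \<Rightarrow> complex \<Rightarrow>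
    nat multiset \<Rightarrow> nat multiset \<Rightarrow> complex" where
  "PhiS_Phi mu v w' lam u w M M' =
     PhiS_coef mu v * Phi_coef lam u * vertex_prod (PhiS_hat mu) w' (Phi_hat lam) w M M'"

text \<open>\<open>wpar u v w i\<close> is $w_i$ for $i \ge 1$ (the value at 0 is irrelevant); \<open>wpar' u v w i\<close>
  is $w'_i$.\<close>

primrec wpar :: "(nat \<Rightarrow> complex) \<Rightarrow> (nat \<Rightarrow> complex) \<Rightarrow> complex \<Rightarrow> nat \<Rightarrow> complex" where
  "wpar u v w 0 = w"
| "wpar u v w (Suc i) = (if i = 0 then w else u i / v i * wpar u v w i)"

definition wpar' :: "(nat \<Rightarrow> complex) \<Rightarrow> (nat \<Rightarrow> complex) \<Rightarrow> complex \<Rightarrow> nat \<Rightarrow> complex" where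
  "wpar' u v w i = u i / v i * wpar u v w i"

text \<open>The families $(\nu^{(1)}, \dots, \nu^{(N-1)})$ with $\sum_i |\nu^{(i)}| = d$, extended by
  $\nu^{(0)} = \nu^{(N)} = \emptyset$.\<close>

definition configs :: "nat \<Rightarrow> nat \<Rightarrow> (nat \<Rightarrow> nat list) set" where
  "configs N d = {\<nu>. (\<forall>i. is_partition (\<nu> i)) \<and> (\<forall>i. i \<notin> {1..<N} \<longrightarrow> \<nu> i = []) \<and>
                     (\<Sum>i\<in>{1..<N}. sum_list (\<nu> i)) = d}"

definition T_term :: "nat \<Rightarrow> (nat \<Rightarrow> complex) \<Rightarrow> (nat \<Rightarrow> complex) \<Rightarrow> complex \<Rightarrow>
    (nat \<Rightarrow> nat list) \<Rightarrow> (nat \<times> nat) multiset \<Rightarrow> (nat \<times> nat) multiset \<Rightarrow> complex" where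
  "T_term N u v w \<nu> M M' =
     (\<Prod>i\<in>{1..<N}. c_fac (\<nu> i) / c'_fac (\<nu> i)) *
     (\<Prod>i\<in>{1..N}. PhiS_Phi (\<nu> i) (v i) (wpar' u v w i) (\<nu> (i - 1)) (u i) (wpar u v w i)
                    (tensor_comp i M) (tensor_comp i M'))"

text \<open>
  The term of $\nu$ depends on the ratios $u_{i+1}/v_i$ through the monomial
  $\prod_i (u_{i+1}/v_i)^{|\nu^{(i)}|}$ and otherwise only on $w$ and the independent ratios
  $u_i/v_i$.  Hence the matrix elements of $T$ are power series in the $u_{i+1}/v_i$ whose
  homogeneous component of degree $d$ is the finite sum over \<open>configs N d\<close>.  The variable
  $h$ of the type \<open>complex fps\<close> keeps track of $d$; in other words, $u_j$ and $v_j$ are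
  replaced by $u_j h^{j-1}$ and $v_j h^{j-1}$, which leaves $u_i/v_i$ and $w$ unchanged and turns
  $u_{i+1}/v_i$ into $h\, u_{i+1}/v_i$.
\<close>

definition T_op :: "nat \<Rightarrow> (nat \<Rightarrow> complex) \<Rightarrow> (nat \<Rightarrow> complex) \<Rightarrow> complex \<Rightarrow> fock_mat" where
  "T_op N u v w = (\<lambda>M M'. Abs_fps (\<lambda>d. \<Sum>\<nu>\<in>configs N d. T_term N u v w \<nu> M M'))"

definition TV :: "nat \<Rightarrow> (nat \<Rightarrow> complex) \<Rightarrow> (nat \<Rightarrow> complex) \<Rightarrow> complex \<Rightarrow> fock_mat" where
  "TV N u v w = (\<lambda>M M'. T_op N u v w M M' / T_op N u v w {#} {#})"

definition graded :: "(nat \<Rightarrow> complex) \<Rightarrow> nat \<Rightarrow> complex fps" where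
  "graded u j = fps_const (u j) * fps_X ^ (j - 1)"

definition Lam_cre :: "nat \<Rightarrow> complex \<Rightarrow> nat \<times> nat \<Rightarrow> complex" where
  "Lam_cre i z = (\<lambda>(j, n).
     if j < i then (1 - inverse t ^ n) / of_nat n * (1 - gam ^ (2 * n)) * gam ^ ((j - 1) * n) * z ^ n
     else if j = i then (1 - inverse t ^ n) / of_nat n * gam ^ ((i - 1) * n) * z ^ n
     else 0)"

definition Lam_ann :: "nat \<Rightarrow> complex \<Rightarrow> nat \<times> nat \<Rightarrow> complex" where
  "Lam_ann i z = (\<lambda>(j, n).
     if j = i then - ((1 - t ^ n) / of_nat n * inverse gam ^ ((i - 1) * n) * inverse z ^ n)
     else 0)"

text \<open>Matrix elements of
  $:\Lambda^{(j_1)}(z) \Lambda^{(j_2)}((q/t) z) \cdots \Lambda^{(j_k)}((q/t)^{k-1} z):$ with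
  \<open>js = [j_1, ..., j_k]\<close>.\<close>

definition Lam_prod :: "nat list \<Rightarrow> complex \<Rightarrow>
    (nat \<times> nat) multiset \<Rightarrow> (nat \<times> nat) multiset \<Rightarrow> complex" where
  "Lam_prod js z = vop (\<lambda>(i, n). kap n)
     (\<lambda>k. \<Sum>l<length js. Lam_cre (js ! l) ((q / t) ^ l * z) k)
     (\<lambda>k. \<Sum>l<length js. Lam_ann (js ! l) ((q / t) ^ l * z) k)"

text \<open>The mode $X^{(k)}_n$ in $X^{(k)}(z) = \sum_n X^{(k)}_n z^{-n}$.  Every matrix element of
  $X^{(k)}(z)$ is a Laurent polynomial in $z$, and $X^{(k)}_n$ is the residue of
  $z^{n-1} X^{(k)}(z)$ at $z = 0$.\<close>

definition X_mode :: "nat \<Rightarrow> nat \<Rightarrow> (nat \<Rightarrow> complex) \<Rightarrow> int \<Rightarrow> fock_mat" where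
  "X_mode N k u n = (\<lambda>M M'. \<Sum>J \<in> {J. J \<subseteq> {1..N} \<and> card J = k}.
     (\<Prod>j\<in>J. graded u j) *
     fps_const (residue (\<lambda>z. z powi (n - 1) * Lam_prod (sorted_list_of_set J) z M M') 0))"

end

end

theory Submission
  imports Defs
begin

text \<open>
  Write $x = 1/z$. Both sides of the relation are sums over pairs of a $k$-element set $J$ of sites
  (a summand of the current) and a family of partitions (a summand of $T$). By Wick's theorem
  (\<open>wick\<close>) such a summand of $(1 - w/z) X T$ is the expansion at $x = 0$ of a scalar rational function
  times a normal-ordered operator, and the corresponding summand of the other side is the expansion
  at $x = \infty$ of the same function (\<open>expansion_XT\<close>, \<open>expansion_TX\<close>, \<open>current_term_inversion\<close>).
  Term by term the relation fails only because these rational functions have poles besides 0 and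
  infinity, so that the two expansions differ.
  
  The rational function is a product, over the places where membership in $J$ changes, of functions
  $Y_\lambda$ or their inverses. The zeros of $Y_\lambda$ sit at the boxes that can be added to
  $\lambda$ and its poles at those that can be removed. A pole of the summand $(J, \nu)$ with
  $i \notin J$, $i + 1 \in J$ at an addable box of $\nu^{(i)}$ is matched by a pole at the same point
  of the summand where $i + 1$ is replaced by $i$ and the box is added. At this point the two
  normal-ordered operators coincide (\<open>wick_coincidence\<close>) and the residues, weighted with the hook
  products $c_\lambda$ and $c'_\lambda$ in $T$, are opposite (\<open>residue_cancellation\<close>). Hence the
  poles cancel in pairs (\<open>pole_pair\<close>, \<open>up_down_pairing\<close>), the finite sum belonging to a fixed power of
  the bookkeeping variable is entire, and by Liouville's theorem it is a polynomial whose coefficients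
  give both sides (\<open>expansions_at_0_and_infinity\<close>, \<open>main_identity_generic\<close>).
  
  This presupposes that poles of different sites do not collide. The general case follows by
  continuity after perturbing \<open>u\<close> (\<open>main_identity\<close>). The contraction factors inside $T$ consist of a
  common scalar, which the normalization removes, and a rational factor (\<open>mero_exp_contr\<close>).
\<close>

section \<open>Matrix elements of normal-ordered exponentials\<close>

text \<open>
  The matrix element of $\exp(a\,a_{-k})\exp(B\,a_k)$ for a single oscillator $k$ between occupation
  numbers \<open>m\<close> and \<open>m'\<close>, where \<open>b\<close> is the commutator times $B$: annihilate down to
  \<open>s\<close> quanta, then create up to \<open>m\<close>.
\<close>
definition mel :: "complex \<Rightarrow> complex \<Rightarrow> nat \<Rightarrow> nat \<Rightarrow> complex" where
  "mel a b m m' = (\<Sum>s\<le>m. a ^ (m - s) / fact (m - s) * of_nat (m' choose s) * b ^ (m' - s))"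

lemma mel_0 [simp]: "mel a b 0 0 = 1"
  by (simp add: mel_def)

definition cre_weight :: "('k \<Rightarrow> complex) \<Rightarrow> 'k multiset \<Rightarrow> complex" where
  "cre_weight A L = (\<Prod>k\<in>set_mset L. A k ^ count L k / fact (count L k))"

lemma cre_weight_superset:
  assumes "finite S" "set_mset L \<subseteq> S"
  shows "cre_weight A L = (\<Prod>k\<in>S. A k ^ count L k / fact (count L k))"
  unfolding cre_weight_def using assms
  by (intro prod.mono_neutral_left) (auto simp: not_in_iff)

lemma cre_weight_add: "A k * cre_weight A L = of_nat (Suc (count L k)) * cre_weight A (add_mset k L)"
proof -
  let ?S = "insert k (set_mset L)"
  let ?g = "\<lambda>L k. A k ^ count L k / fact (count L k)"
  have 1: "cre_weight A L = ?g L k * (\<Prod>j\<in>?S - {k}. ?g L j)"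
    by (subst cre_weight_superset[of ?S]) (auto simp: prod.remove[of ?S k])
  have 2: "cre_weight A (add_mset k L) = ?g (add_mset k L) k * (\<Prod>j\<in>?S - {k}. ?g (add_mset k L) j)"
    by (subst cre_weight_superset[of ?S]) (auto simp: prod.remove[of ?S k])
  have 3: "(\<Prod>j\<in>?S - {k}. ?g (add_mset k L) j) = (\<Prod>j\<in>?S - {k}. ?g L j)"
    by (rule prod.cong) auto
  show ?thesis unfolding 1 2 3 by (simp add: field_simps del: of_nat_Suc)
qed

lemma finite_submultisets: "finite {L. L \<subseteq># (M :: 'a multiset)}"
proof (induction M)
  case empty
  then show ?case by simp
next
  case (add x M)
  have "{L. L \<subseteq># add_mset x M} \<subseteq> {L. L \<subseteq># M} \<union> add_mset x ` {L. L \<subseteq># M}"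
  proof
    fix L assume L: "L \<in> {L. L \<subseteq># add_mset x M}"
    show "L \<in> {L. L \<subseteq># M} \<union> add_mset x ` {L. L \<subseteq># M}"
    proof (cases "x \<in># L")
      case True
      then obtain L' where "L = add_mset x L'" by (meson mset_add)
      with L show ?thesis by auto
    next
      case False
      have "count L y \<le> count M y" for y
        using L False by (cases "y = x") (auto simp: subseteq_mset_def not_in_iff dest: spec[of _ y])
      then show ?thesis by (auto simp: subseteq_mset_def)
    qed
  qed
  then show ?case using add by (meson finite_UnI finite_imageI finite_subset)
qed

lemma Sum_any_on:
  assumes "finite S" "\<And>x. x \<notin> S \<Longrightarrow> f x = 0"
  shows "Sum_any f = sum f S"
  using assms by (intro Sum_any.expand_superset) auto

lemma exp_creation_power:
  "((\<lambda>\<psi> K. Sum_any (\<lambda>k. A k * creat k \<psi> K)) ^^ r) \<psi> M =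
     fact r * (\<Sum>L | L \<subseteq># M \<and> size L = r. cre_weight A L * \<psi> (M - L))"
proof (induction r arbitrary: M)
  case 0
  have "{L. L \<subseteq># M \<and> size L = 0} = {{#}}" by auto
  then show ?case by (simp add: cre_weight_def)
next
  case (Suc r)
  let ?S = "\<lambda>\<psi> K. Sum_any (\<lambda>k. A k * creat k \<psi> K)"
  have fin: "finite {L. L \<subseteq># K \<and> size L = r}" for K :: "'a multiset" and r
    by (rule finite_subset[OF _ finite_submultisets[of K]]) auto
  have "(?S ^^ Suc r) \<psi> M = (\<Sum>k\<in>set_mset M. A k * (?S ^^ r) \<psi> (M - {#k#}))"
    by (simp add: Sum_any_on[of "set_mset M"] creat_def)
  also have "\<dots> = (\<Sum>k\<in>set_mset M. \<Sum>L | L \<subseteq># M - {#k#} \<and> size L = r.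
      fact r * (A k * cre_weight A L * \<psi> (M - {#k#} - L)))"
    unfolding Suc.IH by (simp add: sum_distrib_left mult_ac)
  also have "\<dots> = (\<Sum>(k, L)\<in>(SIGMA k:set_mset M. {L. L \<subseteq># M - {#k#} \<and> size L = r}).
      fact r * (A k * cre_weight A L * \<psi> (M - {#k#} - L)))"
    by (rule sum.Sigma) (auto intro: fin)
  also have "\<dots> = (\<Sum>(L, k)\<in>(SIGMA L:{L. L \<subseteq># M \<and> size L = Suc r}. set_mset L).
      fact r * (of_nat (count L k) * cre_weight A L * \<psi> (M - L)))"
  proof (rule sum.reindex_bij_witness[where i = "\<lambda>(L, k). (k, L - {#k#})" and j = "\<lambda>(k, L). (add_mset k L, k)"])
    fix a assume a: "a \<in> (SIGMA k:set_mset M. {L. L \<subseteq># M - {#k#} \<and> size L = r})"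
    obtain k L where kL: "a = (k, L)" by (cases a)
    show "(case (case a of (k, L) \<Rightarrow> (add_mset k L, k)) of (L, k) \<Rightarrow> (k, L - {#k#})) = a"
      by (auto simp: kL)
    show "(case a of (k, L) \<Rightarrow> (add_mset k L, k)) \<in> (SIGMA L:{L. L \<subseteq># M \<and> size L = Suc r}. set_mset L)"
      using a by (auto simp: kL insert_subset_eq_iff)
    show "(case (case a of (k, L) \<Rightarrow> (add_mset k L, k)) of
          (L, k) \<Rightarrow> fact r * (of_nat (count L k) * cre_weight A L * \<psi> (M - L))) =
         (case a of (k, L) \<Rightarrow> fact r * (A k * cre_weight A L * \<psi> (M - {#k#} - L)))"
      using cre_weight_add[of A k L] by (auto simp: kL)
  next
    fix b assume b: "b \<in> (SIGMA L:{L. L \<subseteq># M \<and> size L = Suc r}. set_mset L)"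
    obtain k L where kL: "b = (L, k)" by (cases b)
    from b kL have "k \<in># L" by auto
    then obtain L' where L': "L = add_mset k L'" by (meson mset_add)
    show "(case (case b of (L, k) \<Rightarrow> (k, L - {#k#})) of (k, L) \<Rightarrow> (add_mset k L, k)) = b"
      using L' by (auto simp: kL)
    show "(case b of (L, k) \<Rightarrow> (k, L - {#k#})) \<in> (SIGMA k:set_mset M. {L. L \<subseteq># M - {#k#} \<and> size L = r})"
      using b L' by (auto simp: kL insert_subset_eq_iff)
  qed
  also have "\<dots> = (\<Sum>L | L \<subseteq># M \<and> size L = Suc r. \<Sum>k\<in>set_mset L.
      fact r * (of_nat (count L k) * cre_weight A L * \<psi> (M - L)))"
    by (rule sum.Sigma[symmetric]) (auto intro: fin)
  also have "\<dots> = (\<Sum>L | L \<subseteq># M \<and> size L = Suc r. fact r * of_nat (size L) * (cre_weight A L * \<psi> (M - L)))"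
  proof (rule sum.cong[OF refl])
    fix L :: "'a multiset"
    have "(\<Sum>k\<in>set_mset L. of_nat (count L k)) = (of_nat (size L) :: complex)"
      by (simp add: size_multiset_overloaded_eq)
    moreover have "(\<Sum>k\<in>set_mset L. fact r * (of_nat (count L k) * cre_weight A L * \<psi> (M - L))) =
        (\<Sum>k\<in>set_mset L. of_nat (count L k)) * (fact r * (cre_weight A L * \<psi> (M - L)))"
      unfolding sum_distrib_right by (rule sum.cong) (auto simp: mult_ac)
    ultimately show "(\<Sum>k\<in>set_mset L. fact r * (of_nat (count L k) * cre_weight A L * \<psi> (M - L))) =
        fact r * of_nat (size L) * (cre_weight A L * \<psi> (M - L))"
      by (simp add: mult_ac)
  qed
  also have "\<dots> = fact (Suc r) * (\<Sum>L | L \<subseteq># M \<and> size L = Suc r. cre_weight A L * \<psi> (M - L))"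
    by (simp add: sum_distrib_left mult_ac)
  finally show ?case .
qed

text \<open>
  The $r$-th power of $\sum_k A_k a_{-k}$ creates every multiset of size $r$ with its multinomial
  weight, and the factor $1/r!$ turns the multinomial coefficient into \<open>cre_weight\<close>.
\<close>
lemma exp_op_creation:
  "exp_op (\<lambda>\<psi> K. Sum_any (\<lambda>k. A k * creat k \<psi> K)) \<psi> M =
     (\<Sum>L | L \<subseteq># M. cre_weight A L * \<psi> (M - L))"
proof -
  have fin: "finite {L. L \<subseteq># M}" by (rule finite_submultisets)
  have "exp_op (\<lambda>\<psi> K. Sum_any (\<lambda>k. A k * creat k \<psi> K)) \<psi> M =
     Sum_any (\<lambda>r. \<Sum>L | L \<subseteq># M \<and> size L = r. cre_weight A L * \<psi> (M - L))"
    unfolding exp_op_def exp_creation_power by simp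
  also have "\<dots> = (\<Sum>r\<in>{..size M}. \<Sum>L\<in>{L \<in> {L. L \<subseteq># M}. size L = r}. cre_weight A L * \<psi> (M - L))"
  proof (subst Sum_any_on[of "{..size M}"])
    fix r assume "r \<notin> {..size M}"
    then have "{L. L \<subseteq># M \<and> size L = r} = {}" using size_mset_mono by fastforce
    then show "(\<Sum>L | L \<subseteq># M \<and> size L = r. cre_weight A L * \<psi> (M - L)) = 0" by (simp only: sum.empty)
  qed (auto)
  also have "\<dots> = (\<Sum>L | L \<subseteq># M. cre_weight A L * \<psi> (M - L))"
    by (rule sum.group) (use fin in \<open>auto intro: size_mset_mono\<close>)
  finally show ?thesis .
qed

definition ann_weight :: "('k \<Rightarrow> complex) \<Rightarrow> 'k multiset \<Rightarrow> 'k multiset \<Rightarrow> complex" where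
  "ann_weight b K M' = (\<Prod>k\<in>set_mset M'. of_nat (count M' k choose count K k) * b k ^ (count M' k - count K k))"

lemma ann_weight_add:
  assumes "add_mset k K \<subseteq># M'"
  shows "b k * of_nat (Suc (count K k)) * ann_weight b (add_mset k K) M' =
         of_nat (count M' k - count K k) * ann_weight b K M'"
proof -
  let ?g = "\<lambda>K k. of_nat (count M' k choose count K k) * b k ^ (count M' k - count K k)"
  have k: "k \<in> set_mset M'" using assms by (meson mset_subset_eq_insertD)
  have less: "count K k < count M' k" using assms
    by (metis add_mset_add_single count_add_mset less_eq_Suc_le mset_subset_eq_count)
  have split: "ann_weight b K M' = ?g K k * (\<Prod>j\<in>set_mset M' - {k}. ?g K j)" for K
    unfolding ann_weight_def using k by (simp add: prod.remove)
  have 3: "(\<Prod>j\<in>set_mset M' - {k}. ?g (add_mset k K) j) = (\<Prod>j\<in>set_mset M' - {k}. ?g K j)"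
    by (rule prod.cong) auto
  obtain d where d: "count M' k = Suc (count K k + d)" using less less_iff_Suc_add by auto
  have "Suc (count K k) * (count M' k choose Suc (count K k)) = (count M' k - count K k) * (count M' k choose count K k)"
    by (metis binomial_absorb_comp binomial_absorption mult.commute)
  then have eq1: "of_nat (Suc (count K k)) * of_nat (count M' k choose Suc (count K k)) =
      (of_nat (count M' k - count K k) * of_nat (count M' k choose count K k) :: complex)"
    by (metis of_nat_mult)
  have eq2: "b k * b k ^ (count M' k - Suc (count K k)) = b k ^ (count M' k - count K k)"
    using d by simp
  have comm: "x * y * (z * p) = (y * z) * (x * p)" for x y z p :: complex
    by simp
  have "b k * of_nat (Suc (count K k)) * (of_nat (count M' k choose Suc (count K k)) * b k ^ (count M' k - Suc (count K k)))
      = of_nat (count M' k - count K k) * (of_nat (count M' k choose count K k) * b k ^ (count M' k - count K k))"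
    unfolding comm[of "b k"] eq1 eq2 by (rule mult.assoc)
  then show ?thesis unfolding split[of "add_mset k K"] split[of K] 3
    by (simp only: count_add_mset if_True refl mult.assoc[symmetric])
qed

lemma exp_annihilation_power:
  "((\<lambda>\<psi> K. Sum_any (\<lambda>k. B k * annih \<kappa> k \<psi> K)) ^^ r) (ket M') K =
     (if K \<subseteq># M' \<and> size M' = size K + r then fact r * ann_weight (\<lambda>k. \<kappa> k * B k) K M' else 0)"
proof (induction r arbitrary: K)
  case 0
  have "K \<subseteq># M' \<and> size M' = size K \<longleftrightarrow> K = M'" 
    by (metis mset_subset_size less_irrefl subset_mset.le_less)
  then show ?case by (simp add: ket_def ann_weight_def)
next
  case (Suc r)
  let ?S = "\<lambda>\<psi> K. Sum_any (\<lambda>k. B k * annih \<kappa> k \<psi> K)"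
  let ?w = "ann_weight (\<lambda>k. \<kappa> k * B k)"
  define P where "P = (?S ^^ r) (ket M')"
  have P: "P K = (if K \<subseteq># M' \<and> size M' = size K + r then fact r * ann_weight (\<lambda>k. \<kappa> k * B k) K M' else 0)" for K
    unfolding P_def by (rule Suc.IH)
  have "(?S ^^ Suc r) (ket M') K = Sum_any (\<lambda>k. B k * annih \<kappa> k P K)"
    by (simp add: P_def)
  also have "\<dots> = Sum_any (\<lambda>k. B k * (\<kappa> k * of_nat (Suc (count K k)) * 
      (if add_mset k K \<subseteq># M' \<and> size M' = Suc (size K) + r then fact r * ?w (add_mset k K) M' else 0)))"
    by (simp only: annih_def P size_add_mset)
  also have "\<dots> = (\<Sum>k\<in>set_mset M'. if add_mset k K \<subseteq># M' \<and> size M' = Suc (size K) + r then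
      fact r * ((\<kappa> k * B k) * of_nat (Suc (count K k)) * ?w (add_mset k K) M') else 0)"
    by (subst Sum_any_on[of "set_mset M'"])
       (auto intro!: sum.cong dest: mset_subset_eq_insertD simp del: of_nat_Suc)
  also have "\<dots> = (\<Sum>k\<in>set_mset M'. if K \<subseteq># M' \<and> size M' = size K + Suc r then
      fact r * (of_nat (count M' k - count K k) * ?w K M') else 0)"
  proof (rule sum.cong[OF refl])
    fix k assume k: "k \<in> set_mset M'"
    show "(if add_mset k K \<subseteq># M' \<and> size M' = Suc (size K) + r then
      fact r * ((\<kappa> k * B k) * of_nat (Suc (count K k)) * ?w (add_mset k K) M') else 0) =
      (if K \<subseteq># M' \<and> size M' = size K + Suc r then
      fact r * (of_nat (count M' k - count K k) * ?w K M') else 0)"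
    proof (cases "add_mset k K \<subseteq># M'")
      case True
      then have "K \<subseteq># M'" by (metis mset_subset_eqD mset_subset_eq_insertD subset_mset.less_imp_le)
      with True show ?thesis using ann_weight_add[OF True, of "\<lambda>k. \<kappa> k * B k"] by simp
    next
      case False
      have "count M' k - count K k = 0" if "K \<subseteq># M'"
      proof (rule ccontr)
        assume "count M' k - count K k \<noteq> 0"
        then have "count (add_mset k K) y \<le> count M' y" for y
          using that by (auto simp: subseteq_mset_def)
        then show False using False by (auto simp: subseteq_mset_def)
      qed
      with False show ?thesis by simp
    qed
  qed
  also have "\<dots> = (if K \<subseteq># M' \<and> size M' = size K + Suc r then
      fact r * ((\<Sum>k\<in>set_mset M'. of_nat (count M' k - count K k)) * ?w K M') else 0)"
    by (cases "K \<subseteq># M' \<and> size M' = size K + Suc r")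
       (simp_all only: sum_distrib_left sum_distrib_right if_True if_False simp_thms sum.neutral_const)
  also have "\<dots> = (if K \<subseteq># M' \<and> size M' = size K + Suc r then fact (Suc r) * ?w K M' else 0)"
  proof (cases "K \<subseteq># M' \<and> size M' = size K + Suc r")
    case True
    then obtain D where D: "M' = K + D" by (auto simp: subset_mset.le_iff_add)
    have "(\<Sum>k\<in>set_mset M'. count M' k - count K k) = (\<Sum>k\<in>set_mset M'. count D k)"
      using D by simp
    also have "\<dots> = size D" 
      unfolding size_multiset_overloaded_eq using D by (intro sum.mono_neutral_right) (auto simp: not_in_iff)
    also have "\<dots> = Suc r" using True D by simp
    finally have "(\<Sum>k\<in>set_mset M'. of_nat (count M' k - count K k)) = (of_nat (Suc r) :: complex)"
      by (metis of_nat_sum)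
    then show ?thesis using True by (simp del: of_nat_Suc) 
  next
    case False
    show ?thesis unfolding if_not_P[OF False] ..
  qed
  finally show ?case .
qed

text \<open>
  Annihilation is differentiation, so the exponential acts as a shift; expanding the shifted
  monomial gives the binomial coefficients in \<open>ann_weight\<close>.
\<close>
lemma exp_op_annihilation:
  "exp_op (\<lambda>\<psi> K. Sum_any (\<lambda>k. B k * annih \<kappa> k \<psi> K)) (ket M') K =
     (if K \<subseteq># M' then ann_weight (\<lambda>k. \<kappa> k * B k) K M' else 0)"
proof -
  have "exp_op (\<lambda>\<psi> K. Sum_any (\<lambda>k. B k * annih \<kappa> k \<psi> K)) (ket M') K =
     Sum_any (\<lambda>r. if K \<subseteq># M' \<and> size M' = size K + r then ann_weight (\<lambda>k. \<kappa> k * B k) K M' else 0)"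
    unfolding exp_op_def exp_annihilation_power by (intro arg_cong[of _ _ Sum_any] ext) simp
  also have "\<dots> = (if K \<subseteq># M' then ann_weight (\<lambda>k. \<kappa> k * B k) K M' else 0)"
  proof (subst Sum_any_on[of "{size M' - size K}"], goal_cases)
    case 3
    then show ?case using size_mset_mono[of K M'] by auto
  qed auto
  finally show ?thesis .
qed

lemma sum_submultisets_prod:
  fixes f :: "'k \<Rightarrow> nat \<Rightarrow> complex"
  assumes "finite S" "set_mset M \<subseteq> S"
  shows "(\<Sum>K | K \<subseteq># M. \<Prod>k\<in>S. f k (count K k)) = (\<Prod>k\<in>S. \<Sum>s\<le>count M k. f k s)"
proof -
  let ?to = "\<lambda>g. Abs_multiset (\<lambda>k. if k \<in> S then g k else 0)"
  have cnt: "count (?to g) = (\<lambda>k. if k \<in> S then g k else (0::nat))" for g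
    using assms(1) by (intro count_Abs_multiset) (auto elim: rev_finite_subset)
  have "(\<Prod>k\<in>S. \<Sum>s\<le>count M k. f k s) = (\<Sum>g\<in>Pi\<^sub>E S (\<lambda>k. {..count M k}). \<Prod>k\<in>S. f k (g k))"
    using assms(1) by (subst prod_sum_PiE) auto
  also have "\<dots> = (\<Sum>K | K \<subseteq># M. \<Prod>k\<in>S. f k (count K k))"
  proof (rule sum.reindex_bij_witness[where i = "\<lambda>K. restrict (count K) S" and j = ?to])
    fix g assume g: "g \<in> Pi\<^sub>E S (\<lambda>k. {..count M k})"
    show "restrict (count (?to g)) S = g"
      using g unfolding cnt by (auto simp: fun_eq_iff restrict_def PiE_def extensional_def)
    show "?to g \<in> {K. K \<subseteq># M}"
      using g by (auto simp: subseteq_mset_def cnt PiE_def Pi_def)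
    show "(\<Prod>k\<in>S. f k (count (?to g) k)) = (\<Prod>k\<in>S. f k (g k))"
      by (simp add: cnt)
  next
    fix K assume K: "K \<in> {K. K \<subseteq># M}"
    then have z: "count K k = 0" if "k \<notin> S" for k
      using assms(2) that by (metis mem_Collect_eq not_in_iff set_mset_mono subsetD)
    show "?to (restrict (count K) S) = K"
      by (rule multiset_eqI) (simp add: cnt z)
    show "restrict (count K) S \<in> Pi\<^sub>E S (\<lambda>k. {..count M k})"
      using K by (auto simp: subseteq_mset_def)
  qed
  finally show ?thesis by simp
qed

text \<open>
  Different oscillators commute, so matrix elements factor over the labels. All later
  computations with operators on Fock space go through this formula; labels outside the two
  states contribute the factor 1.
\<close>
theorem vop_eq_prod:
  assumes "finite S" "set_mset M \<subseteq> S" "set_mset M' \<subseteq> S"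
  shows "vop \<kappa> A B M M' = (\<Prod>k\<in>S. mel (A k) (\<kappa> k * B k) (count M k) (count M' k))"
proof -
  let ?b = "\<lambda>k. \<kappa> k * B k"
  let ?f = "\<lambda>k s. A k ^ (count M k - s) / fact (count M k - s) * of_nat (count M' k choose s) * ?b k ^ (count M' k - s)"
  have "vop \<kappa> A B M M' = (\<Sum>L | L \<subseteq># M. cre_weight A L * (if M - L \<subseteq># M' then ann_weight ?b (M - L) M' else 0))"
    unfolding vop_def exp_op_creation exp_op_annihilation ..
  also have "\<dots> = (\<Sum>K | K \<subseteq># M. cre_weight A (M - K) * (if K \<subseteq># M' then ann_weight ?b K M' else 0))"
    by (rule sum.reindex_bij_witness[where i = "\<lambda>K. M - K" and j = "\<lambda>K. M - K"])
       (auto simp: subset_mset.le_iff_add)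
  also have "\<dots> = (\<Sum>K | K \<subseteq># M. \<Prod>k\<in>S. ?f k (count K k))"
  proof (rule sum.cong[OF refl])
    fix K assume "K \<in> {K. K \<subseteq># M}"
    then have K: "K \<subseteq># M" by simp
    have 1: "cre_weight A (M - K) = (\<Prod>k\<in>S. A k ^ (count M k - count K k) / fact (count M k - count K k))"
      using assms by (subst cre_weight_superset[of S]) (auto dest: in_diffD)
    have 2: "(if K \<subseteq># M' then ann_weight ?b K M' else 0) =
        (\<Prod>k\<in>S. of_nat (count M' k choose count K k) * ?b k ^ (count M' k - count K k))"
    proof (cases "K \<subseteq># M'")
      case True
      then have "count K k = 0" if "k \<notin># M'" for k
        using that by (meson mset_subset_eqD not_in_iff)
      with True show ?thesis unfolding ann_weight_def using assms
        by (simp, intro prod.mono_neutral_left) (auto simp: not_in_iff)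
    next
      case False
      then obtain k where k: "count K k > count M' k" by (auto simp: subseteq_mset_def not_le)
      then have "k \<in># K" by (metis count_inI not_less_zero)
      then have "k \<in> S" using K assms(2) by (meson mset_subset_eqD subsetD)
      moreover have "count M' k choose count K k = 0" using k by (rule binomial_eq_0)
      ultimately have "(\<Prod>k\<in>S. of_nat (count M' k choose count K k) * ?b k ^ (count M' k - count K k)) = 0"
        using assms(1) by (intro prod_zero) auto
      then show ?thesis using False by simp
    qed
    show "cre_weight A (M - K) * (if K \<subseteq># M' then ann_weight ?b K M' else 0) = (\<Prod>k\<in>S. ?f k (count K k))"
      unfolding 1 2 prod.distrib[symmetric] by (rule prod.cong) (auto simp: mult_ac)
  qed
  also have "\<dots> = (\<Prod>k\<in>S. \<Sum>s\<le>count M k. ?f k s)"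
    using assms by (intro sum_submultisets_prod) auto
  also have "\<dots> = (\<Prod>k\<in>S. mel (A k) (?b k) (count M k) (count M' k))"
    by (simp add: mel_def)
  finally show ?thesis .
qed

section \<open>Wick's theorem for one oscillator\<close>

text \<open>
  In \<open>mel\<close> each untouched quantum counts 1; here it carries a factor \<open>C\<close>. This is the
  form that a product of two operators takes after normal ordering.
\<close>
definition gmel :: "complex \<Rightarrow> complex \<Rightarrow> complex \<Rightarrow> nat \<Rightarrow> nat \<Rightarrow> complex" where
  "gmel A B C m m' = (\<Sum>s\<le>m. A ^ (m - s) / fact (m - s) * of_nat (m' choose s) * B ^ (m' - s) * C ^ s)"

lemma mel_eq_gmel: "mel a b = gmel a b 1"
  by (simp add: mel_def gmel_def fun_eq_iff)

lemma gmel_0_left: "gmel A B C 0 m' = B ^ m'"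
  by (simp add: gmel_def)

lemma gmel_0_right: "gmel A B C m 0 = A ^ m / fact m"
proof -
  have "gmel A B C m 0 = (\<Sum>s\<le>m. if s = 0 then A ^ m / fact m else 0)"
    unfolding gmel_def by (rule sum.cong) (auto simp: binomial_eq_0)
  then show ?thesis by simp
qed

lemma gmel_Suc_right:
  "gmel A B C (Suc m) (Suc m') = C * gmel A B C m m' + B * gmel A B C (Suc m) m'"
proof -
  let ?a = "\<lambda>s. A ^ (Suc m - s) / fact (Suc m - s)"
  have "gmel A B C (Suc m) (Suc m') = (\<Sum>s\<le>Suc m. ?a s * of_nat (m' choose s) * (B * B ^ (m' - s)) * C ^ s
     + (if s = 0 then 0 else ?a s * of_nat (m' choose (s - 1)) * B ^ (Suc m' - s) * C ^ s))"
    unfolding gmel_def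
  proof (rule sum.cong[OF refl], goal_cases)
    case (1 s)
    show ?case
    proof (cases s)
      case (Suc r)
      have "of_nat (m' choose Suc r) * B ^ (m' - r) = of_nat (m' choose Suc r) * (B * B ^ (m' - Suc r))"
      proof (cases "Suc r \<le> m'")
        case True
        then have "m' - r = Suc (m' - Suc r)" by simp
        then show ?thesis by simp
      next
        case False
        then show ?thesis by (simp add: binomial_eq_0)
      qed
      then have "X * (of_nat (m' choose Suc r) * B ^ (m' - r)) * Y = X * (of_nat (m' choose Suc r) * (B * B ^ (m' - Suc r))) * Y" for X Y
        by simp
      from this[of "A ^ (m - r) / fact (m - r)" "C * C ^ r"]
      show ?thesis by (simp add: Suc ring_distribs mult_ac add_divide_distrib)
    qed simp
  qed
  also have "\<dots> = B * gmel A B C (Suc m) m' + 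
      (\<Sum>s\<le>Suc m. if s = 0 then 0 else ?a s * of_nat (m' choose (s - 1)) * B ^ (Suc m' - s) * C ^ s)"
    by (simp only: sum.distrib gmel_def sum_distrib_left) (simp add: mult_ac)
  also have "(\<Sum>s\<le>Suc m. if s = 0 then 0 else ?a s * of_nat (m' choose (s - 1)) * B ^ (Suc m' - s) * C ^ s) =
      C * gmel A B C m m'"
    by (subst sum.atMost_Suc_shift) (simp add: gmel_def sum_distrib_left mult_ac)
  finally show ?thesis by simp
qed

lemma gmel_Suc_left:
  "of_nat (Suc m) * gmel A B C (Suc m) j = A * gmel A B C m j + C * of_nat j * gmel A B C m (j - 1)"
proof -
  let ?t = "\<lambda>s. A ^ (Suc m - s) / fact (Suc m - s) * of_nat (j choose s) * B ^ (j - s) * C ^ s"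
  have "of_nat (Suc m) * gmel A B C (Suc m) j = (\<Sum>s\<le>Suc m. of_nat (Suc m - s) * ?t s + of_nat s * ?t s)"
    unfolding gmel_def sum_distrib_left
  proof (rule sum.cong[OF refl], goal_cases)
    case (1 s)
    then have "(of_nat (Suc m) :: complex) = of_nat (Suc m - s) + of_nat s"
      by (simp flip: of_nat_add del: of_nat_Suc)
    then show ?case by (simp only: distrib_right)
  qed
  also have "\<dots> = (\<Sum>s\<le>m. of_nat (Suc m - s) * ?t s) + (\<Sum>s\<le>m. of_nat (Suc s) * ?t (Suc s))"
    by (simp only: sum.distrib sum.atMost_Suc_shift[of "\<lambda>s. of_nat s * ?t s"]) simp
  also have "(\<Sum>s\<le>m. of_nat (Suc m - s) * ?t s) = A * gmel A B C m j"
    unfolding gmel_def sum_distrib_left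
  proof (rule sum.cong[OF refl], goal_cases)
    case (1 s)
    then have "Suc m - s = Suc (m - s)" by auto
    then show ?case by (simp add: field_simps del: of_nat_Suc)
  qed
  also have "(\<Sum>s\<le>m. of_nat (Suc s) * ?t (Suc s)) = C * of_nat j * gmel A B C m (j - 1)"
    unfolding gmel_def sum_distrib_left
  proof (rule sum.cong[OF refl], goal_cases)
    case (1 s)
    have "Suc s * (j choose Suc s) = j * ((j - 1) choose s)"
      by (cases j) (simp_all only: binomial_absorption diff_Suc_1 binomial_0_Suc mult_0_right mult_0)
    then have "of_nat (Suc s) * of_nat (j choose Suc s) = (of_nat j * of_nat ((j - 1) choose s) :: complex)"
      by (metis of_nat_mult)
    then have "X * (of_nat (Suc s) * of_nat (j choose Suc s)) * Y = X * (of_nat j * of_nat ((j - 1) choose s)) * Y" for X Y :: complex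
      by simp
    from this[of "A ^ (m - s) / fact (m - s)" "B ^ (j - Suc s) * C ^ Suc s"]
    show ?case by (simp add: mult_ac del: of_nat_Suc)
  qed
  finally show ?thesis .
qed

lemma sums_shift_right:
  assumes "f sums (l :: complex)"
  shows "(\<lambda>j. if j = 0 then 0 else f (j - 1)) sums l"
  using sums_Suc[of "\<lambda>j. if j = 0 then 0 else f (j - 1)" l] assms by simp

text \<open>
  Summing over the occupation number $j$ of the intermediate state produces the contraction
  factor and the matrix element of the normal-ordered product. Both sides satisfy the same
  recurrences in \<open>m\<close> and \<open>m'\<close>, which reduces the claim to the exponential series.
\<close>
lemma one_label_wick:
  "(\<lambda>j. mel a b m j * mel a' b' j m' * \<sigma> ^ j) sums
     (exp (b * a' * \<sigma>) * gmel (a + a' * \<sigma>) (b * \<sigma> + b') \<sigma> m m')"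
  unfolding mel_eq_gmel
proof (induction m' arbitrary: m)
  case 0
  show ?case
  proof (induction m)
    case 0
    have "(\<lambda>j. (b * a' * \<sigma>) ^ j /\<^sub>R fact j) sums exp (b * a' * \<sigma>)"
      by (rule exp_converges)
    then show ?case
      by (simp add: gmel_0_left gmel_0_right power_mult_distrib field_simps scaleR_conv_of_real)
  next
    case (Suc m)
    let ?E = "exp (b * a' * \<sigma>)"
    let ?L = "?E * gmel (a + a' * \<sigma>) (b * \<sigma> + b') \<sigma> m 0"
    have "(\<lambda>j. a * (gmel a b 1 m j * gmel a' b' 1 j 0 * \<sigma> ^ j) + a' * \<sigma> *
        (if j = 0 then 0 else gmel a b 1 m (j - 1) * gmel a' b' 1 (j - 1) 0 * \<sigma> ^ (j - 1)))
       sums (a * ?L + a' * \<sigma> * ?L)"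
      by (intro sums_add sums_mult sums_shift_right[of "\<lambda>j. gmel a b 1 m j * gmel a' b' 1 j 0 * \<sigma> ^ j"] Suc)
    then have "(\<lambda>j. inverse (of_nat (Suc m)) * (a * (gmel a b 1 m j * gmel a' b' 1 j 0 * \<sigma> ^ j) + a' * \<sigma> *
        (if j = 0 then 0 else gmel a b 1 m (j - 1) * gmel a' b' 1 (j - 1) 0 * \<sigma> ^ (j - 1))))
       sums (inverse (of_nat (Suc m)) * (a * ?L + a' * \<sigma> * ?L))"
      by (rule sums_mult)
    also have "inverse (of_nat (Suc m)) * (a * ?L + a' * \<sigma> * ?L) = ?E * gmel (a + a' * \<sigma>) (b * \<sigma> + b') \<sigma> (Suc m) 0"
      by (simp add: gmel_0_right field_simps del: of_nat_Suc)
    also have "(\<lambda>j. inverse (of_nat (Suc m)) * (a * (gmel a b 1 m j * gmel a' b' 1 j 0 * \<sigma> ^ j) + a' * \<sigma> *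
        (if j = 0 then 0 else gmel a b 1 m (j - 1) * gmel a' b' 1 (j - 1) 0 * \<sigma> ^ (j - 1)))) =
        (\<lambda>j. gmel a b 1 (Suc m) j * gmel a' b' 1 j 0 * \<sigma> ^ j)"
    proof (rule ext)
      fix j
      have "gmel a b 1 (Suc m) j = inverse (of_nat (Suc m)) * (a * gmel a b 1 m j + of_nat j * gmel a b 1 m (j - 1))"
        using gmel_Suc_left[of m a b 1 j] by (simp add: field_simps del: of_nat_Suc)
      then show "inverse (of_nat (Suc m)) * (a * (gmel a b 1 m j * gmel a' b' 1 j 0 * \<sigma> ^ j) + a' * \<sigma> *
        (if j = 0 then 0 else gmel a b 1 m (j - 1) * gmel a' b' 1 (j - 1) 0 * \<sigma> ^ (j - 1))) =
        gmel a b 1 (Suc m) j * gmel a' b' 1 j 0 * \<sigma> ^ j"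
        by (cases j) (simp_all add: gmel_0_right field_simps del: of_nat_Suc)
    qed
    finally show ?case .
  qed
next
  case (Suc m')
  let ?E = "exp (b * a' * \<sigma>)"
  let ?G = "gmel (a + a' * \<sigma>) (b * \<sigma> + b') \<sigma>"
  let ?f = "\<lambda>m j. gmel a b 1 m j * gmel a' b' 1 j m' * \<sigma> ^ j"
  define R where "R = (\<lambda>m j. (if m = 0 then 0 else gmel a b 1 (m - 1) j) + b * gmel a b 1 m j)"
  have R: "gmel a b 1 m (Suc j) = R m j" for m j
    by (cases m) (simp_all add: R_def gmel_0_left gmel_Suc_right)
  have "(\<lambda>j. (if m = 0 then 0 else ?f (m - 1) j) + b * ?f m j) sums
      ((if m = 0 then 0 else ?E * ?G (m - 1) m') + b * (?E * ?G m m'))"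
    by (intro sums_add sums_mult Suc) (auto intro: Suc)
  then have 1: "(\<lambda>j. R m j * gmel a' b' 1 j m' * \<sigma> ^ j) sums
      ((if m = 0 then 0 else ?E * ?G (m - 1) m') + b * (?E * ?G m m'))"
    by (rule back_subst[where P = "\<lambda>h. h sums _"]) (auto simp: R_def algebra_simps)
  have "(\<lambda>j. \<sigma> * (if j = 0 then 0 else R m (j - 1) * gmel a' b' 1 (j - 1) m' * \<sigma> ^ (j - 1)) + b' * ?f m j) sums
      (\<sigma> * ((if m = 0 then 0 else ?E * ?G (m - 1) m') + b * (?E * ?G m m')) + b' * (?E * ?G m m'))"
    by (intro sums_add sums_mult sums_shift_right[OF 1] Suc)
  also have "(\<lambda>j. \<sigma> * (if j = 0 then 0 else R m (j - 1) * gmel a' b' 1 (j - 1) m' * \<sigma> ^ (j - 1)) + b' * ?f m j) =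
      (\<lambda>j. gmel a b 1 m j * gmel a' b' 1 j (Suc m') * \<sigma> ^ j)"
  proof (rule ext)
    fix j
    show "\<sigma> * (if j = 0 then 0 else R m (j - 1) * gmel a' b' 1 (j - 1) m' * \<sigma> ^ (j - 1)) + b' * ?f m j =
      gmel a b 1 m j * gmel a' b' 1 j (Suc m') * \<sigma> ^ j"
      by (cases j) (simp_all add: gmel_0_left gmel_Suc_right R[symmetric] algebra_simps)
  qed
  also have "(\<sigma> * ((if m = 0 then 0 else ?E * ?G (m - 1) m') + b * (?E * ?G m m')) + b' * (?E * ?G m m')) =
      ?E * ?G m (Suc m')"
    by (cases m) (simp_all add: gmel_0_left gmel_Suc_right algebra_simps)
  finally show ?case .
qed

section \<open>Exponentials of power series near the origin\<close>

text \<open>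
  \<open>f\<close> is near 0 the exponential of $\sum_{n>0} s_n x^n/n$. Contractions of vertex operators are
  given by such sequences $s$, and rational functions with value 1 at 0 have sums of $n$-th powers
  as $s_n$, so identities between functions become identities between power sums.
\<close>
definition exp_series :: "(complex \<Rightarrow> complex) \<Rightarrow> (nat \<Rightarrow> complex) \<Rightarrow> bool" where
  "exp_series f s \<longleftrightarrow> (\<forall>\<^sub>F x in nhds 0. \<exists>\<sigma>. (\<lambda>n. s (Suc n) / of_nat (Suc n) * x ^ Suc n) sums \<sigma> \<and> f x = exp \<sigma>)"

lemma exp_series_cong:
  assumes "exp_series f s" "\<forall>\<^sub>F x in nhds 0. f x = g x" "\<And>n. n \<ge> 1 \<Longrightarrow> s n = s' n"
  shows "exp_series g s'"
proof -
  have eq: "s (Suc n) = s' (Suc n)" for n by (rule assms(3)) simp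
  show ?thesis using assms(1,2) unfolding exp_series_def by eventually_elim (simp add: eq)
qed

lemma exp_series_one: "exp_series (\<lambda>_. 1) (\<lambda>_. 0)"
  unfolding exp_series_def by (intro always_eventually allI exI[of _ 0]) simp

lemma exp_series_mult:
  assumes "exp_series f s" "exp_series g s'"
  shows "exp_series (\<lambda>x. f x * g x) (\<lambda>n. s n + s' n)"
  using assms unfolding exp_series_def
proof eventually_elim
  case (elim x)
  then obtain \<sigma> \<tau> where "(\<lambda>n. s (Suc n) / of_nat (Suc n) * x ^ Suc n) sums \<sigma>" "f x = exp \<sigma>"
    "(\<lambda>n. s' (Suc n) / of_nat (Suc n) * x ^ Suc n) sums \<tau>" "g x = exp \<tau>" by blast
  then show ?case
    by (intro exI[of _ "\<sigma> + \<tau>"]) (use sums_add[of _ \<sigma> _ \<tau>] in \<open>auto simp: exp_add add_divide_distrib distrib_right\<close>)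
qed

lemma exp_series_inverse:
  assumes "exp_series f s"
  shows "exp_series (\<lambda>x. inverse (f x)) (\<lambda>n. - s n)"
  using assms unfolding exp_series_def
proof eventually_elim
  case (elim x)
  then obtain \<sigma> where "(\<lambda>n. s (Suc n) / of_nat (Suc n) * x ^ Suc n) sums \<sigma>" "f x = exp \<sigma>" by blast
  then show ?case
    by (intro exI[of _ "- \<sigma>"]) (use sums_minus[of _ \<sigma>] in \<open>auto simp: exp_minus\<close>)
qed

lemma exp_series_prod:
  assumes "\<And>i. i \<in> I \<Longrightarrow> exp_series (f i) (s i)"
  shows "exp_series (\<lambda>x. \<Prod>i\<in>I. f i x) (\<lambda>n. \<Sum>i\<in>I. s i n)"
  using assms
proof (induction I rule: infinite_finite_induct)
  case (insert i I)
  then show ?case using exp_series_mult[of "f i" "s i" "\<lambda>x. \<Prod>i\<in>I. f i x" "\<lambda>n. \<Sum>i\<in>I. s i n"] by simp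
qed (simp_all add: exp_series_one)

lemma exp_series_scale:
  assumes "exp_series f s"
  shows "exp_series (\<lambda>x. f (c * x)) (\<lambda>n. c ^ n * s n)"
proof -
  have "filterlim (\<lambda>x. c * x) (nhds 0) (nhds (0::complex))"
    using tendsto_mult[OF tendsto_const[of c "nhds 0"] filterlim_ident[of "nhds 0"]] by simp
  from eventually_compose_filterlim[OF assms[unfolded exp_series_def] this]
  show ?thesis unfolding exp_series_def
    by eventually_elim (simp add: power_mult_distrib mult_ac)
qed

lemma exp_series_linear: "exp_series (\<lambda>x. 1 - c * x) (\<lambda>n. - (c ^ n))"
proof -
  have 1: "exp_series (\<lambda>x. 1 - x) (\<lambda>n. - 1)"
  proof -
    have "\<forall>\<^sub>F x in nhds (0::complex). x \<in> ball 0 1"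
      by (rule eventually_nhds_in_open) auto
    then show ?thesis unfolding exp_series_def
    proof eventually_elim
      case (elim x)
      then have n: "norm (- x) < 1" by simp
      have "(\<lambda>n. - (x ^ n) / of_nat n) sums ln (1 + - x)"
        using Ln_series'[OF n] by simp
      from sums_Suc_iff[THEN iffD2, of "\<lambda>n. - (x ^ n) / of_nat n" "ln (1 + - x)"] this
      have "(\<lambda>n. - (x ^ Suc n) / of_nat (Suc n)) sums ln (1 + - x)" by simp
      moreover have "1 - x \<noteq> 0" using n by auto
      ultimately show ?case by (intro exI[of _ "ln (1 + - x)"]) (simp add: mult_ac)
    qed
  qed
  show ?thesis using exp_series_scale[OF 1, of c] by simp
qed

lemma exp_series_fps:
  assumes "exp_series f s"
  shows "f has_fps_expansion (fps_exp 1 oo Abs_fps (\<lambda>n. s n / of_nat n))"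
proof -
  let ?G = "Abs_fps (\<lambda>n. s n / of_nat n)"
  have "\<forall>\<^sub>F x in nhds 0. \<exists>\<sigma>. (\<lambda>n. s n / of_nat n * x ^ n) sums \<sigma> \<and> f x = exp \<sigma>"
    using assms unfolding exp_series_def
  proof eventually_elim
    case (elim x)
    then obtain \<sigma> where "(\<lambda>n. s (Suc n) / of_nat (Suc n) * x ^ Suc n) sums \<sigma>" "f x = exp \<sigma>" by blast
    then show ?case using sums_Suc[of "\<lambda>n. s n / of_nat n * x ^ n" \<sigma>] by (intro exI[of _ \<sigma>]) auto
  qed
  then have ev: "\<forall>\<^sub>F x in nhds 0. (\<lambda>n. fps_nth ?G n * x ^ n) sums (suminf (\<lambda>n. fps_nth ?G n * x ^ n)) \<and> f x = exp (suminf (\<lambda>n. fps_nth ?G n * x ^ n))"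
    by eventually_elim (auto simp: sums_iff)
  have g: "(\<lambda>x. suminf (\<lambda>n. fps_nth ?G n * x ^ n)) has_fps_expansion ?G"
    by (rule has_fps_expansionI) (use ev in eventually_elim, auto)
  have "(exp \<circ> (\<lambda>x. suminf (\<lambda>n. fps_nth ?G n * x ^ n))) has_fps_expansion (fps_exp 1 oo ?G)"
    by (rule has_fps_expansion_compose[OF has_fps_expansion_exp1 g]) simp
  moreover have "\<forall>\<^sub>F x in nhds 0. (exp \<circ> (\<lambda>x. suminf (\<lambda>n. fps_nth ?G n * x ^ n))) x = f x"
    using ev by eventually_elim auto
  ultimately show ?thesis unfolding has_fps_expansion_def
    by (auto elim: eventually_elim2)
qed

lemma fps_compose_nth_cong:
  fixes F G1 G2 :: "complex fps"
  assumes "\<And>i. i \<le> p \<Longrightarrow> fps_nth G1 i = fps_nth G2 i"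
  shows "fps_nth (F oo G1) p = fps_nth (F oo G2) p"
proof -
  have "fps_nth (G1 ^ k) i = fps_nth (G2 ^ k) i" if "i \<le> p" for k i
    using that
  proof (induction k arbitrary: i)
    case (Suc k)
    then show ?case using assms by (simp add: fps_mult_nth)
  qed simp
  then show ?thesis by (simp add: fps_compose_nth)
qed

section \<open>Generating functions over multisets\<close>

definition mwt :: "('k \<Rightarrow> nat) \<Rightarrow> 'k multiset \<Rightarrow> nat" where
  "mwt wt K = (\<Sum>k\<in>#K. wt k)"

lemma mwt_simps [simp]: "mwt wt {#} = 0" "mwt wt (add_mset k K) = wt k + mwt wt K"
  "mwt wt (K + L) = mwt wt K + mwt wt L"
  by (simp_all add: mwt_def)

lemma mwt_eq_sum:
  assumes "finite S" "set_mset K \<subseteq> S"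
  shows "mwt wt K = (\<Sum>k\<in>S. count K k * wt k)"
  using assms(2)
proof (induction K)
  case (add x K)
  have "(\<Sum>k\<in>S. count (add_mset x K) k * wt k) = (\<Sum>k\<in>S. count K k * wt k + (if k = x then wt k else 0))"
    by (rule sum.cong) auto
  then show ?case using add assms(1) by (simp add: sum.distrib)
qed simp

lemma finite_weight_sets:
  assumes "finite Lab" "\<And>k. k \<in> Lab \<Longrightarrow> wt k > 0"
  shows "finite {K. set_mset K \<subseteq> Lab \<and> mwt wt K = p}"
proof (rule finite_subset[OF _ finite_submultisets[of "repeat_mset p (mset_set Lab)"]], safe)
  fix K assume K: "set_mset K \<subseteq> Lab" "p = mwt wt K"
  show "K \<subseteq># repeat_mset (mwt wt K) (mset_set Lab)"
    unfolding subseteq_mset_def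
  proof
    fix k
    show "count K k \<le> count (repeat_mset (mwt wt K) (mset_set Lab)) k"
    proof (cases "k \<in> Lab")
      case True
      have "count K k \<le> count K k * wt k" using assms(2)[OF True] by simp
      also have "\<dots> \<le> (\<Sum>k\<in>Lab. count K k * wt k)"
        using True assms(1) by (intro member_le_sum) auto
      also have "\<dots> = mwt wt K" using mwt_eq_sum[OF assms(1) K(1)] by simp
      finally show ?thesis using True assms(1) by simp
    next
      case False
      then show ?thesis using K(1) by (metis not_in_iff subsetD zero_le)
    qed
  qed
qed

lemma has_fps_expansion_power_arg:
  assumes "n > 0" "\<And>\<sigma>. (\<lambda>j. f j * \<sigma> ^ j) sums (F \<sigma> :: complex)"
  shows "(\<lambda>x. F (x ^ n)) has_fps_expansion Abs_fps (\<lambda>i. if n dvd i then f (i div n) else 0)"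
proof (rule has_fps_expansionI, rule always_eventually, rule allI)
  fix u :: complex
  have "strict_mono (\<lambda>j. n * j)" using assms(1) by (auto simp: strict_mono_def)
  moreover have "fps_nth (Abs_fps (\<lambda>i. if n dvd i then f (i div n) else 0)) i * u ^ i = 0" if "i \<notin> range (\<lambda>j. n * j)" for i
    using that by auto
  moreover have "(\<lambda>j. fps_nth (Abs_fps (\<lambda>i. if n dvd i then f (i div n) else 0)) (n * j) * u ^ (n * j)) sums F (u ^ n)"
    using assms(2)[of "u ^ n"] assms(1) by (simp add: power_mult)
  ultimately show "(\<lambda>i. fps_nth (Abs_fps (\<lambda>i. if n dvd i then f (i div n) else 0)) i * u ^ i) sums F (u ^ n)"
    by (rule sums_mono_reindex[THEN iffD1])
qed

text \<open>
  Expanding a product of power series over the labels is the same as summing over multisets of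
  labels; the substitution $x^{wt(k)}$ makes every coefficient a finite sum.
\<close>
lemma weighted_product_expansion:
  assumes "finite Lab" "\<And>k. k \<in> Lab \<Longrightarrow> wt k > 0"
    and "\<And>k \<sigma>. k \<in> Lab \<Longrightarrow> (\<lambda>j. f k j * \<sigma> ^ j) sums (F k \<sigma> :: complex)"
  shows "(\<lambda>x. \<Prod>k\<in>Lab. F k (x ^ wt k)) has_fps_expansion
     Abs_fps (\<lambda>p. \<Sum>K | set_mset K \<subseteq> Lab \<and> mwt wt K = p. \<Prod>k\<in>Lab. f k (count K k))"
  using assms
proof (induction Lab rule: finite_induct)
  case empty
  have "{K. set_mset K \<subseteq> {} \<and> mwt wt K = p} = (if p = 0 then {{#}} else {})" for p by auto
  then have "Abs_fps (\<lambda>p. \<Sum>K | set_mset K \<subseteq> {} \<and> mwt wt K = p. \<Prod>k\<in>{}. f k (count K k)) = (1 :: complex fps)"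
    by (intro fps_ext) auto
  then show ?case by simp
next
  case (insert k Lab)
  let ?W = "\<lambda>Lab p. \<Sum>K | set_mset K \<subseteq> Lab \<and> mwt wt K = p. \<Prod>k\<in>Lab. f k (count K k)"
  let ?P = "Abs_fps (\<lambda>i. if wt k dvd i then f k (i div wt k) else 0)"
  have fin: "finite {K. set_mset K \<subseteq> Lab \<and> mwt wt K = p}" for p
    using insert by (intro finite_weight_sets) auto
  have IH: "(\<lambda>x. \<Prod>k\<in>Lab. F k (x ^ wt k)) has_fps_expansion Abs_fps (?W Lab)"
    using insert by blast
  have one: "(\<lambda>x. F k (x ^ wt k)) has_fps_expansion ?P"
    using insert by (intro has_fps_expansion_power_arg) auto
  have wk: "wt k > 0" using insert by auto
  have "?P * Abs_fps (?W Lab) = Abs_fps (?W (insert k Lab))"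
  proof (rule fps_ext)
    fix p
    have "fps_nth (?P * Abs_fps (?W Lab)) p = (\<Sum>i\<in>{i. i \<le> p \<and> wt k dvd i}. f k (i div wt k) * ?W Lab (p - i))"
      unfolding fps_mult_nth by (rule sum.mono_neutral_cong_right) auto
    also have "\<dots> = (\<Sum>i\<in>{i. i \<le> p \<and> wt k dvd i}. \<Sum>K | set_mset K \<subseteq> Lab \<and> mwt wt K = p - i.
        f k (i div wt k) * (\<Prod>k\<in>Lab. f k (count K k)))"
      by (simp add: sum_distrib_left)
    also have "\<dots> = (\<Sum>(i, K)\<in>(SIGMA i:{i. i \<le> p \<and> wt k dvd i}. {K. set_mset K \<subseteq> Lab \<and> mwt wt K = p - i}).
        f k (i div wt k) * (\<Prod>k\<in>Lab. f k (count K k)))"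
      by (rule sum.Sigma) (auto intro: fin)
    also have "\<dots> = ?W (insert k Lab) p"
    proof (rule sum.reindex_bij_witness[where j = "\<lambda>(i, K). K + replicate_mset (i div wt k) k"
          and i = "\<lambda>K. (wt k * count K k, filter_mset (\<lambda>x. x \<noteq> k) K)"])
      fix a assume a: "a \<in> (SIGMA i:{i. i \<le> p \<and> wt k dvd i}. {K. set_mset K \<subseteq> Lab \<and> mwt wt K = p - i})"
      obtain i K where iK: "a = (i, K)" by (cases a)
      have K: "i \<le> p" "wt k dvd i" "set_mset K \<subseteq> Lab" "mwt wt K = p - i" using a iK by auto
      have kK: "count K k = 0" using K(3) insert(2) by (auto simp: not_in_iff[symmetric])
      have mr: "mwt wt (replicate_mset r k) = r * wt k" for r
        by (simp add: mwt_def)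
      have filt: "filter_mset (\<lambda>x. x \<noteq> k) K = K"
        using K(3) insert(2) by (intro multiset_eqI) (auto simp: kK)
      have filt2: "filter_mset (\<lambda>x. x \<noteq> k) (replicate_mset r k) = {#}" for r
        by (intro multiset_eqI) auto
      show "(\<lambda>K. (wt k * count K k, filter_mset (\<lambda>x. x \<noteq> k) K))
          (case a of (i, K) \<Rightarrow> K + replicate_mset (i div wt k) k) = a"
        using K by (simp add: iK kK filt filt2)
      show "(case a of (i, K) \<Rightarrow> K + replicate_mset (i div wt k) k) \<in> {K. set_mset K \<subseteq> insert k Lab \<and> mwt wt K = p}"
        using K by (auto simp: iK mr split: if_splits)
      have "(\<Prod>j\<in>Lab. f j (count K j + (if j = k then r else 0))) = (\<Prod>j\<in>Lab. f j (count K j))" for r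
        using insert(2) by (intro prod.cong) auto
      then have "(\<Prod>j\<in>insert k Lab. f j (count (K + replicate_mset (i div wt k) k) j)) =
          f k (i div wt k) * (\<Prod>j\<in>Lab. f j (count K j))"
        using insert(1,2) by (simp add: kK eq_commute)
      then show "(\<Prod>j\<in>insert k Lab. f j (count (case a of (i, K) \<Rightarrow> K + replicate_mset (i div wt k) k) j)) =
          (case a of (i, K) \<Rightarrow> f k (i div wt k) * (\<Prod>k\<in>Lab. f k (count K k)))"
        by (simp add: iK)
    next
      fix K assume "K \<in> {K. set_mset K \<subseteq> insert k Lab \<and> mwt wt K = p}"
      then have K: "set_mset K \<subseteq> insert k Lab" "mwt wt K = p" by auto
      let ?K = "filter_mset (\<lambda>x. x \<noteq> k) K"
      have dec: "?K + replicate_mset (count K k) k = K"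
        by (rule multiset_eqI) auto
      have "mwt wt ?K + count K k * wt k = p"
        using arg_cong[OF dec, of "mwt wt"] K(2) by (simp add: mwt_def)
      then show "(wt k * count K k, ?K) \<in>
          (SIGMA i:{i. i \<le> p \<and> wt k dvd i}. {K. set_mset K \<subseteq> Lab \<and> mwt wt K = p - i})"
        using K by (auto simp: mult.commute)
      show "(case (wt k * count K k, ?K) of (i, K) \<Rightarrow> K + replicate_mset (i div wt k) k) = K"
        using wk dec by simp
    qed
    finally show "fps_nth (?P * Abs_fps (?W Lab)) p = fps_nth (Abs_fps (?W (insert k Lab))) p" by simp
  qed
  with has_fps_expansion_mult[OF one IH] insert(1,2) show ?case by simp
qed

section \<open>Wick's theorem on Fock space\<close>

text \<open>
  The matrix element of the normal-ordered product of two exponentials, where the power of $x$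
  records the level of the intermediate states.
\<close>
definition wick_el :: "(nat \<times> nat \<Rightarrow> complex) \<Rightarrow> (nat \<times> nat \<Rightarrow> complex) \<Rightarrow> (nat \<times> nat \<Rightarrow> complex) \<Rightarrow>
    (nat \<times> nat \<Rightarrow> complex) \<Rightarrow> (nat \<times> nat \<Rightarrow> complex) \<Rightarrow>
    (nat \<times> nat) multiset \<Rightarrow> (nat \<times> nat) multiset \<Rightarrow> complex \<Rightarrow> complex" where
  "wick_el \<kappa> A B A' B' M M' x = (\<Prod>k\<in>set_mset M \<union> set_mset M'.
     gmel (A k + A' k * x ^ snd k) (\<kappa> k * B k * x ^ snd k + \<kappa> k * B' k) (x ^ snd k) (count M k) (count M' k))"

lemma wick_el_superset:
  assumes "finite S" "set_mset M \<subseteq> S" "set_mset M' \<subseteq> S"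
  shows "wick_el \<kappa> A B A' B' M M' x = (\<Prod>k\<in>S.
     gmel (A k + A' k * x ^ snd k) (\<kappa> k * B k * x ^ snd k + \<kappa> k * B' k) (x ^ snd k) (count M k) (count M' k))"
  unfolding wick_el_def
  by (rule prod.mono_neutral_left) (use assms in \<open>auto simp: not_in_iff gmel_0_left\<close>)

lemma holomorphic_wick_el [holomorphic_intros]:
  "wick_el \<kappa> A B A' B' M M' holomorphic_on S"
  unfolding wick_el_def[abs_def] gmel_def by (intro holomorphic_intros) auto

lemma exp_series_exp_monomial:
  assumes "n > 0"
  shows "exp_series (\<lambda>x. exp (c * x ^ n)) (\<lambda>m. if m = n then of_nat n * c else 0)"
  unfolding exp_series_def
proof (intro always_eventually allI)
  fix x :: complex
  let ?t = "\<lambda>m. (if Suc m = n then of_nat n * c else 0) / of_nat (Suc m) * x ^ Suc m"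
  have "?t sums (\<Sum>m\<in>{n - 1}. ?t m)"
    by (rule sums_finite) (use assms in auto)
  moreover have "(\<Sum>m\<in>{n - 1}. ?t m) = c * x ^ n"
    using assms by (simp del: of_nat_Suc)
  ultimately show "\<exists>\<sigma>. ?t sums \<sigma> \<and> exp (c * x ^ n) = exp \<sigma>" by metis
qed

lemma finite_fock_weight: "finite {K \<in> fock_basis N. mwt snd K = p}"
proof (rule finite_subset)
  show "finite {K. set_mset K \<subseteq> {1..N} \<times> {1..p} \<and> mwt snd K = p}"
    by (rule finite_weight_sets) auto
  show "{K \<in> fock_basis N. mwt snd K = p} \<subseteq> {K. set_mset K \<subseteq> {1..N} \<times> {1..p} \<and> mwt snd K = p}"
  proof safe
    fix K j n assume K: "K \<in> fock_basis N" "(j, n) \<in># K" 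
    then show "j \<in> {1..N}" by (auto simp: fock_basis_def)
    obtain K' where "K = add_mset (j, n) K'" using K(2) by (meson mset_add)
    then show "n \<in> {1..mwt snd K}" using K(1) by (auto simp: fock_basis_def)
  qed
qed

lemma has_fps_expansion_unique:
  fixes F G :: "complex fps"
  assumes "f has_fps_expansion F" "f has_fps_expansion G"
  shows "F = G"
  using assms by (intro fps_ext) (metis fps_nth_fps_expansion)

text \<open>
  Only finitely many labels enter the $p$-th coefficient, namely those of level at most $p$ and
  those of the two states. So it can be computed in a finite product, to which the one-oscillator
  formula applies; there the contraction exponents may be changed beyond order $p$.
\<close>
theorem wick:
  fixes N :: nat and M M' :: "(nat \<times> nat) multiset"
  assumes f: "exp_series f s"
    and s: "\<And>n. n \<ge> 1 \<Longrightarrow> s n = of_nat n * (\<Sum>j\<in>{1..N}. \<kappa> (j, n) * B (j, n) * A' (j, n))"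
    and M: "M \<in> fock_basis N" and M': "M' \<in> fock_basis N"
  shows "(\<lambda>x. f x * wick_el \<kappa> A B A' B' M M' x) has_fps_expansion
     Abs_fps (\<lambda>p. \<Sum>K | K \<in> fock_basis N \<and> mwt snd K = p. vop \<kappa> A B M K * vop \<kappa> A' B' K M')"
proof -
  let ?H = "\<lambda>p. \<Sum>K | K \<in> fock_basis N \<and> mwt snd K = p. vop \<kappa> A B M K * vop \<kappa> A' B' K M'"
  define G where "G = Abs_fps (\<lambda>n. s n / of_nat n)"
  have fF: "f has_fps_expansion (fps_exp 1 oo G)"
    unfolding G_def by (rule exp_series_fps[OF f])
  have "wick_el \<kappa> A B A' B' M M' analytic_on {0}"
    using holomorphic_wick_el[of \<kappa> A B A' B' M M' UNIV] by (auto simp: analytic_at)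
  then obtain W where W: "wick_el \<kappa> A B A' B' M M' has_fps_expansion W"
    using analytic_at_imp_has_fps_expansion_0 by blast
  have "fps_nth ((fps_exp 1 oo G) * W) p = ?H p" for p
  proof -
    define Lab where "Lab = {1..N} \<times> {1..p} \<union> set_mset M \<union> set_mset M'"
    have fin: "finite Lab" and sub: "set_mset M \<subseteq> Lab" "set_mset M' \<subseteq> Lab"
      by (auto simp: Lab_def)
    have LabN: "Lab \<subseteq> {1..N} \<times> {1..}"
      using M M' by (auto simp: Lab_def fock_basis_def)
    have pos: "snd k > 0" if "k \<in> Lab" for k using LabN that by auto
    define c where "c = (\<lambda>k. \<kappa> k * B k * A' k)"
    define s' where "s' = (\<lambda>n. \<Sum>k\<in>Lab. if n = snd k then of_nat (snd k) * c k else 0)"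
    have E: "exp_series (\<lambda>x. \<Prod>k\<in>Lab. exp (c k * x ^ snd k)) s'"
      unfolding s'_def by (intro exp_series_prod exp_series_exp_monomial pos)
    define G' where "G' = Abs_fps (\<lambda>n. s' n / of_nat n)"
    have EF: "(\<lambda>x. \<Prod>k\<in>Lab. exp (c k * x ^ snd k)) has_fps_expansion (fps_exp 1 oo G')"
      unfolding G'_def by (rule exp_series_fps[OF E])
    have s's: "s' n = s n" if "1 \<le> n" "n \<le> p" for n
    proof -
      have img: "(\<lambda>j. (j, n)) ` {1..N} \<subseteq> Lab" using that by (auto simp: Lab_def)
      have "n \<noteq> snd k" if "k \<in> Lab - (\<lambda>j. (j, n)) ` {1..N}" for k
        using that subsetD[OF LabN, of k] by (cases k) auto
      then have "s' n = (\<Sum>k\<in>(\<lambda>j. (j, n)) ` {1..N}. of_nat n * c k)"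
        unfolding s'_def by (intro sum.mono_neutral_cong_right[OF fin img]) auto
      also have "\<dots> = s n"
        using s[OF that(1)] by (simp add: sum.reindex inj_on_def c_def sum_distrib_left)
      finally show ?thesis .
    qed
    have GG: "fps_nth (fps_exp 1 oo G) i = fps_nth (fps_exp 1 oo G') i" if "i \<le> p" for i
    proof (rule fps_compose_nth_cong)
      fix n assume "n \<le> i"
      then show "fps_nth G n = fps_nth G' n"
        using s's[of n] that by (cases "n = 0") (auto simp: G_def G'_def)
    qed
    let ?mm = "\<lambda>k j. mel (A k) (\<kappa> k * B k) (count M k) j * mel (A' k) (\<kappa> k * B' k) j (count M' k)"
    have e1: "(\<lambda>x. \<Prod>k\<in>Lab. exp (\<kappa> k * B k * A' k * x ^ snd k) * 
          gmel (A k + A' k * x ^ snd k) (\<kappa> k * B k * x ^ snd k + \<kappa> k * B' k) (x ^ snd k) (count M k) (count M' k))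
       has_fps_expansion Abs_fps (\<lambda>p. \<Sum>K | set_mset K \<subseteq> Lab \<and> mwt snd K = p. \<Prod>k\<in>Lab. ?mm k (count K k))"
      by (rule weighted_product_expansion[where wt = snd and f = ?mm and F = "\<lambda>k \<sigma>. exp (\<kappa> k * B k * A' k * \<sigma>) *
          gmel (A k + A' k * \<sigma>) (\<kappa> k * B k * \<sigma> + \<kappa> k * B' k) \<sigma> (count M k) (count M' k)", OF fin pos one_label_wick])
    have e2: "(\<lambda>x. \<Prod>k\<in>Lab. exp (\<kappa> k * B k * A' k * x ^ snd k) * 
          gmel (A k + A' k * x ^ snd k) (\<kappa> k * B k * x ^ snd k + \<kappa> k * B' k) (x ^ snd k) (count M k) (count M' k)) =
          (\<lambda>x. (\<Prod>k\<in>Lab. exp (c k * x ^ snd k)) * wick_el \<kappa> A B A' B' M M' x)"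
      unfolding wick_el_superset[OF fin sub] by (simp add: c_def prod.distrib)
    have e3: "Abs_fps (\<lambda>p. \<Sum>K | set_mset K \<subseteq> Lab \<and> mwt snd K = p. \<Prod>k\<in>Lab. ?mm k (count K k)) =
        (fps_exp 1 oo G') * W"
      by (rule has_fps_expansion_unique[OF e1[unfolded e2] has_fps_expansion_mult[OF EF W]])
    have "fps_nth ((fps_exp 1 oo G') * W) p = (\<Sum>K | set_mset K \<subseteq> Lab \<and> mwt snd K = p. \<Prod>k\<in>Lab. ?mm k (count K k))"
      by (simp only: e3[symmetric] fps_nth_Abs_fps)
    also have "\<dots> = ?H p"
    proof (rule sum.cong)
      show "{K. set_mset K \<subseteq> Lab \<and> mwt snd K = p} = {K. K \<in> fock_basis N \<and> mwt snd K = p}"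
      proof safe
        fix K assume "set_mset K \<subseteq> Lab" then show "K \<in> fock_basis N" using LabN by (auto simp: fock_basis_def)
      next
        fix K j n assume K: "K \<in> fock_basis N" "(j, n) \<in># K" "p = mwt snd K"
        obtain K' where "K = add_mset (j, n) K'" using K(2) by (meson mset_add)
        then show "(j, n) \<in> Lab" using K by (auto simp: fock_basis_def Lab_def)
      qed
      fix K assume "K \<in> {K. K \<in> fock_basis N \<and> mwt snd K = p}"
      then have K: "K \<in> fock_basis N" "mwt snd K = p" by auto
      have "set_mset K \<subseteq> Lab"
      proof
        fix k assume k: "k \<in># K"
        then obtain K' where "K = add_mset k K'" by (meson mset_add)
        then show "k \<in> Lab" using K k by (cases k) (auto simp: fock_basis_def Lab_def)
      qed
      then show "(\<Prod>k\<in>Lab. ?mm k (count K k)) = vop \<kappa> A B M K * vop \<kappa> A' B' K M'"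
        using fin sub by (simp add: vop_eq_prod[of Lab] prod.distrib)
    qed
    finally have "fps_nth ((fps_exp 1 oo G') * W) p = ?H p" .
    moreover have "fps_nth ((fps_exp 1 oo G) * W) p = fps_nth ((fps_exp 1 oo G') * W) p"
      unfolding fps_mult_nth by (intro sum.cong) (auto simp: GG)
    ultimately show ?thesis by simp
  qed
  then have "(fps_exp 1 oo G) * W = Abs_fps ?H" by (intro fps_ext) simp
  with has_fps_expansion_mult[OF fF W] show ?thesis by simp
qed

section \<open>Modes of the currents\<close>

lemma mel_scale:
  assumes "z \<noteq> 0"
  shows "mel (a * z ^ n) (b * inverse z ^ n) m m' = z powi (int (n * m) - int (n * m')) * mel a b m m'"
  unfolding mel_def sum_distrib_left
proof (rule sum.cong[OF refl])
  fix s assume s: "s \<in> {..m}"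
  show "(a * z ^ n) ^ (m - s) / fact (m - s) * of_nat (m' choose s) * (b * inverse z ^ n) ^ (m' - s) =
    z powi (int (n * m) - int (n * m')) * (a ^ (m - s) / fact (m - s) * of_nat (m' choose s) * b ^ (m' - s))"
  proof (cases "s \<le> m'")
    case True
    have "z ^ (n * (m - s)) * inverse z ^ (n * (m' - s)) = z powi (int (n * (m - s)) - int (n * (m' - s)))"
      using assms unfolding power_int_diff[OF disjI1[OF assms]] power_int_of_nat by (simp add: divide_inverse power_inverse)
    also have "int (n * (m - s)) - int (n * (m' - s)) = int (n * m) - int (n * m')"
      using s True by (simp add: of_nat_diff algebra_simps)
    finally have e: "z powi (int (n * m) - int (n * m')) = z ^ (n * (m - s)) * inverse z ^ (n * (m' - s))" by simp
    have e': "(x * y ^ n) ^ k = x ^ k * y ^ (n * k)" for x y :: complex and k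
      by (simp add: power_mult_distrib power_mult)
    have "(X * P) / F * C * (Y * Q) = (P * Q) * (X / F * C * Y)" for X P F C Y Q :: complex
      by simp
    then show ?thesis unfolding e e' .
  qed (simp add: binomial_eq_0)
qed

text \<open>
  Rescaling by $z$ measures the difference of the levels; hence a mode of a current connects
  only levels whose difference is the mode number.
\<close>
lemma vop_scale:
  fixes wt :: "'k \<Rightarrow> nat"
  assumes "z \<noteq> 0"
  shows "vop \<kappa> (\<lambda>k. A k * z ^ wt k) (\<lambda>k. B k * inverse z ^ wt k) M K =
     z powi (int (mwt wt M) - int (mwt wt K)) * vop \<kappa> A B M K"
proof -
  let ?S = "set_mset M \<union> set_mset K"
  have "(\<Prod>k\<in>S. z powi (int (f k) - int (g k))) = z powi (int (\<Sum>k\<in>S. f k) - int (\<Sum>k\<in>S. g k))" for f g and S :: "'k set"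
  proof (induction S rule: infinite_finite_induct)
    case (insert k S)
    then show ?case using power_int_add[OF disjI1[OF assms], of "int (f k) - int (g k)" "int (\<Sum>k\<in>S. f k) - int (\<Sum>k\<in>S. g k)"]
      by (simp add: algebra_simps)
  qed simp_all
  note powi = this[of "\<lambda>k. wt k * count M k" "\<lambda>k. wt k * count K k" ?S]
  have "vop \<kappa> (\<lambda>k. A k * z ^ wt k) (\<lambda>k. B k * inverse z ^ wt k) M K =
      (\<Prod>k\<in>?S. z powi (int (wt k * count M k) - int (wt k * count K k)) * mel (A k) (\<kappa> k * B k) (count M k) (count K k))"
    by (subst vop_eq_prod[of ?S]) (simp_all only: mult.assoc[symmetric] mel_scale[OF assms] finite_UnI finite_set_mset Un_upper1 Un_upper2)
  also have "\<dots> = z powi (int (mwt wt M) - int (mwt wt K)) * vop \<kappa> A B M K"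
    unfolding prod.distrib powi by (subst vop_eq_prod[of ?S]) (simp_all add: mwt_eq_sum[of ?S] mult.commute)
  finally show ?thesis .
qed

lemma residue_monomial: "residue (\<lambda>z. c * z powi m) 0 = (if m = -1 then c else 0)"
proof (cases "m \<ge> 0")
  case True
  then have "(\<lambda>z. c * z powi m) = (\<lambda>z. c * z ^ nat m)" by (auto simp: power_int_def)
  moreover have "residue (\<lambda>z. c * z ^ nat m) 0 = 0"
    by (rule residue_holo[of UNIV]) (auto intro!: holomorphic_intros)
  ultimately show ?thesis using True by simp
next
  case False
  define k where "k = nat (- m - 1)"
  have m: "m = - int (Suc k)" using False by (simp add: k_def)
  have "(\<lambda>z. c * z powi m) = (\<lambda>z. c / z ^ Suc k)"
    unfolding m by (simp add: power_int_minus field_simps power_int_add fun_eq_iff del: power_Suc of_nat_Suc)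
  moreover have "residue (\<lambda>z. c / z ^ Suc k) 0 = (deriv ^^ k) (\<lambda>_. c) 0 / fact k"
    by (rule residue_holomorphic_over_power'[of UNIV]) auto
  moreover have "(deriv ^^ k) (\<lambda>_. c) 0 / fact k = (if k = 0 then c else 0)"
    by (cases k) (simp_all add: higher_deriv_const)
  ultimately show ?thesis using m by simp
qed

context qt_setup begin

lemma Lam_cre_scale: "Lam_cre i (c * z) k = Lam_cre i c k * z ^ snd k"
  by (cases k) (simp add: Lam_cre_def power_mult_distrib)

lemma Lam_ann_scale: "Lam_ann i (c * z) k = Lam_ann i c k * inverse z ^ snd k"
  by (cases k) (simp add: Lam_ann_def power_mult_distrib)

abbreviation kapN :: "nat \<times> nat \<Rightarrow> complex" where
  "kapN \<equiv> \<lambda>(i, n). kap n"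

definition LamC :: "nat list \<Rightarrow> nat \<times> nat \<Rightarrow> complex" where
  "LamC js k = (\<Sum>l<length js. Lam_cre (js ! l) ((q / t) ^ l) k)"

definition LamA :: "nat list \<Rightarrow> nat \<times> nat \<Rightarrow> complex" where
  "LamA js k = (\<Sum>l<length js. Lam_ann (js ! l) ((q / t) ^ l) k)"

lemma Lam_prod_homogeneous:
  assumes "z \<noteq> 0"
  shows "Lam_prod js z M K = z powi (int (mwt snd M) - int (mwt snd K)) * vop kapN (LamC js) (LamA js) M K"
  unfolding Lam_prod_def Lam_cre_scale Lam_ann_scale sum_distrib_right[symmetric] LamC_def LamA_def
  by (rule vop_scale[OF assms])

lemma residue_Lam_prod:
  "residue (\<lambda>z. z powi (n - 1) * Lam_prod js z M K) 0 =
     (if int (mwt snd K) = int (mwt snd M) + n then vop kapN (LamC js) (LamA js) M K else 0)"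
proof -
  let ?c = "vop kapN (LamC js) (LamA js) M K"
  let ?e = "n - 1 + (int (mwt snd M) - int (mwt snd K))"
  have "residue (\<lambda>z. z powi (n - 1) * Lam_prod js z M K) 0 = residue (\<lambda>z. ?c * z powi ?e) 0"
  proof (rule residue_cong)
    have "\<forall>\<^sub>F z in at 0. z \<noteq> (0::complex)" by (simp add: eventually_at_filter)
    then show "\<forall>\<^sub>F z in at 0. z powi (n - 1) * Lam_prod js z M K = ?c * z powi ?e"
      by eventually_elim (simp add: Lam_prod_homogeneous power_int_add)
  qed simp
  also have "\<dots> = (if ?e = - 1 then ?c else 0)" by (rule residue_monomial)
  finally show ?thesis by simp
qed

lemma prod_graded: "(\<Prod>j\<in>J. graded u j) = fps_const (\<Prod>j\<in>J. u j) * fps_X ^ (\<Sum>j\<in>J. j - 1)"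
  by (induction J rule: infinite_finite_induct)
     (simp_all add: graded_def power_add mult_ac flip: fps_const_mult)

lemma X_mode_eq:
  "X_mode N k u n M K = (if int (mwt snd K) = int (mwt snd M) + n then
     \<Sum>J | J \<subseteq> {1..N} \<and> card J = k. fps_const ((\<Prod>j\<in>J. u j) *
        vop kapN (LamC (sorted_list_of_set J)) (LamA (sorted_list_of_set J)) M K) * fps_X ^ (\<Sum>j\<in>J. j - 1) else 0)"
proof (cases "int (mwt snd K) = int (mwt snd M) + n")
  case True
  have comm: "a * b * c = a * c * b" for a b c :: "complex fps" by (simp add: mult_ac)
  show ?thesis unfolding X_mode_def residue_Lam_prod prod_graded fps_const_mult[symmetric] if_P[OF True]
    by (rule sum.cong[OF refl comm])
next
  case False
  then show ?thesis unfolding X_mode_def residue_Lam_prod by simp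
qed

end

section \<open>Partitions, addable and removable boxes\<close>

lemma part_beyond: "length lam < i \<Longrightarrow> part lam i = 0"
  by (simp add: part_def)

lemma part_pos: "is_partition lam \<Longrightarrow> 1 \<le> i \<Longrightarrow> i \<le> length lam \<Longrightarrow> part lam i > 0"
  by (auto simp: part_def is_partition_def) (metis One_nat_def Suc_diff_1 Suc_le_lessD gr0I less_le_trans nth_mem order_less_imp_le diff_less_Suc less_Suc_eq_le)

lemma part_antimono:
  assumes "is_partition lam" "1 \<le> i" "i \<le> j"
  shows "part lam j \<le> part lam i"
proof (cases "j \<le> length lam \<and> i < j")
  case True
  then have "lam ! (i - 1) \<ge> lam ! (j - 1)"
    using assms unfolding is_partition_def by (intro sorted_wrt_nth_less[of "(\<ge>)"]) auto
  then show ?thesis using True assms by (simp add: part_def)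
next
  case False
  then show ?thesis using assms part_beyond[of lam j] by (cases "i = j") auto
qed

lemma mem_boxes: "(i, j) \<in> boxes lam \<longleftrightarrow> 1 \<le> i \<and> 1 \<le> j \<and> j \<le> part lam i"
  unfolding boxes_def using part_beyond[of lam i] by (cases "i \<le> length lam") auto

lemma boxes_Sigma: "boxes lam = (SIGMA i:{1..length lam}. {1..part lam i})"
  by (auto simp: boxes_def)

lemma finite_boxes [simp]: "finite (boxes lam)"
  by (simp add: boxes_Sigma)

lemma boxes_Nil [simp]: "boxes [] = {}"
  by (auto simp: boxes_def)

lemma partition_eqI:
  assumes "is_partition lam" "is_partition mu" "\<And>i. i \<ge> 1 \<Longrightarrow> part lam i = part mu i"
  shows "lam = mu"
proof -
  have le: "length a \<le> length b" if "is_partition a" "is_partition b" "\<And>i. i \<ge> 1 \<Longrightarrow> part a i = part b i" for a b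
  proof (rule ccontr)
    assume "\<not> length a \<le> length b"
    then have "length b < length a" by simp
    then have "part a (length a) > 0" "part b (length a) = 0" "length a \<ge> 1"
      using part_pos[OF that(1), of "length a"] part_beyond[of b "length a"] by auto
    then show False using that(3)[of "length a"] by simp
  qed
  have len: "length lam = length mu"
    by (rule antisym[OF le[OF assms] le[OF assms(2,1) assms(3)[symmetric]]])
  show ?thesis
  proof (rule nth_equalityI[OF len])
    fix i assume "i < length lam"
    then show "lam ! i = mu ! i" using assms(3)[of "Suc i"] len by (simp add: part_def)
  qed
qed

lemma partition_with_parts:
  fixes f :: "nat \<Rightarrow> nat"
  assumes anti: "\<And>i j. 1 \<le> i \<Longrightarrow> i \<le> j \<Longrightarrow> f j \<le> f i" and fin: "\<And>i. i > n \<Longrightarrow> f i = 0"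
  shows "\<exists>lam. is_partition lam \<and> (\<forall>i\<ge>1. part lam i = f i)"
proof -
  define m where "m = (LEAST m. \<forall>i>m. f i = 0)"
  have m: "f i = 0" if "i > m" for i
    using LeastI[of "\<lambda>m. \<forall>i>m. f i = 0" n] fin that unfolding m_def by blast
  have pos: "f i > 0" if i: "1 \<le> i" "i \<le> m" for i
  proof (rule ccontr)
    assume "\<not> f i > 0"
    then have "\<forall>k>i - 1. f k = 0" using anti[of i] i by (metis Suc_diff_1 Suc_leI le_zero_eq neq0_conv not_less_eq_eq One_nat_def)
    then have "m \<le> i - 1" unfolding m_def by (rule Least_le)
    then show False using i by auto
  qed
  define lam where "lam = map f [1..<Suc m]"
  have "part lam i = f i" if "i \<ge> 1" for i
    using m[of i] that by (cases "i \<le> m") (auto simp: part_def lam_def nth_append simp del: upt_Suc)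
  moreover have "is_partition lam"
    unfolding is_partition_def
  proof
    show "sorted_wrt (\<ge>) lam"
      unfolding lam_def sorted_wrt_map by (rule sorted_wrt_mono_rel[OF _ sorted_wrt_upt[of 1 "Suc m"]]) (auto intro!: anti)
    show "0 \<notin> set lam" using pos by (auto simp: lam_def simp del: upt_Suc) force
  qed
  ultimately show ?thesis by blast
qed

lemma down_closed_eq_lessThan:
  assumes "finite S" "\<And>x y. x \<in> S \<Longrightarrow> y < x \<Longrightarrow> y \<in> S"
  shows "S = {..<card S}"
proof -
  define n where "n = (LEAST n. n \<notin> S)"
  have n: "n \<notin> S" unfolding n_def using assms(1) by (metis LeastI ex_new_if_finite infinite_UNIV_nat)
  have "S = {..<n}"
  proof (intro set_eqI iffI)
    fix x assume "x \<in> S"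
    then show "x \<in> {..<n}" using n assms(2)[of x n] by (metis lessThan_iff nat_neq_iff)
  next
    fix x assume "x \<in> {..<n}"
    then show "x \<in> S" using not_less_Least[of x "\<lambda>n. n \<notin> S"] by (auto simp: n_def)
  qed
  then show ?thesis by (metis card_lessThan)
qed

text \<open>
  Membership of a box can be read off from its row or from its column; for a fixed column the rows
  that reach it form an initial segment.
\<close>
lemma part_transp_iff:
  assumes "is_partition lam" "i \<ge> 1" "j \<ge> 1"
  shows "i \<le> part (transp lam) j \<longleftrightarrow> j \<le> part lam i"
proof (cases "j \<le> part lam 1")
  case True
  let ?S = "{i. i < length lam \<and> j \<le> lam ! i}"
  have len: "length (transp lam) = part lam 1" by (simp add: transp_def)
  have "part (transp lam) j = transp lam ! (j - 1)"
    using True assms(3) by (simp add: part_def[of "transp lam"] len)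
  also have "\<dots> = length (filter (\<lambda>p. j \<le> p) lam)"
    unfolding transp_def using True assms(3) by (subst nth_map) (auto simp del: upt_Suc)
  also have "\<dots> = card ?S" by (simp add: length_filter_conv_card)
  finally have col: "part (transp lam) j = card ?S" .
  have "?S = {..<card ?S}"
  proof (rule down_closed_eq_lessThan)
    fix x y assume "x \<in> ?S" "y < x"
    then show "y \<in> ?S" using assms(1) sorted_wrt_nth_less[of "(\<ge>)" lam y x]
      unfolding is_partition_def by auto
  qed simp
  from arg_cong[OF this, of "\<lambda>S. i - 1 \<in> S"] have "i - 1 \<in> ?S \<longleftrightarrow> i - 1 < card ?S" by (simp only: lessThan_iff)
  moreover have "j \<le> part lam i \<longleftrightarrow> i - 1 \<in> ?S"
    using assms by (auto simp: part_def)
  ultimately show ?thesis using assms(2) unfolding col by linarith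
next
  case False
  then have "part (transp lam) j = 0" by (simp add: part_def transp_def)
  moreover have "part lam i \<le> part lam 1" by (rule part_antimono) (use assms in auto)
  ultimately show ?thesis using False assms by auto
qed

lemma boxes_transp_Sigma:
  assumes "is_partition lam"
  shows "(i, j) \<in> boxes lam \<longleftrightarrow> j \<in> {1..length (transp lam)} \<and> i \<in> {1..part (transp lam) j}"
proof -
  have "length (transp lam) = part lam 1" by (simp add: transp_def)
  moreover have "part lam i \<le> part lam 1" if "1 \<le> i" by (rule part_antimono) (use assms that in auto)
  ultimately show ?thesis using part_transp_iff[OF assms, of i j] by (auto simp: mem_boxes)
qed

lemma sum_list_card_boxes: "sum_list lam = card (boxes lam)"
proof -
  have "card (boxes lam) = (\<Sum>i\<in>{1..length lam}. part lam i)"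
    unfolding boxes_Sigma by simp
  also have "\<dots> = (\<Sum>i<length lam. lam ! i)"
    by (rule sum.reindex_bij_witness[of _ Suc "\<lambda>i. i - 1"]) (auto simp: part_def)
  finally show ?thesis by (simp add: sum_list_sum_nth atLeast0LessThan)
qed

lemma n_stat_boxes: "n_stat lam = (\<Sum>b\<in>boxes lam. fst b - 1)"
proof -
  have "(\<Sum>(i, j)\<in>boxes lam. i - 1) = (\<Sum>i\<in>{1..length lam}. \<Sum>j\<in>{1..part lam i}. i - 1)"
    unfolding boxes_Sigma by (rule sum.Sigma[symmetric]) auto
  then show ?thesis by (simp add: n_stat_def mult.commute case_prod_beta)
qed

lemma n_stat_transp_boxes:
  assumes "is_partition lam"
  shows "n_stat (transp lam) = (\<Sum>b\<in>boxes lam. snd b - 1)"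
proof -
  have "n_stat (transp lam) = (\<Sum>j\<in>{1..length (transp lam)}. \<Sum>i\<in>{1..part (transp lam) j}. j - 1)"
    by (simp add: n_stat_def mult.commute)
  also have "\<dots> = (\<Sum>(j, i)\<in>(SIGMA j:{1..length (transp lam)}. {1..part (transp lam) j}). j - 1)"
    by (rule sum.Sigma) auto
  also have "\<dots> = (\<Sum>b\<in>boxes lam. snd b - 1)"
    by (rule sum.reindex_bij_witness[of _ prod.swap prod.swap])
       (auto simp: boxes_transp_Sigma[OF assms] simp del: atLeastAtMost_iff)
  finally show ?thesis .
qed

definition addable :: "nat list \<Rightarrow> nat \<times> nat \<Rightarrow> bool" where
  "addable lam = (\<lambda>(r, c). r \<ge> 1 \<and> c = Suc (part lam r) \<and> (r = 1 \<or> c \<le> part lam (r - 1)))"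

definition removable :: "nat list \<Rightarrow> nat \<times> nat \<Rightarrow> bool" where
  "removable lam = (\<lambda>(r, c). r \<ge> 1 \<and> c = part lam r \<and> part lam (Suc r) < c)"

text \<open>
  Partitions are lists without zeros, so changing a part can change the length; choosing the
  partition by its parts avoids the case distinction.
\<close>
definition set_part :: "nat list \<Rightarrow> nat \<Rightarrow> nat \<Rightarrow> nat list" where
  "set_part lam r c = (SOME mu. is_partition mu \<and> (\<forall>i\<ge>1. part mu i = (if i = r then c else part lam i)))"

definition add_box :: "nat list \<Rightarrow> nat \<times> nat \<Rightarrow> nat list" where
  "add_box lam = (\<lambda>(r, c). set_part lam r c)"

definition rem_box :: "nat list \<Rightarrow> nat \<times> nat \<Rightarrow> nat list" where
  "rem_box lam = (\<lambda>(r, c). set_part lam r (c - 1))"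

lemma set_part:
  assumes lam: "is_partition lam" and r: "r \<ge> 1"
    and up: "r = 1 \<or> c \<le> part lam (r - 1)" and down: "part lam (Suc r) \<le> c"
  shows "is_partition (set_part lam r c)"
    and "\<And>i. i \<ge> 1 \<Longrightarrow> part (set_part lam r c) i = (if i = r then c else part lam i)"
proof -
  let ?f = "\<lambda>i. if i = r then c else part lam i"
  have "\<exists>mu. is_partition mu \<and> (\<forall>i\<ge>1. part mu i = ?f i)"
  proof (rule partition_with_parts[where n = "max r (length lam)"])
    fix i j :: nat assume ij: "1 \<le> i" "i \<le> j"
    have "part lam j \<le> c" if "r < j" using part_antimono[OF lam, of "Suc r" j] that down by auto
    moreover have "c \<le> part lam i" if "i < r"
    proof -
      have "r \<noteq> 1" "i \<le> r - 1" using that ij by linarith+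
      then show ?thesis using up part_antimono[OF lam ij(1), of "r - 1"] by linarith
    qed
    ultimately show "?f j \<le> ?f i" using part_antimono[OF lam ij] ij by auto
  qed (auto simp: part_beyond)
  from someI_ex[OF this] show "is_partition (set_part lam r c)"
    "\<And>i. i \<ge> 1 \<Longrightarrow> part (set_part lam r c) i = (if i = r then c else part lam i)"
    unfolding set_part_def by blast+
qed

lemma add_box:
  assumes lam: "is_partition lam" and A: "addable lam (r, c)"
  shows "is_partition (add_box lam (r, c))"
    and "\<And>i. i \<ge> 1 \<Longrightarrow> part (add_box lam (r, c)) i = (if i = r then c else part lam i)"
    and "boxes (add_box lam (r, c)) = insert (r, c) (boxes lam)"
    and "(r, c) \<notin> boxes lam"
    and "removable (add_box lam (r, c)) (r, c)"
    and "rem_box (add_box lam (r, c)) (r, c) = lam"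
proof -
  have c: "c = Suc (part lam r)" "r \<ge> 1" "r = 1 \<or> c \<le> part lam (r - 1)" using A by (auto simp: addable_def)
  have down: "part lam (Suc r) \<le> part lam r" by (rule part_antimono) (use lam c in auto)
  have P: "is_partition (add_box lam (r, c))"
    "\<And>i. i \<ge> 1 \<Longrightarrow> part (add_box lam (r, c)) i = (if i = r then c else part lam i)"
    unfolding add_box_def prod.case by (rule set_part; use lam c down in simp)+
  show "is_partition (add_box lam (r, c))"
    "\<And>i. i \<ge> 1 \<Longrightarrow> part (add_box lam (r, c)) i = (if i = r then c else part lam i)" by (fact P)+
  show "boxes (add_box lam (r, c)) = insert (r, c) (boxes lam)"
  proof (intro set_eqI)
    fix b :: "nat \<times> nat"
    obtain i j where b: "b = (i, j)" by (cases b)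
    show "b \<in> boxes (add_box lam (r, c)) \<longleftrightarrow> b \<in> insert (r, c) (boxes lam)"
    proof (cases "i = r \<and> i \<ge> 1")
      case True
      then have "part (add_box lam (r, c)) i = Suc (part lam i)" using P(2)[of i] c(1) by simp
      then show ?thesis unfolding b mem_boxes insert_iff using True c(1) by (simp add: le_Suc_eq) blast
    next
      case False
      then show ?thesis unfolding b mem_boxes insert_iff using P(2)[of i] c(2) by (cases "1 \<le> i") auto
    qed
  qed
  show "(r, c) \<notin> boxes lam" using c by (simp add: mem_boxes)
  show R: "removable (add_box lam (r, c)) (r, c)"
  proof -
    have "part (add_box lam (r, c)) r = c" "part (add_box lam (r, c)) (Suc r) = part lam (Suc r)"
      using P(2)[of r] P(2)[of "Suc r"] c(2) by simp_all
    then show ?thesis unfolding removable_def prod.case using c down by linarith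
  qed
  have Q: "is_partition (rem_box (add_box lam (r, c)) (r, c))"
    "\<And>i. i \<ge> 1 \<Longrightarrow> part (rem_box (add_box lam (r, c)) (r, c)) i = (if i = r then c - 1 else part (add_box lam (r, c)) i)"
  proof -
    have u: "r = 1 \<or> c - 1 \<le> part (add_box lam (r, c)) (r - 1)"
    proof (cases "r = 1")
      case False
      then have "r - 1 \<ge> 1" "r - 1 \<noteq> r" using c(2) by linarith+
      then have "part (add_box lam (r, c)) (r - 1) = part lam (r - 1)" using P(2)[of "r - 1"] by simp
      then show ?thesis using c(3) by linarith
    qed simp
    have "part (add_box lam (r, c)) (Suc r) = part lam (Suc r)" using P(2)[of "Suc r"] by simp
    then have d: "part (add_box lam (r, c)) (Suc r) \<le> c - 1" using c(1) down by linarith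
    show "is_partition (rem_box (add_box lam (r, c)) (r, c))"
      "\<And>i. i \<ge> 1 \<Longrightarrow> part (rem_box (add_box lam (r, c)) (r, c)) i = (if i = r then c - 1 else part (add_box lam (r, c)) i)"
      unfolding rem_box_def prod.case using set_part[OF P(1) c(2) u d] by blast+
  qed
  show "rem_box (add_box lam (r, c)) (r, c) = lam"
  proof (rule partition_eqI[OF Q(1) lam])
    fix i :: nat assume i: "i \<ge> 1"
    show "part (rem_box (add_box lam (r, c)) (r, c)) i = part lam i"
      unfolding Q(2)[OF i] P(2)[OF i] using c(1) by simp
  qed
qed

lemma rem_box:
  assumes lam: "is_partition lam" and R: "removable lam (r, c)"
  shows "is_partition (rem_box lam (r, c))"
    and "addable (rem_box lam (r, c)) (r, c)"
    and "add_box (rem_box lam (r, c)) (r, c) = lam"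
proof -
  have c: "c = part lam r" "r \<ge> 1" "part lam (Suc r) < c"
    using R unfolding removable_def prod.case by blast+
  have up: "r = 1 \<or> part lam r \<le> part lam (r - 1)"
    using part_antimono[OF lam, of "r - 1" r] c by (cases "r = 1") auto
  have P: "is_partition (rem_box lam (r, c))"
    "\<And>i. i \<ge> 1 \<Longrightarrow> part (rem_box lam (r, c)) i = (if i = r then c - 1 else part lam i)"
  proof -
    have u: "r = 1 \<or> c - 1 \<le> part lam (r - 1)" using up c(1) by linarith
    have d: "part lam (Suc r) \<le> c - 1" using c(3) by linarith
    show "is_partition (rem_box lam (r, c))"
      "\<And>i. i \<ge> 1 \<Longrightarrow> part (rem_box lam (r, c)) i = (if i = r then c - 1 else part lam i)"
      unfolding rem_box_def prod.case using set_part[OF lam c(2) u d] by blast+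
  qed
  show "is_partition (rem_box lam (r, c))" by (fact P)
  show A: "addable (rem_box lam (r, c)) (r, c)"
  proof (cases "r = 1")
    case True
    then show ?thesis unfolding addable_def using P(2)[of r] c by simp
  next
    case False
    then have "r - 1 \<ge> 1" "r - 1 \<noteq> r" using c(2) by linarith+
    then have "part (rem_box lam (r, c)) (r - 1) = part lam (r - 1)" using P(2)[of "r - 1"] by simp
    then show ?thesis unfolding addable_def using P(2)[of r] c up by simp
  qed
  show "add_box (rem_box lam (r, c)) (r, c) = lam"
  proof (rule partition_eqI[OF add_box(1)[OF P(1) A] lam])
    fix i :: nat assume i: "i \<ge> 1"
    show "part (add_box (rem_box lam (r, c)) (r, c)) i = part lam i"
      unfolding add_box(2)[OF P(1) A i] P(2)[OF i] using c(1) by simp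
  qed
qed

lemma nat_eqI_le:
  fixes a b :: nat
  assumes "\<And>i. i \<ge> 1 \<Longrightarrow> i \<le> a \<longleftrightarrow> i \<le> b"
  shows "a = b"
proof (rule ccontr)
  assume "a \<noteq> b"
  then consider "a < b" | "b < a" by linarith
  then show False using assms[of a] assms[of b] by cases linarith+
qed

lemma part_transp_add_box:
  assumes lam: "is_partition lam" and A: "addable lam (r, c)" and j: "j \<ge> 1"
  shows "part (transp (add_box lam (r, c))) j = (if j = c then r else part (transp lam) j)"
proof -
  have c: "c = Suc (part lam r)" "r \<ge> 1" "r = 1 \<or> c \<le> part lam (r - 1)" using A by (auto simp: addable_def)
  have "i \<le> part (transp (add_box lam (r, c))) j \<longleftrightarrow> i \<le> (if j = c then r else part (transp lam) j)" if i: "i \<ge> 1" for i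
  proof -
    have "i \<le> part (transp (add_box lam (r, c))) j \<longleftrightarrow> j \<le> part (add_box lam (r, c)) i"
      by (rule part_transp_iff[OF add_box(1)[OF lam A] i j])
    also have "\<dots> \<longleftrightarrow> j \<le> (if i = r then c else part lam i)" using add_box(2)[OF lam A i] by simp
    also have "\<dots> \<longleftrightarrow> i \<le> (if j = c then r else part (transp lam) j)"
    proof (cases "j = c")
      case True
      have "c \<le> part lam i \<longleftrightarrow> i < r" if "i \<noteq> r"
      proof (cases "i < r")
        case True
        then have "r \<noteq> 1" "i \<le> r - 1" using i by linarith+
        then show ?thesis using part_antimono[OF lam i, of "r - 1"] c(3) True by linarith
      next
        case False
        then show ?thesis using part_antimono[OF lam c(2), of i] that c(1) by linarith
      qed
      then show ?thesis using True by auto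
    next
      case False
      then show ?thesis using part_transp_iff[OF lam i j] c by auto
    qed
    finally show ?thesis .
  qed
  then show ?thesis by (rule nat_eqI_le)
qed

lemma part_transp_addable:
  assumes lam: "is_partition lam" and A: "addable lam (r, c)"
  shows "part (transp lam) c = r - 1"
proof -
  have c: "c = Suc (part lam r)" "r \<ge> 1" "r = 1 \<or> c \<le> part lam (r - 1)" using A by (auto simp: addable_def)
  have "\<not> r \<le> part (transp lam) c" using part_transp_iff[OF lam, of r c] c by simp
  moreover have "r - 1 \<le> part (transp lam) c"
    using part_transp_iff[OF lam, of "r - 1" c] c by (cases "r = 1") auto
  ultimately show ?thesis by simp
qed

lemma finite_partitions: "finite {lam. is_partition lam \<and> sum_list lam \<le> (d::nat)}"
proof (rule finite_subset)
  show "finite {xs. set xs \<subseteq> {..d} \<and> length xs \<le> d}"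
    by (rule finite_lists_length_le) simp
  show "{lam. is_partition lam \<and> sum_list lam \<le> d} \<subseteq> {xs. set xs \<subseteq> {..d} \<and> length xs \<le> d}"
  proof
    fix lam assume "lam \<in> {lam. is_partition lam \<and> sum_list lam \<le> d}"
    then have lam: "is_partition lam" "sum_list lam \<le> d" by auto
    have "length xs \<le> sum_list xs" if "0 \<notin> set xs" for xs :: "nat list"
      using that by (induction xs) auto
    then have "length lam \<le> d" using lam unfolding is_partition_def by (meson le_trans)
    moreover have "set lam \<subseteq> {..d}" using lam(2) member_le_sum_list[of _ lam] by (auto intro: le_trans)
    ultimately show "lam \<in> {xs. set xs \<subseteq> {..d} \<and> length xs \<le> d}" by auto
  qed
qed

lemma is_partition_Nil [simp]: "is_partition []"
  by (simp add: is_partition_def)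

lemma (in qt_setup) finite_configs: "finite (configs N d)"
proof (rule finite_subset)
  let ?P = "{lam. is_partition lam \<and> sum_list lam \<le> (d::nat)}"
  let ?F = "\<lambda>g i. if i \<in> {1..<N} then g i else []"
  show "finite (?F ` Pi\<^sub>E {1..<N} (\<lambda>_. ?P))"
    by (intro finite_imageI finite_PiE finite_partitions) auto
  show "configs N d \<subseteq> ?F ` Pi\<^sub>E {1..<N} (\<lambda>_. ?P)"
  proof
    fix \<nu> assume \<nu>: "\<nu> \<in> configs N d"
    have "sum_list (\<nu> i) \<le> d" if "i \<in> {1..<N}" for i
      using \<nu> member_le_sum[of i "{1..<N}" "\<lambda>i. sum_list (\<nu> i)"] that by (auto simp: configs_def)
    then have "restrict \<nu> {1..<N} \<in> Pi\<^sub>E {1..<N} (\<lambda>_. ?P)" using \<nu> by (auto simp: configs_def)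
    moreover have "\<nu> = ?F (restrict \<nu> {1..<N})" using \<nu> by (auto simp: configs_def fun_eq_iff)
    ultimately show "\<nu> \<in> ?F ` Pi\<^sub>E {1..<N} (\<lambda>_. ?P)" by blast
  qed
qed

section \<open>Monomials in q and t\<close>

lemma telescope_step:
  fixes X :: complex
  assumes "X * P = F * R * (z / a)" "a \<noteq> 0" "a' \<noteq> 0" "z \<noteq> 0"
  shows "X * (P * (a / z * (z' / b))) = F * (R * (a' / b)) * (z' / a')"
proof -
  have "X * (P * (a / z * (z' / b))) = F * R * (z / a) * (a / z * (z' / b))"
    using assms(1) by (metis mult.assoc)
  then show ?thesis using assms(2-4) by (simp add: field_simps)
qed

lemma telescope_quotient:
  fixes A :: complex
  assumes "A \<noteq> 0" "B \<noteq> 0"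
  shows "A / a * (b / B) * ((B * A') / (A * B')) = A' / a * (b / B')"
  using assms by (simp add: field_simps)

locale generic_qt = qt_setup q t qh th for q t qh th :: complex +
  assumes q0: "q \<noteq> 0" and t0: "t \<noteq> 0" and qh2: "qh ^ 2 = q" and th2: "th ^ 2 = t"
    and generic: "\<And>a b :: int. (a, b) \<noteq> (0, 0) \<Longrightarrow> qh powi a * th powi b \<noteq> 1"
begin

lemma qh0: "qh \<noteq> 0" and th0: "th \<noteq> 0"
  using q0 t0 qh2 th2 by auto

lemma gam0: "gam \<noteq> 0"
  using qh0 th0 by (simp add: gam_def)

lemma gam2: "gam ^ 2 = t / q"
  using qh2 th2 by (simp add: gam_def power_divide)

text \<open>
  The exceptional values of the ratios of spectral parameters. All zeros and poles of the rational
  functions below that belong to a single site lie in this multiplicative group.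
\<close>
definition lat :: "complex set" where
  "lat = {qh powi a * th powi b | a b. True}"

lemma lat_0: "x \<in> lat \<Longrightarrow> x \<noteq> 0"
  using qh0 th0 by (auto simp: lat_def)

lemma lat_mult: assumes "x \<in> lat" "y \<in> lat" shows "x * y \<in> lat"
proof -
  obtain a b c d where "x = qh powi a * th powi b" "y = qh powi c * th powi d"
    using assms by (auto simp: lat_def)
  then have "x * y = qh powi (a + c) * th powi (b + d)"
    using qh0 th0 by (simp add: power_int_add)
  then show ?thesis by (auto simp: lat_def)
qed

lemma lat_inverse: assumes "x \<in> lat" shows "inverse x \<in> lat"
proof -
  obtain a b where "x = qh powi a * th powi b"
    using assms by (auto simp: lat_def)
  then have "inverse x = qh powi (- a) * th powi (- b)"
    using qh0 th0 by (simp add: power_int_minus)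
  then show ?thesis by (auto simp: lat_def)
qed

lemma lat_divide: "x \<in> lat \<Longrightarrow> y \<in> lat \<Longrightarrow> x / y \<in> lat"
  by (simp add: divide_inverse lat_mult lat_inverse)

lemma lat_one: "1 \<in> lat" and lat_qh: "qh \<in> lat" and lat_th: "th \<in> lat"
proof -
  show "1 \<in> lat" unfolding lat_def by (rule CollectI, rule exI[of _ 0], rule exI[of _ 0]) simp
  show "qh \<in> lat" unfolding lat_def by (rule CollectI, rule exI[of _ 1], rule exI[of _ 0]) simp
  show "th \<in> lat" unfolding lat_def by (rule CollectI, rule exI[of _ 0], rule exI[of _ 1]) simp
qed

lemma lat_power: "x \<in> lat \<Longrightarrow> x ^ n \<in> lat"
  by (induction n) (auto intro: lat_one lat_mult)

lemma lat_powi: "x \<in> lat \<Longrightarrow> x powi n \<in> lat"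
  by (auto simp: power_int_def intro: lat_power lat_inverse)

lemma lat_q: "q \<in> lat" and lat_t: "t \<in> lat" and lat_gam: "gam \<in> lat"
  using lat_power[OF lat_qh, of 2] lat_power[OF lat_th, of 2] lat_divide[OF lat_th lat_qh]
  by (simp_all add: qh2 th2 gam_def)

definition mon :: "int \<Rightarrow> int \<Rightarrow> complex" where
  "mon a b = q powi a * t powi b"

lemma mon_nz [simp]: "mon a b \<noteq> 0"
  using q0 t0 by (simp add: mon_def)

lemma mon_mult: "mon a b * mon c d = mon (a + c) (b + d)"
  using q0 t0 by (simp add: mon_def power_int_add)

lemma mon_eq_1: "mon a b = 1 \<longleftrightarrow> a = 0 \<and> b = 0"
proof
  assume "mon a b = 1"
  then have "qh powi (2 * a) * th powi (2 * b) = 1"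
    by (simp add: mon_def power_int_mult qh2 th2)
  then show "a = 0 \<and> b = 0" using generic[of "2 * a" "2 * b"] by auto
qed (simp add: mon_def)

lemma mon_0 [simp]: "mon 0 0 = 1"
  by (simp add: mon_def)

lemma mon_minus: "mon (- a) (- b) = inverse (mon a b)"
  by (simp add: mon_def power_int_minus)

lemma q_mult_mon: "q * mon a b = mon (a + 1) b" and mon_div_t: "mon a b / t = mon a (b - 1)"
  using q0 t0 by (simp_all add: mon_def power_int_add power_int_diff)

lemma one_minus_mon_nz: "a \<noteq> 0 \<or> b \<noteq> 0 \<Longrightarrow> 1 - mon a b \<noteq> 0"
  using mon_eq_1[of a b] by auto

lemma box_par_mon: "(i, j) \<in> boxes lam \<or> 1 \<le> i \<and> 1 \<le> j \<Longrightarrow> box_par (i, j) = mon (int j - 1) (1 - int i)"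
proof -
  assume "(i, j) \<in> boxes lam \<or> 1 \<le> i \<and> 1 \<le> j"
  then have "1 \<le> i" "1 \<le> j" by (auto simp: mem_boxes)
  then have "int j - 1 = int (j - 1)" "1 - int i = - int (i - 1)" by auto
  then show ?thesis by (simp only: mon_def box_par_def prod.case power_int_of_nat power_int_minus power_inverse)
qed

lemma box_par_lat: "box_par b \<in> lat"
  by (cases b) (auto simp: box_par_def intro!: lat_mult lat_power lat_q lat_t lat_inverse)

lemma box_par_nz [simp]: "box_par b \<noteq> 0"
  using box_par_lat lat_0 by blast

lemma box_par_inj:
  assumes "box_par (i, j) = box_par (k, l)" "1 \<le> i" "1 \<le> j" "1 \<le> k" "1 \<le> l"
  shows "i = k \<and> j = l"
proof -
  have "mon (int j - 1) (1 - int i) = mon (int l - 1) (1 - int k)"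
    using assms by (simp add: box_par_mon)
  then have "mon (int j - 1) (1 - int i) * mon (- (int l - 1)) (- (1 - int k)) = 1"
    unfolding mon_minus by simp
  then show ?thesis unfolding mon_mult mon_eq_1 by auto
qed

section \<open>The Y-function of a partition\<close>

text \<open>
  The contribution of one box to \<open>Yf\<close>. It is an alternating product over the four corners of the
  box, so products over rows, columns and whole diagrams telescope.
\<close>
definition gbox :: "complex \<Rightarrow> complex" where
  "gbox s = ((1 - s / t) * (1 - q * s)) / ((1 - s) * (1 - q * s / t))"

definition Yf :: "nat list \<Rightarrow> complex \<Rightarrow> complex" where
  "Yf lam x = (1 - x) * (\<Prod>b\<in>boxes lam. gbox (box_par b * x))"

text \<open>
  None of the finitely many linear factors that can occur for diagrams inside an $n \times n$
  square vanishes at \<open>x\<close>. Telescoping with division by zero equal to zero is only valid at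
  such points; limits then extend the results.
\<close>
definition nonres :: "nat \<Rightarrow> complex \<Rightarrow> bool" where
  "nonres n x \<longleftrightarrow> (\<forall>a b. \<bar>a\<bar> \<le> int n \<and> \<bar>b\<bar> \<le> int n \<longrightarrow> 1 - mon a b * x \<noteq> 0)"

lemma eventually_linear_nz:
  assumes "c \<noteq> 0"
  shows "\<forall>\<^sub>F x in at x0. 1 - c * x \<noteq> (0::complex)"
proof -
  have "\<forall>\<^sub>F x in at x0. x \<noteq> 1 / c"
    by (rule eventually_neq_at_within)
  then show ?thesis by eventually_elim (use assms in \<open>auto simp: field_simps\<close>)
qed

lemma eventually_nonres: "\<forall>\<^sub>F x in at x0. nonres n x"
proof -
  have "\<forall>\<^sub>F x in at x0. \<forall>p\<in>{- int n..int n} \<times> {- int n..int n}. 1 - mon (fst p) (snd p) * x \<noteq> 0"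
    by (intro eventually_ball_finite ballI eventually_linear_nz) simp_all
  then show ?thesis
    by eventually_elim (force simp: nonres_def abs_le_iff)
qed

lemma gbox_mon: "gbox (mon a b * x) =
    ((1 - mon a (b - 1) * x) * (1 - mon (a + 1) b * x)) / ((1 - mon a b * x) * (1 - mon (a + 1) (b - 1) * x))"
proof -
  have d: "mon a b * x / t = mon a (b - 1) * x" for a b
    by (metis mon_div_t times_divide_eq_left)
  have m: "q * (mon a b * x) = mon (a + 1) b * x" for a b
    by (simp only: mult.assoc[symmetric] q_mult_mon)
  show ?thesis unfolding gbox_def m d ..
qed

lemma row_telescope:
  assumes x: "nonres n x" and c: "1 \<le> c" "c \<le> Suc m" and i: "i \<ge> 1" and n: "i \<le> n" "m \<le> n"
  shows "(\<Prod>j\<in>{c..m}. gbox (box_par (i, j) * x)) =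
    (1 - mon (int m) (1 - int i) * x) / (1 - mon (int c - 1) (1 - int i) * x) *
    ((1 - mon (int c - 1) (- int i) * x) / (1 - mon (int m) (- int i) * x))"
proof -
  let ?A = "\<lambda>k. 1 - mon k (1 - int i) * x" and ?B = "\<lambda>k. 1 - mon k (- int i) * x"
  have nz: "?A (int k) \<noteq> 0" "?B (int k) \<noteq> 0" if "k \<le> n" for k
    using x i n that unfolding nonres_def by auto
  have c': "int c - 1 = int (c - 1)" using c by simp
  have "(\<Prod>j\<in>{c..<c + d}. gbox (box_par (i, j) * x)) =
      ?A (int (c + d) - 1) / ?A (int c - 1) * (?B (int c - 1) / ?B (int (c + d) - 1))" if "c + d \<le> Suc n" for d
    using that
  proof (induction d)
    case 0
    then show ?case using nz[of "c - 1"] unfolding c'[symmetric] by simp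
  next
    case (Suc d)
    have e: "int (c + d) - 1 = int (c + d - 1)" "int (c + Suc d) - 1 = int (c + d)" using c by auto
    have bp: "box_par (i, c + d) = mon (int (c + d) - 1) (1 - int i)" using i c by (simp add: box_par_mon)
    have g: "gbox (box_par (i, c + d) * x) = (?B (int (c + d - 1)) * ?A (int (c + d))) / (?A (int (c + d - 1)) * ?B (int (c + d)))"
      unfolding bp gbox_mon e(1) using c by (simp add: of_nat_diff)
    have nz': "?A (int (c + d - 1)) \<noteq> 0" "?B (int (c + d - 1)) \<noteq> 0" by (rule nz; use Suc.prems in linarith)+
    have "(\<Prod>j\<in>{c..<c + Suc d}. gbox (box_par (i, j) * x)) = 
       ?A (int (c + d - 1)) / ?A (int c - 1) * (?B (int c - 1) / ?B (int (c + d - 1))) * gbox (box_par (i, c + d) * x)"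
    proof -
      have "c + d \<le> Suc n" using Suc.prems by simp
      from Suc.IH[OF this, unfolded e(1)] show ?thesis by (simp only: add_Suc_right prod.atLeastLessThan_Suc le_add1)
    qed
    then show ?case unfolding g e(2) telescope_quotient[OF nz'] .
  qed
  from this[of "Suc m - c"] have "(\<Prod>j\<in>{c..<Suc m}. gbox (box_par (i, j) * x)) =
      ?A (int (Suc m) - 1) / ?A (int c - 1) * (?B (int c - 1) / ?B (int (Suc m) - 1))"
    using c n by (simp only: le_add_diff_inverse Suc_le_mono)
  moreover have "int (Suc m) - 1 = int m" "{c..<Suc m} = {c..m}" by auto
  ultimately show ?thesis by (simp only:)
qed

lemma col_telescope:
  assumes x: "nonres n x" and j: "j \<ge> 1" and n: "j \<le> n" "h \<le> n"
  shows "(\<Prod>i\<in>{1..h}. gbox (box_par (i, j) * x)) =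
    (1 - mon (int j - 1) (- int h) * x) / (1 - mon (int j - 1) 0 * x) *
    ((1 - mon (int j) 0 * x) / (1 - mon (int j) (- int h) * x))"
  using n(2)
proof (induction h)
  case 0
  have "1 - mon (int j - 1) 0 * x \<noteq> 0" "1 - mon (int j) 0 * x \<noteq> 0"
    using x j n unfolding nonres_def by auto
  then show ?case by simp
next
  case (Suc h)
  have bp: "box_par (Suc h, j) = mon (int j - 1) (- int h)" using j by (simp add: box_par_mon)
  have g: "gbox (box_par (Suc h, j) * x) = ((1 - mon (int j) (- int h) * x) * (1 - mon (int j - 1) (- int (Suc h)) * x)) /
    ((1 - mon (int j - 1) (- int h) * x) * (1 - mon (int j) (- int (Suc h)) * x))"
  proof -
    have "- int h - 1 = - int (Suc h)" "int j - 1 + 1 = int j" by auto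
    then show ?thesis unfolding bp gbox_mon by (simp only: mult.commute)
  qed
  have nz: "1 - mon (int j - 1) (- int h) * x \<noteq> 0" "1 - mon (int j) (- int h) * x \<noteq> 0"
    using x j n Suc.prems unfolding nonres_def by auto
  have "(\<Prod>i\<in>{1..Suc h}. gbox (box_par (i, j) * x)) = 
    (1 - mon (int j - 1) (- int h) * x) / (1 - mon (int j - 1) 0 * x) *
    ((1 - mon (int j) 0 * x) / (1 - mon (int j) (- int h) * x)) * gbox (box_par (Suc h, j) * x)"
    using Suc by (simp add: mult.commute)
  then show ?case unfolding g telescope_quotient[OF nz] .
qed

lemma Yf_rows:
  assumes x: "nonres n x" and n: "length lam < n" "part lam 1 \<le> n" and lam: "is_partition lam"
  shows "Yf lam x = (1 - mon (int (part lam 1)) 0 * x) *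
    (\<Prod>i\<in>{1..length lam}. (1 - mon (int (part lam (Suc i))) (- int i) * x) / (1 - mon (int (part lam i)) (- int i) * x))"
proof -
  let ?f = "\<lambda>i k. 1 - mon (int (part lam i)) k * x"
  have p: "part lam i \<le> n" if "i \<ge> 1" for i using part_antimono[OF lam, of 1 i] that n by auto
  have nz: "?f i (- int k) \<noteq> 0" if "i \<ge> 1" "k \<le> n" for i k
    using x p[OF that(1)] that(2) unfolding nonres_def by auto
  have nz0: "1 - mon 0 (- int k) * x \<noteq> 0" if "k \<le> n" for k
    using x that unfolding nonres_def by auto
  have "Yf lam x = (1 - x) * (\<Prod>i\<in>{1..length lam}. \<Prod>j\<in>{1..part lam i}. gbox (box_par (i, j) * x))"
    unfolding Yf_def boxes_Sigma by (subst prod.Sigma) auto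
  also have "(\<Prod>i\<in>{1..length lam}. \<Prod>j\<in>{1..part lam i}. gbox (box_par (i, j) * x)) =
     (\<Prod>i\<in>{1..length lam}. ?f i (1 - int i) / (1 - mon 0 (1 - int i) * x) * ((1 - mon 0 (- int i) * x) / ?f i (- int i)))"
    by (rule prod.cong[OF refl], subst row_telescope[OF x]) (use n p in auto)
  also have "(1 - x) * \<dots> = (1 - mon (int (part lam 1)) 0 * x) *
    (\<Prod>i\<in>{1..length lam}. ?f (Suc i) (- int i) / ?f i (- int i)) * ((1 - mon 0 (- int (length lam)) * x) / ?f (Suc (length lam)) (- int (length lam)))"
  proof -
    have "(1 - x) * (\<Prod>i\<in>{1..l}. ?f i (1 - int i) / (1 - mon 0 (1 - int i) * x) * ((1 - mon 0 (- int i) * x) / ?f i (- int i))) =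
      (1 - mon (int (part lam 1)) 0 * x) *
    (\<Prod>i\<in>{1..l}. ?f (Suc i) (- int i) / ?f i (- int i)) * ((1 - mon 0 (- int l) * x) / ?f (Suc l) (- int l))"
      if "l \<le> length lam" for l
      using that
    proof (induction l)
      case 0
      have "1 - mon (int (part lam 1)) 0 * x \<noteq> 0" using nz[of 1 0] by simp
      then show ?case by simp
    next
      case (Suc l)
      have nz': "?f (Suc l) (- int l) \<noteq> 0" "?f (Suc (Suc l)) (- int (Suc l)) \<noteq> 0" "1 - mon 0 (- int l) * x \<noteq> 0"
        by (rule nz nz0; use Suc.prems n in simp)+
      have split: "(\<Prod>i\<in>{1..Suc l}. h i) = (\<Prod>i\<in>{1..l}. h i) * h (Suc l)" for h :: "nat \<Rightarrow> complex"
        by simp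
      have e: "1 - int (Suc l) = - int l" by simp
      have "l \<le> length lam" using Suc.prems by simp
      from telescope_step[OF Suc.IH[OF this] nz'] show ?case
        unfolding split e .
    qed
    then show ?thesis by blast
  qed
  also have "(1 - mon 0 (- int (length lam)) * x) / ?f (Suc (length lam)) (- int (length lam)) = 1"
    using nz0[of "length lam"] n by (simp add: part_beyond)
  finally show ?thesis by simp
qed


lemma prod_telescope_ratio:
  fixes g :: "nat \<Rightarrow> complex"
  assumes "\<And>k. k \<le> m \<Longrightarrow> g k \<noteq> 0"
  shows "(\<Prod>i\<in>{1..<Suc m}. g i / g (i - 1)) = g m / g 0"
  using assms by (induction m) auto

section \<open>Factorization of the Y-function at a corner\<close>

text \<open>
  What is left of \<open>Yf\<close> after the zero belonging to an addable box has been taken out. The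
  columns to the left of the box and the rows above it telescope separately.
\<close>
definition corner_prod :: "nat list \<Rightarrow> nat \<times> nat \<Rightarrow> complex \<Rightarrow> complex" where
  "corner_prod lam = (\<lambda>(r, c) x.
     (\<Prod>j\<in>{1..<c}. (1 - mon (int j - 1) (- int (part (transp lam) j)) * x) / (1 - mon (int j) (- int (part (transp lam) j)) * x)) *
     (\<Prod>i\<in>{1..<r}. (1 - mon (int (part lam i)) (1 - int i) * x) / (1 - mon (int (part lam i)) (- int i) * x)))"

text \<open>
  The diagram is the disjoint union of the columns to the left of the addable box and of the parts,
  to the right of these columns, of the rows above it. Each piece telescopes.
\<close>
lemma Yf_corner:
  assumes lam: "is_partition lam" and A: "addable lam (r, c)"
    and x: "nonres n x" and n: "length lam < n" "part lam 1 < n"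
  shows "Yf lam x = (1 - box_par (r, c) * x) * corner_prod lam (r, c) x"
proof -
  let ?h = "\<lambda>j. part (transp lam) j"
  have c: "c = Suc (part lam r)" "r \<ge> 1" "r = 1 \<or> c \<le> part lam (r - 1)" using A by (auto simp: addable_def)
  have p: "part lam i < n" if "i \<ge> 1" for i using part_antimono[OF lam, of 1 i] that n by auto
  have hn: "?h j \<le> length lam" if "j \<ge> 1" for j
  proof (rule ccontr)
    assume "\<not> ?h j \<le> length lam"
    then have "j \<le> part lam (?h j)" using part_transp_iff[OF lam, of "?h j" j] that by auto
    then show False using \<open>\<not> ?h j \<le> length lam\<close> part_beyond[of lam "?h j"] that by auto
  qed
  have rn: "r \<le> n"
  proof (rule ccontr)
    assume "\<not> r \<le> n"
    then have "part lam (r - 1) = 0" using n by (intro part_beyond) linarith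
    then show False using c \<open>\<not> r \<le> n\<close> n by simp
  qed
  have cn: "c \<le> n" using p[of r] c by simp
  have nz: "1 - mon a b * x \<noteq> 0" if "\<bar>a\<bar> \<le> int n" "\<bar>b\<bar> \<le> int n" for a b
    using x that unfolding nonres_def by auto
  let ?B1 = "SIGMA j:{1..<c}. {1..?h j}" and ?B2 = "SIGMA i:{1..<r}. {c..part lam i}"
  have dec: "boxes lam = prod.swap ` ?B1 \<union> ?B2"
  proof (intro set_eqI)
    fix b :: "nat \<times> nat"
    obtain i j where b: "b = (i, j)" by (cases b)
    have "i < r" if "1 \<le> i" "c \<le> j" "j \<le> part lam i"
    proof (rule ccontr)
      assume "\<not> i < r"
      then have "part lam i \<le> part lam r" using part_antimono[OF lam c(2), of i] by simp
      then show False using that c(1) by linarith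
    qed
    moreover have "i \<le> ?h j \<longleftrightarrow> j \<le> part lam i" if "1 \<le> i" "1 \<le> j" using part_transp_iff[OF lam that] .
    moreover have "1 \<le> c" using c by simp
    moreover have "b \<in> prod.swap ` ?B1 \<longleftrightarrow> (j, i) \<in> ?B1" unfolding b by (force simp: image_iff)
    ultimately show "b \<in> boxes lam \<longleftrightarrow> b \<in> prod.swap ` ?B1 \<union> ?B2"
      unfolding b mem_boxes Un_iff mem_Sigma_iff atLeastLessThan_iff atLeastAtMost_iff
      by (meson le_trans linorder_not_less)
  qed
  have disj: "prod.swap ` ?B1 \<inter> ?B2 = {}" by auto
  let ?g = "\<lambda>b. gbox (box_par b * x)"
  have "(\<Prod>b\<in>boxes lam. ?g b) = (\<Prod>b\<in>prod.swap ` ?B1. ?g b) * (\<Prod>b\<in>?B2. ?g b)"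
    unfolding dec by (rule prod.union_disjoint) (use disj in auto)
  also have "(\<Prod>b\<in>prod.swap ` ?B1. ?g b) = (\<Prod>j\<in>{1..<c}. \<Prod>i\<in>{1..?h j}. ?g (i, j))"
    by (subst prod.reindex) (auto simp: prod.Sigma intro!: prod.cong)
  also have "\<dots> = (\<Prod>j\<in>{1..<c}. (1 - mon (int j - 1) (- int (?h j)) * x) / (1 - mon (int j - 1) 0 * x) *
    ((1 - mon (int j) 0 * x) / (1 - mon (int j) (- int (?h j)) * x)))"
  proof (rule prod.cong[OF refl])
    fix j assume "j \<in> {1..<c}"
    then have j: "1 \<le> j" "j \<le> n" "?h j \<le> n" using cn hn[of j] n by auto
    show "(\<Prod>i\<in>{1..?h j}. ?g (i, j)) = (1 - mon (int j - 1) (- int (?h j)) * x) / (1 - mon (int j - 1) 0 * x) *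
      ((1 - mon (int j) 0 * x) / (1 - mon (int j) (- int (?h j)) * x))"
      by (rule col_telescope[OF x j])
  qed
  also have "\<dots> = (\<Prod>j\<in>{1..<c}. (1 - mon (int j - 1) (- int (?h j)) * x) / (1 - mon (int j) (- int (?h j)) * x)) *
      (\<Prod>j\<in>{1..<c}. (1 - mon (int j) 0 * x) / (1 - mon (int (j - 1)) 0 * x))"
    unfolding prod.distrib[symmetric] by (rule prod.cong) (auto simp: of_nat_diff)
  also have "(\<Prod>j\<in>{1..<c}. (1 - mon (int j) 0 * x) / (1 - mon (int (j - 1)) 0 * x)) = (1 - mon (int c - 1) 0 * x) / (1 - x)"
    using prod_telescope_ratio[of "c - 1" "\<lambda>k. 1 - mon (int k) 0 * x"] nz cn c(1) by (auto simp: of_nat_diff)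
  also have "(\<Prod>b\<in>?B2. ?g b) = (\<Prod>i\<in>{1..<r}. \<Prod>j\<in>{c..part lam i}. ?g (i, j))"
    by (subst prod.Sigma) auto
  also have "\<dots> = (\<Prod>i\<in>{1..<r}. (1 - mon (int (part lam i)) (1 - int i) * x) / (1 - mon (int c - 1) (1 - int i) * x) *
    ((1 - mon (int c - 1) (- int i) * x) / (1 - mon (int (part lam i)) (- int i) * x)))"
  proof (rule prod.cong[OF refl])
    fix i assume "i \<in> {1..<r}"
    then have i: "1 \<le> i" "i \<le> n" "part lam i \<le> n" "c \<le> Suc (part lam i)"
      using rn p[of i] part_antimono[OF lam, of i r] c(1) by auto
    show "(\<Prod>j\<in>{c..part lam i}. ?g (i, j)) = (1 - mon (int (part lam i)) (1 - int i) * x) / (1 - mon (int c - 1) (1 - int i) * x) *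
      ((1 - mon (int c - 1) (- int i) * x) / (1 - mon (int (part lam i)) (- int i) * x))"
      by (rule row_telescope[OF x _ i(4,1,2,3)]) (use c in simp)
  qed
  also have "\<dots> = (\<Prod>i\<in>{1..<r}. (1 - mon (int (part lam i)) (1 - int i) * x) / (1 - mon (int (part lam i)) (- int i) * x)) *
      (\<Prod>i\<in>{1..<r}. (1 - mon (int c - 1) (- int i) * x) / (1 - mon (int c - 1) (- int (i - 1)) * x))"
    unfolding prod.distrib[symmetric] by (rule prod.cong) (auto simp: of_nat_diff)
  also have "(\<Prod>i\<in>{1..<r}. (1 - mon (int c - 1) (- int i) * x) / (1 - mon (int c - 1) (- int (i - 1)) * x)) =
      (1 - mon (int c - 1) (1 - int r) * x) / (1 - mon (int c - 1) 0 * x)"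
    using prod_telescope_ratio[of "r - 1" "\<lambda>k. 1 - mon (int c - 1) (- int k) * x"] nz cn rn c(1,2) by (auto simp: of_nat_diff)
  finally have "Yf lam x = (1 - x) * ((\<Prod>j\<in>{1..<c}. (1 - mon (int j - 1) (- int (?h j)) * x) / (1 - mon (int j) (- int (?h j)) * x)) *
     ((1 - mon (int c - 1) 0 * x) / (1 - x)) *
     ((\<Prod>i\<in>{1..<r}. (1 - mon (int (part lam i)) (1 - int i) * x) / (1 - mon (int (part lam i)) (- int i) * x)) *
     ((1 - mon (int c - 1) (1 - int r) * x) / (1 - mon (int c - 1) 0 * x))))"
    unfolding Yf_def by (simp only:)
  moreover have "1 - x \<noteq> 0" "1 - mon (int c - 1) 0 * x \<noteq> 0"
    using nz[of 0 0] nz[of "int c - 1" 0] cn c(1) by auto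
  moreover have "box_par (r, c) = mon (int c - 1) (1 - int r)" using c by (simp add: box_par_mon)
  moreover have "(1 - x) * (P * (a / (1 - x)) * (Q * (b / a))) = b * (P * Q)" if "1 - x \<noteq> 0" "a \<noteq> 0" for a b P Q
    using that by (simp add: field_simps)
  ultimately show ?thesis unfolding corner_prod_def by simp
qed

lemma eventually_Yf_corner:
  assumes "is_partition lam" "addable lam (r, c)"
  shows "\<forall>\<^sub>F x in at x0. Yf lam x = (1 - box_par (r, c) * x) * corner_prod lam (r, c) x"
  using eventually_nonres[of "Suc (length lam + part lam 1)"]
proof eventually_elim
  case (elim x)
  show ?case by (rule Yf_corner[OF assms elim]) simp_all
qed

lemma tendsto_prod_exists:
  fixes f :: "'i \<Rightarrow> 'a \<Rightarrow> complex"
  assumes "\<And>i. i \<in> I \<Longrightarrow> \<exists>l. (f i \<longlongrightarrow> l) F"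
  shows "\<exists>l. ((\<lambda>x. \<Prod>i\<in>I. f i x) \<longlongrightarrow> l) F"
proof -
  obtain l where "\<And>i. i \<in> I \<Longrightarrow> (f i \<longlongrightarrow> l i) F" using assms by metis
  then show ?thesis by (intro exI) (rule tendsto_prod)
qed

lemma linear_ratio_limit:
  assumes "a = b \<or> 1 - b * x0 \<noteq> 0"
  shows "\<exists>l. ((\<lambda>x. (1 - a * x) / (1 - b * x)) \<longlongrightarrow> (l::complex)) (at x0)"
proof (cases "1 - b * x0 = 0")
  case True
  then have "a = b" "b \<noteq> 0" using assms by auto
  then have "\<forall>\<^sub>F x in at x0. (1 - a * x) / (1 - b * x) = 1"
    using eventually_linear_nz[of b x0] by (auto elim: eventually_mono)
  then show ?thesis by (intro exI) (rule tendsto_eventually)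
next
  case False
  then have "((\<lambda>x. (1 - a * x) / (1 - b * x)) \<longlongrightarrow> (1 - a * x0) / (1 - b * x0)) (at x0)"
    by (intro tendsto_intros)
  then show ?thesis by blast
qed

text \<open>
  The zeros of \<open>Yf\<close> sit exactly at the addable boxes: in the row formula every other linear
  factor in the denominator of the inverse cancels because two consecutive parts coincide.
\<close>
lemma inverse_Yf_limit:
  assumes lam: "is_partition lam" and x0: "\<And>A. addable lam A \<Longrightarrow> 1 - box_par A * x0 \<noteq> 0"
  shows "\<exists>l. ((\<lambda>x. inverse (Yf lam x)) \<longlongrightarrow> l) (at x0)"
proof -
  let ?p = "\<lambda>i. int (part lam i)"
  have lim: "\<exists>l. ((\<lambda>x. (1 - mon (?p i) (- int i) * x) / (1 - mon (?p (Suc i)) (- int i) * x)) \<longlongrightarrow> l) (at x0)"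
    if i: "i \<in> {1..length lam}" for i
  proof (rule linear_ratio_limit)
    have le: "part lam (Suc i) \<le> part lam i" by (rule part_antimono) (use lam i in auto)
    show "mon (?p i) (- int i) = mon (?p (Suc i)) (- int i) \<or> 1 - mon (?p (Suc i)) (- int i) * x0 \<noteq> 0"
    proof (cases "part lam (Suc i) = part lam i")
      case False
      then have "addable lam (Suc i, Suc (part lam (Suc i)))" using le by (simp add: addable_def)
      from x0[OF this] show ?thesis by (simp add: box_par_mon)
    qed simp
  qed
  have "addable lam (1, Suc (part lam 1))" by (simp add: addable_def)
  from x0[OF this] have "\<exists>l. ((\<lambda>x. (1 - 0 * x) / (1 - mon (?p 1) 0 * x)) \<longlongrightarrow> l) (at x0)"
    by (intro linear_ratio_limit) (simp add: box_par_mon)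
  then obtain l1 where "((\<lambda>x. (1 - 0 * x) / (1 - mon (?p 1) 0 * x)) \<longlongrightarrow> l1) (at x0)" by blast
  moreover have "\<exists>l. ((\<lambda>x. \<Prod>i\<in>{1..length lam}. (1 - mon (?p i) (- int i) * x) / (1 - mon (?p (Suc i)) (- int i) * x)) \<longlongrightarrow> l) (at x0)"
    by (rule tendsto_prod_exists) (rule lim)
  then obtain l2 where "((\<lambda>x. \<Prod>i\<in>{1..length lam}. (1 - mon (?p i) (- int i) * x) / (1 - mon (?p (Suc i)) (- int i) * x)) \<longlongrightarrow> l2) (at x0)"
    by (rule exE)
  ultimately have L: "((\<lambda>x. (1 - 0 * x) / (1 - mon (?p 1) 0 * x) *
      (\<Prod>i\<in>{1..length lam}. (1 - mon (?p i) (- int i) * x) / (1 - mon (?p (Suc i)) (- int i) * x))) \<longlongrightarrow> l1 * l2) (at x0)"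
    by (rule tendsto_mult)
  have "\<forall>\<^sub>F x in at x0. (1 - 0 * x) / (1 - mon (?p 1) 0 * x) *
      (\<Prod>i\<in>{1..length lam}. (1 - mon (?p i) (- int i) * x) / (1 - mon (?p (Suc i)) (- int i) * x)) = inverse (Yf lam x)"
    using eventually_nonres[of "Suc (length lam + part lam 1)"]
  proof eventually_elim
    case (elim x)
    show ?case
      by (subst Yf_rows[OF elim _ _ lam]) (simp_all add: divide_inverse prod_inversef[symmetric] mult.commute)
  qed
  from tendsto_cong[OF this] L show ?thesis by (intro exI) (rule iffD1)
qed

text \<open>
  Likewise the poles sit at the removable boxes, shifted by $t/q$.
\<close>
lemma Yf_limit:
  assumes lam: "is_partition lam" and x0: "\<And>R. removable lam R \<Longrightarrow> 1 - box_par R * (q / t * x0) \<noteq> 0"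
  shows "\<exists>l. (Yf lam \<longlongrightarrow> l) (at x0)"
proof -
  let ?p = "\<lambda>i. int (part lam i)"
  have lim: "\<exists>l. ((\<lambda>x. (1 - mon (?p (Suc i)) (- int i) * x) / (1 - mon (?p i) (- int i) * x)) \<longlongrightarrow> l) (at x0)"
    if i: "i \<in> {1..length lam}" for i
  proof (rule linear_ratio_limit)
    have le: "part lam (Suc i) \<le> part lam i" by (rule part_antimono) (use lam i in auto)
    show "mon (?p (Suc i)) (- int i) = mon (?p i) (- int i) \<or> 1 - mon (?p i) (- int i) * x0 \<noteq> 0"
    proof (cases "part lam (Suc i) = part lam i")
      case False
      then have "removable lam (i, part lam i)" using le i by (simp add: removable_def)
      from x0[OF this] have "1 - mon (?p i - 1) (1 - int i) * (q / t * x0) \<noteq> 0"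
        using i False le by (simp add: box_par_mon)
      moreover have "mon (?p i - 1) (1 - int i) * (q / t) = mon (?p i) (- int i)"
        using mon_mult[of "?p i - 1" "1 - int i" 1 "-1"] by (simp add: mon_def[of 1 "-1"] divide_inverse power_int_minus)
      ultimately show ?thesis by (metis mult.assoc)
    qed simp
  qed
  have "\<exists>l. ((\<lambda>x. \<Prod>i\<in>{1..length lam}. (1 - mon (?p (Suc i)) (- int i) * x) / (1 - mon (?p i) (- int i) * x)) \<longlongrightarrow> l) (at x0)"
    by (rule tendsto_prod_exists) (rule lim)
  then obtain l2 where l2: "((\<lambda>x. \<Prod>i\<in>{1..length lam}. (1 - mon (?p (Suc i)) (- int i) * x) / (1 - mon (?p i) (- int i) * x)) \<longlongrightarrow> l2) (at x0)"
    by (rule exE)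
  have L: "((\<lambda>x. (1 - mon (?p 1) 0 * x) *
      (\<Prod>i\<in>{1..length lam}. (1 - mon (?p (Suc i)) (- int i) * x) / (1 - mon (?p i) (- int i) * x))) \<longlongrightarrow> (1 - mon (?p 1) 0 * x0) * l2) (at x0)"
    by (intro tendsto_intros l2)
  have "\<forall>\<^sub>F x in at x0. (1 - mon (?p 1) 0 * x) *
      (\<Prod>i\<in>{1..length lam}. (1 - mon (?p (Suc i)) (- int i) * x) / (1 - mon (?p i) (- int i) * x)) = Yf lam x"
    using eventually_nonres[of "Suc (length lam + part lam 1)"]
  proof eventually_elim
    case (elim x)
    show ?case by (subst Yf_rows[OF elim _ _ lam]) simp_all
  qed
  from tendsto_cong[OF this] L show ?thesis by (intro exI) (rule iffD1)
qed

lemma off_lat_nz: "x \<notin> lat \<Longrightarrow> y \<in> lat \<Longrightarrow> 1 - y * x \<noteq> 0"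
  using lat_inverse[of y] lat_0[of y] by (metis eq_iff_diff_eq_0 inverse_unique)

lemma off_lat_mult: "x \<notin> lat \<Longrightarrow> y \<in> lat \<Longrightarrow> y * x \<notin> lat"
proof
  assume "x \<notin> lat" "y \<in> lat" "y * x \<in> lat"
  then have "inverse y * (y * x) \<in> lat" by (intro lat_mult[OF lat_inverse])
  moreover have "inverse y * (y * x) = x" using lat_0[OF \<open>y \<in> lat\<close>] by (simp add: field_simps)
  ultimately show False using \<open>x \<notin> lat\<close> by simp
qed

lemma gbox_off_lat:
  assumes "s \<notin> lat"
  shows "gbox s \<noteq> 0" "isCont gbox s"
proof -
  have nz: "1 - s / t \<noteq> 0" "1 - q * s \<noteq> 0" "1 - s \<noteq> 0" "1 - q * s / t \<noteq> 0"
    using off_lat_nz[OF assms, of "inverse t"] off_lat_nz[OF assms, of q] off_lat_nz[OF assms, of 1]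
      off_lat_nz[OF assms, of "q * inverse t"] lat_inverse lat_t lat_q lat_one lat_mult[OF lat_q lat_inverse[OF lat_t]]
    by (simp_all add: divide_inverse mult_ac)
  then show "gbox s \<noteq> 0" by (simp add: gbox_def)
  show "isCont gbox s"
    unfolding gbox_def using nz t0 by (intro continuous_intros) auto
qed

lemma Yf_off_lat:
  assumes "x0 \<notin> lat"
  shows "Yf lam x0 \<noteq> 0" "isCont (Yf lam) x0"
proof -
  have s: "box_par b * x0 \<notin> lat" for b using off_lat_mult[OF assms box_par_lat] .
  have "1 - x0 \<noteq> 0" using off_lat_nz[OF assms lat_one] by simp
  then show "Yf lam x0 \<noteq> 0" using gbox_off_lat(1)[OF s] by (simp add: Yf_def)
  show "isCont (Yf lam) x0"
  proof -
    have "isCont (\<lambda>x. gbox (box_par b * x)) x0" for b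
      by (rule isCont_o2[where g = gbox]) (auto intro!: continuous_intros gbox_off_lat(2) s)
    then show ?thesis unfolding Yf_def[abs_def] by (intro continuous_intros)
  qed
qed


section \<open>Hook products and residues\<close>

text \<open>
  The two arguments are arm and leg; the two factors come from $c_\lambda$ and $c'_\lambda$.
\<close>
definition hook :: "int \<Rightarrow> int \<Rightarrow> complex" where
  "hook a l = (1 - mon a (l + 1)) * (1 - mon (a + 1) l)"

lemma hook_nz: "0 \<le> a \<Longrightarrow> 0 \<le> l \<Longrightarrow> hook a l \<noteq> 0"
  using one_minus_mon_nz[of a "l + 1"] one_minus_mon_nz[of "a + 1" l] by (auto simp: hook_def)

definition box_hook :: "nat list \<Rightarrow> nat \<times> nat \<Rightarrow> complex" where
  "box_hook lam = (\<lambda>(i, j). hook (int (part lam i) - int j) (int (part (transp lam) j) - int i))"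

lemma c_c'_hooks:
  assumes "is_partition lam"
  shows "c_fac lam * c'_fac lam = (\<Prod>b\<in>boxes lam. box_hook lam b)"
  unfolding c_fac_def c'_fac_def prod.distrib[symmetric]
proof (rule prod.cong[OF refl])
  fix b assume "b \<in> boxes lam"
  obtain i j where b: "b = (i, j)" by (cases b)
  with \<open>b \<in> boxes lam\<close> have ij: "1 \<le> i" "1 \<le> j" "j \<le> part lam i" by (auto simp: mem_boxes)
  then have "i \<le> part (transp lam) j" using part_transp_iff[OF assms] by auto
  then have e: "int (part lam i) - int j = int (part lam i - j)"
    "int (part (transp lam) j) - int i = int (part (transp lam) j - i)" using ij by auto
  have h: "hook (int a) (int l) = (1 - q ^ a * t ^ (l + 1)) * (1 - q ^ (a + 1) * t ^ l)" for a l
    by (simp add: hook_def mon_def power_int_add q0 t0 mult.commute mult.left_commute)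
  show "(case b of (i, j) \<Rightarrow> 1 - q ^ (part lam i - j) * t ^ (part (transp lam) j - i + 1)) *
      (case b of (i, j) \<Rightarrow> 1 - q ^ (part lam i - j + 1) * t ^ (part (transp lam) j - i)) = box_hook lam b"
    unfolding b box_hook_def prod.case e h ..
qed

lemma box_hook_nz:
  assumes "is_partition lam" "b \<in> boxes lam"
  shows "box_hook lam b \<noteq> 0"
proof -
  obtain i j where b: "b = (i, j)" by (cases b)
  with assms have ij: "1 \<le> i" "1 \<le> j" "j \<le> part lam i" by (auto simp: mem_boxes)
  then have "i \<le> part (transp lam) j" using part_transp_iff[OF assms(1)] by auto
  then show ?thesis unfolding b box_hook_def prod.case using ij by (intro hook_nz) auto
qed

lemma c_c'_nz: "is_partition lam \<Longrightarrow> c_fac lam * c'_fac lam \<noteq> 0"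
  by (simp only: c_c'_hooks) (auto dest: box_hook_nz)

lemma mon_flip:
  assumes "mon a b \<noteq> 1"
  shows "(1 - mon (- a - 1) (- b)) / (1 - mon (- a) (- b)) = inverse q * ((1 - mon (a + 1) b) / (1 - mon a b))"
proof -
  have 1: "1 - mon (- a) (- b) = - inverse (mon a b) * (1 - mon a b)" for a b
    unfolding mon_minus by (simp add: field_simps)
  have 2: "- a - 1 = - (a + 1)" by simp
  have 3: "mon (a + 1) b = q * mon a b" by (simp add: q_mult_mon)
  show ?thesis unfolding 2 1 3 using assms q0 by (simp add: field_simps)
qed

text \<open>
  Adding a box changes the hooks only in its row and in its column. Along them the quotients of
  hook factors are, up to powers of $q$ from inverting monomials, the factors of \<open>corner_prod\<close> at
  the point where the zero of \<open>Yf\<close> sits and at its shift by $t/q$.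
\<close>
lemma hook_ratio:
  assumes lam: "is_partition lam" and A: "addable lam (r, c)"
  shows "c_fac (add_box lam (r, c)) * c'_fac (add_box lam (r, c)) = c_fac lam * c'_fac lam *
     ((1 - q) * (1 - t) * q ^ (2 * (c - 1)) * corner_prod lam (r, c) (mon (1 - int c) (int r - 1)) *
      corner_prod lam (r, c) (mon (- int c) (int r)))"
proof -
  let ?mu = "add_box lam (r, c)" and ?h = "\<lambda>j. part (transp lam) j"
  have c: "c = Suc (part lam r)" "r \<ge> 1" using A by (auto simp: addable_def)
  have mu: "is_partition ?mu" by (rule add_box(1)[OF lam A])
  have hc: "?h c = r - 1" by (rule part_transp_addable[OF lam A])
  let ?G = "box_hook lam" and ?G' = "box_hook ?mu"
  let ?R = "(\<lambda>j. (r, j)) ` {1..<c}" and ?C = "(\<lambda>i. (i, c)) ` {1..<r}"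
  have pm: "part ?mu i = (if i = r then c else part lam i)" if "i \<ge> 1" for i by (rule add_box(2)[OF lam A that])
  have hm: "part (transp ?mu) j = (if j = c then r else ?h j)" if "j \<ge> 1" for j by (rule part_transp_add_box[OF lam A that])
  have R: "?R \<subseteq> boxes lam" using c by (auto simp: mem_boxes)
  have C: "?C \<subseteq> boxes lam"
  proof safe
    fix i assume "i \<in> {1..<r}"
    then show "(i, c) \<in> boxes lam"
      using part_transp_iff[OF lam, of i c] hc c(1) unfolding mem_boxes by auto
  qed
  have same: "?G' b / ?G b = 1" if b: "b \<in> boxes lam - (?R \<union> ?C)" for b
  proof -
    obtain i j where ij: "b = (i, j)" by (cases b)
    have m: "1 \<le> i" "1 \<le> j" "j \<le> part lam i" using b ij by (auto simp: mem_boxes)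
    have "i \<noteq> r" using b ij m c by auto
    moreover have "j \<noteq> c" using b ij m part_transp_iff[OF lam m(1), of c] hc c by auto
    ultimately have "?G' b = ?G b" using m by (simp add: ij box_hook_def pm hm)
    then show ?thesis using box_hook_nz[OF lam] b by auto
  qed
  have row: "?G' (r, j) / ?G (r, j) = q ^ 2 *
      ((1 - mon (int j - 1) (- int (?h j)) * mon (1 - int c) (int r - 1)) / (1 - mon (int j) (- int (?h j)) * mon (1 - int c) (int r - 1)) *
       ((1 - mon (int j - 1) (- int (?h j)) * mon (- int c) (int r)) / (1 - mon (int j) (- int (?h j)) * mon (- int c) (int r))))"
    if j: "j \<in> {1..<c}" for j
  proof -
    define a l where "a = int c - 1 - int j" and "l = int (?h j) - int r"
    have "r \<le> ?h j" using part_transp_iff[OF lam c(2), of j] j c by auto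
    then have al: "a \<ge> 0" "l \<ge> 0" using j by (auto simp: a_def l_def)
    have g: "?G (r, j) = hook a l" "?G' (r, j) = hook (a + 1) l"
    proof -
      have pr: "part ?mu r = c" "int (part lam r) = int c - 1" using pm[OF c(2)] c(1) by simp_all
      have hj: "part (transp ?mu) j = ?h j" using hm[of j] j by simp
      show "?G (r, j) = hook a l" "?G' (r, j) = hook (a + 1) l"
        unfolding box_hook_def prod.case pr hj a_def l_def by simp_all
    qed
    have e: "mon (int j - 1) (- int (?h j)) * mon (1 - int c) (int r - 1) = mon (- a - 1) (- (l + 1))"
      "mon (int j) (- int (?h j)) * mon (1 - int c) (int r - 1) = mon (- a) (- (l + 1))"
      "mon (int j - 1) (- int (?h j)) * mon (- int c) (int r) = mon (- (a + 1) - 1) (- l)"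
      "mon (int j) (- int (?h j)) * mon (- int c) (int r) = mon (- (a + 1)) (- l)"
      unfolding mon_mult a_def l_def by (rule arg_cong2[of _ _ _ _ mon]; simp)+
    have ne: "mon a (l + 1) \<noteq> 1" "mon (a + 1) l \<noteq> 1" using al by (simp_all add: mon_eq_1)
    have field: "(A * B) / (C * A') = q ^ 2 * (inverse q * (A / C) * (inverse q * (B / A')))" for A B C A' :: complex
      using q0 by (simp add: field_simps power2_eq_square)
    show ?thesis
      unfolding e mon_flip[OF ne(1)] mon_flip[OF ne(2)] g hook_def by (rule field)
  qed
  have col: "?G' (i, c) / ?G (i, c) =
      (1 - mon (int (part lam i)) (1 - int i) * mon (1 - int c) (int r - 1)) / (1 - mon (int (part lam i)) (- int i) * mon (1 - int c) (int r - 1)) *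
      ((1 - mon (int (part lam i)) (1 - int i) * mon (- int c) (int r)) / (1 - mon (int (part lam i)) (- int i) * mon (- int c) (int r)))"
    if i: "i \<in> {1..<r}" for i
  proof -
    define a l where "a = int (part lam i) - int c" and "l = int r - 1 - int i"
    have g: "?G (i, c) = hook a l" "?G' (i, c) = hook a (l + 1)"
    proof -
      have pr: "part ?mu i = part lam i" using pm[of i] i by simp
      have hj: "part (transp ?mu) c = r" "int (?h c) = int r - 1" using hm[of c] hc c by simp_all
      show "?G (i, c) = hook a l" "?G' (i, c) = hook a (l + 1)"
        unfolding box_hook_def prod.case pr hj a_def l_def by simp_all
    qed
    have e: "mon (int (part lam i)) (1 - int i) * mon (1 - int c) (int r - 1) = mon (a + 1) (l + 1)"
      "mon (int (part lam i)) (- int i) * mon (1 - int c) (int r - 1) = mon (a + 1) l"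
      "mon (int (part lam i)) (1 - int i) * mon (- int c) (int r) = mon a (l + 1 + 1)"
      "mon (int (part lam i)) (- int i) * mon (- int c) (int r) = mon a (l + 1)"
      unfolding mon_mult a_def l_def by (rule arg_cong2[of _ _ _ _ mon]; simp)+
    have field: "(A * B) / (C * D) = B / D * (A / C)" for A B C D :: complex
      by (simp add: mult.commute)
    show ?thesis unfolding e g hook_def by (rule field)
  qed
  have split: "(\<Prod>j\<in>{1..<c}. q ^ 2 * (a j * b j)) * (\<Prod>i\<in>{1..<r}. u i * v i) =
      q ^ (2 * (c - 1)) * ((\<Prod>j\<in>{1..<c}. a j) * (\<Prod>i\<in>{1..<r}. u i) * ((\<Prod>j\<in>{1..<c}. b j) * (\<Prod>i\<in>{1..<r}. v i)))"
    for a b u v :: "nat \<Rightarrow> complex"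
    by (simp add: prod.distrib power_mult)
  have "(\<Prod>b\<in>boxes lam. ?G' b / ?G b) = (\<Prod>b\<in>?R \<union> ?C. ?G' b / ?G b)"
    using R C same by (intro prod.mono_neutral_right) auto
  also have "\<dots> = (\<Prod>j\<in>{1..<c}. ?G' (r, j) / ?G (r, j)) * (\<Prod>i\<in>{1..<r}. ?G' (i, c) / ?G (i, c))"
    by (subst prod.union_disjoint) (auto simp: prod.reindex inj_on_def)
  also have "\<dots> = q ^ (2 * (c - 1)) * (corner_prod lam (r, c) (mon (1 - int c) (int r - 1)) *
      corner_prod lam (r, c) (mon (- int c) (int r)))"
    unfolding corner_prod_def prod.case
    by (rule trans[OF _ split], rule arg_cong2[of _ _ _ _ times]; intro prod.cong refl row col)
  finally have ratio: "(\<Prod>b\<in>boxes lam. ?G' b / ?G b) = q ^ (2 * (c - 1)) * (corner_prod lam (r, c) (mon (1 - int c) (int r - 1)) *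
      corner_prod lam (r, c) (mon (- int c) (int r)))" .
  have "?G' (r, c) = (1 - q) * (1 - t)"
    using c pm[of r] hm[of c] by (simp add: box_hook_def hook_def mon_def mult.commute)
  then have "(\<Prod>b\<in>boxes ?mu. ?G' b) = (1 - q) * (1 - t) * (\<Prod>b\<in>boxes lam. ?G' b)"
    unfolding add_box(3)[OF lam A] using add_box(4)[OF lam A] by simp
  also have "(\<Prod>b\<in>boxes lam. ?G' b) = (\<Prod>b\<in>boxes lam. ?G b) * (\<Prod>b\<in>boxes lam. ?G' b / ?G b)"
    unfolding prod.distrib[symmetric] using box_hook_nz[OF lam] by (intro prod.cong) auto
  finally show ?thesis unfolding c_c'_hooks[OF lam] c_c'_hooks[OF mu] ratio by (simp only: mult_ac)
qed

text \<open>
  At the two points in question the linear factors are hook factors of boxes in the row and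
  column of the corner, so genericity of $q$ and $t$ excludes zeros and poles.
\<close>
lemma corner_prod_regular:
  assumes lam: "is_partition lam" and A: "addable lam (r, c)"
    and x: "x = mon (1 - int c) (int r - 1) \<or> x = mon (- int c) (int r)"
  shows "corner_prod lam (r, c) x \<noteq> 0" "isCont (corner_prod lam (r, c)) x"
proof -
  have c: "c = Suc (part lam r)" "r \<ge> 1" "r = 1 \<or> c \<le> part lam (r - 1)" using A by (auto simp: addable_def)
  have row: "1 - mon (int j - 1) (- int (part (transp lam) j)) * x \<noteq> 0" "1 - mon (int j) (- int (part (transp lam) j)) * x \<noteq> 0"
    if j: "j \<in> {1..<c}" for j
  proof -
    have "r \<le> part (transp lam) j" using part_transp_iff[OF lam c(2), of j] j c by auto
    then show "1 - mon (int j - 1) (- int (part (transp lam) j)) * x \<noteq> 0" "1 - mon (int j) (- int (part (transp lam) j)) * x \<noteq> 0"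
      using x j by (elim disjE; simp only: mon_mult; intro one_minus_mon_nz; simp; arith)+
  qed
  have col: "1 - mon (int (part lam i)) (1 - int i) * x \<noteq> 0" "1 - mon (int (part lam i)) (- int i) * x \<noteq> 0"
    if i: "i \<in> {1..<r}" for i
  proof -
    have "1 \<le> i" "i \<le> r - 1" "r \<noteq> 1" using i by auto
    then have "c \<le> part lam i" using part_antimono[OF lam, of i "r - 1"] c(3) by linarith
    then show "1 - mon (int (part lam i)) (1 - int i) * x \<noteq> 0" "1 - mon (int (part lam i)) (- int i) * x \<noteq> 0"
      using x i by (elim disjE; simp only: mon_mult; intro one_minus_mon_nz; simp; arith)+
  qed
  show "corner_prod lam (r, c) x \<noteq> 0"
    unfolding corner_prod_def prod.case using row col by (auto simp del: One_nat_def)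
  show "isCont (corner_prod lam (r, c)) x"
    unfolding corner_prod_def prod.case using row col by (intro continuous_intros) auto
qed

section \<open>Weights of a site\<close>

text \<open>
  The scalars attached to one partition in the sum for $\mathcal T^V$: it occurs once as a dual
  vertex and once as a vertex.
\<close>
definition site_weight :: "nat list \<Rightarrow> complex \<Rightarrow> complex \<Rightarrow> complex" where
  "site_weight lam x y = c_fac lam / c'_fac lam * (PhiS_coef lam y * Phi_coef lam x)"

lemma site_weight_eq:
  assumes "is_partition lam" "y \<noteq> 0"
  shows "site_weight lam x y * (c_fac lam * c'_fac lam) =
     q ^ n_stat (transp lam) * t ^ n_stat lam * (- (th * qh * x / y)) ^ sum_list lam"
proof -
  let ?n = "n_stat lam" and ?n' = "n_stat (transp lam)" and ?s = "sum_list lam"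
  have nz: "c_fac lam \<noteq> 0" "c'_fac lam \<noteq> 0" using c_c'_nz[OF assms(1)] by auto
  have inv: "inverse (f_fac lam) = (- 1) ^ ?s * (t ^ ?n * th ^ ?s) / (q ^ ?n' * qh ^ ?s)"
    unfolding f_fac_def by (simp add: power_inverse[symmetric] divide_inverse mult_ac)
  have "(- (th * qh * x / y)) ^ ?s = (- 1) ^ ?s * (th ^ ?s * inverse (inverse q * y) ^ ?s * x ^ ?s / qh ^ ?s)"
    using qh0 assms(2) qh2[symmetric] unfolding power_mult_distrib[symmetric] power_divide[symmetric]
    by (simp add: field_simps power2_eq_square)
  then show ?thesis
    unfolding site_weight_def PhiS_coef_def Phi_coef_def inv using nz q0 by (simp add: field_simps)
qed

lemma site_weight_add_box:
  assumes lam: "is_partition lam" and A: "addable lam (r, c)" and y: "y \<noteq> 0"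
  shows "site_weight (add_box lam (r, c)) x y *
     ((1 - q) * (1 - t) * q ^ (c - 1) * corner_prod lam (r, c) (mon (1 - int c) (int r - 1)) *
      corner_prod lam (r, c) (mon (- int c) (int r))) =
     site_weight lam x y * t ^ (r - 1) * (- (th * qh * x / y))"
proof -
  let ?mu = "add_box lam (r, c)"
  let ?P = "corner_prod lam (r, c) (mon (1 - int c) (int r - 1)) * corner_prod lam (r, c) (mon (- int c) (int r))"
  have mu: "is_partition ?mu" by (rule add_box(1)[OF lam A])
  have bx: "boxes ?mu = insert (r, c) (boxes lam)" "(r, c) \<notin> boxes lam" by (rule add_box(3,4)[OF lam A])+
  have n: "n_stat ?mu = n_stat lam + (r - 1)" "n_stat (transp ?mu) = n_stat (transp lam) + (c - 1)" "sum_list ?mu = Suc (sum_list lam)"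
    unfolding n_stat_transp_boxes[OF lam] n_stat_transp_boxes[OF mu] unfolding n_stat_boxes sum_list_card_boxes using bx by simp_all
  let ?cc = "c_fac lam * c'_fac lam"
  have cc: "?cc \<noteq> 0" by (rule c_c'_nz[OF lam])
  have "site_weight ?mu x y * (?cc * ((1 - q) * (1 - t) * q ^ (2 * (c - 1)) * ?P)) =
     q ^ (c - 1) * t ^ (r - 1) * (- (th * qh * x / y)) * (site_weight lam x y * ?cc)"
    using site_weight_eq[OF mu y, of x] unfolding hook_ratio[OF lam A] site_weight_eq[OF lam y] n
    by (simp add: power_add mult_ac)
  then have "?cc * q ^ (c - 1) * (site_weight ?mu x y * ((1 - q) * (1 - t) * q ^ (c - 1) * ?P)) =
     ?cc * q ^ (c - 1) * (site_weight lam x y * t ^ (r - 1) * (- (th * qh * x / y)))"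
    by (simp add: mult_2 power_add mult_ac)
  moreover have "?cc * q ^ (c - 1) \<noteq> 0" using cc q0 by simp
  ultimately have "site_weight ?mu x y * ((1 - q) * (1 - t) * q ^ (c - 1) * ?P) = site_weight lam x y * t ^ (r - 1) * (- (th * qh * x / y))"
    using mult_left_cancel by blast
  then show ?thesis by (simp only: mult.assoc)
qed

text \<open>
  This is the reason why the poles cancel. The first summand is the residue of the term in which
  the box is missing, the second that of the term in which it is present; the quotient of the two
  weights is a quotient of hook products, which is also the quotient of the residues.
\<close>
lemma residue_cancellation:
  assumes lam: "is_partition lam" and A: "addable lam (r, c)" and nz: "x \<noteq> 0" "y \<noteq> 0"
  shows "y' * site_weight lam x y / corner_prod lam (r, c) (mon (1 - int c) (int r - 1)) +
     y * site_weight (add_box lam (r, c)) x y * (- (box_par (r, c) * y' / (gam * x))) *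
       (corner_prod lam (r, c) (mon (- int c) (int r)) * ((1 - 1 / q) * (1 - t))) = 0"
proof -
  let ?y1 = "corner_prod lam (r, c) (mon (1 - int c) (int r - 1))" and ?y2 = "corner_prod lam (r, c) (mon (- int c) (int r))"
  let ?s = "site_weight lam x y" and ?s' = "site_weight (add_box lam (r, c)) x y"
  have c: "c = Suc (part lam r)" "r \<ge> 1" using A by (auto simp: addable_def)
  have y1: "?y1 \<noteq> 0" by (rule corner_prod_regular(1)[OF lam A]) simp
  have q1: "1 - q \<noteq> 0" using one_minus_mon_nz[of 1 0] by (simp add: mon_def)
  have b: "box_par (r, c) = q ^ (c - 1) / t ^ (r - 1)" using t0 by (simp add: box_par_def power_inverse divide_inverse)
  have qg: "th * qh = q * gam" using qh2 qh0 by (simp add: gam_def field_simps power2_eq_square)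
  have w: "?s' * ((1 - q) * (1 - t) * q ^ (c - 1) * ?y1 * ?y2) = ?s * t ^ (r - 1) * (- (q * gam * x / y))"
    using site_weight_add_box[OF lam A nz(2), of x] unfolding qg .
  have "(1 - q) * ?y1 * (y * ?s' * (- (box_par (r, c) * y' / (gam * x))) * (?y2 * ((1 - 1 / q) * (1 - t)))) =
     (?s' * ((1 - q) * (1 - t) * q ^ (c - 1) * ?y1 * ?y2)) * (- (y * y' * (1 - 1 / q) / (t ^ (r - 1) * gam * x)))"
    unfolding b by (simp add: mult_ac)
  also have "\<dots> = - ((1 - q) * (y' * ?s))"
    unfolding w using nz gam0 q0 t0 by (simp add: field_simps)
  finally have e: "(1 - q) * ?y1 * (y * ?s' * (- (box_par (r, c) * y' / (gam * x))) * (?y2 * ((1 - 1 / q) * (1 - t)))) = - ((1 - q) * (y' * ?s))" .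
  have "W / y1 + Z = 0" if "p * y1 * Z = - (p * W)" "p \<noteq> 0" "y1 \<noteq> 0" for p y1 Z W :: complex
  proof -
    have "p * (y1 * Z + W) = 0" using that(1) by (simp add: algebra_simps)
    then have "W = - (y1 * Z)" using that(2) by (simp add: add_eq_0_iff)
    then show ?thesis using that(3) by simp
  qed
  from this[OF e q1 y1] show ?thesis .
qed

end

section \<open>Meromorphic continuation of exponential series\<close>

lemma exp_series_radius:
  assumes "exp_series f s"
  obtains r where "r > 0" "ereal r \<le> fps_conv_radius (Abs_fps (\<lambda>n. s n / of_nat n))"
    "\<And>x. norm x < r \<Longrightarrow> f x = exp (eval_fps (Abs_fps (\<lambda>n. s n / of_nat n)) x)"
proof -
  let ?G = "Abs_fps (\<lambda>n. s n / of_nat n)"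
  obtain e where e: "e > 0" "\<And>x. dist x 0 < e \<Longrightarrow> \<exists>\<sigma>. (\<lambda>n. s (Suc n) / of_nat (Suc n) * x ^ Suc n) sums \<sigma> \<and> f x = exp \<sigma>"
    using assms unfolding exp_series_def eventually_nhds_metric by blast
  have sums: "\<exists>\<sigma>. (\<lambda>n. fps_nth ?G n * x ^ n) sums \<sigma> \<and> f x = exp \<sigma>" if "norm x < e" for x
  proof -
    have "dist x 0 < e" using that by simp
    from e(2)[OF this] obtain \<sigma> where "(\<lambda>n. s (Suc n) / of_nat (Suc n) * x ^ Suc n) sums \<sigma>" "f x = exp \<sigma>"
      by blast
    then show ?thesis using sums_Suc[of "\<lambda>n. fps_nth ?G n * x ^ n" \<sigma>] by (intro exI[of _ \<sigma>]) auto
  qed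
  have rad: "ereal (e / 2) \<le> fps_conv_radius ?G"
  proof -
    have "norm (of_real (e / 2) :: complex) < e" using e(1) by simp
    then obtain \<sigma> where "(\<lambda>n. fps_nth ?G n * of_real (e / 2) ^ n) sums \<sigma>" using sums by blast
    then have "ereal (norm (of_real (e / 2) :: complex)) \<le> conv_radius (fps_nth ?G)"
      by (intro conv_radius_geI) (rule sums_summable)
    then show ?thesis using e(1) by (simp add: fps_conv_radius_def)
  qed
  show ?thesis
  proof (rule that[of "e / 2"])
    show "e / 2 > 0" using e(1) by simp
    show "ereal (e / 2) \<le> fps_conv_radius ?G" by (rule rad)
    fix x :: complex assume x: "norm x < e / 2"
    then have "norm x < e" using e(1) by simp
    then obtain \<sigma> where \<sigma>: "(\<lambda>n. fps_nth ?G n * x ^ n) sums \<sigma>" "f x = exp \<sigma>" using sums by blast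
    moreover have "eval_fps ?G x = \<sigma>" unfolding eval_fps_def using \<sigma>(1) by (simp add: sums_iff)
    ultimately show "f x = exp (eval_fps ?G x)" by simp
  qed
qed

lemma exp_series_eval:
  fixes G :: "complex fps"
  assumes G: "\<And>n. fps_nth G n = s n / of_nat n" and rad: "fps_conv_radius G > 0"
    and f: "\<forall>\<^sub>F x in nhds 0. f x = exp (eval_fps G x)"
  shows "exp_series f s"
proof -
  have "\<forall>\<^sub>F x in nhds 0. x \<in> eball 0 (fps_conv_radius G)"
    using rad by (intro eventually_nhds_in_open) (auto simp: zero_ereal_def)
  with f show ?thesis unfolding exp_series_def
  proof eventually_elim
    case (elim x)
    then have "(\<lambda>n. fps_nth G n * x ^ n) sums eval_fps G x" by (intro sums_eval_fps) auto
    then have "(\<lambda>n. fps_nth G (Suc n) * x ^ Suc n) sums eval_fps G x"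
      by (subst sums_Suc_iff) (simp add: G)
    with elim show ?case by (intro exI[of _ "eval_fps G x"]) (simp add: G)
  qed
qed

text \<open>
  The function sought is $\prod_{m \ge 0} p(a^m x)$. For given $x$ and large $k$ it equals the
  finite product over $m < k$ times the exponential of a series at the point $a^k x$, which is so
  close to 0 that the series converges; different $k$ agree on their common domain.
\<close>
lemma entire_q_product:
  fixes p :: "complex \<Rightarrow> complex" and a :: complex
  assumes p: "p holomorphic_on UNIV" and s: "exp_series p s" and a: "norm a < 1" "a \<noteq> 0"
  shows "\<exists>P. P holomorphic_on UNIV \<and> exp_series P (\<lambda>n. s n / (1 - a ^ n))"
proof -
  define G where "G = Abs_fps (\<lambda>n. s n / of_nat n)"
  define H where "H = Abs_fps (\<lambda>n. s n / (1 - a ^ n) / of_nat n)"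
  obtain r where r: "r > 0" "ereal r \<le> fps_conv_radius G" "\<And>x. norm x < r \<Longrightarrow> p x = exp (eval_fps G x)"
    using exp_series_radius[OF s] unfolding G_def by blast
  have low: "norm (1 - a ^ n) \<ge> 1 - norm a" if "n \<ge> 1" for n
  proof -
    have "norm (a ^ n) \<le> norm a" using a that by (simp add: norm_power power_le_one_iff power_decreasing[of 1 n "norm a", simplified])
    then show ?thesis using norm_triangle_ineq2[of 1 "a ^ n"] by simp
  qed
  have coef: "norm (fps_nth H n) \<le> norm (fps_nth G n) / (1 - norm a)" for n
  proof (cases "n = 0")
    case False
    then have "norm (s n / of_nat n) / norm (1 - a ^ n) \<le> norm (s n / of_nat n) / (1 - norm a)"
      using low[of n] a by (intro divide_left_mono mult_pos_pos) auto
    then show ?thesis by (simp add: G_def H_def norm_divide norm_mult mult.commute)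
  qed (simp add: G_def H_def)
  have "ereal (r / 2) \<le> fps_conv_radius H"
  proof -
    have "ereal (norm (of_real (r / 2) :: complex)) < conv_radius (fps_nth G)"
      using r(1,2) unfolding fps_conv_radius_def by (simp add: less_le_trans[of _ "ereal r"])
    from abs_summable_in_conv_radius[OF this]
    have "summable (\<lambda>n. norm (fps_nth G n * of_real (r / 2) ^ n) / (1 - norm a))"
      by (rule summable_divide)
    then have "summable (\<lambda>n. fps_nth H n * of_real (r / 2) ^ n)"
    proof (rule summable_comparison_test'[of _ 0])
      fix n :: nat
      show "norm (fps_nth H n * of_real (r / 2) ^ n) \<le> norm (fps_nth G n * of_real (r / 2) ^ n) / (1 - norm a)"
        using mult_right_mono[OF coef[of n], of "norm (of_real (r / 2) ^ n :: complex)"] by (simp add: norm_mult)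
    qed
    from conv_radius_geI[OF this] show ?thesis using r(1) by (simp add: fps_conv_radius_def)
  qed
  then have in_rad: "ereal (norm x) < fps_conv_radius H" if "norm x < r / 2" for x :: complex
    using that by (metis ereal_less_eq(3) less_ereal.simps(1) less_le_trans)
  define E where "E = (\<lambda>x. exp (eval_fps H x))"
  have E_rec: "E x = p x * E (a * x)" if x: "norm x < r / 2" for x
  proof -
    have ax: "norm (a * x) < r / 2" using x a by (simp add: norm_mult) (smt (verit) mult_left_le_one_le norm_ge_zero)
    have "(\<lambda>n. fps_nth H n * x ^ n - fps_nth H n * (a * x) ^ n) sums (eval_fps H x - eval_fps H (a * x))"
      by (intro sums_diff sums_eval_fps in_rad x ax)
    moreover have "(\<lambda>n. fps_nth H n * x ^ n - fps_nth H n * (a * x) ^ n) = (\<lambda>n. fps_nth G n * x ^ n)"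
    proof
      fix n
      have "1 - a ^ n \<noteq> 0" if "n \<ge> 1" using low[OF that] a by auto
      then have "fps_nth H n * (1 - a ^ n) = fps_nth G n"
        by (cases "n = 0") (auto simp: G_def H_def)
      moreover have "fps_nth H n * x ^ n - fps_nth H n * (a * x) ^ n = fps_nth H n * (1 - a ^ n) * x ^ n"
        by (simp add: power_mult_distrib algebra_simps)
      ultimately show "fps_nth H n * x ^ n - fps_nth H n * (a * x) ^ n = fps_nth G n * x ^ n"
        by (simp only:)
    qed
    ultimately have "eval_fps H x - eval_fps H (a * x) = eval_fps G x"
      by (simp add: sums_iff eval_fps_def)
    then have "eval_fps H x = eval_fps G x + eval_fps H (a * x)" by (simp add: algebra_simps)
    then show ?thesis using r(3)[of x] x r(1) by (simp add: E_def exp_add)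
  qed
  define V where "V = (\<lambda>m x. (\<Prod>k<m. p (a ^ k * x)) * E (a ^ m * x))"
  have V_step: "V (m + d) x = V m x" if "norm (a ^ m * x) < r / 2" for m d x
  proof (induction d)
    case (Suc d)
    have "norm a ^ (m + d) \<le> norm a ^ m" using a by (intro power_decreasing) auto
    then have "norm (a ^ (m + d) * x) \<le> norm (a ^ m * x)"
      unfolding norm_mult norm_power by (rule mult_right_mono) simp
    then have "E (a ^ (m + d) * x) = p (a ^ (m + d) * x) * E (a * (a ^ (m + d) * x))"
      using that by (intro E_rec) simp
    then show ?case using Suc by (simp add: V_def mult_ac)
  qed simp
  define P where "P = (\<lambda>x. V (LEAST m. norm (a ^ m * x) < r / 2) x)"
  have P_eq: "P x = V m x" if "norm (a ^ m * x) < r / 2" for m x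
  proof -
    let ?l = "LEAST m. norm (a ^ m * x) < r / 2"
    have "norm (a ^ ?l * x) < r / 2" using that by (rule LeastI)
    moreover have "?l \<le> m" using that by (rule Least_le)
    ultimately show ?thesis using V_step[of ?l x "m - ?l"] by (simp add: P_def)
  qed
  have "\<exists>f'. (P has_field_derivative f') (at x)" for x
  proof -
    have "(\<lambda>m. norm a ^ m * norm x) \<longlonglongrightarrow> 0 * norm x"
      using a by (intro tendsto_mult tendsto_const LIMSEQ_realpow_zero) auto
    then have "\<forall>\<^sub>F m in sequentially. norm a ^ m * norm x < r / 2"
      using r(1) by (intro order_tendstoD(2)) auto
    then obtain m where "norm a ^ m * norm x < r / 2"
      by (metis eventually_sequentially order_refl)
    then have m: "norm (a ^ m * x) < r / 2" by (simp add: norm_mult norm_power)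
    let ?U = "{y. norm (a ^ m * y) < r / 2}"
    have U: "open ?U" by (intro open_Collect_less continuous_intros)
    have lin: "(\<lambda>x. c * x) holomorphic_on ?U" for c by (intro holomorphic_intros)
    have ph: "(\<lambda>x. p (a ^ k * x)) holomorphic_on ?U" for k
      using holomorphic_on_compose_gen[OF lin p] by (simp add: o_def)
    have "eval_fps H holomorphic_on eball 0 (fps_conv_radius H)" by (intro holomorphic_intros) auto
    from holomorphic_on_compose_gen[OF lin this] have evh: "(\<lambda>x. eval_fps H (a ^ m * x)) holomorphic_on ?U"
      using in_rad by (auto simp: o_def image_subset_iff)
    have "V m holomorphic_on ?U"
      unfolding V_def E_def by (intro holomorphic_intros ph evh)
    then have "P holomorphic_on ?U" by (rule holomorphic_transform) (use P_eq in auto)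
    then show "\<exists>f'. (P has_field_derivative f') (at x)"
      using U m holomorphic_on_open[OF U, of P] by auto
  qed
  then have "P holomorphic_on UNIV" by (simp add: holomorphic_on_open)
  moreover have "exp_series P (\<lambda>n. s n / (1 - a ^ n))"
  proof (rule exp_series_eval[of H])
    show "fps_conv_radius H > 0" using \<open>ereal (r / 2) \<le> fps_conv_radius H\<close> r(1)
      by (metis ereal_less(2) half_gt_zero less_le_trans)
    have "\<forall>\<^sub>F x in nhds 0. x \<in> ball (0::complex) (r / 2)"
      using r(1) by (intro eventually_nhds_in_open) auto
    then show "\<forall>\<^sub>F x in nhds 0. P x = exp (eval_fps H x)"
      by eventually_elim (use P_eq[of 0] in \<open>simp add: V_def E_def\<close>)
  qed (simp add: H_def)
  ultimately show ?thesis by blast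
qed

lemma nicely_meromorphic_eqI:
  assumes F: "F nicely_meromorphic_on UNIV" and G: "G nicely_meromorphic_on UNIV"
    and eq: "\<forall>\<^sub>F x in nhds 0. F x = G x"
  shows "F x = (G x :: complex)"
proof -
  have mF: "F meromorphic_on UNIV" and mG: "G meromorphic_on UNIV"
    using F G by (auto simp: nicely_meromorphic_on_def)
  define D where "D = remove_sings (\<lambda>x. F x - G x)"
  have mD: "(\<lambda>x. F x - G x) meromorphic_on UNIV" using mF mG by (intro meromorphic_intros)
  have Dn: "D nicely_meromorphic_on UNIV" unfolding D_def by (rule remove_sings_nicely_meromorphic[OF mD])
  have ev0: "\<forall>\<^sub>F x in at 0. F x - G x = 0"
    using eq by (auto simp: eventually_at_filter elim: eventually_mono)
  have evD: "\<forall>\<^sub>F x in at y. D x = F x - G x" for y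
    unfolding D_def by (rule eventually_remove_sings_eq_at) (use mD in \<open>auto intro: meromorphic_on_isolated_singularity meromorphic_on_subset\<close>)
  have "\<forall>\<^sub>F x in at 0. D x = 0" using evD[of 0] ev0 by eventually_elim simp
  then have "\<exists>\<^sub>F x in at 0. D x = 0" by (rule eventually_frequently[rotated]) simp
  then have D0: "D y = 0" for y
    using frequently_eq_meromorphic_imp_constant[of D 0 0 UNIV y] Dn convex_connected[OF convex_UNIV] by simp
  have "\<forall>\<^sub>F y in at x. F y = G y" using evD[of x] by eventually_elim (simp add: D0)
  then have "(F \<longlongrightarrow> l) (at x) \<longleftrightarrow> (G \<longlongrightarrow> l) (at x)" "is_pole F x \<longleftrightarrow> is_pole G x" for l
    by (auto intro!: tendsto_cong is_pole_cong)
  moreover have "(is_pole F x \<and> F x = 0) \<or> (F \<longlongrightarrow> F x) (at x)" "(is_pole G x \<and> G x = 0) \<or> (G \<longlongrightarrow> G x) (at x)"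
    using F G by (auto simp: nicely_meromorphic_on_def)
  ultimately show ?thesis
    by (metis at_neq_bot not_tendsto_and_filterlim_at_infinity is_pole_def tendsto_unique)
qed

lemma mero_exp_eq:
  assumes "is_mero_cont c F"
  shows "mero_exp c x = F x"
proof -
  define G where "G = (SOME F. is_mero_cont c F)"
  have G: "is_mero_cont c G" unfolding G_def by (rule someI[of "is_mero_cont c", OF assms])
  have ev: "\<forall>\<^sub>F x in nhds 0. \<exists>s. (\<lambda>n. c (Suc n) * x ^ Suc n) sums s \<and> H x = exp s" if "is_mero_cont c H" for H
    using that unfolding is_mero_cont_def by blast
  have "\<forall>\<^sub>F x in nhds 0. G x = F x"
    using ev[OF G] ev[OF assms] by eventually_elim (auto dest: sums_unique2)
  then have "G x = F x"
    using G assms unfolding is_mero_cont_def by (intro nicely_meromorphic_eqI) auto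
  then show ?thesis using assms by (auto simp: mero_exp_def G_def)
qed

lemma is_mero_cont_remove_sings:
  assumes mf: "f meromorphic_on UNIV" and f: "exp_series f (\<lambda>n. of_nat n * c n)"
  shows "is_mero_cont c (remove_sings f)"
  unfolding is_mero_cont_def
proof
  show "remove_sings f nicely_meromorphic_on UNIV" by (rule remove_sings_nicely_meromorphic[OF mf])
  obtain S where S: "open S" "0 \<in> S" "f holomorphic_on S"
    using has_fps_expansion_imp_holomorphic[OF exp_series_fps[OF f]] by metis
  have "\<forall>\<^sub>F x in nhds 0. x \<in> S" by (rule eventually_nhds_in_open[OF S(1,2)])
  then have ev: "\<forall>\<^sub>F x in nhds 0. f x = remove_sings f x"
  proof eventually_elim
    case (elim x)
    then have "f analytic_on {x}" using S analytic_at by blast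
    then show ?case by simp
  qed
  have "exp_series (remove_sings f) (\<lambda>n. of_nat n * c n)" by (rule exp_series_cong[OF f ev]) simp
  then show "\<forall>\<^sub>F x in nhds 0. \<exists>s. (\<lambda>n. c (Suc n) * x ^ Suc n) sums s \<and> remove_sings f x = exp s"
    unfolding exp_series_def by (elim eventually_mono) (simp del: of_nat_Suc)
qed

text \<open>
  Uniqueness of the continuation makes it multiplicative. This separates a transcendental scalar
  common to all summands from a rational factor depending on the partitions.
\<close>
lemma mero_exp_mult:
  assumes F: "is_mero_cont c0 F" and R: "exp_series R s" "R meromorphic_on UNIV"
    and c: "\<And>n. n \<ge> 1 \<Longrightarrow> c n = c0 n + s n / of_nat n"
    and x: "R analytic_on {x}" "R x \<noteq> 0"
  shows "mero_exp c x = mero_exp c0 x * R x"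
proof -
  have mF: "F meromorphic_on UNIV" and nF: "F nicely_meromorphic_on UNIV"
    using F by (auto simp: is_mero_cont_def nicely_meromorphic_on_def)
  let ?FR = "\<lambda>x. F x * R x"
  have mFR: "?FR meromorphic_on UNIV" using mF R(2) by (intro meromorphic_intros)
  have "exp_series F (\<lambda>n. of_nat n * c0 n)"
    using F unfolding is_mero_cont_def exp_series_def
    by (elim conjE eventually_mono) (simp del: of_nat_Suc)
  from exp_series_mult[OF this R(1)] have FR: "exp_series ?FR (\<lambda>n. of_nat n * c n)"
    by (rule exp_series_cong) (auto simp: c distrib_left)
  have G: "is_mero_cont c (remove_sings ?FR)" by (rule is_mero_cont_remove_sings[OF mFR FR])
  have "remove_sings ?FR x = F x * R x"
  proof (cases "is_pole F x")
    case True
    have "(R \<longlongrightarrow> R x) (at x)" using x(1) analytic_at_imp_isCont isContD by blast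
    from tendsto_mult_filterlim_at_infinity[OF this x(2) True[unfolded is_pole_def]]
    have pole: "is_pole ?FR x" unfolding is_pole_def by (simp add: mult.commute)
    have no_lim: "\<not> (?FR \<longlongrightarrow> l) (at x)" for l
      using pole not_tendsto_and_filterlim_at_infinity[of "at x" ?FR l] unfolding is_pole_def by auto
    have "F x = 0"
      using nF True unfolding nicely_meromorphic_on_def is_pole_def
      by (metis UNIV_I at_neq_bot not_tendsto_and_filterlim_at_infinity)
    then show ?thesis using no_lim by (simp add: remove_sings_def)
  next
    case False
    then have "F analytic_on {x}" using nicely_meromorphic_on_imp_analytic_at[OF nF, of x] by simp
    then have "?FR analytic_on {x}" using x(1) by (rule analytic_on_mult)
    then show ?thesis by simp
  qed
  then show ?thesis unfolding mero_exp_eq[OF G] mero_exp_eq[OF F] .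
qed

context generic_qt begin

lemma one_minus_q_pow: "n \<ge> 1 \<Longrightarrow> 1 - q ^ n \<noteq> 0" and one_minus_t_pow: "n \<ge> 1 \<Longrightarrow> 1 - t ^ n \<noteq> 0"
  using one_minus_mon_nz[of "int n" 0] one_minus_mon_nz[of 0 "int n"] by (auto simp: mon_def)

section \<open>Power sums and contractions of a single site\<close>

definition box_power_sum :: "nat list \<Rightarrow> int \<Rightarrow> complex" where
  "box_power_sum lam k = (\<Sum>b\<in>boxes lam. box_par b powi k)"

text \<open>
  The power sums of the alphabet behind \<open>Yf\<close>; positive exponents belong to \<open>Yf\<close>, negative ones
  to its counterpart \<open>Yt\<close> at infinity.
\<close>
definition yps :: "nat list \<Rightarrow> int \<Rightarrow> complex" where
  "yps lam k = 1 - (1 - t powi (- k)) * (1 - q powi k) * box_power_sum lam k"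

lemma yps_Nil [simp]: "yps [] k = 1"
  by (simp add: yps_def box_power_sum_def)

definition Yt :: "nat list \<Rightarrow> complex \<Rightarrow> complex" where
  "Yt lam x = (1 - x) * (\<Prod>b\<in>boxes lam. ((1 - t * (x / box_par b)) * (1 - x / box_par b / q)) /
      ((1 - x / box_par b) * (1 - t * (x / box_par b) / q)))"

lemma exp_series_rational:
  "exp_series (\<lambda>s. ((1 - a * s) * (1 - b * s)) / ((1 - s) * (1 - a * b * s))) (\<lambda>n. (1 - a ^ n) * (1 - b ^ n))"
proof -
  have "exp_series (\<lambda>s. ((1 - a * s) * (1 - b * s)) * inverse ((1 - 1 * s) * (1 - a * b * s)))
     (\<lambda>n. (- (a ^ n) + - (b ^ n)) + - (- (1 ^ n) + - ((a * b) ^ n)))"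
    by (intro exp_series_mult exp_series_inverse exp_series_linear)
  then show ?thesis
    by (rule exp_series_cong) (auto simp: divide_inverse algebra_simps power_mult_distrib)
qed

lemma exp_series_Yf: "exp_series (Yf lam) (\<lambda>n. - yps lam (int n))"
proof -
  have g: "exp_series gbox (\<lambda>n. (1 - inverse t ^ n) * (1 - q ^ n))"
    by (rule exp_series_cong[OF exp_series_rational]) (auto simp: gbox_def divide_inverse mult_ac)
  have "exp_series (\<lambda>x. (1 - 1 * x) * (\<Prod>b\<in>boxes lam. gbox (box_par b * x)))
      (\<lambda>n. - (1 ^ n) + (\<Sum>b\<in>boxes lam. box_par b ^ n * ((1 - inverse t ^ n) * (1 - q ^ n))))"
    by (intro exp_series_mult exp_series_prod exp_series_scale g exp_series_linear)
  then show ?thesis unfolding sum_distrib_right[symmetric]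
    by (rule exp_series_cong)
      (auto simp: Yf_def yps_def box_power_sum_def power_int_minus power_inverse mult.commute)
qed

lemma exp_series_Yt: "exp_series (Yt lam) (\<lambda>n. - yps lam (- int n))"
proof -
  let ?g = "\<lambda>s. ((1 - t * s) * (1 - inverse q * s)) / ((1 - s) * (1 - t * inverse q * s))"
  have "exp_series (\<lambda>x. (1 - 1 * x) * (\<Prod>b\<in>boxes lam. ?g (inverse (box_par b) * x)))
      (\<lambda>n. - (1 ^ n) + (\<Sum>b\<in>boxes lam. inverse (box_par b) ^ n * ((1 - t ^ n) * (1 - inverse q ^ n))))"
    by (intro exp_series_mult exp_series_prod exp_series_scale exp_series_rational exp_series_linear)
  then show ?thesis unfolding sum_distrib_right[symmetric]
    by (rule exp_series_cong)
      (auto simp: Yt_def yps_def box_power_sum_def power_int_minus power_inverse divide_inverse mult_ac)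
qed

text \<open>
  Each of the four factors of a box changes under inversion by a monomial, and the monomials of a
  box multiply to 1; only the factor $1-x$ leaves one.
\<close>
lemma Yf_inversion:
  assumes "z \<noteq> 0"
  shows "Yf lam (inverse z) = - inverse z * Yt lam z"
proof -
  have g: "gbox (b * inverse z) = ((1 - t * (z / b)) * (1 - z / b / q)) / ((1 - z / b) * (1 - t * (z / b) / q))"
    if b: "b \<noteq> 0" for b
  proof -
    define s where "s = z / b"
    have s: "s \<noteq> 0" "b * inverse z = inverse s" using assms b by (auto simp: s_def field_simps)
    have "1 - inverse s / t = - (inverse s / t) * (1 - t * s)" "1 - q * inverse s = - (q * inverse s) * (1 - s / q)"
      "1 - inverse s = - inverse s * (1 - s)" "1 - q * inverse s / t = - (q * inverse s / t) * (1 - t * s / q)"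
      using s(1) q0 t0 by (simp_all add: field_simps)
    then show ?thesis unfolding s(2) gbox_def s_def[symmetric] using s(1) q0 t0 by simp
  qed
  have "1 - inverse z = - inverse z * (1 - z)" using assms by (simp add: field_simps)
  then show ?thesis unfolding Yf_def Yt_def by (simp add: g)
qed

lemma Yt_off_lat:
  assumes "x \<notin> lat" "x \<noteq> 0"
  shows "Yt lam x \<noteq> 0"
proof -
  have "inverse x \<notin> lat" using assms(1) lat_inverse[of "inverse x"] by auto
  from Yf_off_lat(1)[OF this] show ?thesis using Yf_inversion[OF assms(2), of lam] assms(2) by auto
qed

text \<open>
  Dressing by boxes adds a power sum over the boxes to the coefficients of the empty partition, which
  is how the coefficients become multiples of \<open>yps\<close>.
\<close>
lemma Phi_hat_coeffs:
  assumes n: "n \<ge> 1"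
  shows "cre (Phi_hat lam) n = - yps lam (int n) / (of_nat n * (1 - q ^ n))"
    and "ann (Phi_hat lam) n = - (q ^ n * yps lam (- int n)) / (of_nat n * (1 - q ^ n))"
    and "cre (PhiS_hat lam) n = gam ^ n * yps lam (int n) / (of_nat n * (1 - q ^ n))"
    and "ann (PhiS_hat lam) n = gam ^ n * q ^ n * yps lam (- int n) / (of_nat n * (1 - q ^ n))"
proof -
  let ?S = "box_power_sum lam (int n)" and ?S' = "box_power_sum lam (- int n)"
  have nz: "of_nat n \<noteq> (0::complex)" "1 - q ^ n \<noteq> 0" "q ^ n \<noteq> 0" "1 \<noteq> q ^ n" using n one_minus_q_pow[OF n] q0 by auto
  have S: "(\<Sum>b\<in>boxes lam. x * box_par b ^ n) = x * ?S" for x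
    by (simp add: box_power_sum_def sum_distrib_left)
  have S': "(\<Sum>b\<in>boxes lam. x / box_par b ^ n) = x * ?S'" for x
    by (simp add: box_power_sum_def sum_distrib_left power_int_minus divide_inverse)
  have y: "yps lam (int n) = 1 - (1 - inverse t ^ n) * (1 - q ^ n) * ?S"
    by (simp add: yps_def power_int_minus power_inverse)
  have y': "q ^ n * yps lam (- int n) = q ^ n + (1 - t ^ n) * (1 - q ^ n) * ?S'"
    using nz by (simp add: yps_def power_int_minus field_simps)
  show "cre (Phi_hat lam) n = - yps lam (int n) / (of_nat n * (1 - q ^ n))"
  proof -
    have "cre (Phi_hat lam) n = - (1 / of_nat n * (1 / (1 - q ^ n)) - (1 - inverse t ^ n) / of_nat n * ?S)"
      unfolding Phi_hat_def dress_def Phi0_def eta_def vertex.sel S by (simp add: algebra_simps)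
    also have "1 / of_nat n * (1 / (1 - q ^ n)) - (1 - inverse t ^ n) / of_nat n * ?S = yps lam (int n) / (of_nat n * (1 - q ^ n))"
      unfolding y using nz by (simp add: divide_simps)
    finally show ?thesis by simp
  qed
  show "cre (PhiS_hat lam) n = gam ^ n * yps lam (int n) / (of_nat n * (1 - q ^ n))"
  proof -
    have "cre (PhiS_hat lam) n = gam ^ n * (1 / of_nat n * (1 / (1 - q ^ n)) - (1 - inverse t ^ n) / of_nat n * ?S)"
      unfolding PhiS_hat_def dress_def PhiS0_def xi_def vertex.sel S by (simp add: algebra_simps)
    also have "1 / of_nat n * (1 / (1 - q ^ n)) - (1 - inverse t ^ n) / of_nat n * ?S = yps lam (int n) / (of_nat n * (1 - q ^ n))"
      unfolding y using nz by (simp add: divide_simps)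
    finally show ?thesis by simp
  qed
  show "ann (Phi_hat lam) n = - (q ^ n * yps lam (- int n)) / (of_nat n * (1 - q ^ n))"
  proof -
    have "ann (Phi_hat lam) n = - (1 / of_nat n * (q ^ n / (1 - q ^ n)) + (1 - t ^ n) / of_nat n * ?S')"
      unfolding Phi_hat_def dress_def Phi0_def eta_def vertex.sel S' by (simp add: algebra_simps)
    also have "1 / of_nat n * (q ^ n / (1 - q ^ n)) + (1 - t ^ n) / of_nat n * ?S' = q ^ n * yps lam (- int n) / (of_nat n * (1 - q ^ n))"
      unfolding y' using nz by (simp add: divide_simps)
    finally show ?thesis by simp
  qed
  show "ann (PhiS_hat lam) n = gam ^ n * q ^ n * yps lam (- int n) / (of_nat n * (1 - q ^ n))"
  proof -
    have "ann (PhiS_hat lam) n = gam ^ n * (1 / of_nat n * (q ^ n / (1 - q ^ n)) + (1 - t ^ n) / of_nat n * ?S')"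
      unfolding PhiS_hat_def dress_def PhiS0_def xi_def vertex.sel S' by (simp add: algebra_simps)
    also have "1 / of_nat n * (q ^ n / (1 - q ^ n)) + (1 - t ^ n) / of_nat n * ?S' = q ^ n * yps lam (- int n) / (of_nat n * (1 - q ^ n))"
      unfolding y' using nz by (simp add: divide_simps)
    finally show ?thesis by (simp add: mult.assoc)
  qed
qed

definition contr :: "nat list \<Rightarrow> nat list \<Rightarrow> nat \<Rightarrow> complex" where
  "contr mu lam = (\<lambda>n. ann (PhiS_hat mu) n * cre (Phi_hat lam) n * kap n)"

lemma contr_eq:
  assumes "n \<ge> 1"
  shows "of_nat n * contr mu lam n = - (gam ^ n * q ^ n * yps mu (- int n) * yps lam (int n)) / ((1 - q ^ n) * (1 - t ^ n))"
  unfolding contr_def Phi_hat_coeffs[OF assms] kap_def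
  using assms one_minus_q_pow[OF assms] by (simp add: divide_simps)

text \<open>
  The sequence has the denominators $1-q^n$ and $1-t^n$. As $|q|<1<|t|$, it is obtained from
  a linear function by the infinite product construction in $1/t$ and then in $q$, and finally
  inverted.
\<close>
lemma contr_empty_continuation:
  assumes q: "norm q < 1" and t: "norm t > 1"
  shows "\<exists>F. is_mero_cont (contr [] []) F"
proof -
  \<comment> \<open>Rewriting $1/(1-t^n)$ in terms of $1/t$ turns the sequence into one of a linear function at this point.\<close>
  define \<rho> where "\<rho> = gam * q / t"
  have "exp_series (\<lambda>x. 1 - \<rho> * x) (\<lambda>n. - (\<rho> ^ n))" by (rule exp_series_linear)
  moreover have "(\<lambda>x. 1 - \<rho> * x) holomorphic_on UNIV" by (intro holomorphic_intros)
  moreover have "norm (inverse t) < 1" "inverse t \<noteq> 0"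
    using t t0 by (auto simp: norm_inverse inverse_less_1_iff)
  ultimately obtain P1 where P1: "P1 holomorphic_on UNIV" "exp_series P1 (\<lambda>n. - (\<rho> ^ n) / (1 - inverse t ^ n))"
    using entire_q_product by blast
  obtain P where P: "P holomorphic_on UNIV" "exp_series P (\<lambda>n. - (\<rho> ^ n) / (1 - inverse t ^ n) / (1 - q ^ n))"
    using entire_q_product[OF P1 q q0] by blast
  have "exp_series (\<lambda>x. inverse (P x)) (\<lambda>n. - (- (\<rho> ^ n) / (1 - inverse t ^ n) / (1 - q ^ n)))"
    by (rule exp_series_inverse[OF P(2)])
  then have "exp_series (\<lambda>x. inverse (P x)) (\<lambda>n. of_nat n * contr [] [] n)"
  proof (rule exp_series_cong)
    fix n :: nat assume n: "n \<ge> 1"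
    have "- (\<rho> ^ n) / (1 - inverse t ^ n) = gam ^ n * q ^ n / (1 - t ^ n)"
      using one_minus_t_pow[OF n] t0 unfolding \<rho>_def power_divide power_mult_distrib power_inverse
      by (simp add: field_simps)
    then show "- (- (\<rho> ^ n) / (1 - inverse t ^ n) / (1 - q ^ n)) = of_nat n * contr [] [] n"
      unfolding contr_eq[OF n] by (simp add: mult.commute)
  qed simp
  moreover have "P analytic_on UNIV" using P(1) by (simp add: analytic_on_open)
  then have "(\<lambda>x. inverse (P x)) meromorphic_on UNIV"
    by (intro meromorphic_intros analytic_on_imp_meromorphic_on)
  ultimately show ?thesis using is_mero_cont_remove_sings by blast
qed

section \<open>The rational part of a contraction\<close>

definition contr_ratio :: "nat list \<Rightarrow> nat list \<Rightarrow> complex \<Rightarrow> complex" where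
  "contr_ratio mu lam x = (\<Prod>b\<in>boxes mu. 1 - gam * x / box_par b) * (\<Prod>b\<in>boxes lam. Yt mu (box_par b * x / gam))"

text \<open>
  The definition is adapted to adding a box to \<open>lam\<close>, this form to adding one to \<open>mu\<close>; both are
  the same double product over pairs of boxes, read by rows or by columns.
\<close>
lemma contr_ratio_alt:
  "contr_ratio mu lam x = (\<Prod>b\<in>boxes lam. 1 - box_par b * x / gam) * (\<Prod>b\<in>boxes mu. Yf lam (gam * x / box_par b))"
proof -
  let ?k = "\<lambda>b b'. gbox (box_par b' * (gam * x / box_par b))"
  have g: "((1 - t * (b' * x / gam / b)) * (1 - b' * x / gam / b / q)) / ((1 - b' * x / gam / b) * (1 - t * (b' * x / gam / b) / q))
     = gbox (b' * (gam * x / b))" if "b \<noteq> 0" for b b'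
  proof -
    define s where "s = b' * x / b"
    have t: "t = q * gam ^ 2" using gam2 q0 by simp
    have "t * (b' * x / gam / b) = q * (gam * s)" "b' * x / gam / b / q = gam * s / t"
      "b' * x / gam / b = q * (gam * s) / t" "t * (b' * x / gam / b) / q = gam * s" "b' * (gam * x / b) = gam * s"
      using that q0 gam0 by (simp_all add: s_def t power2_eq_square field_simps)
    then show ?thesis unfolding gbox_def by (simp only: mult.commute)
  qed
  have "(\<Prod>b\<in>boxes lam. Yt mu (box_par b * x / gam)) =
      (\<Prod>b'\<in>boxes lam. (1 - box_par b' * x / gam) * (\<Prod>b\<in>boxes mu. ?k b b'))"
    unfolding Yt_def g[OF box_par_nz] ..
  also have "\<dots> = (\<Prod>b'\<in>boxes lam. 1 - box_par b' * x / gam) * (\<Prod>b\<in>boxes mu. \<Prod>b'\<in>boxes lam. ?k b b')"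
    unfolding prod.distrib by (subst (2) prod.swap) simp
  finally show ?thesis unfolding contr_ratio_def Yf_def prod.distrib by (simp add: mult_ac)
qed

lemma contr_ratio_add_left:
  assumes "is_partition mu" "addable mu (r, c)"
  shows "contr_ratio (add_box mu (r, c)) lam x = contr_ratio mu lam x * Yf lam (gam * x / box_par (r, c))"
  unfolding contr_ratio_alt add_box(3)[OF assms] using add_box(4)[OF assms] by simp

lemma contr_ratio_add_right:
  assumes "is_partition lam" "addable lam (r, c)"
  shows "contr_ratio mu (add_box lam (r, c)) x = contr_ratio mu lam x * Yt mu (box_par (r, c) * x / gam)"
  unfolding contr_ratio_def add_box(3)[OF assms] using add_box(4)[OF assms] by simp

lemma contr_ratio_off_lat:
  assumes "x \<notin> lat" "x \<noteq> 0"
  shows "contr_ratio mu lam x \<noteq> 0" "contr_ratio mu lam analytic_on {x}"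
proof -
  have off: "y * x \<notin> lat" if "y \<in> lat" for y using off_lat_mult[OF assms(1) that] .
  have l1: "1 - y * x \<noteq> 0" if "y \<in> lat" for y using off_lat_nz[OF assms(1) that] .
  have a: "1 - gam * x / box_par b \<noteq> 0" for b
    using l1[OF lat_divide[OF lat_gam box_par_lat[of b]]] by simp
  have b: "Yt mu (box_par b * x / gam) \<noteq> 0" for b
    using Yt_off_lat[of "box_par b * x / gam" mu] off[OF lat_divide[OF box_par_lat[of b] lat_gam]] assms(2) gam0 by simp
  show "contr_ratio mu lam x \<noteq> 0"
    unfolding contr_ratio_def using a b by simp
  have c: "1 - box_par b * x / gam / box_par b' \<noteq> 0" "1 - t * (box_par b * x / gam / box_par b') / q \<noteq> 0" for b b'
    using l1[OF lat_divide[OF lat_divide[OF box_par_lat[of b] lat_gam] box_par_lat[of b']]]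
      l1[OF lat_divide[OF lat_mult[OF lat_t lat_divide[OF lat_divide[OF box_par_lat[of b] lat_gam] box_par_lat[of b']]] lat_q]]
    by (simp_all add: mult.assoc)
  show "contr_ratio mu lam analytic_on {x}"
    unfolding contr_ratio_def[abs_def] Yt_def
    by (intro analytic_intros) (use c gam0 q0 in auto)
qed

lemma contr_ratio_meromorphic: "contr_ratio mu lam meromorphic_on UNIV"
  unfolding contr_ratio_def[abs_def] Yt_def by (intro meromorphic_intros)

lemma exp_series_contr_ratio:
  "exp_series (contr_ratio mu lam) (\<lambda>n. of_nat n * contr mu lam n - of_nat n * contr [] [] n)"
proof -
  have "exp_series (\<lambda>x. (\<Prod>b\<in>boxes mu. 1 - gam / box_par b * x) * (\<Prod>b\<in>boxes lam. Yt mu (box_par b / gam * x)))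
      (\<lambda>n. (\<Sum>b\<in>boxes mu. - ((gam / box_par b) ^ n)) + (\<Sum>b\<in>boxes lam. (box_par b / gam) ^ n * (- yps mu (- int n))))"
    by (intro exp_series_mult exp_series_prod exp_series_scale exp_series_linear exp_series_Yt)
  then show ?thesis
  proof (rule exp_series_cong)
    fix n :: nat assume n: "n \<ge> 1"
    let ?S = "box_power_sum lam (int n)" and ?S' = "box_power_sum mu (- int n)" and ?y = "yps mu (- int n)"
    have nz: "1 - q ^ n \<noteq> 0" "1 - t ^ n \<noteq> 0" "q ^ n \<noteq> 0" "t ^ n \<noteq> 0" "gam ^ n \<noteq> 0" "1 \<noteq> q ^ n" "1 \<noteq> t ^ n"
      using one_minus_q_pow[OF n] one_minus_t_pow[OF n] q0 t0 gam0 by auto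
    have "t = q * (gam * gam)" using gam2 q0 by (simp add: power2_eq_square field_simps)
    from arg_cong[OF this, of "\<lambda>x. x ^ n"] have tg: "t ^ n = q ^ n * (gam ^ n * gam ^ n)"
      by (simp only: power_mult_distrib)
    have y1: "q ^ n * (?y - 1) = (1 - t ^ n) * (1 - q ^ n) * ?S'"
      using nz by (simp add: yps_def power_int_minus field_simps)
    have y2: "t ^ n * (yps lam (int n) - 1) = (1 - t ^ n) * (1 - q ^ n) * ?S"
      using nz by (simp add: yps_def power_int_minus field_simps)
    have "(\<Sum>b\<in>boxes mu. - ((gam / box_par b) ^ n)) = - (gam ^ n * ?S')"
      by (simp add: box_power_sum_def sum_negf sum_distrib_left power_divide power_int_minus divide_inverse power_mult_distrib power_inverse)
    moreover have "(\<Sum>b\<in>boxes lam. (box_par b / gam) ^ n * (- ?y)) = - (?S * ?y / gam ^ n)"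
      by (simp add: box_power_sum_def sum_negf sum_divide_distrib sum_distrib_right power_divide)
    moreover have "- (gam ^ n * ?S') + - (?S * ?y / gam ^ n) =
        - (gam ^ n * q ^ n * ?y * yps lam (int n)) / ((1 - q ^ n) * (1 - t ^ n)) - - (gam ^ n * q ^ n) / ((1 - q ^ n) * (1 - t ^ n))"
    proof -
      let ?D = "(1 - q ^ n) * (1 - t ^ n)"
      have D: "?D \<noteq> 0" using nz by simp
      have "?S' = q ^ n * (?y - 1) / ?D" unfolding y1 using nz by simp
      then have e1: "gam ^ n * ?S' = gam ^ n * (q ^ n * (?y - 1)) / ?D" by (simp only: times_divide_eq_right)
      have e2: "?S * ?y / gam ^ n = gam ^ n * q ^ n * (yps lam (int n) - 1) * ?y / ?D"
      proof -
        have S: "?S = t ^ n * (yps lam (int n) - 1) / ?D" unfolding y2 using nz by simp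
        have "t ^ n * a / ?D * ?y / gam ^ n = gam ^ n * q ^ n * a * ?y / ?D" for a
          using nz by (simp add: divide_simps) (simp add: tg)
        then show ?thesis unfolding S .
      qed
      have e3: "gam ^ n * (q ^ n * (?y - 1)) + gam ^ n * q ^ n * (yps lam (int n) - 1) * ?y =
          gam ^ n * q ^ n * ?y * yps lam (int n) - gam ^ n * q ^ n" by (simp add: algebra_simps)
      have "- (X / E) + - (Z / E) = - U / E - - V / E" if "X + Z = U - V" for X Z U V E :: complex
      proof -
        have X: "X = U - V - Z" using that by (simp add: algebra_simps)
        show ?thesis unfolding X by (simp add: diff_divide_distrib)
      qed
      from this[OF e3] show ?thesis unfolding e1 e2 .
    qed
    ultimately show "(\<Sum>b\<in>boxes mu. - ((gam / box_par b) ^ n)) + (\<Sum>b\<in>boxes lam. (box_par b / gam) ^ n * (- ?y)) =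
        of_nat n * contr mu lam n - of_nat n * contr [] [] n"
      unfolding contr_eq[OF n] by simp
  qed (simp add: contr_ratio_def)
qed

theorem mero_exp_contr:
  assumes "norm q < 1" "norm t > 1" "x \<notin> lat" "x \<noteq> 0"
  shows "mero_exp (contr mu lam) x = mero_exp (contr [] []) x * contr_ratio mu lam x"
proof -
  obtain F where F: "is_mero_cont (contr [] []) F" using contr_empty_continuation[OF assms(1,2)] by blast
  show ?thesis
    by (rule mero_exp_mult[OF F exp_series_contr_ratio contr_ratio_meromorphic _ contr_ratio_off_lat(2,1)[OF assms(3,4)]])
      (simp add: field_simps)
qed

end

section \<open>Counting in index sets\<close>

lemma sum_sorted_list_index:
  fixes J :: "nat set"
  assumes "finite J"
  shows "(\<Sum>l<length (sorted_list_of_set J). f (sorted_list_of_set J ! l) l) = (\<Sum>j\<in>J. f j (card {i\<in>J. i < j}))"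
proof -
  let ?js = "sorted_list_of_set J"
  have sorted: "?js ! m < ?js ! l" if "m < l" "l < length ?js" for m l
    using sorted_wrt_nth_less[OF strict_sorted_list_of_set that] .
  have "card {i\<in>J. i < ?js ! l} = l" if l: "l < length ?js" for l
  proof -
    have "{i\<in>J. i < ?js ! l} = (!) ?js ` {..<l}"
    proof (intro set_eqI iffI)
      fix i assume "i \<in> {i\<in>J. i < ?js ! l}"
      then obtain m where m: "m < length ?js" "?js ! m = i" "i < ?js ! l"
        using assms by (metis (no_types, lifting) in_set_conv_nth mem_Collect_eq set_sorted_list_of_set)
      then have "m < l" using sorted[of l m] by (metis linorder_neqE_nat order_less_asym order_less_irrefl)
      then show "i \<in> (!) ?js ` {..<l}" using m by auto
    next
      fix i assume "i \<in> (!) ?js ` {..<l}"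
      then obtain m where m: "m < l" "i = ?js ! m" by auto
      then have "i \<in> set ?js" using l by simp
      then show "i \<in> {i\<in>J. i < ?js ! l}" using sorted[of m l] m l assms by simp
    qed
    then show ?thesis
      using l by (subst \<open>{i\<in>J. i < ?js ! l} = _\<close>, subst card_image) (auto simp: inj_on_def nth_eq_iff_index_eq)
  qed
  then have "(\<Sum>l<length ?js. f (?js ! l) l) = (\<Sum>l<length ?js. f (?js ! l) (card {i\<in>J. i < ?js ! l}))"
    by simp
  also have "\<dots> = (\<Sum>j\<in>J. f j (card {i\<in>J. i < j}))"
    by (rule sum.reindex_bij_betw) (use bij_betw_nth[of ?js "{..<length ?js}" J] assms in auto)
  finally show ?thesis .
qed

definition cnt :: "nat set \<Rightarrow> nat \<Rightarrow> nat" where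
  "cnt J i = card {j\<in>J. j \<le> i}"

lemma cnt_before: "j \<ge> 1 \<Longrightarrow> card {i\<in>J. i < j} = cnt J (j - 1)"
  unfolding cnt_def by (rule arg_cong[of _ _ card]) auto

lemma cnt_Suc: assumes "finite J" shows "cnt J (Suc i) = cnt J i + (if Suc i \<in> J then 1 else 0)"
proof -
  have "{j\<in>J. j \<le> Suc i} = {j\<in>J. j \<le> i} \<union> (if Suc i \<in> J then {Suc i} else {})" by (auto simp: le_Suc_eq)
  then show ?thesis unfolding cnt_def using assms by (subst \<open>{j\<in>J. j \<le> Suc i} = _\<close>, subst card_Un_disjoint) auto
qed

lemma cnt_mem: "finite J \<Longrightarrow> j \<in> J \<Longrightarrow> j \<ge> 1 \<Longrightarrow> cnt J j = Suc (cnt J (j - 1))"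
  using cnt_Suc[of J "j - 1"] by simp

text \<open>
  The power of \<open>y\<close> with exponent $e - e' \in \{-1, 0, 1\}$, for truth values read as 0 and 1.
\<close>
definition spow :: "bool \<Rightarrow> bool \<Rightarrow> complex \<Rightarrow> complex" where
  "spow e e' y = (if e = e' then 1 else if e then y else inverse y)"

lemma spow_mult: "spow e e' (x * y) = spow e e' x * spow e e' y"
  by (simp add: spow_def)

text \<open>
  Index 0 counts as a member because the boundary term at the left end is part of the telescoping
  sums below; at the right end \<open>N + 1\<close> is not a member.
\<close>
abbreviation lo :: "nat set \<Rightarrow> nat \<Rightarrow> bool" where "lo J i \<equiv> i = 0 \<or> i \<in> J"

lemma sum_spow:
  fixes f :: "nat \<Rightarrow> complex"
  assumes J: "J \<subseteq> {1..N}"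
  shows "(\<Sum>i\<le>N. (of_bool (lo J i) - of_bool (Suc i \<in> J)) * f i) = f 0 + (\<Sum>j\<in>J. f j - f (j - 1))"
proof -
  have fin: "finite J" using J finite_subset by blast
  have "(\<Sum>i\<le>N. of_bool (lo J i) * f i) = (\<Sum>i\<in>insert 0 J. f i)"
    by (rule sum.mono_neutral_cong_right) (use J in auto)
  moreover have "(\<Sum>i\<le>N. of_bool (Suc i \<in> J) * f i) = (\<Sum>i\<in>(\<lambda>j. j - 1) ` J. f i)"
  proof (rule sum.mono_neutral_cong_right)
    show "(\<lambda>j. j - 1) ` J \<subseteq> {..N}" using J by fastforce
    show "\<forall>i\<in>{..N} - (\<lambda>j. j - 1) ` J. of_bool (Suc i \<in> J) * f i = 0" by (force simp: image_iff)
    show "of_bool (Suc i \<in> J) * f i = f i" if "i \<in> (\<lambda>j. j - 1) ` J" for i using that J by force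
  qed simp
  moreover have "(\<Sum>i\<in>(\<lambda>j. j - 1) ` J. f i) = (\<Sum>j\<in>J. f (j - 1))"
    using J by (intro sum.reindex_cong[of "\<lambda>j. j - 1" J]) (auto simp: inj_on_def subset_iff, metis One_nat_def Suc_diff_1 Suc_le_lessD)
  moreover have "0 \<notin> J" using J by auto
  ultimately show ?thesis using fin by (simp add: left_diff_distrib sum_subtractf sum.insert algebra_simps)
qed

lemma prod_spow:
  fixes f :: "nat \<Rightarrow> complex"
  assumes J: "J \<subseteq> {1..N}" and nz: "\<And>i. i \<le> N \<Longrightarrow> f i \<noteq> 0"
  shows "(\<Prod>i\<le>N. spow (lo J i) (Suc i \<in> J) (f i)) = f 0 * (\<Prod>j\<in>J. f j / f (j - 1))"
proof -
  have fin: "finite J" using J finite_subset by blast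
  have e: "spow a b y = (if a then y else 1) / (if b then y else 1)" if "y \<noteq> 0" for a b y
    using that by (auto simp: spow_def divide_inverse)
  have "(\<Prod>i\<le>N. if lo J i then f i else 1) = (\<Prod>i\<in>insert 0 J. f i)"
    by (rule prod.mono_neutral_cong_right) (use J in auto)
  moreover have "(\<Prod>i\<le>N. if Suc i \<in> J then f i else 1) = (\<Prod>i\<in>(\<lambda>j. j - 1) ` J. f i)"
  proof (rule prod.mono_neutral_cong_right)
    show "(\<lambda>j. j - 1) ` J \<subseteq> {..N}" using J by fastforce
    show "\<forall>i\<in>{..N} - (\<lambda>j. j - 1) ` J. (if Suc i \<in> J then f i else 1) = 1" by (force simp: image_iff)
    show "(if Suc i \<in> J then f i else 1) = f i" if "i \<in> (\<lambda>j. j - 1) ` J" for i using that J by force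
  qed simp
  moreover have "(\<Prod>i\<in>(\<lambda>j. j - 1) ` J. f i) = (\<Prod>j\<in>J. f (j - 1))"
    using J by (intro prod.reindex_cong[of "\<lambda>j. j - 1" J]) (auto simp: inj_on_def subset_iff, metis One_nat_def Suc_diff_1 Suc_le_lessD)
  moreover have "0 \<notin> J" using J by auto
  moreover have "(\<Prod>i\<le>N. spow (lo J i) (Suc i \<in> J) (f i)) = (\<Prod>i\<le>N. (if lo J i then f i else 1) / (if Suc i \<in> J then f i else 1))"
    by (intro prod.cong refl e nz) simp
  ultimately show ?thesis using fin unfolding prod_dividef by simp
qed

lemma exp_series_spow:
  assumes "exp_series f s"
  shows "exp_series (\<lambda>x. spow e e' (f x)) (\<lambda>n. (of_bool e - of_bool e') * s n)"
proof (cases "e = e'")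
  case True
  then show ?thesis using exp_series_one by (simp add: spow_def)
next
  case False
  then show ?thesis using assms exp_series_inverse[OF assms] by (cases e) (simp_all add: spow_def)
qed

section \<open>Spectral parameters and vertex coefficients\<close>

locale mukade = generic_qt q t qh th for q t qh th :: complex +
  fixes N :: nat and u v :: "nat \<Rightarrow> complex" and w :: complex
  assumes N1: "N \<ge> 1" and w0: "w \<noteq> 0"
    and uv0: "\<And>j. j \<in> {1..N} \<Longrightarrow> u j \<noteq> 0 \<and> v j \<noteq> 0"
    and uv_lat: "\<And>j. j \<in> {1..N} \<Longrightarrow> u j / v j \<notin> lat"
begin

text \<open>
  The argument at which the partition number \<open>i\<close> enters the current relations. It combines the
  argument $w_{i+1}$ with the powers of $\gamma$ in $\Lambda^{(i)}$, which makes all formulas uniform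
  in \<open>i\<close>.
\<close>
definition om :: "nat \<Rightarrow> complex" where
  "om i = inverse gam ^ i * wpar u v w (Suc i)"

lemma om_0 [simp]: "om 0 = w"
  by (simp add: om_def)

lemma om_Suc: "om (Suc i) = u (Suc i) / v (Suc i) * inverse gam * om i"
  by (simp add: om_def)

lemma om_step: "j \<in> {1..N} \<Longrightarrow> om j = u j / v j * inverse gam * om (j - 1)"
  using om_Suc[of "j - 1"] by simp

lemma om_nz: "i \<le> N \<Longrightarrow> om i \<noteq> 0"
  by (induction i) (use w0 gam0 uv0 in \<open>auto simp: om_Suc\<close>)

lemma wpar_om: "j \<in> {1..N} \<Longrightarrow> wpar u v w j = gam ^ (j - 1) * om (j - 1)"
  using gam0 by (simp add: om_def power_mult_distrib[symmetric] mult.assoc[symmetric])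

lemma wpar'_om: "j \<in> {1..N} \<Longrightarrow> wpar' u v w j = gam ^ j * om j"
proof -
  assume j: "j \<in> {1..N}"
  have "gam ^ j * (inverse gam ^ j * y) = y" for y using gam0 by (simp add: power_inverse)
  moreover have "wpar u v w (Suc j) = u j / v j * wpar u v w j" using j by simp
  ultimately show ?thesis unfolding om_def wpar'_def by (simp only:)
qed

definition PS :: "(nat \<Rightarrow> nat list) \<Rightarrow> nat \<Rightarrow> int \<Rightarrow> complex" where
  "PS \<nu> i k = yps (\<nu> i) k * om i powi k"

definition VC :: "(nat \<Rightarrow> nat list) \<Rightarrow> nat \<times> nat \<Rightarrow> complex" where
  "VC \<nu> = (\<lambda>(j, n). cre (PhiS_hat (\<nu> j)) n * wpar' u v w j ^ n + cre (Phi_hat (\<nu> (j - 1))) n * wpar u v w j ^ n)"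

definition VA :: "(nat \<Rightarrow> nat list) \<Rightarrow> nat \<times> nat \<Rightarrow> complex" where
  "VA \<nu> = (\<lambda>(j, n). ann (PhiS_hat (\<nu> j)) n / wpar' u v w j ^ n + ann (Phi_hat (\<nu> (j - 1))) n / wpar u v w j ^ n)"

lemma VC_eq:
  assumes j: "j \<in> {1..N}" and n: "n \<ge> 1"
  shows "VC \<nu> (j, n) = (gam ^ (j - 1)) ^ n * ((gam ^ n) ^ 2 * PS \<nu> j n - PS \<nu> (j - 1) n) / (of_nat n * (1 - q ^ n))"
proof -
  have jj: "gam ^ j = gam ^ (j - 1) * gam" using j by (metis One_nat_def Suc_diff_1 Suc_le_lessD atLeastAtMost_iff power_Suc2)
  show ?thesis
    unfolding VC_def prod.case Phi_hat_coeffs[OF n] wpar_om[OF j] wpar'_om[OF j] jj PS_def power_mult_distrib power_int_of_nat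
    by (simp add: diff_divide_distrib right_diff_distrib power2_eq_square mult_ac)
qed

lemma VA_eq:
  assumes j: "j \<in> {1..N}" and n: "n \<ge> 1"
  shows "VA \<nu> (j, n) = q ^ n * (PS \<nu> j (- int n) - PS \<nu> (j - 1) (- int n)) / ((gam ^ (j - 1)) ^ n * (of_nat n * (1 - q ^ n)))"
proof -
  have jj: "gam ^ j = gam ^ (j - 1) * gam" using j by (metis One_nat_def Suc_diff_1 Suc_le_lessD atLeastAtMost_iff power_Suc2)
  have nz: "om j \<noteq> 0" "om (j - 1) \<noteq> 0" "gam ^ n \<noteq> 0" using om_nz j gam0 by (auto intro!: om_nz)
  have 1: "(g * qn * y / D) / ((G * g) * o1) = qn * (y * inverse o1) / (G * D)" if "g \<noteq> 0" for g qn y D G o1 :: complex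
    using that by (simp add: divide_inverse mult_ac)
  have 2: "(- (qn * y) / D) / (G * o1) = - (qn * (y * inverse o1) / (G * D))" for qn y D G o1 :: complex
    by (simp add: divide_inverse mult_ac)
  show ?thesis
    unfolding VA_def prod.case Phi_hat_coeffs[OF n] wpar_om[OF j] wpar'_om[OF j] jj PS_def power_mult_distrib power_int_minus power_int_of_nat
      1[OF nz(3)] 2
    by (simp add: diff_divide_distrib right_diff_distrib)
qed

section \<open>Factorization of the summands of T\<close>

text \<open>
  The part of a summand that depends on the partitions; it is rational in the spectral
  parameters.
\<close>
definition T_weight :: "(nat \<Rightarrow> nat list) \<Rightarrow> complex" where
  "T_weight \<nu> = (\<Prod>i\<in>{1..<N}. site_weight (\<nu> i) (u (Suc i)) (v i)) * (\<Prod>j\<in>{1..N}. contr_ratio (\<nu> j) (\<nu> (j - 1)) (v j / u j))"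

text \<open>
  The common factor of all summands. It may vanish for special parameters, in which case the
  normalized operator is 0.
\<close>
definition T_scalar :: complex where
  "T_scalar = (\<Prod>j\<in>{1..N}. mero_exp (contr [] []) (v j / u j))"

lemma vu_off_lat: "j \<in> {1..N} \<Longrightarrow> v j / u j \<notin> lat" "j \<in> {1..N} \<Longrightarrow> v j / u j \<noteq> 0"
  using uv_lat[of j] lat_inverse[of "v j / u j"] uv0[of j] by (auto simp: inverse_divide)

lemma count_tensor_comp: "count (tensor_comp j M) n = count M (j, n)"
proof (induction M)
  case (add k M)
  then show ?case by (cases k) (auto simp: tensor_comp_def)
qed (simp add: tensor_comp_def)

lemma vop_tensor:
  assumes M: "M \<in> fock_basis N" and M': "M' \<in> fock_basis N"
  shows "(\<Prod>j\<in>{1..N}. vop kap (\<lambda>n. A (j, n)) (\<lambda>n. B (j, n)) (tensor_comp j M) (tensor_comp j M')) = vop kapN A B M M'"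
proof -
  let ?L = "snd ` (set_mset M \<union> set_mset M')"
  have sub: "set_mset (tensor_comp j M) \<subseteq> ?L" "set_mset (tensor_comp j M') \<subseteq> ?L" for j
    by (auto simp: tensor_comp_def)
  have subN: "set_mset M \<subseteq> {1..N} \<times> ?L" "set_mset M' \<subseteq> {1..N} \<times> ?L"
    using M M' by (force simp: fock_basis_def)+
  have "(\<Prod>j\<in>{1..N}. vop kap (\<lambda>n. A (j, n)) (\<lambda>n. B (j, n)) (tensor_comp j M) (tensor_comp j M')) =
     (\<Prod>j\<in>{1..N}. \<Prod>n\<in>?L. mel (A (j, n)) (kap n * B (j, n)) (count M (j, n)) (count M' (j, n)))"
    by (intro prod.cong refl, subst vop_eq_prod[of ?L]) (use sub in \<open>auto simp: count_tensor_comp\<close>)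
  also have "\<dots> = (\<Prod>k\<in>{1..N} \<times> ?L. mel (A k) (kapN k * B k) (count M k) (count M' k))"
    by (subst prod.cartesian_product) (auto intro!: prod.cong)
  also have "\<dots> = vop kapN A B M M'"
    by (rule vop_eq_prod[symmetric]) (use subN in auto)
  finally show ?thesis .
qed

lemma T_term_eq:
  assumes \<nu>: "\<And>i. i \<notin> {1..<N} \<Longrightarrow> \<nu> i = []"
    and qt: "N \<ge> 2 \<Longrightarrow> norm q < 1 \<and> norm t > 1"
    and M: "M \<in> fock_basis N" and M': "M' \<in> fock_basis N"
  shows "T_term N u v w \<nu> M M' = T_scalar * (T_weight \<nu> * vop kapN (VC \<nu>) (VA \<nu>) M M')"
proof -
  have mero: "mero_exp (contr (\<nu> j) (\<nu> (j - 1))) (v j / u j) = mero_exp (contr [] []) (v j / u j) * contr_ratio (\<nu> j) (\<nu> (j - 1)) (v j / u j)"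
    if j: "j \<in> {1..N}" for j
  proof (cases "N \<ge> 2")
    case True
    then show ?thesis using mero_exp_contr qt vu_off_lat[OF j] by blast
  next
    case False
    then have "\<nu> j = []" "\<nu> (j - 1) = []" using \<nu> j by auto
    then show ?thesis by (simp add: contr_ratio_def)
  qed
  have ratio: "wpar u v w j / wpar' u v w j = v j / u j" if j: "j \<in> {1..N}" for j
  proof -
    have "om (j - 1) \<noteq> 0" by (rule om_nz) (use j in auto)
    then show ?thesis using uv0[OF j] gam0 unfolding wpar'_def wpar_om[OF j] by (auto simp: field_simps)
  qed
  have site: "PhiS_Phi (\<nu> j) (v j) (wpar' u v w j) (\<nu> (j - 1)) (u j) (wpar u v w j) m m' =
      (PhiS_coef (\<nu> j) (v j) * Phi_coef (\<nu> (j - 1)) (u j)) * (mero_exp (contr [] []) (v j / u j) * contr_ratio (\<nu> j) (\<nu> (j - 1)) (v j / u j)) *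
      vop kap (\<lambda>n. VC \<nu> (j, n)) (\<lambda>n. VA \<nu> (j, n)) m m'"
    if j: "j \<in> {1..N}" for j m m'
    unfolding PhiS_Phi_def vertex_prod_def ratio[OF j] mero[OF j, symmetric] unfolding contr_def VC_def VA_def by simp
  have nil: "PhiS_coef [] y = 1" "Phi_coef [] y = 1" for y
    by (simp_all add: PhiS_coef_def Phi_coef_def f_fac_def c_fac_def n_stat_def transp_def part_def)
  have "(\<Prod>j\<in>{1..N}. PhiS_coef (\<nu> j) (v j)) = (\<Prod>j\<in>{1..<N}. PhiS_coef (\<nu> j) (v j))"
    by (rule prod.mono_neutral_right) (use \<nu> nil in auto)
  moreover have "(\<Prod>j\<in>{1..N}. Phi_coef (\<nu> (j - 1)) (u j)) = (\<Prod>i\<in>{0..<N}. Phi_coef (\<nu> i) (u (Suc i)))"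
    by (rule prod.reindex_bij_witness[of _ Suc "\<lambda>j. j - 1"]) auto
  moreover have "(\<Prod>i\<in>{0..<N}. Phi_coef (\<nu> i) (u (Suc i))) = (\<Prod>i\<in>{1..<N}. Phi_coef (\<nu> i) (u (Suc i)))"
    by (rule prod.mono_neutral_right) (use \<nu> nil in auto)
  ultimately have coef: "(\<Prod>i\<in>{1..<N}. c_fac (\<nu> i) / c'_fac (\<nu> i)) * (\<Prod>j\<in>{1..N}. PhiS_coef (\<nu> j) (v j) * Phi_coef (\<nu> (j - 1)) (u j)) =
      (\<Prod>i\<in>{1..<N}. site_weight (\<nu> i) (u (Suc i)) (v i))"
    unfolding site_weight_def prod.distrib by simp
  have "T_term N u v w \<nu> M M' = (\<Prod>i\<in>{1..<N}. c_fac (\<nu> i) / c'_fac (\<nu> i)) *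
      (\<Prod>j\<in>{1..N}. (PhiS_coef (\<nu> j) (v j) * Phi_coef (\<nu> (j - 1)) (u j)) * (mero_exp (contr [] []) (v j / u j) * contr_ratio (\<nu> j) (\<nu> (j - 1)) (v j / u j)) *
      vop kap (\<lambda>n. VC \<nu> (j, n)) (\<lambda>n. VA \<nu> (j, n)) (tensor_comp j M) (tensor_comp j M'))"
    unfolding T_term_def by (intro arg_cong2[of _ _ _ _ times] refl prod.cong site) auto
  also have "\<dots> = (\<Prod>i\<in>{1..<N}. site_weight (\<nu> i) (u (Suc i)) (v i)) * (T_scalar * (\<Prod>j\<in>{1..N}. contr_ratio (\<nu> j) (\<nu> (j - 1)) (v j / u j))) *
      vop kapN (VC \<nu>) (VA \<nu>) M M'"
    unfolding coef[symmetric] vop_tensor[OF M M', symmetric] T_scalar_def prod.distrib by (simp add: mult_ac)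
  finally show ?thesis unfolding T_weight_def by (simp add: mult_ac)
qed

abbreviation js :: "nat set \<Rightarrow> nat list" where "js \<equiv> sorted_list_of_set"

lemma qt_gam: "q / t = inverse gam ^ 2"
  unfolding power_inverse gam2 by simp

lemma qt_pow: "((q / t) ^ l) ^ n = inverse (((gam ^ n) ^ 2) ^ l)"
  unfolding qt_gam by (simp add: power_mult[symmetric] power_inverse mult_ac)

section \<open>Contractions with the currents\<close>

lemma LamC_eq:
  assumes J: "J \<subseteq> {1..N}"
  shows "LamC (js J) (j, n) = (1 - inverse t ^ n) / of_nat n * (gam ^ (j - 1)) ^ n *
     (\<Sum>i\<in>J. inverse (((gam ^ n) ^ 2) ^ cnt J (i - 1)) * (if j < i then 1 - (gam ^ n) ^ 2 else if j = i then 1 else 0))"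
proof -
  have "LamC (js J) (j, n) = (\<Sum>i\<in>J. Lam_cre i ((q / t) ^ card {k\<in>J. k < i}) (j, n))"
    unfolding LamC_def by (rule sum_sorted_list_index) (use J finite_subset in blast)
  also have "\<dots> = (\<Sum>i\<in>J. (1 - inverse t ^ n) / of_nat n * (gam ^ (j - 1)) ^ n *
      (inverse (((gam ^ n) ^ 2) ^ cnt J (i - 1)) * (if j < i then 1 - (gam ^ n) ^ 2 else if j = i then 1 else 0)))"
  proof (rule sum.cong[OF refl])
    fix i assume "i \<in> J"
    then have "card {k\<in>J. k < i} = cnt J (i - 1)" using J by (intro cnt_before) auto
    then show "Lam_cre i ((q / t) ^ card {k\<in>J. k < i}) (j, n) = (1 - inverse t ^ n) / of_nat n * (gam ^ (j - 1)) ^ n *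
      (inverse (((gam ^ n) ^ 2) ^ cnt J (i - 1)) * (if j < i then 1 - (gam ^ n) ^ 2 else if j = i then 1 else 0))"
      unfolding Lam_cre_def prod.case qt_pow by (auto simp: power_mult[symmetric] mult.commute)
  qed
  finally show ?thesis unfolding sum_distrib_left .
qed

lemma LamA_eq:
  assumes J: "J \<subseteq> {1..N}"
  shows "LamA (js J) (j, n) = (if j \<in> J then - ((1 - t ^ n) / of_nat n * ((gam ^ n) ^ 2) ^ cnt J (j - 1) / (gam ^ (j - 1)) ^ n) else 0)"
proof -
  have fin: "finite J" using J finite_subset by blast
  have "LamA (js J) (j, n) = (\<Sum>i\<in>J. Lam_ann i ((q / t) ^ card {k\<in>J. k < i}) (j, n))"
    unfolding LamA_def by (rule sum_sorted_list_index[OF fin])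
  also have "\<dots> = (\<Sum>i\<in>J. if i = j then Lam_ann j ((q / t) ^ card {k\<in>J. k < j}) (j, n) else 0)"
    by (rule sum.cong) (auto simp: Lam_ann_def)
  also have "\<dots> = (if j \<in> J then Lam_ann j ((q / t) ^ card {k\<in>J. k < j}) (j, n) else 0)"
    using fin by simp
  also have "\<dots> = (if j \<in> J then - ((1 - t ^ n) / of_nat n * ((gam ^ n) ^ 2) ^ cnt J (j - 1) / (gam ^ (j - 1)) ^ n) else 0)"
  proof (cases "j \<in> J")
    case True
    then have c: "card {k\<in>J. k < j} = cnt J (j - 1)" using J by (intro cnt_before) auto
    have "inverse ((q / t) ^ l) ^ n = ((gam ^ n) ^ 2) ^ l" for l
      using qt_pow[of l n] by (metis inverse_inverse_eq power_inverse)
    moreover have "inverse gam ^ ((j - 1) * n) = inverse ((gam ^ (j - 1)) ^ n)"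
      by (simp add: power_mult power_inverse)
    ultimately show ?thesis using True by (simp add: Lam_ann_def c divide_inverse mult_ac)
  qed simp
  finally show ?thesis .
qed

text \<open>
  Only the contractions at the sites in \<open>J\<close> contribute, and each is a difference of power sums at
  neighbouring partitions.
\<close>
lemma contraction_XT:
  assumes J: "J \<subseteq> {1..N}" and n: "n \<ge> 1"
  shows "of_nat n * (\<Sum>j\<in>{1..N}. kapN (j, n) * LamA (js J) (j, n) * VC \<nu> (j, n)) =
     - (\<Sum>j\<in>J. ((gam ^ n) ^ 2) ^ cnt J j * PS \<nu> j n - ((gam ^ n) ^ 2) ^ cnt J (j - 1) * PS \<nu> (j - 1) n)"
proof -
  have nz: "1 - q ^ n \<noteq> 0" "1 - t ^ n \<noteq> 0" "of_nat n \<noteq> (0::complex)" using one_minus_q_pow[OF n] one_minus_t_pow[OF n] n by auto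
  have fin: "finite J" using J finite_subset by blast
  have "(\<Sum>j\<in>{1..N}. of_nat n * (kapN (j, n) * LamA (js J) (j, n) * VC \<nu> (j, n))) =
     (\<Sum>j\<in>J. - (((gam ^ n) ^ 2) ^ cnt J j * PS \<nu> j n - ((gam ^ n) ^ 2) ^ cnt J (j - 1) * PS \<nu> (j - 1) n))"
  proof (rule sum.mono_neutral_cong_right)
    show "\<forall>j\<in>{1..N} - J. of_nat n * (kapN (j, n) * LamA (js J) (j, n) * VC \<nu> (j, n)) = 0"
      by (simp add: LamA_eq[OF J])
  next
    fix j assume j: "j \<in> J"
    then have jN: "j \<in> {1..N}" using J by auto
    have c: "cnt J j = Suc (cnt J (j - 1))" by (rule cnt_mem[OF fin j]) (use jN in auto)
    have "n' * ((n' * Q / T) * (- (T / n' * L / G)) * (G * X / (n' * Q))) = - (L * X)"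
      if "n' \<noteq> 0" "Q \<noteq> 0" "T \<noteq> 0" "G \<noteq> 0" for n' Q T L G X :: complex
      using that by (simp add: field_simps)
    note e = this[OF nz(3,1,2), of "(gam ^ (j - 1)) ^ n"]
    show "of_nat n * (kapN (j, n) * LamA (js J) (j, n) * VC \<nu> (j, n)) =
       - (((gam ^ n) ^ 2) ^ cnt J j * PS \<nu> j n - ((gam ^ n) ^ 2) ^ cnt J (j - 1) * PS \<nu> (j - 1) n)"
      unfolding LamA_eq[OF J] VC_eq[OF jN n] c prod.case kap_def if_P[OF j]
      by (subst e) (use gam0 in simp, simp add: algebra_simps)
  qed (use J in auto)
  then show ?thesis by (simp only: sum_distrib_left sum_negf)
qed

text \<open>
  The creation part of $\Lambda^{(i)}$ involves all sites up to \<open>i\<close>; the sum over them telescopes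
  twice, and what remains at the left end is the shift of $w$ by a power of $\gamma$.
\<close>
lemma contraction_TX:
  assumes J: "J \<subseteq> {1..N}" and n: "n \<ge> 1"
  shows "of_nat n * (\<Sum>j\<in>{1..N}. kapN (j, n) * VA \<nu> (j, n) * LamC (js J) (j, n)) =
     - (\<Sum>j\<in>J. inverse (((gam ^ n) ^ 2) ^ cnt J j) * PS \<nu> j (- int n) - inverse (((gam ^ n) ^ 2) ^ cnt J (j - 1)) * PS \<nu> (j - 1) (- int n))
     + (inverse (((gam ^ n) ^ 2) ^ card J) - 1) * PS \<nu> 0 (- int n)"
proof -
  let ?g = "(gam ^ n) ^ 2" and ?P = "\<lambda>j. PS \<nu> j (- int n)"
  have nz: "1 - q ^ n \<noteq> 0" "1 - t ^ n \<noteq> 0" "of_nat n \<noteq> (0::complex)" "q ^ n \<noteq> 0" "t ^ n \<noteq> 0" "?g \<noteq> 0"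
    using one_minus_q_pow[OF n] one_minus_t_pow[OF n] n q0 t0 gam0 by auto
  have fin: "finite J" using J finite_subset by blast
  have tg: "t ^ n = q ^ n * ?g"
  proof -
    have "t = q * (gam * gam)" using gam2 q0 by (simp add: power2_eq_square field_simps)
    from arg_cong[OF this, of "\<lambda>x. x ^ n"] show ?thesis by (simp only: power_mult_distrib power2_eq_square)
  qed
  let ?e = "\<lambda>i j. if j < i then 1 - ?g else if j = i then 1 else 0"
  have "of_nat n * (\<Sum>j\<in>{1..N}. kapN (j, n) * VA \<nu> (j, n) * LamC (js J) (j, n)) =
      (\<Sum>j\<in>{1..N}. - inverse ?g * ((?P j - ?P (j - 1)) * (\<Sum>i\<in>J. inverse (?g ^ cnt J (i - 1)) * ?e i j)))"
    unfolding sum_distrib_left[of "of_nat n"]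
  proof (rule sum.cong[OF refl])
    fix j assume j: "j \<in> {1..N}"
    have ti: "1 - inverse t ^ n = - inverse (t ^ n) * (1 - t ^ n)" using nz by (simp add: field_simps power_inverse)
    have "n' * ((n' * Q / T) * (q' * X / (G * (n' * Q))) * ((- inverse t' * T) / n' * G * S)) = - (q' / t') * (X * S)"
      if "n' \<noteq> 0" "Q \<noteq> 0" "T \<noteq> 0" "G \<noteq> 0" for n' Q T q' G X S t' :: complex
      using that by (simp add: field_simps)
    note e = this[OF nz(3,1,2), of "(gam ^ (j - 1)) ^ n"]
    have qt': "- (q ^ n / t ^ n) = - inverse ?g" unfolding tg using nz by (simp add: field_simps)
    show "of_nat n * (kapN (j, n) * VA \<nu> (j, n) * LamC (js J) (j, n)) =
       - inverse ?g * ((?P j - ?P (j - 1)) * (\<Sum>i\<in>J. inverse (?g ^ cnt J (i - 1)) * ?e i j))"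
      unfolding LamC_eq[OF J] VA_eq[OF j n] prod.case kap_def ti qt'[symmetric] using gam0 by (intro e) simp
  qed
  also have "\<dots> = (\<Sum>i\<in>J. - inverse (?g ^ Suc (cnt J (i - 1))) * (\<Sum>j\<in>{1..N}. (?P j - ?P (j - 1)) * ?e i j))"
    unfolding sum_distrib_left by (subst sum.swap) (simp add: mult_ac)
  also have "\<dots> = (\<Sum>i\<in>J. - (inverse (?g ^ cnt J i) * ?P i - inverse (?g ^ cnt J (i - 1)) * ?P (i - 1)) +
      (inverse (?g ^ cnt J i) - inverse (?g ^ cnt J (i - 1))) * ?P 0)"
  proof (rule sum.cong[OF refl])
    fix i assume i: "i \<in> J"
    then have iN: "i \<in> {1..N}" using J by auto
    have c: "cnt J i = Suc (cnt J (i - 1))" by (rule cnt_mem[OF fin i]) (use iN in auto)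
    have "(\<Sum>j\<in>{1..N}. (?P j - ?P (j - 1)) * ?e i j) = (\<Sum>j\<in>{1..<Suc i}. (?P j - ?P (j - 1)) * ?e i j)"
      by (rule sum.mono_neutral_right) (use iN in auto)
    also have "\<dots> = (\<Sum>j\<in>{1..<i}. (?P j - ?P (j - 1)) * (1 - ?g)) + (?P i - ?P (i - 1))"
      using iN by (simp add: sum.atLeastLessThan_Suc)
    also have "(\<Sum>j\<in>{1..<i}. (?P j - ?P (j - 1)) * (1 - ?g)) = (1 - ?g) * (?P (i - 1) - ?P 0)"
    proof -
      have "(\<Sum>j\<in>{1..<Suc m}. f j - f (j - 1)) = f m - f 0" for m and f :: "nat \<Rightarrow> complex"
        by (induction m) auto
      note tele = this[of ?P "i - 1"]
      have "Suc (i - 1) = i" using iN by simp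
      from tele[unfolded this] have "(\<Sum>j\<in>{1..<i}. ?P j - ?P (j - 1)) = ?P (i - 1) - ?P 0" .
      then show ?thesis unfolding sum_distrib_right[symmetric] by (simp only: mult.commute)
    qed
    finally have s: "(\<Sum>j\<in>{1..N}. (?P j - ?P (j - 1)) * ?e i j) = (1 - ?g) * (?P (i - 1) - ?P 0) + (?P i - ?P (i - 1))" .
    show "- inverse (?g ^ Suc (cnt J (i - 1))) * (\<Sum>j\<in>{1..N}. (?P j - ?P (j - 1)) * ?e i j) =
       - (inverse (?g ^ cnt J i) * ?P i - inverse (?g ^ cnt J (i - 1)) * ?P (i - 1)) +
      (inverse (?g ^ cnt J i) - inverse (?g ^ cnt J (i - 1))) * ?P 0"
    proof -
      have "- inverse (g ^ Suc k) * ((1 - g) * (a - z) + (b - a)) = - (inverse (g ^ Suc k) * b - inverse (g ^ k) * a) +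
        (inverse (g ^ Suc k) - inverse (g ^ k)) * z" if "g \<noteq> 0" for g a b z :: complex and k
        using that by (simp add: field_simps)
      then show ?thesis unfolding s c using nz(6) by blast
    qed
  qed
  also have "\<dots> = - (\<Sum>j\<in>J. inverse (?g ^ cnt J j) * ?P j - inverse (?g ^ cnt J (j - 1)) * ?P (j - 1)) +
     (\<Sum>i\<in>J. inverse (?g ^ cnt J i) - inverse (?g ^ cnt J (i - 1))) * ?P 0"
    unfolding sum.distrib sum_negf sum_distrib_right ..
  also have "(\<Sum>i\<in>J. inverse (?g ^ cnt J i) - inverse (?g ^ cnt J (i - 1))) = inverse (?g ^ card J) - 1"
  proof -
    let ?f = "\<lambda>i. inverse (?g ^ cnt J i)"
    have "(\<Sum>i\<in>J. ?f i - ?f (i - 1)) = (\<Sum>i\<in>{1..<Suc N}. ?f i - ?f (i - 1))"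
    proof (rule sum.mono_neutral_left)
      show "\<forall>i\<in>{1..<Suc N} - J. ?f i - ?f (i - 1) = 0"
      proof
        fix i assume i: "i \<in> {1..<Suc N} - J"
        then have "cnt J i = cnt J (i - 1)" using cnt_Suc[OF fin, of "i - 1"] by simp
        then show "?f i - ?f (i - 1) = 0" by simp
      qed
    qed (use J in auto)
    also have "\<dots> = ?f N - ?f 0"
    proof -
      have "(\<Sum>j\<in>{1..<Suc m}. f j - f (j - 1)) = f m - f 0" for m and f :: "nat \<Rightarrow> complex"
        by (induction m) auto
      then show ?thesis .
    qed
    finally have "(\<Sum>i\<in>J. ?f i - ?f (i - 1)) = ?f N - ?f 0" .
    moreover have "{j\<in>J. j \<le> N} = J" "{j\<in>J. j \<le> 0} = {}" using J by auto
    then have "cnt J N = card J" "cnt J 0 = 0" by (simp_all add: cnt_def)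
    ultimately show ?thesis by simp
  qed
  finally show ?thesis .
qed

end

section \<open>Inversion of the variable\<close>

lemma has_fps_expansion_eventually:
  assumes "f has_fps_expansion F" "\<forall>\<^sub>F x in nhds 0. f x = g x"
  shows "g has_fps_expansion F"
proof -
  have "\<forall>\<^sub>F x in nhds 0. eval_fps F x = f x" using assms(1) by (simp add: has_fps_expansion_def)
  with assms(2) have "\<forall>\<^sub>F x in nhds 0. eval_fps F x = g x" by eventually_elim simp
  then show ?thesis using assms(1) by (simp add: has_fps_expansion_def)
qed

lemma gmel_inversion:
  assumes "z \<noteq> 0"
  shows "gmel (A + A' * inverse z) (B * inverse z + B') (inverse z) m m' * z ^ (m + m') = gmel (A' + A * z) (B' * z + B) z m m'"
  unfolding gmel_def sum_distrib_right
proof (rule sum.cong[OF refl])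
  fix s assume s: "s \<in> {..m}"
  show "(A + A' * inverse z) ^ (m - s) / fact (m - s) * of_nat (m' choose s) * (B * inverse z + B') ^ (m' - s) * inverse z ^ s * z ^ (m + m') =
    (A' + A * z) ^ (m - s) / fact (m - s) * of_nat (m' choose s) * (B' * z + B) ^ (m' - s) * z ^ s"
  proof (cases "s \<le> m'")
    case True
    have "z ^ (m + m') = z ^ (m - s) * z ^ (m' - s) * z ^ s * z ^ s"
      unfolding power_add[symmetric] using s True by simp
    moreover have "(A + A' * inverse z) ^ (m - s) * z ^ (m - s) = (A' + A * z) ^ (m - s)"
      "(B * inverse z + B') ^ (m' - s) * z ^ (m' - s) = (B' * z + B) ^ (m' - s)" "inverse z ^ s * z ^ s = 1"
      unfolding power_mult_distrib[symmetric] using assms by (simp_all add: distrib_right mult.assoc add.commute)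
    moreover have "a / f * c * b * i * (x * y * z * z') = (a * x) / f * c * (b * y) * z' * (i * z)" for a f c b i x y z z' :: complex
      by simp
    ultimately show ?thesis by (simp only: mult_1_right)
  qed (simp add: binomial_eq_0)
qed

text \<open>
  A normal-ordered product does not depend on the order of its factors, so the same Laurent
  polynomial describes both products, expanded at opposite ends.
\<close>
lemma wick_el_inversion:
  assumes "z \<noteq> 0"
  shows "wick_el \<kappa> A B A' B' M M' (inverse z) * z ^ (mwt snd M + mwt snd M') = wick_el \<kappa> A' B' A B M M' z"
proof -
  let ?S = "set_mset M \<union> set_mset M'"
  have "mwt snd M + mwt snd M' = (\<Sum>k\<in>?S. snd k * (count M k + count M' k))"
    by (simp add: mwt_eq_sum[of ?S] sum.distrib[symmetric] distrib_left mult.commute)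
  then have pw: "z ^ (mwt snd M + mwt snd M') = (\<Prod>k\<in>?S. (z ^ snd k) ^ (count M k + count M' k))"
    by (simp add: power_sum power_mult)
  show ?thesis unfolding wick_el_def pw prod.distrib[symmetric]
  proof (intro prod.cong refl)
    fix k :: "nat \<times> nat"
    have "z ^ snd k \<noteq> 0" using assms by simp
    from gmel_inversion[OF this, of "A k" "A' k" "\<kappa> k * B k" "\<kappa> k * B' k" "count M k" "count M' k"]
    show "gmel (A k + A' k * inverse z ^ snd k) (\<kappa> k * B k * inverse z ^ snd k + \<kappa> k * B' k) (inverse z ^ snd k) (count M k) (count M' k) *
         (z ^ snd k) ^ (count M k + count M' k) =
         gmel (A' k + A k * z ^ snd k) (\<kappa> k * B' k * z ^ snd k + \<kappa> k * B k) (z ^ snd k) (count M k) (count M' k)"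
      unfolding power_inverse .
  qed
qed

text \<open>
  An entire function of polynomial growth is a polynomial. Its coefficients can be read from the
  bottom, giving \<open>F\<close>, or from the top, giving \<open>G\<close>.
\<close>
lemma expansions_at_0_and_infinity:
  fixes E f g :: "complex \<Rightarrow> complex"
  assumes E: "E holomorphic_on UNIV"
    and f: "f has_fps_expansion F" "\<forall>\<^sub>F x in at 0. E x = f x"
    and g: "g has_fps_expansion G" "\<forall>\<^sub>F z in at 0. z ^ b * E (inverse z) = g z"
  shows "fps_nth F k = (if k \<le> b then fps_nth G (b - k) else 0)" and "b < k \<Longrightarrow> fps_nth G k = 0"
proof -
  have contg: "isCont g 0"
    using has_fps_expansion_imp_continuous[OF g(1)] by simp
  then have "\<forall>\<^sub>F z in at 0. norm (g z) < norm (g 0) + 1"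
    by (intro order_tendstoD(2)[of "\<lambda>z. norm (g z)" "norm (g 0)"] tendsto_norm) (auto simp: isCont_def)
  with g(2) have "\<forall>\<^sub>F z in at 0. norm (z ^ b * E (inverse z)) < norm (g 0) + 1"
    by eventually_elim simp
  then obtain d where d: "d > 0" "\<And>z. z \<noteq> 0 \<Longrightarrow> norm z < d \<Longrightarrow> norm (z ^ b * E (inverse z)) < norm (g 0) + 1"
    by (auto simp: eventually_at)
  have bound: "norm (E x) \<le> (norm (g 0) + 1) * norm x ^ b" if "2 / d \<le> norm x" for x
  proof -
    have "0 < 2 / d" using d(1) by simp
    then have x: "norm x > 0" using that by linarith
    have "2 \<le> d * norm x" using that d(1) by (simp add: divide_le_eq mult.commute)
    then have "1 / norm x < d" using x by (simp add: divide_less_eq)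
    then have "norm (inverse x) < d" by (simp add: norm_inverse inverse_eq_divide norm_divide)
    from d(2)[OF _ this] x have "norm (inverse x ^ b * E x) < norm (g 0) + 1" by auto
    then have "norm (E x) / norm x ^ b < norm (g 0) + 1" by (simp add: norm_mult norm_power norm_inverse power_inverse divide_inverse mult.commute)
    then show ?thesis using x by (simp add: field_simps)
  qed
  define e where "e = (\<lambda>k. (deriv ^^ k) E 0 / fact k)"
  have Epoly: "E x = (\<Sum>k\<le>b. e k * x ^ k)" for x
    unfolding e_def by (rule Liouville_polynomial[OF E bound])
  define P where "P = (\<Sum>k\<le>b. fps_const (e k) * fps_X ^ k)"
  define R where "R = (\<Sum>k\<le>b. fps_const (e k) * fps_X ^ (b - k))"
  have EP: "E has_fps_expansion P"
    unfolding P_def Epoly[abs_def] by (intro fps_expansion_intros)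
  have gR: "(\<lambda>z. \<Sum>k\<le>b. e k * z ^ (b - k)) has_fps_expansion R"
    unfolding R_def by (intro fps_expansion_intros)
  have transfer: "f1 has_fps_expansion F2" if "f1 has_fps_expansion F1" "f2 has_fps_expansion F2" "\<forall>\<^sub>F x in at 0. f2 x = f1 x"
    for f1 f2 :: "complex \<Rightarrow> complex" and F1 F2
  proof -
    have "isCont f1 0" "isCont f2 0"
      using has_fps_expansion_imp_continuous[OF that(1)] has_fps_expansion_imp_continuous[OF that(2)] by simp_all
    then have "(f1 \<longlongrightarrow> f1 0) (at 0)" "(f2 \<longlongrightarrow> f2 0) (at 0)" by (simp_all add: isCont_def)
    moreover have "(f2 \<longlongrightarrow> l) (at 0) \<longleftrightarrow> (f1 \<longlongrightarrow> l) (at 0)" for l by (rule tendsto_cong[OF that(3)])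
    ultimately have "f2 0 = f1 0" using tendsto_unique[of "at (0::complex)" f1] by auto
    then have "\<forall>\<^sub>F x in nhds 0. f2 x = f1 x" using that(3) by (simp add: eventually_nhds_conv_at)
    then show ?thesis using that(2) by (rule has_fps_expansion_eventually[rotated])
  qed
  have "F = P" using transfer[OF f(1) EP f(2)] f(1) has_fps_expansion_unique by blast
  have nz: "\<forall>\<^sub>F z in at (0::complex). z \<noteq> 0" by (simp add: eventually_at_filter)
  have "\<forall>\<^sub>F z in at 0. (\<Sum>k\<le>b. e k * z ^ (b - k)) = g z"
    using g(2) nz
  proof eventually_elim
    case (elim z)
    have "z ^ b * E (inverse z) = (\<Sum>k\<le>b. e k * z ^ (b - k))"
      unfolding Epoly sum_distrib_left using elim(2)
      by (intro sum.cong refl) (simp add: power_diff power_inverse field_simps)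
    then show ?case using elim by simp
  qed
  from transfer[OF g(1) gR this] have "G = R" using g(1) has_fps_expansion_unique by blast
  have nthP: "fps_nth P k = (if k \<le> b then e k else 0)" for k
    unfolding P_def by (simp add: fps_sum_nth if_distrib[of "\<lambda>x. _ * x"] cong: if_cong)
  have nthR: "fps_nth R k = (if k \<le> b then e (b - k) else 0)" for k
  proof -
    have "fps_nth R k = (\<Sum>i\<le>b. if i = b - k \<and> k \<le> b then e i else 0)"
      unfolding R_def fps_sum_nth by (intro sum.cong) auto
    then show ?thesis by (cases "k \<le> b") auto
  qed
  show "fps_nth F k = (if k \<le> b then fps_nth G (b - k) else 0)" "b < k \<Longrightarrow> fps_nth G k = 0"
    unfolding \<open>F = P\<close> \<open>G = R\<close> nthP nthR by auto
qed

context mukade begin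

section \<open>Current contractions as rational functions\<close>

definition phi :: "(nat \<Rightarrow> nat list) \<Rightarrow> nat set \<Rightarrow> nat \<Rightarrow> complex \<Rightarrow> complex" where
  "phi \<nu> J i x = spow (lo J i) (Suc i \<in> J) (Yf (\<nu> i) (om i * (gam ^ 2) ^ cnt J i * x))"

definition Phi :: "(nat \<Rightarrow> nat list) \<Rightarrow> nat set \<Rightarrow> complex \<Rightarrow> complex" where
  "Phi \<nu> J x = (\<Prod>i\<le>N. phi \<nu> J i x)"

definition Phit :: "(nat \<Rightarrow> nat list) \<Rightarrow> nat set \<Rightarrow> complex \<Rightarrow> complex" where
  "Phit \<nu> J z = (\<Prod>i\<le>N. spow (lo J i) (Suc i \<in> J) (Yt (\<nu> i) (inverse (om i * (gam ^ 2) ^ cnt J i) * z)))"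

lemma cnt_0: "J \<subseteq> {1..N} \<Longrightarrow> cnt J 0 = 0"
proof -
  assume "J \<subseteq> {1..N}"
  then have "{j\<in>J. j \<le> 0} = {}" by auto
  then show ?thesis by (simp add: cnt_def)
qed

lemma gam_pow_swap: "((gam ^ 2) ^ c) ^ n = ((gam ^ n) ^ 2) ^ c"
  by (simp add: power_mult[symmetric] mult_ac)

lemma exp_series_Phi:
  assumes J: "J \<subseteq> {1..N}"
  shows "exp_series (Phi \<nu> J) (\<lambda>n. - (PS \<nu> 0 n +
     (\<Sum>j\<in>J. ((gam ^ n) ^ 2) ^ cnt J j * PS \<nu> j n - ((gam ^ n) ^ 2) ^ cnt J (j - 1) * PS \<nu> (j - 1) n)))"
proof -
  have "exp_series (Phi \<nu> J) (\<lambda>n. \<Sum>i\<le>N. (of_bool (lo J i) - of_bool (Suc i \<in> J)) *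
      ((om i * (gam ^ 2) ^ cnt J i) ^ n * (- yps (\<nu> i) (int n))))"
    unfolding Phi_def[abs_def] phi_def by (intro exp_series_prod exp_series_spow exp_series_scale exp_series_Yf)
  then show ?thesis
  proof (rule exp_series_cong)
    fix n :: nat
    let ?f = "\<lambda>i. - (((gam ^ n) ^ 2) ^ cnt J i * PS \<nu> i n)"
    have e: "(om i * (gam ^ 2) ^ cnt J i) ^ n * (- yps (\<nu> i) (int n)) = ?f i" for i
      unfolding power_mult_distrib gam_pow_swap by (simp add: PS_def)
    show "(\<Sum>i\<le>N. (of_bool (lo J i) - of_bool (Suc i \<in> J)) * ((om i * (gam ^ 2) ^ cnt J i) ^ n * (- yps (\<nu> i) (int n)))) =
      - (PS \<nu> 0 n + (\<Sum>j\<in>J. ((gam ^ n) ^ 2) ^ cnt J j * PS \<nu> j n - ((gam ^ n) ^ 2) ^ cnt J (j - 1) * PS \<nu> (j - 1) n))"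
      unfolding e sum_spow[OF J, of ?f] by (simp add: cnt_0[OF J] sum_negf[symmetric] algebra_simps)
  qed simp
qed

lemma exp_series_Phit:
  assumes J: "J \<subseteq> {1..N}"
  shows "exp_series (Phit \<nu> J) (\<lambda>n. - (PS \<nu> 0 (- int n) +
     (\<Sum>j\<in>J. inverse (((gam ^ n) ^ 2) ^ cnt J j) * PS \<nu> j (- int n) - inverse (((gam ^ n) ^ 2) ^ cnt J (j - 1)) * PS \<nu> (j - 1) (- int n))))"
proof -
  have "exp_series (Phit \<nu> J) (\<lambda>n. \<Sum>i\<le>N. (of_bool (lo J i) - of_bool (Suc i \<in> J)) *
      (inverse (om i * (gam ^ 2) ^ cnt J i) ^ n * (- yps (\<nu> i) (- int n))))"
    unfolding Phit_def[abs_def] by (intro exp_series_prod exp_series_spow exp_series_scale exp_series_Yt)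
  then show ?thesis
  proof (rule exp_series_cong)
    fix n :: nat
    let ?f = "\<lambda>i. - (inverse (((gam ^ n) ^ 2) ^ cnt J i) * PS \<nu> i (- int n))"
    have e: "inverse (om i * (gam ^ 2) ^ cnt J i) ^ n * (- yps (\<nu> i) (- int n)) = ?f i" for i
      unfolding inverse_mult_distrib power_mult_distrib power_inverse gam_pow_swap by (simp add: PS_def power_int_minus)
    show "(\<Sum>i\<le>N. (of_bool (lo J i) - of_bool (Suc i \<in> J)) * (inverse (om i * (gam ^ 2) ^ cnt J i) ^ n * (- yps (\<nu> i) (- int n)))) =
      - (PS \<nu> 0 (- int n) + (\<Sum>j\<in>J. inverse (((gam ^ n) ^ 2) ^ cnt J j) * PS \<nu> j (- int n) - inverse (((gam ^ n) ^ 2) ^ cnt J (j - 1)) * PS \<nu> (j - 1) (- int n)))"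
      unfolding e sum_spow[OF J, of ?f] by (simp add: cnt_0[OF J] sum_negf[symmetric] algebra_simps)
  qed simp
qed

text \<open>
  Inversion turns each \<open>Yf\<close> into \<open>Yt\<close> and leaves monomials. Their signed product telescopes over the
  indices in \<open>J\<close> to the ratios $u_j/v_j$ and powers of $\gamma$; this is where the weights of
  $X^{(k)}$ with parameters \<open>v\<close> become those with parameters \<open>u\<close>.
\<close>
lemma Phi_inversion:
  assumes J: "J \<subseteq> {1..N}" and z: "z \<noteq> 0"
  shows "(\<Prod>j\<in>J. v j) * Phi \<nu> J (inverse z) = - (w * gam ^ card J * inverse z) * ((\<Prod>j\<in>J. u j) * Phit \<nu> J z)"
proof -
  let ?d = "\<lambda>i. - (om i * (gam ^ 2) ^ cnt J i * inverse z)"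
  have fin: "finite J" using J finite_subset by blast
  have dnz: "?d i \<noteq> 0" if "i \<le> N" for i using om_nz[OF that] gam0 z by simp
  have "Phi \<nu> J (inverse z) = (\<Prod>i\<le>N. spow (lo J i) (Suc i \<in> J) (?d i) *
      spow (lo J i) (Suc i \<in> J) (Yt (\<nu> i) (inverse (om i * (gam ^ 2) ^ cnt J i) * z)))"
    unfolding Phi_def phi_def spow_mult[symmetric]
  proof (intro prod.cong refl arg_cong[of _ _ "spow _ _"])
    fix i assume "i \<in> {..N}"
    then have nz: "om i * (gam ^ 2) ^ cnt J i \<noteq> 0" using om_nz[of i] gam0 by simp
    have "om i * (gam ^ 2) ^ cnt J i * inverse z = inverse (inverse (om i * (gam ^ 2) ^ cnt J i) * z)"
      using nz z by simp
    then show "Yf (\<nu> i) (om i * (gam ^ 2) ^ cnt J i * inverse z) = ?d i * Yt (\<nu> i) (inverse (om i * (gam ^ 2) ^ cnt J i) * z)"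
      using Yf_inversion[of "inverse (om i * (gam ^ 2) ^ cnt J i) * z" "\<nu> i"] nz z by simp
  qed
  also have "\<dots> = ?d 0 * (\<Prod>j\<in>J. ?d j / ?d (j - 1)) * Phit \<nu> J z"
    unfolding prod.distrib Phit_def by (rule arg_cong2[of _ _ _ _ times, OF prod_spow[of J N ?d, OF J dnz] refl])
  also have "(\<Prod>j\<in>J. ?d j / ?d (j - 1)) = (\<Prod>j\<in>J. u j / v j * gam)"
  proof (rule prod.cong[OF refl])
    fix j assume j: "j \<in> J"
    then have jN: "j \<in> {1..N}" using J by auto
    have c: "cnt J j = Suc (cnt J (j - 1))" by (rule cnt_mem[OF fin j]) (use jN in auto)
    have "om (j - 1) \<noteq> 0" by (rule om_nz) (use jN in auto)
    then show "?d j / ?d (j - 1) = u j / v j * gam"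
      unfolding om_step[OF jN] c using gam0 z by (simp add: field_simps power2_eq_square)
  qed
  also have "\<dots> = (\<Prod>j\<in>J. u j) / (\<Prod>j\<in>J. v j) * gam ^ card J"
    by (simp add: prod.distrib prod_dividef)
  finally have "Phi \<nu> J (inverse z) = ?d 0 * ((\<Prod>j\<in>J. u j) / (\<Prod>j\<in>J. v j) * gam ^ card J) * Phit \<nu> J z" .
  moreover have "(\<Prod>j\<in>J. v j) \<noteq> 0" using uv0 J fin by (auto simp: subset_iff)
  ultimately show ?thesis by (simp add: cnt_0[OF J] field_simps)
qed

abbreviation "wickX \<nu> J M M' \<equiv> wick_el kapN (LamC (js J)) (LamA (js J)) (VC \<nu>) (VA \<nu>) M M'"
abbreviation "wickT \<nu> J M M' \<equiv> wick_el kapN (VC \<nu>) (VA \<nu>) (LamC (js J)) (LamA (js J)) M M'"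

definition XTs :: "(nat \<Rightarrow> nat list) \<Rightarrow> nat set \<Rightarrow> (nat \<times> nat) multiset \<Rightarrow> (nat \<times> nat) multiset \<Rightarrow> nat \<Rightarrow> complex" where
  "XTs \<nu> J M M' p = (\<Sum>K | K \<in> fock_basis N \<and> mwt snd K = p. vop kapN (LamC (js J)) (LamA (js J)) M K * vop kapN (VC \<nu>) (VA \<nu>) K M')"

definition TXs :: "(nat \<Rightarrow> nat list) \<Rightarrow> nat set \<Rightarrow> (nat \<times> nat) multiset \<Rightarrow> (nat \<times> nat) multiset \<Rightarrow> nat \<Rightarrow> complex" where
  "TXs \<nu> J M M' p = (\<Sum>K | K \<in> fock_basis N \<and> mwt snd K = p. vop kapN (VC \<nu>) (VA \<nu>) M K * vop kapN (LamC (js J)) (LamA (js J)) K M')"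

lemma eventually_linear_nz_nhds: "\<forall>\<^sub>F x in nhds 0. 1 - c * x \<noteq> (0::complex)"
proof -
  have "isCont (\<lambda>x. 1 - c * x) 0" by (intro continuous_intros)
  from continuous_at_avoid[OF this, of 0] show ?thesis
    unfolding eventually_nhds_metric by (auto simp: dist_commute)
qed

lemma expansion_XT:
  assumes J: "J \<subseteq> {1..N}" and \<nu>: "\<nu> 0 = []" and M: "M \<in> fock_basis N" "M' \<in> fock_basis N"
  shows "(\<lambda>x. Phi \<nu> J x * wickX \<nu> J M M' x) has_fps_expansion (1 - fps_const w * fps_X) * Abs_fps (XTs \<nu> J M M')"
proof -
  have P0: "PS \<nu> 0 (int n) = w ^ n" for n by (simp add: PS_def \<nu>)
  have "exp_series (\<lambda>x. Phi \<nu> J x * inverse (1 - w * x)) (\<lambda>n. - (PS \<nu> 0 n +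
     (\<Sum>j\<in>J. ((gam ^ n) ^ 2) ^ cnt J j * PS \<nu> j n - ((gam ^ n) ^ 2) ^ cnt J (j - 1) * PS \<nu> (j - 1) n)) + - (- (w ^ n)))"
    by (intro exp_series_mult exp_series_Phi[OF J] exp_series_inverse exp_series_linear)
  from wick[OF this _ M, of kapN "LamA (js J)" "VC \<nu>" "LamC (js J)" "VA \<nu>"]
  have "(\<lambda>x. Phi \<nu> J x * inverse (1 - w * x) * wickX \<nu> J M M' x) has_fps_expansion Abs_fps (XTs \<nu> J M M')"
    unfolding XTs_def[abs_def] using contraction_XT[OF J, of _ \<nu>] by (simp add: P0)
  then have "(\<lambda>x. (1 - w * x) * (Phi \<nu> J x * inverse (1 - w * x) * wickX \<nu> J M M' x)) has_fps_expansion
     (1 - fps_const w * fps_X) * Abs_fps (XTs \<nu> J M M')"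
    by (intro fps_expansion_intros)
  then show ?thesis
    by (rule has_fps_expansion_eventually) (use eventually_linear_nz_nhds[of w] in eventually_elim, simp)
qed

lemma expansion_TX:
  assumes J: "J \<subseteq> {1..N}" and \<nu>: "\<nu> 0 = []" and M: "M \<in> fock_basis N" "M' \<in> fock_basis N"
  shows "(\<lambda>z. - (w * gam ^ card J) * Phit \<nu> J z * wickT \<nu> J M M' z) has_fps_expansion
     (fps_const (inverse gam ^ card J) * fps_X - fps_const (w * gam ^ card J)) * Abs_fps (TXs \<nu> J M M')"
proof -
  let ?c = "inverse ((gam ^ 2) ^ card J * w)"
  have P0: "PS \<nu> 0 (- int n) = inverse (w ^ n)" for n by (simp add: PS_def \<nu> power_int_minus)
  have c: "?c ^ n = inverse (((gam ^ n) ^ 2) ^ card J) * inverse (w ^ n)" for n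
    unfolding power_inverse[symmetric] power_mult_distrib gam_pow_swap inverse_mult_distrib by (simp add: power_mult_distrib power_inverse gam_pow_swap)
  have cond: "- (PS \<nu> 0 (- int n) +
     (\<Sum>j\<in>J. inverse (((gam ^ n) ^ 2) ^ cnt J j) * PS \<nu> j (- int n) - inverse (((gam ^ n) ^ 2) ^ cnt J (j - 1)) * PS \<nu> (j - 1) (- int n))) + - (- (?c ^ n)) =
     of_nat n * (\<Sum>j\<in>{1..N}. kapN (j, n) * VA \<nu> (j, n) * LamC (js J) (j, n))" if "n \<ge> 1" for n
    unfolding contraction_TX[OF J that] P0 c by (simp add: left_diff_distrib)
  have "exp_series (\<lambda>z. Phit \<nu> J z * inverse (1 - ?c * z)) (\<lambda>n. - (PS \<nu> 0 (- int n) +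
     (\<Sum>j\<in>J. inverse (((gam ^ n) ^ 2) ^ cnt J j) * PS \<nu> j (- int n) - inverse (((gam ^ n) ^ 2) ^ cnt J (j - 1)) * PS \<nu> (j - 1) (- int n))) + - (- (?c ^ n)))"
    by (intro exp_series_mult exp_series_Phit[OF J] exp_series_inverse exp_series_linear)
  from wick[OF this cond M, of "VC \<nu>" "LamA (js J)"]
  have "(\<lambda>z. Phit \<nu> J z * inverse (1 - ?c * z) * wickT \<nu> J M M' z) has_fps_expansion Abs_fps (TXs \<nu> J M M')"
    unfolding TXs_def[abs_def] by simp
  then have "(\<lambda>z. (inverse gam ^ card J * z - w * gam ^ card J) * (Phit \<nu> J z * inverse (1 - ?c * z) * wickT \<nu> J M M' z)) has_fps_expansion
     (fps_const (inverse gam ^ card J) * fps_X - fps_const (w * gam ^ card J)) * Abs_fps (TXs \<nu> J M M')"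
    by (intro fps_expansion_intros)
  then show ?thesis
  proof (rule has_fps_expansion_eventually)
    have e: "inverse gam ^ card J * z - w * gam ^ card J = - (w * gam ^ card J) * (1 - ?c * z)" for z
    proof -
      have "w * gam ^ card J * ?c = inverse gam ^ card J"
      proof -
        have gk: "(gam ^ 2) ^ card J = gam ^ card J * gam ^ card J" by (simp add: power2_eq_square power_mult_distrib)
        show ?thesis unfolding gk using w0 gam0 by (simp add: power_inverse field_simps)
      qed
      then show ?thesis by (simp add: right_diff_distrib mult.assoc[symmetric])
    qed
    show "\<forall>\<^sub>F z in nhds 0. (inverse gam ^ card J * z - w * gam ^ card J) * (Phit \<nu> J z * inverse (1 - ?c * z) * wickT \<nu> J M M' z) =
       - (w * gam ^ card J) * Phit \<nu> J z * wickT \<nu> J M M' z"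
      using eventually_linear_nz_nhds[of ?c]
    proof eventually_elim
      case (elim z)
      have "a * b * (p * inverse b * x) = a * p * x" if "b \<noteq> 0" for a b p x :: complex
        using that by simp
      from this[OF elim] show ?case unfolding e .
    qed
  qed
qed

end

section \<open>Behaviour of the terms at a point\<close>

lemma filterlim_scale_at:
  assumes "c \<noteq> (0::complex)"
  shows "filterlim (\<lambda>x. c * x) (at (c * x0)) (at x0)"
  unfolding filterlim_at
proof
  show "((\<lambda>x. c * x) \<longlongrightarrow> c * x0) (at x0)" by (intro tendsto_intros)
  have "\<forall>\<^sub>F x in at x0. x \<noteq> x0" by (simp add: eventually_at_filter)
  then show "\<forall>\<^sub>F x in at x0. c * x \<in> UNIV \<and> c * x \<noteq> c * x0" by eventually_elim (use assms in auto)
qed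

lemma cnt_move:
  assumes J: "finite J" and i: "i \<notin> J" "Suc i \<in> J"
  shows "cnt (insert i (J - {Suc i})) k = (if k = i then Suc (cnt J i) else cnt J k)"
proof -
  let ?J = "insert i (J - {Suc i})"
  consider "k < i" | "k = i" | "k > i" by linarith
  then show ?thesis
  proof cases
    case 1
    then have "{j\<in>?J. j \<le> k} = {j\<in>J. j \<le> k}" by auto
    with 1 show ?thesis by (simp add: cnt_def)
  next
    case 2
    then have "{j\<in>?J. j \<le> k} = insert i {j\<in>J. j \<le> k}" by auto
    then show ?thesis using 2 J i by (simp add: cnt_def)
  next
    case 3
    then have e: "{j\<in>?J. j \<le> k} = insert i ({j\<in>J. j \<le> k} - {Suc i})" "Suc i \<in> {j\<in>J. j \<le> k}" using i by auto
    then have "card {j\<in>?J. j \<le> k} = Suc (card {j\<in>J. j \<le> k} - 1)" using J i by simp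
    moreover have "card {j\<in>J. j \<le> k} > 0" using e(2) J by (auto simp: card_gt_0_iff)
    ultimately show ?thesis using 3 by (simp add: cnt_def)
  qed
qed

lemma prod_two_changes:
  fixes f g :: "nat \<Rightarrow> complex"
  assumes "finite I" "a \<in> I" "b \<in> I" "a \<noteq> b"
    and "\<And>i. i \<in> I \<Longrightarrow> g i = f i * (if i = a then x else 1) * (if i = b then y else 1)"
  shows "prod g I = prod f I * x * y"
proof -
  have "prod g I = (\<Prod>i\<in>I. f i * (if i = a then x else 1) * (if i = b then y else 1))"
    using assms(5) by (rule prod.cong[OF refl])
  then show ?thesis using assms(1-3) by (simp add: prod.distrib)
qed

context mukade begin

definition coef_at :: "nat set \<Rightarrow> nat \<Rightarrow> complex" where
  "coef_at J i = om i * (gam ^ 2) ^ cnt J i"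

lemma coef_at_nz: "i \<le> N \<Longrightarrow> coef_at J i \<noteq> 0"
  using om_nz gam0 by (simp add: coef_at_def)

lemma coef_at_lat: "coef_at J i * x0 \<in> lat \<longleftrightarrow> om i * x0 \<in> lat"
proof
  have g: "(gam ^ 2) ^ c \<in> lat" for c by (intro lat_power lat_gam)
  show "coef_at J i * x0 \<in> lat" if "om i * x0 \<in> lat"
    using lat_mult[OF g that, of "cnt J i"] by (simp add: coef_at_def mult_ac)
  show "om i * x0 \<in> lat" if "coef_at J i * x0 \<in> lat"
    using lat_divide[OF that g, of "cnt J i"] gam0 by (simp add: coef_at_def)
qed

lemma phi_eq: "phi \<nu> J i x = spow (lo J i) (Suc i \<in> J) (Yf (\<nu> i) (coef_at J i * x))"
  by (simp add: phi_def coef_at_def)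

lemma Yf_scaled_limit:
  assumes "i \<le> N" "om i * x0 \<notin> lat"
  shows "((\<lambda>x. Yf lam (coef_at J i * x)) \<longlongrightarrow> Yf lam (coef_at J i * x0)) (at x0)" "Yf lam (coef_at J i * x0) \<noteq> 0"
proof -
  have off: "coef_at J i * x0 \<notin> lat" using assms(2) coef_at_lat by simp
  show "Yf lam (coef_at J i * x0) \<noteq> 0" by (rule Yf_off_lat(1)[OF off])
  show "((\<lambda>x. Yf lam (coef_at J i * x)) \<longlongrightarrow> Yf lam (coef_at J i * x0)) (at x0)"
    by (rule isCont_tendsto_compose[OF Yf_off_lat(2)[OF off]]) (intro tendsto_intros)
qed

lemma phi_limit_off:
  assumes "i \<le> N" "om i * x0 \<notin> lat"
  shows "\<exists>l. (phi \<nu> J i \<longlongrightarrow> l) (at x0)"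
  unfolding phi_eq[abs_def] spow_def
  using tendsto_inverse[OF Yf_scaled_limit[OF assms]] Yf_scaled_limit(1)[OF assms] tendsto_const[of 1 "at x0"]
  by (cases "lo J i"; cases "Suc i \<in> J") (simp_all, blast+)

lemma phi_limit_end:
  assumes "i \<le> N" "\<nu> i = []" "lo J i \<or> Suc i \<notin> J"
  shows "\<exists>l. (phi \<nu> J i \<longlongrightarrow> l) (at x0)"
proof -
  have "((\<lambda>x. Yf (\<nu> i) (coef_at J i * x)) \<longlongrightarrow> 1 - coef_at J i * x0) (at x0)"
    unfolding Yf_def assms(2) by (simp, intro tendsto_intros)
  then show ?thesis
    unfolding phi_eq[abs_def] spow_def
    using tendsto_const[of 1 "at x0"] assms(3)
    by (cases "lo J i"; cases "Suc i \<in> J") (simp_all, blast+)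
qed

lemma phi_limit_box:
  assumes i: "i \<le> N" and lam: "is_partition (\<nu> i)"
    and R: "\<And>R. lo J i \<Longrightarrow> Suc i \<notin> J \<Longrightarrow> removable (\<nu> i) R \<Longrightarrow> 1 - box_par R * (q / t * (coef_at J i * x0)) \<noteq> 0"
    and A: "\<And>A. \<not> lo J i \<Longrightarrow> Suc i \<in> J \<Longrightarrow> addable (\<nu> i) A \<Longrightarrow> 1 - box_par A * (coef_at J i * x0) \<noteq> 0"
  shows "\<exists>l. (phi \<nu> J i \<longlongrightarrow> l) (at x0)"
proof -
  note sc = filterlim_scale_at[OF coef_at_nz[OF i, of J], of x0]
  consider "lo J i = (Suc i \<in> J)" | "lo J i" "Suc i \<notin> J" | "\<not> lo J i" "Suc i \<in> J" by blast
  then show ?thesis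
  proof cases
    case 1
    then have "phi \<nu> J i = (\<lambda>x. 1)" by (simp add: phi_eq[abs_def] spow_def)
    then show ?thesis by auto
  next
    case 2
    obtain l where "(Yf (\<nu> i) \<longlongrightarrow> l) (at (coef_at J i * x0))" using Yf_limit[OF lam R[OF 2]] by blast
    from filterlim_compose[OF this sc] have "((\<lambda>x. Yf (\<nu> i) (coef_at J i * x)) \<longlongrightarrow> l) (at x0)" .
    moreover have "phi \<nu> J i = (\<lambda>x. Yf (\<nu> i) (coef_at J i * x))" using 2 by (auto simp: phi_eq[abs_def] spow_def)
    ultimately show ?thesis by auto
  next
    case 3
    obtain l where "((\<lambda>x. inverse (Yf (\<nu> i) x)) \<longlongrightarrow> l) (at (coef_at J i * x0))" using inverse_Yf_limit[OF lam A[OF 3]] by blast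
    from filterlim_compose[OF this sc] have "((\<lambda>x. inverse (Yf (\<nu> i) (coef_at J i * x))) \<longlongrightarrow> l) (at x0)" .
    moreover have "phi \<nu> J i = (\<lambda>x. inverse (Yf (\<nu> i) (coef_at J i * x)))" using 3 by (auto simp: phi_eq[abs_def] spow_def)
    ultimately show ?thesis by auto
  qed
qed

text \<open>
  The function of $x = 1/z$ whose expansion at 0 gives $(1-w/z)X\,T$ and whose expansion at
  infinity gives the other side of the relation, for one choice of indices and partitions.
\<close>
definition current_term :: "(nat \<times> nat) multiset \<Rightarrow> (nat \<times> nat) multiset \<Rightarrow> nat set \<times> (nat \<Rightarrow> nat list) \<Rightarrow> complex \<Rightarrow> complex" where
  "current_term M M' = (\<lambda>(J, \<nu>) x. (\<Prod>j\<in>J. v j) * T_weight \<nu> * (Phi \<nu> J x * wickX \<nu> J M M' x))"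

text \<open>
  The pairs that contribute to a fixed power of the bookkeeping variable. Moving an index from
  \<open>i + 1\<close> to \<open>i\<close> lowers the first sum by one and adding a box raises the second, so
  cancelling terms occur in the same power.
\<close>
definition confs :: "nat \<Rightarrow> nat \<Rightarrow> (nat set \<times> (nat \<Rightarrow> nat list)) set" where
  "confs k d = {(J, \<nu>). J \<subseteq> {1..N} \<and> card J = k \<and> (\<forall>i. is_partition (\<nu> i)) \<and> (\<forall>i. i \<notin> {1..<N} \<longrightarrow> \<nu> i = []) \<and>
     (\<Sum>j\<in>J. j - 1) + (\<Sum>i\<in>{1..<N}. sum_list (\<nu> i)) = d}"

lemma finite_confs: "finite (confs k d)"
proof (rule finite_subset)
  show "finite (Pow {1..N} \<times> (\<Union>e\<in>{..d}. configs N e))" using finite_configs by auto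
  show "confs k d \<subseteq> Pow {1..N} \<times> (\<Union>e\<in>{..d}. configs N e)" by (auto simp: confs_def configs_def)
qed

lemma isCont_wickX: "isCont (wickX \<nu> J M M') x"
proof -
  have "wickX \<nu> J M M' holomorphic_on UNIV" by (rule holomorphic_wick_el)
  then show ?thesis using holomorphic_on_imp_continuous_on continuous_on_eq_continuous_at by blast
qed

lemma regular_term:
  assumes "\<And>i. i \<le> N \<Longrightarrow> \<exists>l. (phi \<nu> J i \<longlongrightarrow> l) (at x0)" and x0: "x0 \<noteq> 0"
  shows "((\<lambda>x. (1 - x / x0) * current_term M M' (J, \<nu>) x) \<longlongrightarrow> 0) (at x0)"
proof -
  obtain l where l: "((\<lambda>x. \<Prod>i\<le>N. phi \<nu> J i x) \<longlongrightarrow> l) (at x0)"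
    using tendsto_prod_exists[of "{..N}" "phi \<nu> J" "at x0"] assms(1) by auto
  have "(wickX \<nu> J M M' \<longlongrightarrow> wickX \<nu> J M M' x0) (at x0)" using isCont_wickX by (simp add: isCont_def)
  then have "((\<lambda>x. (1 - x / x0) * current_term M M' (J, \<nu>) x) \<longlongrightarrow>
      (1 - x0 / x0) * ((\<Prod>j\<in>J. v j) * T_weight \<nu> * (l * wickX \<nu> J M M' x0))) (at x0)"
    unfolding current_term_def prod.case Phi_def using x0 by (intro tendsto_intros l) auto
  then show ?thesis using x0 by simp
qed

section \<open>Coincidence of normal-ordered operators at a pole\<close>

lemma box_power_sum_add_box:
  assumes "is_partition lam" "addable lam (r, c)"
  shows "yps (add_box lam (r, c)) k = yps lam k - (1 - t powi (- k)) * (1 - q powi k) * box_par (r, c) powi k"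
  unfolding yps_def box_power_sum_def add_box(3)[OF assms] using add_box(4)[OF assms] by (simp add: algebra_simps)

text \<open>
  At the pole the change of the current under $i+1 \mapsto i$ compensates the change
  that the added box makes in the two vertices carrying $\nu^{(i)}$, those at the sites \<open>i\<close> and
  \<open>i + 1\<close>. So the residues of the two terms are multiples of the same operator.
\<close>
lemma wick_coincidence:
  assumes J: "J \<subseteq> {1..N}" and i: "i \<in> {1..<N}" "i \<notin> J" "Suc i \<in> J"
    and lam: "is_partition (\<nu> i)" and A: "addable (\<nu> i) (r, c)"
    and x0: "box_par (r, c) * (coef_at J i * x0) = 1"
    and M: "M \<in> fock_basis N" "M' \<in> fock_basis N"
  shows "wickX (\<nu>(i := add_box (\<nu> i) (r, c))) (insert i (J - {Suc i})) M M' x0 = wickX \<nu> J M M' x0"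
proof -
  let ?J = "insert i (J - {Suc i})" and ?\<nu> = "\<nu>(i := add_box (\<nu> i) (r, c))"
  have fin: "finite J" using J finite_subset by blast
  have J': "?J \<subseteq> {1..N}" using J i by auto
  have x0nz: "x0 \<noteq> 0" using x0 by auto
  have cS: "cnt J (Suc i) = Suc (cnt J i)" using cnt_Suc[OF fin, of i] i by simp
  have ci: "cnt J (i - 1) = cnt J i" using cnt_Suc[OF fin, of "i - 1"] i by simp
  have cmv: "cnt ?J k = (if k = i then Suc (cnt J i) else cnt J k)" for k by (rule cnt_move[OF fin i(2,3)])
  have c1: "cnt ?J (j - 1) = cnt J (j - 1)" if "j \<in> J - {Suc i}" for j
    using that i cmv[of "j - 1"] by (cases j) auto
  have labels: "LamC (js ?J) (j, n) + VC ?\<nu> (j, n) * x0 ^ n = LamC (js J) (j, n) + VC \<nu> (j, n) * x0 ^ n"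
    "LamA (js ?J) (j, n) * x0 ^ n + VA ?\<nu> (j, n) = LamA (js J) (j, n) * x0 ^ n + VA \<nu> (j, n)"
    if j: "j \<in> {1..N}" and n: "n \<ge> 1" for j n
  proof -
    let ?g = "(gam ^ n) ^ 2" and ?G = "\<lambda>j. (gam ^ (j - 1)) ^ n" and ?l = "cnt J i"
    let ?cl = "(1 - inverse t ^ n) / of_nat n"
    have nz: "1 - q ^ n \<noteq> 0" "1 - t ^ n \<noteq> 0" "of_nat n \<noteq> (0::complex)" "q ^ n \<noteq> 0" "?g \<noteq> 0" "gam ^ n \<noteq> 0"
      using one_minus_q_pow[OF n] one_minus_t_pow[OF n] n q0 t0 gam0 by auto
    have GS: "?G (Suc i) = ?G i * gam ^ n" using i by (simp add: power_mult_distrib[symmetric] power_Suc2[symmetric] del: power_Suc)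
    define X where "X = (box_par (r, c) * om i) ^ n"
    have X: "X * x0 ^ n = inverse (?g ^ ?l)"
    proof -
      have "(box_par (r, c) * (coef_at J i * x0)) ^ n = 1" using x0 by simp
      then have "X * x0 ^ n * ?g ^ ?l = 1" unfolding X_def coef_at_def power_mult_distrib gam_pow_swap by (simp add: mult_ac)
      then show ?thesis using nz by (simp add: field_simps)
    qed
    have X0: "X \<noteq> 0" unfolding X_def using om_nz[of i] i by simp
    have Xi: "x0 ^ n * ?g ^ ?l = inverse X" using X X0 nz x0nz by (simp add: field_simps)
    have PSn: "PS ?\<nu> i n = PS \<nu> i n - (1 - inverse t ^ n) * (1 - q ^ n) * X"
      by (simp add: PS_def box_power_sum_add_box[OF lam A] X_def power_mult_distrib algebra_simps power_int_minus power_inverse)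
    have PSm: "PS ?\<nu> i (- int n) = PS \<nu> i (- int n) - (1 - t ^ n) * (1 - inverse q ^ n) * inverse X"
      by (simp add: PS_def box_power_sum_add_box[OF lam A] X_def power_mult_distrib algebra_simps power_int_minus power_inverse)
    have PSo: "PS ?\<nu> k m = PS \<nu> k m" if "k \<noteq> i" for k m using that by (simp add: PS_def)
    let ?e = "\<lambda>i j. if j < i then 1 - ?g else if j = i then 1 else (0::complex)"
    let ?T = "\<lambda>J i. inverse (?g ^ cnt J (i - 1)) * ?e i j"
    have im: "i - 1 \<noteq> i" using i by auto
    then have c': "cnt ?J (i - 1) = ?l" using cmv[of "i - 1"] ci by simp
    have cSi: "cnt J (Suc i - 1) = ?l" by simp
    have "(\<Sum>k\<in>?J. ?T ?J k) = ?T ?J i + (\<Sum>k\<in>J - {Suc i}. ?T ?J k)"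
      using fin i by simp
    also have "(\<Sum>k\<in>J - {Suc i}. ?T ?J k) = (\<Sum>k\<in>J - {Suc i}. ?T J k)"
    proof (rule sum.cong[OF refl])
      fix k assume k: "k \<in> J - {Suc i}"
      show "?T ?J k = ?T J k" unfolding c1[OF k] ..
    qed
    also have "\<dots> = (\<Sum>k\<in>J. ?T J k) - ?T J (Suc i)" using fin i by (simp add: sum_diff1)
    finally have S: "(\<Sum>k\<in>?J. ?T ?J k) = (\<Sum>k\<in>J. ?T J k) + inverse (?g ^ ?l) * (?e i j - ?e (Suc i) j)"
      unfolding c' cSi by (simp only: algebra_simps)
    show "LamC (js ?J) (j, n) + VC ?\<nu> (j, n) * x0 ^ n = LamC (js J) (j, n) + VC \<nu> (j, n) * x0 ^ n"
    proof -
      have L: "LamC (js ?J) (j, n) = LamC (js J) (j, n) + ?cl * ?G j * (inverse (?g ^ ?l) * (?e i j - ?e (Suc i) j))"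
        unfolding LamC_eq[OF J] LamC_eq[OF J'] S by (simp add: algebra_simps)
      have e: "(a + b * (inverse (?g ^ ?l) * - d)) + (y + b * d * X) * x0 ^ n = a + y * x0 ^ n" for a b d y
        unfolding X[symmetric] by (simp add: algebra_simps)
      consider "j = i" | "j = Suc i" | "j \<noteq> i" "j \<noteq> Suc i" by blast
      then show ?thesis
      proof cases
        case 1
        have V: "VC ?\<nu> (j, n) = VC \<nu> (j, n) + ?cl * ?G j * - ?g * X"
          unfolding 1 VC_eq[OF j[unfolded 1] n] PSn PSo[OF im] using nz by (simp add: divide_simps) (simp add: algebra_simps)
        have D: "?e i j - ?e (Suc i) j = - (- ?g)" using 1 by simp
        show ?thesis unfolding L D V by (rule e)
      next
        case 2
        have V: "VC ?\<nu> (j, n) = VC \<nu> (j, n) + ?cl * ?G j * 1 * X"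
          unfolding 2 VC_eq[OF j[unfolded 2] n] diff_Suc_1 PSn using nz PSo[of "Suc i"] by (simp add: divide_simps) (simp add: algebra_simps)
        have D: "?e i j - ?e (Suc i) j = - 1" using 2 by simp
        show ?thesis unfolding L D V by (rule e)
      next
        case 3
        then have "j - 1 \<noteq> i" using j by auto
        then have "VC ?\<nu> (j, n) = VC \<nu> (j, n)" unfolding VC_eq[OF j n] using 3 PSo by simp
        moreover have "?e i j - ?e (Suc i) j = 0" using 3 by auto
        ultimately show ?thesis unfolding L by simp
      qed
    qed
    show "LamA (js ?J) (j, n) * x0 ^ n + VA ?\<nu> (j, n) = LamA (js J) (j, n) * x0 ^ n + VA \<nu> (j, n)"
    proof -
      have "a - (- Q) * b * d / (G * (m * Q)) = a + b / m * d / G" "a + (- Q) * b * d / (G * (m * Q)) = a - b / m * d / G"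
        if "Q \<noteq> 0" "m \<noteq> 0" "G \<noteq> 0" for Q m G a b d :: complex
        using that by (simp_all add: field_simps)
      note this[OF nz(1,3)]
      then have e1: "a - (- (1 - q ^ n)) * b * d / (?G j * (of_nat n * (1 - q ^ n))) = a + b / of_nat n * d / ?G j"
        and e2: "a + (- (1 - q ^ n)) * b * d / (?G j * (of_nat n * (1 - q ^ n))) = a - b / of_nat n * d / ?G j" for a b d j
        using gam0 by simp_all
      have qq: "q ^ n * (1 - inverse q ^ n) = - (1 - q ^ n)" using nz by (simp add: field_simps power_inverse)
      consider "j = i" | "j = Suc i" | "j \<noteq> i" "j \<noteq> Suc i" by blast
      then show ?thesis
      proof cases
        case 1
        have "VA ?\<nu> (i, n) = VA \<nu> (i, n) - (q ^ n * (1 - inverse q ^ n)) * (1 - t ^ n) * inverse X / (?G i * (of_nat n * (1 - q ^ n)))"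
          unfolding VA_eq[OF j[unfolded 1] n] PSm PSo[OF im] by (simp add: diff_divide_distrib right_diff_distrib mult_ac)
        also have "\<dots> = VA \<nu> (i, n) + (1 - t ^ n) / of_nat n * inverse X / ?G i"
          unfolding qq by (rule e1)
        finally have V: "VA ?\<nu> (i, n) = VA \<nu> (i, n) + (1 - t ^ n) / of_nat n * (x0 ^ n * ?g ^ ?l) / ?G i" unfolding Xi .
        show ?thesis unfolding 1 V LamA_eq[OF J] LamA_eq[OF J'] using i c' by simp
      next
        case 2
        have "VA ?\<nu> (Suc i, n) = VA \<nu> (Suc i, n) + (q ^ n * (1 - inverse q ^ n)) * (1 - t ^ n) * inverse X / (?G (Suc i) * (of_nat n * (1 - q ^ n)))"
          unfolding VA_eq[OF j[unfolded 2] n] diff_Suc_1 PSm using PSo[of "Suc i"] by (simp add: diff_divide_distrib right_diff_distrib add_divide_distrib distrib_left mult_ac)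
        also have "\<dots> = VA \<nu> (Suc i, n) - (1 - t ^ n) / of_nat n * inverse X / ?G (Suc i)"
          unfolding qq by (rule e2)
        finally have V: "VA ?\<nu> (Suc i, n) = VA \<nu> (Suc i, n) - (1 - t ^ n) / of_nat n * (x0 ^ n * ?g ^ ?l) / ?G (Suc i)" unfolding Xi .
        show ?thesis unfolding 2 V LamA_eq[OF J] LamA_eq[OF J'] using i by simp
      next
        case 3
        then have ji: "j - 1 \<noteq> i" using j by auto
        then have V: "VA ?\<nu> (j, n) = VA \<nu> (j, n)" unfolding VA_eq[OF j n] using 3 PSo by simp
        have "j \<in> ?J \<longleftrightarrow> j \<in> J" "cnt ?J (j - 1) = cnt J (j - 1)" using 3 ji cmv by auto
        then show ?thesis unfolding V LamA_eq[OF J] LamA_eq[OF J'] by simp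
      qed
    qed
  qed
  show ?thesis unfolding wick_el_def
  proof (rule prod.cong[OF refl])
    fix k assume "k \<in> set_mset M \<union> set_mset M'"
    then have "k \<in> {1..N} \<times> {1..}" using M by (auto simp: fock_basis_def)
    then obtain j n where k: "k = (j, n)" "j \<in> {1..N}" "n \<ge> 1" by auto
    have B: "kapN k * LamA (js J) k * x0 ^ snd k + kapN k * VA \<nu> k = kapN k * (LamA (js J) k * x0 ^ snd k + VA \<nu> k)" for J \<nu>
      by (simp add: algebra_simps)
    show "gmel (LamC (js ?J) k + VC ?\<nu> k * x0 ^ snd k) (kapN k * LamA (js ?J) k * x0 ^ snd k + kapN k * VA ?\<nu> k) (x0 ^ snd k) (count M k) (count M' k) =
      gmel (LamC (js J) k + VC \<nu> k * x0 ^ snd k) (kapN k * LamA (js J) k * x0 ^ snd k + kapN k * VA \<nu> k) (x0 ^ snd k) (count M k) (count M' k)"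
      unfolding B using labels[OF k(2,3)] by (simp add: k(1))
  qed
qed

end

context generic_qt begin

section \<open>Cancellation of a pair of poles\<close>

text \<open>
  The value \<open>x0\<close> makes the factor of the addable box vanish. Without the box the inverse of
  \<open>Yf\<close> has a simple pole there; with the box the shifted \<open>Yf\<close> does.
\<close>
lemma corner_limits:
  assumes lam: "is_partition lam" and A: "addable lam (r, c)" and x0: "box_par (r, c) * (\<kappa> * x0) = 1"
  shows "((\<lambda>x. (1 - x / x0) * inverse (Yf lam (\<kappa> * x))) \<longlongrightarrow>
      inverse (corner_prod lam (r, c) (mon (1 - int c) (int r - 1)))) (at x0)"
    and "((\<lambda>x. (1 - x / x0) * Yf (add_box lam (r, c)) (gam ^ 2 * \<kappa> * x)) \<longlongrightarrow>
      corner_prod lam (r, c) (mon (- int c) (int r)) * ((1 - 1 / q) * (1 - t))) (at x0)"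
proof -
  let ?\<chi> = "box_par (r, c)"
  have nz: "\<kappa> \<noteq> 0" "x0 \<noteq> 0" using x0 by auto
  have r: "1 \<le> r" "1 \<le> c" using A by (auto simp: addable_def)
  have chi: "?\<chi> = mon (int c - 1) (1 - int r)" using box_par_mon[of r c] r by blast
  have k0: "\<kappa> * x0 = mon (1 - int c) (int r - 1)"
  proof -
    have "\<kappa> * x0 = inverse ?\<chi>" using x0 by (simp add: field_simps)
    then show ?thesis unfolding chi mon_minus[symmetric] by simp
  qed
  have g0: "gam ^ 2 * \<kappa> * x0 = mon (- int c) (int r)"
  proof -
    have "gam ^ 2 = mon (- 1) 1" by (simp add: gam2 mon_def divide_inverse power_int_minus)
    then show ?thesis unfolding mult.assoc k0 by (simp add: mon_mult)
  qed
  have ne: "\<forall>\<^sub>F x in at x0. x \<noteq> x0" by (simp add: eventually_at_filter)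
  have xk: "x / x0 = ?\<chi> * (\<kappa> * x)" for x
  proof -
    have "?\<chi> * \<kappa> = 1 / x0" using x0 nz by (simp add: field_simps)
    then show ?thesis by (simp add: mult.assoc[symmetric])
  qed
  note reg = corner_prod_regular[OF lam A]
  have lim: "((\<lambda>x. corner_prod lam (r, c) (k * x)) \<longlongrightarrow> corner_prod lam (r, c) (k * x0)) (at x0)"
    if "isCont (corner_prod lam (r, c)) (k * x0)" for k
    by (rule isCont_tendsto_compose[OF that]) (intro tendsto_intros)
  have ev: "\<forall>\<^sub>F x in at x0. Yf lam (k * x) = (1 - ?\<chi> * (k * x)) * corner_prod lam (r, c) (k * x)" if "k \<noteq> 0" for k
    using eventually_compose_filterlim[OF eventually_Yf_corner[OF lam A] filterlim_scale_at[OF that]] .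
  show "((\<lambda>x. (1 - x / x0) * inverse (Yf lam (\<kappa> * x))) \<longlongrightarrow> inverse (corner_prod lam (r, c) (mon (1 - int c) (int r - 1)))) (at x0)"
  proof (rule Lim_transform_eventually)
    show "((\<lambda>x. inverse (corner_prod lam (r, c) (\<kappa> * x))) \<longlongrightarrow> inverse (corner_prod lam (r, c) (mon (1 - int c) (int r - 1)))) (at x0)"
      using lim[of \<kappa>] reg[of "\<kappa> * x0"] unfolding k0 by (intro tendsto_inverse) auto
    show "\<forall>\<^sub>F x in at x0. inverse (corner_prod lam (r, c) (\<kappa> * x)) = (1 - x / x0) * inverse (Yf lam (\<kappa> * x))"
      using ev[OF nz(1)] ne
    proof eventually_elim
      case (elim x)
      then have "1 - x / x0 \<noteq> 0" using nz by simp
      then show ?case using elim by (simp add: xk)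
    qed
  qed
  let ?s = "\<lambda>x. t / q * (x / x0)"
  have gnz: "gam ^ 2 * \<kappa> \<noteq> 0" using gam0 nz by simp
  have s1: "\<forall>\<^sub>F x in at x0. 1 - ?s x \<noteq> 0"
    using eventually_linear_nz[of "t / q / x0" x0] q0 t0 nz by simp
  show "((\<lambda>x. (1 - x / x0) * Yf (add_box lam (r, c)) (gam ^ 2 * \<kappa> * x)) \<longlongrightarrow>
      corner_prod lam (r, c) (mon (- int c) (int r)) * ((1 - 1 / q) * (1 - t))) (at x0)"
  proof (rule Lim_transform_eventually)
    have "((\<lambda>x. corner_prod lam (r, c) (gam ^ 2 * \<kappa> * x) * ((1 - ?s x / t) * (1 - q * ?s x))) \<longlongrightarrow>
      corner_prod lam (r, c) (gam ^ 2 * \<kappa> * x0) * ((1 - ?s x0 / t) * (1 - q * ?s x0))) (at x0)"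
      using reg[of "gam ^ 2 * \<kappa> * x0"] g0 nz t0 by (intro tendsto_intros lim) auto
    then show "((\<lambda>x. corner_prod lam (r, c) (gam ^ 2 * \<kappa> * x) * ((1 - ?s x / t) * (1 - q * ?s x))) \<longlongrightarrow>
      corner_prod lam (r, c) (mon (- int c) (int r)) * ((1 - 1 / q) * (1 - t))) (at x0)"
      unfolding g0 using nz q0 t0 by simp
    show "\<forall>\<^sub>F x in at x0. corner_prod lam (r, c) (gam ^ 2 * \<kappa> * x) * ((1 - ?s x / t) * (1 - q * ?s x)) =
      (1 - x / x0) * Yf (add_box lam (r, c)) (gam ^ 2 * \<kappa> * x)"
      using ev[OF gnz] ne s1
    proof eventually_elim
      case (elim x)
      have e1: "1 - x / x0 \<noteq> 0" using elim nz by simp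
      have s: "?\<chi> * (gam ^ 2 * \<kappa> * x) = ?s x" unfolding xk gam2 by simp
      have "q * ?s x / t = x / x0" using q0 t0 by simp
      then have g: "gbox (?s x) = ((1 - ?s x / t) * (1 - q * ?s x)) / ((1 - ?s x) * (1 - x / x0))"
        unfolding gbox_def by simp
      have "Yf (add_box lam (r, c)) (gam ^ 2 * \<kappa> * x) = Yf lam (gam ^ 2 * \<kappa> * x) * gbox (?s x)"
        unfolding Yf_def add_box(3)[OF lam A] using add_box(4)[OF lam A] by (simp add: s)
      also have "\<dots> = (1 - ?s x) * corner_prod lam (r, c) (gam ^ 2 * \<kappa> * x) *
          (((1 - ?s x / t) * (1 - q * ?s x)) / ((1 - ?s x) * (1 - x / x0)))"
        unfolding elim(1) s g ..
      finally have Y: "Yf (add_box lam (r, c)) (gam ^ 2 * \<kappa> * x) = \<dots>" .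
      have "d * e = b * (a * d * (e / (a * b)))" if "a \<noteq> 0" "b \<noteq> 0" for a b d e :: complex
        using that by simp
      from this[OF elim(3) e1] show ?case unfolding Y .
    qed
  qed
qed

end

context mukade begin

text \<open>
  The two terms differ in the factors at site \<open>i\<close>, which have the pole, in the factors of the
  neighbouring sites, and in the weights. The neighbouring factors of the rational function are
  compensated at \<open>x0\<close> by the change of the contraction factors in \<open>T_weight\<close>; then
  \<open>residue_cancellation\<close> and \<open>wick_coincidence\<close> apply.
\<close>
lemma pole_pair:
  assumes J: "J \<subseteq> {1..N}" and i: "i \<in> {1..<N}" "i \<notin> J" "Suc i \<in> J"
    and \<nu>: "is_partition (\<nu> i)" and A: "addable (\<nu> i) (r, c)"
    and x0: "box_par (r, c) * (coef_at J i * x0) = 1"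
    and off: "\<And>k. k \<le> N \<Longrightarrow> k \<noteq> i \<Longrightarrow> om k * x0 \<notin> lat"
    and M: "M \<in> fock_basis N" "M' \<in> fock_basis N"
  shows "((\<lambda>x. (1 - x / x0) * (current_term M M' (J, \<nu>) x +
      current_term M M' (insert i (J - {Suc i}), \<nu>(i := add_box (\<nu> i) (r, c))) x)) \<longlongrightarrow> 0) (at x0)"
proof -
  let ?J = "insert i (J - {Suc i})" and ?\<nu> = "\<nu>(i := add_box (\<nu> i) (r, c))"
  let ?a = "i - 1" and ?b = "Suc i" and ?\<chi> = "box_par (r, c)" and ?k = "coef_at J i"
  have fin: "finite J" using J finite_subset by blast
  have iN: "i \<in> {1..N}" "?b \<in> {1..N}" "?a \<le> N" "?b \<le> N" "?a \<noteq> i" "Suc ?a = i" using i by auto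
  have x0nz: "x0 \<noteq> 0" using x0 by auto
  have cS: "cnt J ?b = Suc (cnt J i)" using cnt_Suc[OF fin, of i] i by simp
  have ca: "cnt J ?a = cnt J i" using cnt_Suc[OF fin, of ?a] i by simp
  have cmv: "coef_at ?J k = (if k = i then gam ^ 2 * coef_at J i else coef_at J k)" for k
    unfolding coef_at_def cnt_move[OF fin i(2,3)] by simp
  define C where "C x = (\<Prod>k\<in>{..N} - {i}. phi \<nu> J k x)" for x
  define Ym where "Ym x = Yf (\<nu> ?a) (coef_at J ?a * x)" for x
  define Yp where "Yp x = Yf (\<nu> ?b) (coef_at J ?b * x)" for x
  have "\<exists>l. (C \<longlongrightarrow> l) (at x0)"
    unfolding C_def[abs_def] using phi_limit_off off by (intro tendsto_prod_exists) auto
  then obtain C0 where C0: "(C \<longlongrightarrow> C0) (at x0)" by (rule exE)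
  have Ym: "(Ym \<longlongrightarrow> Ym x0) (at x0)" "Ym x0 \<noteq> 0"
    unfolding Ym_def[abs_def] by (rule Yf_scaled_limit[OF iN(3) off[OF iN(3,5)]])+
  have Yp: "(Yp \<longlongrightarrow> Yp x0) (at x0)" "Yp x0 \<noteq> 0"
    unfolding Yp_def[abs_def] using Yf_scaled_limit[OF iN(4) off[OF iN(4)]] by simp_all
  have P1: "Phi \<nu> J x = inverse (Yf (\<nu> i) (?k * x)) * C x" for x
  proof -
    have "Phi \<nu> J x = phi \<nu> J i x * C x" unfolding Phi_def C_def by (rule prod.remove) (use iN in auto)
    moreover have "phi \<nu> J i x = inverse (Yf (\<nu> i) (?k * x))" using i by (simp add: phi_eq spow_def)
    ultimately show ?thesis by simp
  qed
  have P2: "Phi ?\<nu> ?J x = Yf (add_box (\<nu> i) (r, c)) (gam ^ 2 * ?k * x) * (C x * inverse (Ym x) * inverse (Yp x))"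
    if nz: "Ym x \<noteq> 0" "Yp x \<noteq> 0" for x
  proof -
    have "Phi ?\<nu> ?J x = phi ?\<nu> ?J i x * (\<Prod>k\<in>{..N} - {i}. phi ?\<nu> ?J k x)" unfolding Phi_def by (rule prod.remove) (use iN in auto)
    moreover have "phi ?\<nu> ?J i x = Yf (add_box (\<nu> i) (r, c)) (gam ^ 2 * ?k * x)" using i by (simp add: phi_eq spow_def cmv)
    moreover have "(\<Prod>k\<in>{..N} - {i}. phi ?\<nu> ?J k x) = C x * inverse (Ym x) * inverse (Yp x)"
      unfolding C_def
    proof (rule prod_two_changes[of _ ?a ?b])
      fix k assume k: "k \<in> {..N} - {i}"
      have sL: "spow e True y = spow e False y * inverse y" and sR: "spow False e y = spow True e y * inverse y" if "y \<noteq> 0" for e y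
        using that by (auto simp: spow_def)
      consider "k = ?a" | "k = ?b" | "k \<noteq> ?a" "k \<noteq> ?b" by blast
      then show "phi ?\<nu> ?J k x = phi \<nu> J k x * (if k = ?a then inverse (Ym x) else 1) * (if k = ?b then inverse (Yp x) else 1)"
      proof cases
        case 1
        have "lo ?J ?a = lo J ?a" "Suc ?a \<in> ?J" "Suc ?a \<notin> J" "?a \<noteq> ?b" using iN i by auto
        then show ?thesis using sL[OF nz(1), of "lo J ?a"] iN unfolding 1 phi_eq by (simp add: cmv Ym_def)
      next
        case 2
        have "lo ?J ?b = False" "lo J ?b = True" "Suc ?b \<in> ?J \<longleftrightarrow> Suc ?b \<in> J" "?a \<noteq> ?b" using i by auto
        then show ?thesis using sR[OF nz(2), of "Suc ?b \<in> J"] iN unfolding 2 phi_eq by (simp add: cmv Yp_def)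
      next
        case 3
        then have "lo ?J k = lo J k" "Suc k \<in> ?J \<longleftrightarrow> Suc k \<in> J" "k \<noteq> i" using k i by auto
        then show ?thesis using 3 unfolding phi_eq by (simp add: cmv)
      qed
    qed (use iN in auto)
    ultimately show ?thesis by simp
  qed
  define S0 where "S0 = (\<Prod>k\<in>{1..<N} - {i}. site_weight (\<nu> k) (u (Suc k)) (v k))"
  define K where "K = (\<Prod>j\<in>{1..N}. contr_ratio (\<nu> j) (\<nu> (j - 1)) (v j / u j))"
  define V0 where "V0 = (\<Prod>j\<in>J - {Suc i}. v j)"
  let ?z = "?\<chi> * v ?b / (gam * u ?b)"
  let ?w = "site_weight (\<nu> i) (u ?b) (v i)" and ?w' = "site_weight (add_box (\<nu> i) (r, c)) (u ?b) (v i)"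
  have uv: "u i \<noteq> 0" "v i \<noteq> 0" "u ?b \<noteq> 0" "v ?b \<noteq> 0" using uv0 iN by auto
  have kx: "?k * x0 = inverse ?\<chi>" using x0 by (simp add: field_simps)
  have T1: "T_weight \<nu> = ?w * S0 * K"
    unfolding T_weight_def K_def S0_def by (subst prod.remove[of _ i]) (use i in auto)
  have T2: "T_weight ?\<nu> = ?w' * S0 * (K * Ym x0 * (- ?z * Yp x0))"
  proof -
    have "(\<Prod>k\<in>{1..<N}. site_weight (?\<nu> k) (u (Suc k)) (v k)) = ?w' * S0"
      unfolding S0_def by (subst prod.remove[of _ i]) (use i in \<open>auto intro!: prod.cong\<close>)
    moreover have "(\<Prod>j\<in>{1..N}. contr_ratio (?\<nu> j) (?\<nu> (j - 1)) (v j / u j)) = K * Ym x0 * (- ?z * Yp x0)"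
      unfolding K_def
    proof (rule prod_two_changes[of _ i ?b])
      fix j assume j: "j \<in> {1..N}"
      consider "j = i" | "j = ?b" | "j \<noteq> i" "j \<noteq> ?b" by blast
      then show "contr_ratio (?\<nu> j) (?\<nu> (j - 1)) (v j / u j) = contr_ratio (\<nu> j) (\<nu> (j - 1)) (v j / u j) *
          (if j = i then Ym x0 else 1) * (if j = ?b then - ?z * Yp x0 else 1)"
      proof cases
        case 1
        have "om i = u i / v i * inverse gam * om ?a" by (rule om_step[OF iN(1)])
        then have "om ?a = gam * (v i / u i) * om i" using uv gam0 by simp
        then have "coef_at J ?a * x0 = gam * (v i / u i) * (?k * x0)" by (simp only: coef_at_def ca mult_ac)
        then have "gam * (v i / u i) / ?\<chi> = coef_at J ?a * x0" unfolding kx by (simp add: divide_inverse)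
        then show ?thesis using contr_ratio_add_left[OF \<nu> A, of "\<nu> ?a" "v i / u i"] iN unfolding 1 Ym_def by simp
      next
        case 2
        have gg: "gam ^ 2 * inverse gam = gam" using gam0 by (simp add: power2_eq_square)
        have "coef_at J ?b * x0 = u ?b / v ?b * (gam ^ 2 * inverse gam) * (?k * x0)"
          unfolding coef_at_def cS om_Suc power_Suc by (simp only: mult_ac)
        then have "coef_at J ?b * x0 = inverse ?z" unfolding kx gg using uv gam0 by (simp add: field_simps)
        moreover have "?z \<noteq> 0" using uv gam0 by simp
        ultimately have "Yt (\<nu> ?b) ?z = - ?z * Yp x0" using Yf_inversion[of ?z "\<nu> ?b"] unfolding Yp_def by simp
        moreover have "?\<chi> * (v ?b / u ?b) / gam = ?z" by simp
        ultimately have "Yt (\<nu> ?b) (?\<chi> * (v ?b / u ?b) / gam) = - ?z * Yp x0" by (simp only:)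
        then show ?thesis using contr_ratio_add_right[OF \<nu> A, of "\<nu> ?b" "v ?b / u ?b"] unfolding 2 by simp
      next
        case 3
        then have "j - 1 \<noteq> i" using j by auto
        then show ?thesis using 3 by simp
      qed
    qed (use iN in auto)
    ultimately show ?thesis unfolding T_weight_def by simp
  qed
  have V1: "(\<Prod>j\<in>J. v j) = v ?b * V0" unfolding V0_def by (rule prod.remove) (use fin i in auto)
  have V2: "(\<Prod>j\<in>?J. v j) = v i * V0" unfolding V0_def by (rule prod.insert) (use fin i in auto)
  note lims = corner_limits[OF \<nu> A x0]
  let ?c1 = "corner_prod (\<nu> i) (r, c) (mon (1 - int c) (int r - 1))"
  let ?c2 = "corner_prod (\<nu> i) (r, c) (mon (- int c) (int r)) * ((1 - 1 / q) * (1 - t))"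
  define W1 where "W1 = wickX \<nu> J M M'"
  define W2 where "W2 = wickX ?\<nu> ?J M M'"
  have W: "(W1 \<longlongrightarrow> W1 x0) (at x0)" "(W2 \<longlongrightarrow> W2 x0) (at x0)"
    unfolding W1_def W2_def using isCont_wickX by (simp_all add: isCont_def)
  have W12: "W2 x0 = W1 x0" unfolding W1_def W2_def by (rule wick_coincidence[where \<nu> = \<nu>, OF J i \<nu> A x0 M])
  let ?F = "\<lambda>x. v ?b * V0 * (?w * S0 * K) * (((1 - x / x0) * inverse (Yf (\<nu> i) (?k * x))) * C x * W1 x) +
     v i * V0 * (?w' * S0 * (K * Ym x0 * (- ?z * Yp x0))) *
       (((1 - x / x0) * Yf (add_box (\<nu> i) (r, c)) (gam ^ 2 * ?k * x)) * (C x * inverse (Ym x) * inverse (Yp x)) * W2 x)"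
  have L: "(?F \<longlongrightarrow> v ?b * V0 * (?w * S0 * K) * (inverse ?c1 * C0 * W1 x0) +
     v i * V0 * (?w' * S0 * (K * Ym x0 * (- ?z * Yp x0))) * (?c2 * (C0 * inverse (Ym x0) * inverse (Yp x0)) * W2 x0)) (at x0)"
    by (intro tendsto_add tendsto_mult tendsto_const lims C0 W tendsto_inverse Ym Yp)
  have res: "v ?b * ?w / ?c1 + v i * ?w' * (- ?z) * ?c2 = 0"
    using residue_cancellation[OF \<nu> A uv(3) uv(2), of "v ?b"] .
  have "b * V * (w * S * k) * (inverse c1 * D * W) + a * V * (w' * S * (k * m * (mz * p))) * (c2 * (D * inverse m * inverse p) * W) =
     V * S * k * D * W * (b * w / c1 + a * w' * mz * c2)" if "m \<noteq> 0" "p \<noteq> 0" for a b V w w' S k c1 D W m p mz c2 :: complex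
  proof -
    have "a * V * (w' * S * (k * m * (mz * p))) * (c2 * (D * inverse m * inverse p) * W) =
      a * V * (w' * S * (k * mz)) * (c2 * D * W) * (m * inverse m) * (p * inverse p)" by (simp only: mult_ac)
    also have "\<dots> = a * V * (w' * S * (k * mz)) * (c2 * D * W)" using that by simp
    finally show ?thesis by (simp add: divide_inverse algebra_simps)
  qed
  note e = this[OF Ym(2) Yp(2), of "v ?b" V0 ?w S0 K ?c1 C0 "W1 x0" "v i" ?w' "- ?z" ?c2]
  have "(?F \<longlongrightarrow> 0) (at x0)" using L unfolding W12 e res mult_zero_right .
  then show ?thesis
  proof (rule Lim_transform_eventually)
    show "\<forall>\<^sub>F x in at x0. ?F x = (1 - x / x0) * (current_term M M' (J, \<nu>) x + current_term M M' (?J, ?\<nu>) x)"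
      using tendsto_imp_eventually_ne[OF Ym] tendsto_imp_eventually_ne[OF Yp]
    proof eventually_elim
      case (elim x)
      have "b * (e * y * D * W) + b' * (e * y' * D' * W') = e * (b * (y * D * W) + b' * (y' * D' * W'))" for b e y D W b' y' D' W' :: complex
        by (simp add: algebra_simps)
      then show ?case unfolding current_term_def prod.case V1 V2 T1 T2 P1 P2[OF elim] W1_def W2_def by (simp only:)
    qed
  qed
qed

end

section \<open>Regularity of the sum\<close>

lemma remove_sings_analytic_lim:
  fixes f :: "complex \<Rightarrow> complex"
  assumes iso: "isolated_singularity_at f x0" and x0: "x0 \<noteq> 0" and lim: "((\<lambda>x. (1 - x / x0) * f x) \<longlongrightarrow> 0) (at x0)"
  shows "remove_sings f analytic_on {x0}"
proof -
  from iso obtain r where r: "r > 0" "f analytic_on ball x0 r - {x0}" unfolding isolated_singularity_at_def by blast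
  have "((\<lambda>x. - x0 * ((1 - x / x0) * f x)) \<longlongrightarrow> - x0 * 0) (at x0)" by (intro tendsto_mult tendsto_const lim)
  moreover have "(\<lambda>x. - x0 * ((1 - x / x0) * f x)) = (\<lambda>x. (x - x0) * f x)" using x0 by (simp add: fun_eq_iff field_simps)
  ultimately have l: "((\<lambda>x. (x - x0) * f x) \<longlongrightarrow> 0) (at x0)" by simp
  have hol: "f holomorphic_on ball x0 r - {x0}" by (rule analytic_imp_holomorphic[OF r(2)])
  have int: "x0 \<in> interior (ball x0 r)" using r(1) by simp
  from holomorphic_on_extend_lim[OF hol int] l
  obtain g where g: "g holomorphic_on ball x0 r" "\<And>z. z \<in> ball x0 r - {x0} \<Longrightarrow> g z = f z" by blast
  have "continuous_on (ball x0 r) g" using g(1) by (rule holomorphic_on_imp_continuous_on)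
  then have "(g \<longlongrightarrow> g x0) (at x0)" using r(1) by (simp add: continuous_on_eq_continuous_at isCont_def)
  moreover have "\<forall>\<^sub>F z in at x0. g z = f z"
    unfolding eventually_at using r(1) g(2) by (intro exI[of _ r]) (auto simp: dist_commute)
  ultimately have "(f \<longlongrightarrow> g x0) (at x0)" using Lim_transform_eventually by blast
  then show ?thesis by (rule remove_sings_analytic_at[OF iso])
qed

lemma fps_expansion_sum:
  assumes "finite I" "\<And>i. i \<in> I \<Longrightarrow> f i has_fps_expansion F i"
  shows "(\<lambda>x. \<Sum>i\<in>I. f i x) has_fps_expansion (\<Sum>i\<in>I. F i :: complex fps)"
  using assms by (induction I rule: finite_induct) (auto intro!: fps_expansion_intros)

context generic_qt begin

lemma Yf_meromorphic: "Yf lam meromorphic_on UNIV"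
  unfolding Yf_def[abs_def] gbox_def by (intro meromorphic_intros)

end

context mukade begin

definition up_confs :: "nat \<Rightarrow> complex \<Rightarrow> nat \<Rightarrow> nat \<Rightarrow> (nat set \<times> (nat \<Rightarrow> nat list)) set" where
  "up_confs i x0 k d = {(J, \<nu>) \<in> confs k d. i \<notin> J \<and> Suc i \<in> J \<and> (\<exists>A. addable (\<nu> i) A \<and> box_par A * (coef_at J i * x0) = 1)}"

definition down_confs :: "nat \<Rightarrow> complex \<Rightarrow> nat \<Rightarrow> nat \<Rightarrow> (nat set \<times> (nat \<Rightarrow> nat list)) set" where
  "down_confs i x0 k d = {(J, \<nu>) \<in> confs k d. i \<in> J \<and> Suc i \<notin> J \<and> (\<exists>R. removable (\<nu> i) R \<and> box_par R * (q / t * (coef_at J i * x0)) = 1)}"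

lemma confs_move:
  assumes i: "i \<in> {1..<N}" "i \<notin> J" "Suc i \<in> J" and lam: "is_partition (\<nu> i)" and A: "addable (\<nu> i) (r, c)"
  shows "(insert i (J - {Suc i}), \<nu>(i := add_box (\<nu> i) (r, c))) \<in> confs k d \<longleftrightarrow> (J, \<nu>) \<in> confs k d"
proof (cases "finite J")
  case True
  let ?J = "insert i (J - {Suc i})" and ?\<nu> = "\<nu>(i := add_box (\<nu> i) (r, c))"
  have sub: "?J \<subseteq> {1..N} \<longleftrightarrow> J \<subseteq> {1..N}" using i by auto
  have crd: "card ?J = card J" using True i by (simp add: card_Diff_singleton_if) (metis Suc_pred card_gt_0_iff empty_iff)
  have "(\<Sum>j\<in>J. j - 1) = i + (\<Sum>j\<in>J - {Suc i}. j - 1)" using sum.remove[OF True i(3), of "\<lambda>j. j - 1"] by simp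
  moreover have "(\<Sum>j\<in>?J. j - 1) = (i - 1) + (\<Sum>j\<in>J - {Suc i}. j - 1)" using True i by simp
  moreover have "sum_list (add_box (\<nu> i) (r, c)) = Suc (sum_list (\<nu> i))"
    unfolding sum_list_card_boxes add_box(3)[OF lam A] using add_box(4)[OF lam A] by simp
  moreover have "(\<Sum>l\<in>{1..<N}. sum_list (\<nu> l)) = sum_list (\<nu> i) + (\<Sum>l\<in>{1..<N} - {i}. sum_list (\<nu> l))"
    by (rule sum.remove) (use i in auto)
  moreover have "(\<Sum>l\<in>{1..<N}. sum_list (?\<nu> l)) = sum_list (add_box (\<nu> i) (r, c)) + (\<Sum>l\<in>{1..<N} - {i}. sum_list (\<nu> l))"
    by (subst sum.remove[of _ i]) (use i in \<open>auto intro!: sum.cong\<close>)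
  moreover have "i \<ge> 1" using i by simp
  ultimately have wt: "(\<Sum>j\<in>?J. j - 1) + (\<Sum>l\<in>{1..<N}. sum_list (?\<nu> l)) = (\<Sum>j\<in>J. j - 1) + (\<Sum>l\<in>{1..<N}. sum_list (\<nu> l))"
    by linarith
  have part: "(\<forall>l. is_partition (?\<nu> l)) \<longleftrightarrow> (\<forall>l. is_partition (\<nu> l))" using add_box(1)[OF lam A] lam by auto
  have nil: "(\<forall>l. l \<notin> {1..<N} \<longrightarrow> ?\<nu> l = []) \<longleftrightarrow> (\<forall>l. l \<notin> {1..<N} \<longrightarrow> \<nu> l = [])" using i by auto
  show ?thesis unfolding confs_def mem_Collect_eq prod.case sub crd wt part nil ..
next
  case False
  then have "infinite (insert i (J - {Suc i}))" by simp
  with False have "\<not> J \<subseteq> {1..N}" "\<not> insert i (J - {Suc i}) \<subseteq> {1..N}" using finite_subset[OF _ finite_atLeastAtMost] by blast+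
  then show ?thesis unfolding confs_def by blast
qed

lemma box_par_unique:
  assumes "box_par A * y = 1" "box_par B * y = 1" "fst A \<ge> 1" "snd A \<ge> 1" "fst B \<ge> 1" "snd B \<ge> 1"
  shows "A = B"
proof -
  have "y \<noteq> 0" using assms(1) by auto
  then have "box_par (fst A, snd A) = box_par (fst B, snd B)" using assms(1,2) by (metis mult_right_cancel prod.collapse)
  from box_par_inj[OF this assms(3-6)] show ?thesis by (simp add: prod_eq_iff)
qed

lemma addable_ge: "addable lam A \<Longrightarrow> fst A \<ge> 1 \<and> snd A \<ge> 1" and removable_ge: "removable lam A \<Longrightarrow> fst A \<ge> 1 \<and> snd A \<ge> 1"
  by (cases A, auto simp: addable_def removable_def)+

text \<open>
  The box with the given parameter is unique, so adding and removing it are inverse to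
  each other.
\<close>
lemma up_down_pairing:
  assumes i: "i \<in> {1..<N}"
  obtains \<tau> where "bij_betw \<tau> (up_confs i x0 k d) (down_confs i x0 k d)"
    "\<And>J \<nu>. (J, \<nu>) \<in> up_confs i x0 k d \<Longrightarrow> \<exists>r c. addable (\<nu> i) (r, c) \<and> box_par (r, c) * (coef_at J i * x0) = 1 \<and>
       \<tau> (J, \<nu>) = (insert i (J - {Suc i}), \<nu>(i := add_box (\<nu> i) (r, c)))"
proof -
  define P where "P J \<nu> A \<longleftrightarrow> addable (\<nu> i) A \<and> box_par A * (coef_at J i * x0) = 1" for J \<nu> A
  define Q where "Q J \<nu> A \<longleftrightarrow> removable (\<nu> i) A \<and> box_par A * (q / t * (coef_at J i * x0)) = 1" for J \<nu> A
  define \<tau> where "\<tau> = (\<lambda>(J, \<nu>). (insert i (J - {Suc i}), \<nu>(i := add_box (\<nu> i) (SOME A. P J \<nu> A))))"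
  define \<sigma> where "\<sigma> = (\<lambda>(J, \<nu>). (insert (Suc i) (J - {i}), \<nu>(i := rem_box (\<nu> i) (SOME A. Q J \<nu> A))))"
  have someP: "(SOME A. P J \<nu> A) = A" if "P J \<nu> A" for J \<nu> A
  proof (rule some_equality[of "P J \<nu>"])
    show "B = A" if "P J \<nu> B" for B
      using box_par_unique[of B "coef_at J i * x0" A] addable_ge that \<open>P J \<nu> A\<close> unfolding P_def by blast
  qed (rule that)
  have someQ: "(SOME A. Q J \<nu> A) = A" if "Q J \<nu> A" for J \<nu> A
  proof (rule some_equality[of "Q J \<nu>"])
    show "B = A" if "Q J \<nu> B" for B
      using box_par_unique[of B "q / t * (coef_at J i * x0)" A] removable_ge that \<open>Q J \<nu> A\<close> unfolding Q_def by blast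
  qed (rule that)
  have coef: "q / t * (coef_at (insert i (J - {Suc i})) i * x0) = coef_at J i * x0" if "finite J" "i \<notin> J" "Suc i \<in> J" for J
  proof -
    have "q / t * gam ^ 2 = 1" using gam2 q0 t0 by simp
    moreover have "q / t * (coef_at (insert i (J - {Suc i})) i * x0) = q / t * gam ^ 2 * (coef_at J i * x0)"
      unfolding coef_at_def cnt_move[OF that] by (simp add: mult_ac)
    ultimately show ?thesis by (metis mult_1)
  qed
  have upD: "\<exists>r c. P J \<nu> (r, c) \<and> i \<notin> J \<and> Suc i \<in> J \<and> is_partition (\<nu> i) \<and> finite J \<and> (J, \<nu>) \<in> confs k d" if "(J, \<nu>) \<in> up_confs i x0 k d" for J \<nu>
    using that finite_subset[of J "{1..N}"] unfolding up_confs_def P_def confs_def by auto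
  have downD: "\<exists>r c. Q J \<nu> (r, c) \<and> i \<in> J \<and> Suc i \<notin> J \<and> is_partition (\<nu> i) \<and> finite J \<and> (J, \<nu>) \<in> confs k d" if "(J, \<nu>) \<in> down_confs i x0 k d" for J \<nu>
    using that finite_subset[of J "{1..N}"] unfolding down_confs_def Q_def confs_def by auto
  have up: "\<tau> (J, \<nu>) \<in> down_confs i x0 k d \<and> \<sigma> (\<tau> (J, \<nu>)) = (J, \<nu>)" if a: "(J, \<nu>) \<in> up_confs i x0 k d" for J \<nu>
  proof -
    obtain r c where J: "P J \<nu> (r, c)" "i \<notin> J" "Suc i \<in> J" "is_partition (\<nu> i)" "finite J" "(J, \<nu>) \<in> confs k d" using upD[OF a] by blast
    let ?J = "insert i (J - {Suc i})" and ?\<nu> = "\<nu>(i := add_box (\<nu> i) (r, c))"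
    have A: "addable (\<nu> i) (r, c)" "box_par (r, c) * (coef_at J i * x0) = 1" using J(1) by (auto simp: P_def)
    have t: "\<tau> (J, \<nu>) = (?J, ?\<nu>)" by (simp add: \<tau>_def someP[OF J(1)])
    have Q: "Q ?J ?\<nu> (r, c)" unfolding Q_def coef[OF J(5,2,3)] using A add_box(5)[OF J(4) A(1)] by simp
    have "(?J, ?\<nu>) \<in> confs k d" using confs_move[where \<nu> = \<nu>, OF i J(2,3,4) A(1)] J(6) by blast
    then have "(?J, ?\<nu>) \<in> down_confs i x0 k d" using Q J(2,3) unfolding down_confs_def Q_def by auto
    moreover have "\<sigma> (?J, ?\<nu>) = (J, \<nu>)"
    proof -
      have "insert (Suc i) (?J - {i}) = J" using J(2,3) by auto
      then show ?thesis unfolding \<sigma>_def prod.case someQ[OF Q] using add_box(6)[OF J(4) A(1)] by simp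
    qed
    ultimately show ?thesis unfolding t by simp
  qed
  have down: "\<sigma> (J, \<nu>) \<in> up_confs i x0 k d \<and> \<tau> (\<sigma> (J, \<nu>)) = (J, \<nu>)" if a: "(J, \<nu>) \<in> down_confs i x0 k d" for J \<nu>
  proof -
    obtain r c where J: "Q J \<nu> (r, c)" "i \<in> J" "Suc i \<notin> J" "is_partition (\<nu> i)" "finite J" "(J, \<nu>) \<in> confs k d" using downD[OF a] by blast
    let ?J = "insert (Suc i) (J - {i})" and ?\<nu> = "\<nu>(i := rem_box (\<nu> i) (r, c))"
    have R: "removable (\<nu> i) (r, c)" "box_par (r, c) * (q / t * (coef_at J i * x0)) = 1" using J(1) by (auto simp: Q_def)
    have s: "\<sigma> (J, \<nu>) = (?J, ?\<nu>)" by (simp add: \<sigma>_def someQ[OF J(1)])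
    have restore: "insert i (?J - {Suc i}) = J" "?\<nu>(i := add_box (?\<nu> i) (r, c)) = \<nu>"
      using J(2,3) rem_box(3)[OF J(4) R(1)] by auto
    have J': "i \<notin> ?J" "Suc i \<in> ?J" "finite ?J" using J by auto
    have A: "addable (?\<nu> i) (r, c)" "is_partition (?\<nu> i)" using rem_box(1,2)[OF J(4) R(1)] by simp_all
    have "q / t * (coef_at J i * x0) = coef_at ?J i * x0" using coef[OF J'(3,1,2)] unfolding restore .
    from R(2)[unfolded this] have P: "P ?J ?\<nu> (r, c)" using A(1) unfolding P_def by blast
    have "(?J, ?\<nu>) \<in> confs k d" using confs_move[where \<nu> = "?\<nu>", OF i J'(1,2) A(2,1)] J(6) unfolding restore by blast
    then have "(?J, ?\<nu>) \<in> up_confs i x0 k d" using P J' unfolding up_confs_def P_def by auto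
    moreover have "\<tau> (?J, ?\<nu>) = (J, \<nu>)" unfolding \<tau>_def prod.case someP[OF P] restore ..
    ultimately show ?thesis unfolding s by simp
  qed
  have "bij_betw \<tau> (up_confs i x0 k d) (down_confs i x0 k d)"
    by (rule bij_betw_byWitness[of _ \<sigma>]) (use up down in auto)
  moreover have "\<exists>r c. addable (\<nu> i) (r, c) \<and> box_par (r, c) * (coef_at J i * x0) = 1 \<and>
       \<tau> (J, \<nu>) = (insert i (J - {Suc i}), \<nu>(i := add_box (\<nu> i) (r, c)))" if J\<nu>: "(J, \<nu>) \<in> up_confs i x0 k d" for J \<nu>
  proof -
    obtain r c where "P J \<nu> (r, c)" using upD[OF J\<nu>] by blast
    note rc = this
    show ?thesis unfolding \<tau>_def prod.case someP[OF rc] using rc unfolding P_def by blast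
  qed
  ultimately show ?thesis by (rule that)
qed

text \<open>
  If the ratios of the \<open>om i\<close> avoid \<open>lat\<close>, a nonzero point can be a pole of the factors of one site
  only. The terms singular there come in the pairs above, and every other term is bounded.
\<close>
lemma total_limit:
  assumes full: "\<And>k l. k < l \<Longrightarrow> l \<le> N \<Longrightarrow> om l / om k \<notin> lat" and x0: "x0 \<noteq> 0"
    and M: "M \<in> fock_basis N" "M' \<in> fock_basis N"
  shows "((\<lambda>x. (1 - x / x0) * (\<Sum>a\<in>confs k d. current_term M M' a x)) \<longlongrightarrow> 0) (at x0)"
proof -
  have unique: "k = l" if "om k * x0 \<in> lat" "om l * x0 \<in> lat" "k \<le> N" "l \<le> N" for k l
  proof (rule ccontr)
    assume "k \<noteq> l"
    have "om l / om k \<in> lat" "om k / om l \<in> lat" using lat_divide[OF that(2,1)] lat_divide[OF that(1,2)] x0 by simp_all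
    then show False using full[of k l] full[of l k] that \<open>k \<noteq> l\<close> by (meson linorder_neqE_nat)
  qed
  show ?thesis
  proof (cases "\<exists>i\<in>{1..<N}. om i * x0 \<in> lat")
    case False
    have "((\<lambda>x. (1 - x / x0) * current_term M M' a x) \<longlongrightarrow> 0) (at x0)" if a: "a \<in> confs k d" for a
    proof -
      obtain J \<nu> where a_eq: "a = (J, \<nu>)" by (cases a)
      have J: "J \<subseteq> {1..N}" "\<And>i. i \<notin> {1..<N} \<Longrightarrow> \<nu> i = []" using a by (auto simp: a_eq confs_def)
      show ?thesis unfolding a_eq
      proof (rule regular_term[OF _ x0])
        fix i assume i: "i \<le> N"
        show "\<exists>l. (phi \<nu> J i \<longlongrightarrow> l) (at x0)"
        proof (cases "i \<in> {1..<N}")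
          case True
          then show ?thesis using phi_limit_off[OF i] False by blast
        next
          case ends: False
          then have "lo J i \<or> Suc i \<notin> J" using i J(1) by force
          then show ?thesis using phi_limit_end[of i \<nu> J x0] i J(2)[OF ends] by blast
        qed
      qed
    qed
    then show ?thesis unfolding sum_distrib_left by (rule tendsto_null_sum)
  next
    case True
    then obtain i where i: "i \<in> {1..<N}" "om i * x0 \<in> lat" by blast
    have off: "om l * x0 \<notin> lat" if "l \<le> N" "l \<noteq> i" for l using unique[OF _ i(2) that(1)] that i by auto
    obtain \<tau> where \<tau>: "bij_betw \<tau> (up_confs i x0 k d) (down_confs i x0 k d)"
      "\<And>J \<nu>. (J, \<nu>) \<in> up_confs i x0 k d \<Longrightarrow> \<exists>r c. addable (\<nu> i) (r, c) \<and> box_par (r, c) * (coef_at J i * x0) = 1 \<and>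
       \<tau> (J, \<nu>) = (insert i (J - {Suc i}), \<nu>(i := add_box (\<nu> i) (r, c)))"
      using up_down_pairing[OF i(1), of x0 k d] by blast
    let ?U = "up_confs i x0 k d" and ?D = "down_confs i x0 k d"
    define R where "R = confs k d - (?U \<union> ?D)"
    have sub: "?U \<subseteq> confs k d" "?D \<subseteq> confs k d" "?U \<inter> ?D = {}" by (auto simp: up_confs_def down_confs_def)
    have fin: "finite ?U" "finite ?D" "finite R" using finite_subset[OF sub(1) finite_confs] finite_subset[OF sub(2) finite_confs] finite_confs
      by (auto simp: R_def)
    have split: "(\<Sum>a\<in>confs k d. f a) = (\<Sum>a\<in>?U. f a + f (\<tau> a)) + (\<Sum>a\<in>R. f a)" for f :: "_ \<Rightarrow> complex"
    proof -
      have "(\<Sum>a\<in>confs k d. f a) = (\<Sum>a\<in>?U \<union> ?D. f a) + (\<Sum>a\<in>R. f a)"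
        unfolding R_def using sum.subset_diff[OF _ finite_confs, of "?U \<union> ?D" k d f] sub by (simp add: add.commute)
      also have "(\<Sum>a\<in>?U \<union> ?D. f a) = (\<Sum>a\<in>?U. f a) + (\<Sum>a\<in>?D. f a)" by (rule sum.union_disjoint[OF fin(1,2) sub(3)])
      also have "(\<Sum>a\<in>?D. f a) = (\<Sum>a\<in>?U. f (\<tau> a))" by (rule sum.reindex_bij_betw[OF \<tau>(1), symmetric])
      finally show ?thesis by (simp add: sum.distrib)
    qed
    have pair: "((\<lambda>x. (1 - x / x0) * (current_term M M' a x + current_term M M' (\<tau> a) x)) \<longlongrightarrow> 0) (at x0)" if a: "a \<in> ?U" for a
    proof -
      obtain J \<nu> where a_eq: "a = (J, \<nu>)" by (cases a)
      have J: "J \<subseteq> {1..N}" "i \<notin> J" "Suc i \<in> J" "is_partition (\<nu> i)" using a by (auto simp: a_eq up_confs_def confs_def)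
      obtain r c where rc: "addable (\<nu> i) (r, c)" "box_par (r, c) * (coef_at J i * x0) = 1"
        "\<tau> (J, \<nu>) = (insert i (J - {Suc i}), \<nu>(i := add_box (\<nu> i) (r, c)))" using \<tau>(2) a unfolding a_eq by blast
      show ?thesis unfolding a_eq rc(3) by (rule pole_pair[where \<nu> = \<nu>, OF J(1) i(1) J(2-4) rc(1,2) off M])
    qed
    have rest: "((\<lambda>x. (1 - x / x0) * current_term M M' a x) \<longlongrightarrow> 0) (at x0)" if a: "a \<in> R" for a
    proof -
      obtain J \<nu> where a_eq: "a = (J, \<nu>)" by (cases a)
      have J: "(J, \<nu>) \<in> confs k d" "(J, \<nu>) \<notin> ?U" "(J, \<nu>) \<notin> ?D" using a by (auto simp: a_eq R_def)
      have lam: "is_partition (\<nu> i)" using J(1) by (simp add: confs_def)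
      show ?thesis unfolding a_eq
      proof (rule regular_term[OF _ x0])
        fix l assume l: "l \<le> N"
        show "\<exists>m. (phi \<nu> J l \<longlongrightarrow> m) (at x0)"
        proof (cases "l = i")
          case False
          then show ?thesis using phi_limit_off[OF l] off[OF l] by blast
        next
          case True
          show ?thesis unfolding True
          proof (rule phi_limit_box)
            show "1 - box_par A * (q / t * (coef_at J i * x0)) \<noteq> 0" if "lo J i" "Suc i \<notin> J" "removable (\<nu> i) A" for A
            proof
              assume "1 - box_par A * (q / t * (coef_at J i * x0)) = 0"
              then have "box_par A * (q / t * (coef_at J i * x0)) = 1" by (simp only: right_minus_eq)
              moreover have "i \<in> J" using that(1) i(1) by auto
              ultimately have "(J, \<nu>) \<in> ?D" using J(1) that(2,3) unfolding down_confs_def mem_Collect_eq prod.case by blast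
              with J(3) show False ..
            qed
            show "1 - box_par A * (coef_at J i * x0) \<noteq> 0" if "\<not> lo J i" "Suc i \<in> J" "addable (\<nu> i) A" for A
            proof
              assume "1 - box_par A * (coef_at J i * x0) = 0"
              then have "box_par A * (coef_at J i * x0) = 1" by (simp only: right_minus_eq)
              then have "(J, \<nu>) \<in> ?U" using J(1) that unfolding up_confs_def mem_Collect_eq prod.case by blast
              with J(2) show False ..
            qed
          qed (use i lam in auto)
        qed
      qed
    qed
    have "((\<lambda>x. (\<Sum>a\<in>?U. (1 - x / x0) * (current_term M M' a x + current_term M M' (\<tau> a) x)) + (\<Sum>a\<in>R. (1 - x / x0) * current_term M M' a x)) \<longlongrightarrow> 0 + 0) (at x0)"
      by (intro tendsto_add tendsto_null_sum pair rest)
    then show ?thesis unfolding split by (simp add: distrib_left sum_distrib_left)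
  qed
qed


section \<open>Comparison of the expansions at 0 and at infinity\<close>

text \<open>
  Extended by 0 to negative levels, so that a mode number can be any integer.
\<close>
abbreviation XTz :: "(nat \<Rightarrow> nat list) \<Rightarrow> nat set \<Rightarrow> (nat \<times> nat) multiset \<Rightarrow> (nat \<times> nat) multiset \<Rightarrow> int \<Rightarrow> complex" where
  "XTz \<nu> J M M' p \<equiv> (if p \<ge> 0 then XTs \<nu> J M M' (nat p) else 0)"

abbreviation TXz :: "(nat \<Rightarrow> nat list) \<Rightarrow> nat set \<Rightarrow> (nat \<times> nat) multiset \<Rightarrow> (nat \<times> nat) multiset \<Rightarrow> int \<Rightarrow> complex" where
  "TXz \<nu> J M M' p \<equiv> (if p \<ge> 0 then TXs \<nu> J M M' (nat p) else 0)"

lemma current_term_inversion: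
  assumes J: "J \<subseteq> {1..N}" and z: "z \<noteq> 0"
  shows "z ^ Suc (mwt snd M + mwt snd M') * current_term M M' (J, \<nu>) (inverse z) =
    (\<Prod>j\<in>J. u j) * T_weight \<nu> * (- (w * gam ^ card J) * Phit \<nu> J z * wickT \<nu> J M M' z)"
proof -
  have "z ^ Suc (mwt snd M + mwt snd M') * current_term M M' (J, \<nu>) (inverse z) =
      T_weight \<nu> * z * ((\<Prod>j\<in>J. v j) * Phi \<nu> J (inverse z)) * (wickX \<nu> J M M' (inverse z) * z ^ (mwt snd M + mwt snd M'))"
    unfolding current_term_def prod.case power_Suc by (simp only: mult_ac)
  also have "\<dots> = T_weight \<nu> * z * (- (w * gam ^ card J * inverse z) * ((\<Prod>j\<in>J. u j) * Phit \<nu> J z)) * wickT \<nu> J M M' z"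
    unfolding Phi_inversion[OF J z] wick_el_inversion[OF z] ..
  also have "\<dots> = (\<Prod>j\<in>J. u j) * T_weight \<nu> * (- (w * gam ^ card J) * Phit \<nu> J z * wickT \<nu> J M M' z)"
    using z by simp
  finally show ?thesis .
qed

text \<open>
  The sum of all terms has only removable singularities, hence is entire. Its expansions at 0 and at
  infinity are the modes of the two sides of the relation.
\<close>
lemma main_identity_generic:
  assumes full: "\<And>k l. k < l \<Longrightarrow> l \<le> N \<Longrightarrow> om l / om k \<notin> lat"
    and M: "M \<in> fock_basis N" "M' \<in> fock_basis N"
  shows "(\<Sum>(J, \<nu>)\<in>confs k d. (\<Prod>j\<in>J. v j) * T_weight \<nu> * (XTz \<nu> J M M' (int (mwt snd M) + n) - w * XTz \<nu> J M M' (int (mwt snd M) + n - 1))) =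
    (\<Sum>(J, \<nu>)\<in>confs k d. (\<Prod>j\<in>J. u j) * T_weight \<nu> * (inverse gam ^ k * TXz \<nu> J M M' (int (mwt snd M') - n) - w * gam ^ k * TXz \<nu> J M M' (int (mwt snd M') - n + 1)))"
proof -
  \<comment> \<open>The normal-ordered part is a polynomial in $x$ of degree at most the sum of the levels, and the rational factor grows linearly at infinity.\<close>
  let ?b = "Suc (mwt snd M + mwt snd M')"
  have conf: "J \<subseteq> {1..N}" "card J = k" "\<nu> 0 = []" if "(J, \<nu>) \<in> confs k d" for J \<nu> using that by (auto simp: confs_def)
  define f where "f x = (\<Sum>a\<in>confs k d. current_term M M' a x)" for x
  define g where "g z = (\<Sum>a\<in>confs k d. case a of (J, \<nu>) \<Rightarrow> (\<Prod>j\<in>J. u j) * T_weight \<nu> * (- (w * gam ^ card J) * Phit \<nu> J z * wickT \<nu> J M M' z))" for z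
  define F where "F = (\<Sum>a\<in>confs k d. case a of (J, \<nu>) \<Rightarrow> fps_const ((\<Prod>j\<in>J. v j) * T_weight \<nu>) * ((1 - fps_const w * fps_X) * Abs_fps (XTs \<nu> J M M')))"
  define G where "G = (\<Sum>a\<in>confs k d. case a of (J, \<nu>) \<Rightarrow> fps_const ((\<Prod>j\<in>J. u j) * T_weight \<nu>) *
      ((fps_const (inverse gam ^ card J) * fps_X - fps_const (w * gam ^ card J)) * Abs_fps (TXs \<nu> J M M')))"
  have fF: "f has_fps_expansion F"
    unfolding f_def[abs_def] F_def
  proof (rule fps_expansion_sum[OF finite_confs])
    fix a assume a: "a \<in> confs k d"
    obtain J \<nu> where e: "a = (J, \<nu>)" by (cases a)
    show "current_term M M' a has_fps_expansion (case a of (J, \<nu>) \<Rightarrow> fps_const ((\<Prod>j\<in>J. v j) * T_weight \<nu>) * ((1 - fps_const w * fps_X) * Abs_fps (XTs \<nu> J M M')))"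
      unfolding e current_term_def prod.case using conf[OF a[unfolded e]] by (intro fps_expansion_intros expansion_XT M)
  qed
  have gG: "g has_fps_expansion G"
    unfolding g_def[abs_def] G_def
  proof (rule fps_expansion_sum[OF finite_confs])
    fix a assume a: "a \<in> confs k d"
    obtain J \<nu> where e: "a = (J, \<nu>)" by (cases a)
    show "(\<lambda>z. case a of (J, \<nu>) \<Rightarrow> (\<Prod>j\<in>J. u j) * T_weight \<nu> * (- (w * gam ^ card J) * Phit \<nu> J z * wickT \<nu> J M M' z)) has_fps_expansion
      (case a of (J, \<nu>) \<Rightarrow> fps_const ((\<Prod>j\<in>J. u j) * T_weight \<nu>) *
      ((fps_const (inverse gam ^ card J) * fps_X - fps_const (w * gam ^ card J)) * Abs_fps (TXs \<nu> J M M')))"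
      unfolding e prod.case using conf[OF a[unfolded e]] by (intro has_fps_expansion_mult has_fps_expansion_const expansion_TX M)
  qed
  have inv: "z ^ ?b * f (inverse z) = g z" if "z \<noteq> 0" for z
    unfolding f_def g_def sum_distrib_left using current_term_inversion[OF _ that] conf by (intro sum.cong refl) auto
  have mero: "f meromorphic_on UNIV"
    unfolding f_def[abs_def]
  proof (rule meromorphic_on_sum)
    fix a :: "nat set \<times> (nat \<Rightarrow> nat list)"
    obtain J \<nu> where e: "a = (J, \<nu>)" by (cases a)
    have "phi \<nu> J i meromorphic_on UNIV" for i
    proof -
      have Y: "(\<lambda>x. Yf (\<nu> i) (coef_at J i * x)) meromorphic_on UNIV"
        by (rule meromorphic_on_compose[OF Yf_meromorphic]) (auto intro!: analytic_intros)
      then show ?thesis unfolding phi_eq[abs_def] spow_def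
        using meromorphic_on_inverse[OF Y] by (cases "lo J i = (Suc i \<in> J)"; cases "lo J i") auto
    qed
    moreover have "wickX \<nu> J M M' meromorphic_on UNIV"
      by (intro analytic_on_imp_meromorphic_on) (simp add: analytic_on_open holomorphic_wick_el)
    ultimately show "current_term M M' a meromorphic_on UNIV"
      unfolding e current_term_def prod.case Phi_def by (intro meromorphic_on_mult meromorphic_on_const meromorphic_on_prod)
  qed
  have iso: "isolated_singularity_at f x" for x
    using mero by (intro meromorphic_on_isolated_singularity) (rule meromorphic_on_subset[of _ UNIV], auto)
  define E where "E = remove_sings f"
  have "E analytic_on {x}" for x
  proof (cases "x = 0")
    case True
    show ?thesis unfolding E_def True by (rule remove_sings_analytic_on[OF has_fps_expansion_imp_analytic_0[OF fF]])
  next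
    case False
    show ?thesis unfolding E_def
      by (rule remove_sings_analytic_lim[OF iso False]) (use total_limit[OF full False M] in \<open>simp add: f_def\<close>)
  qed
  then have "E analytic_on UNIV" using analytic_on_analytic_at by blast
  then have E: "E holomorphic_on UNIV" by (rule analytic_imp_holomorphic)
  have E0: "\<forall>\<^sub>F x in at 0. E x = f x" unfolding E_def by (rule eventually_remove_sings_eq_at[OF iso])
  have Einf: "\<forall>\<^sub>F z in at 0. z ^ ?b * E (inverse z) = g z"
  proof -
    obtain S where S: "open S" "0 \<in> S" "g holomorphic_on S"
      using has_fps_expansion_imp_analytic_0[OF gG] unfolding analytic_at by blast
    have "\<forall>\<^sub>F z in nhds 0. z \<in> S" using S(1,2) by (rule eventually_nhds_in_open)
    then have "\<forall>\<^sub>F z in nhds 0. g analytic_on {z}" by eventually_elim (use S in \<open>auto simp: analytic_at\<close>)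
    then have "\<forall>\<^sub>F z in at 0. g analytic_on {z}" by (simp add: eventually_nhds_conv_at)
    moreover have "\<forall>\<^sub>F z in at (0::complex). z \<noteq> 0" by (simp add: eventually_at_filter)
    ultimately show ?thesis
    proof eventually_elim
      case (elim z)
      have fx: "f x = x ^ ?b * g (inverse x)" if "x \<noteq> 0" for x
        using inv[of "inverse x"] that by (simp add: field_simps)
      have "isCont g (inverse (inverse z))" using elim analytic_at_imp_isCont by simp
      then have "((\<lambda>x. x ^ ?b * g (inverse x)) \<longlongrightarrow> inverse z ^ ?b * g (inverse (inverse z))) (at (inverse z))"
        using elim by (intro tendsto_mult tendsto_power tendsto_ident_at isCont_tendsto_compose[of _ g] tendsto_inverse) auto
      moreover have "\<forall>\<^sub>F x in at (inverse z). x \<noteq> 0" using elim tendsto_imp_eventually_ne[OF tendsto_ident_at, of "inverse z" 0 UNIV] by simp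
      then have "\<forall>\<^sub>F x in at (inverse z). x ^ ?b * g (inverse x) = f x" by eventually_elim (rule fx[symmetric])
      ultimately have "(f \<longlongrightarrow> inverse z ^ ?b * g (inverse (inverse z))) (at (inverse z))" using Lim_transform_eventually by blast
      then have "E (inverse z) = f (inverse z)" unfolding E_def using fx[of "inverse z"] elim by (simp add: remove_sings_eqI)
      then show ?case using inv elim by simp
    qed
  qed
  note coefs = expansions_at_0_and_infinity[OF E fF E0 gG Einf]
  have nthF: "fps_nth F p = (\<Sum>(J, \<nu>)\<in>confs k d. (\<Prod>j\<in>J. v j) * T_weight \<nu> * (XTz \<nu> J M M' (int p) - w * XTz \<nu> J M M' (int p - 1)))" for p
  proof -
    have "fps_nth ((1 - fps_const w * fps_X) * Abs_fps X) p = X p - w * (if p = 0 then 0 else X (p - 1))" for X :: "nat \<Rightarrow> complex"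
      by (simp add: left_diff_distrib mult.assoc)
    moreover have "XTz \<nu> J M M' (int p - 1) = (if p = 0 then 0 else XTs \<nu> J M M' (p - 1))" for \<nu> J
      by (cases p) auto
    ultimately show ?thesis unfolding F_def fps_sum_nth case_prod_beta by simp
  qed
  have nthG: "fps_nth G p = (\<Sum>(J, \<nu>)\<in>confs k d. (\<Prod>j\<in>J. u j) * T_weight \<nu> * (inverse gam ^ k * TXz \<nu> J M M' (int p - 1) - w * gam ^ k * TXz \<nu> J M M' (int p)))" for p
  proof -
    have e: "fps_nth ((fps_const a * fps_X - fps_const b) * Abs_fps X) p = a * (if p = 0 then 0 else X (p - 1)) - b * X p" for X :: "nat \<Rightarrow> complex" and a b
      by (simp add: left_diff_distrib mult.assoc)
    moreover have "TXz \<nu> J M M' (int p - 1) = (if p = 0 then 0 else TXs \<nu> J M M' (p - 1))" for \<nu> J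
      by (cases p) auto
    ultimately show ?thesis unfolding G_def fps_sum_nth case_prod_beta using conf(2) by (intro sum.cong refl) (auto simp: mult.assoc)
  qed
  let ?p = "int (mwt snd M) + n"
  show ?thesis
  proof (cases "?p \<ge> 0")
    case True
    have p: "int (nat ?p) = ?p" using True by simp
    show ?thesis
    proof (cases "nat ?p \<le> ?b")
      case le: True
      have r: "int (?b - nat ?p) = int (mwt snd M') - n + 1" "int (?b - nat ?p) - 1 = int (mwt snd M') - n" using le True by (simp_all add: of_nat_diff)
      show ?thesis using coefs(1)[of "nat ?p"] unfolding if_P[OF le] nthF nthG p r(2) unfolding r(1) .
    next
      case False
      then have "int (mwt snd M') - n + 1 < 0" using True by linarith
      then have "\<not> 0 \<le> int (mwt snd M') - n" "\<not> 0 \<le> int (mwt snd M') - n + 1" by linarith+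
      then show ?thesis using coefs(1)[of "nat ?p"] False unfolding nthF p by (simp add: case_prod_beta)
    qed
  next
    case False
    have b: "?b < nat (int (mwt snd M') - n + 1)" and i: "int (nat (int (mwt snd M') - n + 1)) = int (mwt snd M') - n + 1" using False by linarith+
    have "\<not> 0 \<le> ?p - 1" using False by linarith
    then show ?thesis using coefs(2)[OF b] False unfolding nthG i by (simp add: case_prod_beta)
  qed
qed

end

section \<open>Removing the genericity of the ratios\<close>

lemma isCont_vop:
  fixes A B :: "complex \<Rightarrow> 'k \<Rightarrow> complex"
  assumes "\<And>k. k \<in> set_mset M \<union> set_mset M' \<Longrightarrow> isCont (\<lambda>s. A s k) s0"
    "\<And>k. k \<in> set_mset M \<union> set_mset M' \<Longrightarrow> isCont (\<lambda>s. B s k) s0"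
  shows "isCont (\<lambda>s. vop \<kappa> (A s) (B s) M M') s0"
proof -
  let ?S = "set_mset M \<union> set_mset M'"
  have "vop \<kappa> (A s) (B s) M M' = (\<Prod>k\<in>?S. mel (A s k) (\<kappa> k * B s k) (count M k) (count M' k))" for s
    by (rule vop_eq_prod) auto
  then show ?thesis unfolding mel_def by (simp, intro continuous_intros assms) auto
qed

lemma uncountable_good_parameter:
  assumes "countable (B :: complex set)" "e > 0"
  obtains s where "norm s < e" "s \<notin> B"
proof -
  have "\<not> ball 0 e \<subseteq> B" using uncountable_ball[OF assms(2), of "0::complex"] countable_subset assms(1) by blast
  then obtain s where "s \<in> ball 0 e" "s \<notin> B" by blast
  then show ?thesis using that[of s] by simp
qed

lemma (in generic_qt) countable_scaled_lat:
  assumes "m > 0" "c \<noteq> 0"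
  shows "countable {s. (1 + s) ^ m * c \<in> lat}"
proof -
  have "countable lat"
  proof -
    have "lat = (\<lambda>(a, b). qh powi a * th powi b) ` UNIV" unfolding lat_def by auto
    then show ?thesis by simp
  qed
  moreover have "{s. (1 + s) ^ m * c \<in> lat} \<subseteq> (\<Union>y\<in>lat. (\<lambda>z. z - 1) ` {z. z ^ m = y / c})"
  proof
    fix s assume "s \<in> {s. (1 + s) ^ m * c \<in> lat}"
    then have "(1 + s) ^ m * c \<in> lat" "(1 + s) \<in> {z. z ^ m = ((1 + s) ^ m * c) / c}" using assms(2) by auto
    moreover have "s = (1 + s) - 1" by simp
    ultimately show "s \<in> (\<Union>y\<in>lat. (\<lambda>z. z - 1) ` {z. z ^ m = y / c})" by blast
  qed
  moreover have "countable {z. z ^ m = y / c}" for y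
    using finite_nth_roots[OF assms(1)] by (rule countable_finite)
  ultimately show ?thesis
    by (meson countable_subset countable_UN countable_image)
qed

context mukade begin

lemma wpar_scaled:
  "wpar (\<lambda>j. (1 + s) * u j) v w (Suc i) = (1 + s) ^ i * wpar u v w (Suc i)"
  by (induction i) (auto simp: mult_ac)

text \<open>
  Collisions of poles of different sites are excluded after replacing \<open>u\<close> by \<open>(1 + s) u\<close>, except for
  countably many \<open>s\<close>. Both sides are finite sums of rational functions continuous at
  \<open>s = 0\<close>, so the identity persists there.
\<close>
lemma main_identity:
  assumes M: "M \<in> fock_basis N" "M' \<in> fock_basis N"
  shows "(\<Sum>(J, \<nu>)\<in>confs k d. (\<Prod>j\<in>J. v j) * T_weight \<nu> * (XTz \<nu> J M M' (int (mwt snd M) + n) - w * XTz \<nu> J M M' (int (mwt snd M) + n - 1))) =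
    (\<Sum>(J, \<nu>)\<in>confs k d. (\<Prod>j\<in>J. u j) * T_weight \<nu> * (inverse gam ^ k * TXz \<nu> J M M' (int (mwt snd M') - n) - w * gam ^ k * TXz \<nu> J M M' (int (mwt snd M') - n + 1)))"
proof -
  define us where "us s = (\<lambda>j. (1 + s) * u j)" for s
  define T_weight' where "T_weight' s \<nu> = (\<Prod>i\<in>{1..<N}. site_weight (\<nu> i) (us s (Suc i)) (v i)) * (\<Prod>j\<in>{1..N}. contr_ratio (\<nu> j) (\<nu> (j - 1)) (v j / us s j))" for s \<nu>
  define VC' where "VC' s \<nu> = (\<lambda>(j, n). cre (PhiS_hat (\<nu> j)) n * wpar' (us s) v w j ^ n + cre (Phi_hat (\<nu> (j - 1))) n * wpar (us s) v w j ^ n)" for s \<nu>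
  define VA' where "VA' s \<nu> = (\<lambda>(j, n). ann (PhiS_hat (\<nu> j)) n / wpar' (us s) v w j ^ n + ann (Phi_hat (\<nu> (j - 1))) n / wpar (us s) v w j ^ n)" for s \<nu>
  define XT' where "XT' s \<nu> J p = (if p \<ge> 0 then \<Sum>K | K \<in> fock_basis N \<and> mwt snd K = nat p.
      vop kapN (LamC (js J)) (LamA (js J)) M K * vop kapN (VC' s \<nu>) (VA' s \<nu>) K M' else 0)" for s \<nu> J and p :: int
  define TX' where "TX' s \<nu> J p = (if p \<ge> 0 then \<Sum>K | K \<in> fock_basis N \<and> mwt snd K = nat p.
      vop kapN (VC' s \<nu>) (VA' s \<nu>) M K * vop kapN (LamC (js J)) (LamA (js J)) K M' else 0)" for s \<nu> J and p :: int
  let ?m = "int (mwt snd M) + n" and ?m' = "int (mwt snd M') - n"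
  define D where "D s = (\<Sum>(J, \<nu>)\<in>confs k d. (\<Prod>j\<in>J. v j) * T_weight' s \<nu> * (XT' s \<nu> J ?m - w * XT' s \<nu> J (?m - 1))) -
    (\<Sum>(J, \<nu>)\<in>confs k d. (\<Prod>j\<in>J. us s j) * T_weight' s \<nu> * (inverse gam ^ k * TX' s \<nu> J ?m' - w * gam ^ k * TX' s \<nu> J (?m' + 1)))" for s
  have us0: "us 0 = u" by (simp add: us_def)
  have at0: "T_weight' 0 = T_weight" "VC' 0 = VC" "VA' 0 = VA"
    by (simp_all add: fun_eq_iff T_weight'_def T_weight_def VC'_def VC_def VA'_def VA_def us0)
  have ws: "wpar (us s) v w j = (1 + s) ^ (j - 1) * wpar u v w j" "wpar' (us s) v w j = (1 + s) ^ j * wpar' u v w j" if "j \<in> {1..N}" for s j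
  proof -
    obtain i where i: "j = Suc i" using \<open>j \<in> {1..N}\<close> by (cases j) auto
    show "wpar (us s) v w j = (1 + s) ^ (j - 1) * wpar u v w j" unfolding us_def i wpar_scaled by simp
    then show "wpar' (us s) v w j = (1 + s) ^ j * wpar' u v w j" unfolding wpar'_def by (simp add: i us_def mult_ac del: wpar.simps)
  qed
  have wnz: "wpar u v w j \<noteq> 0" "wpar' u v w j \<noteq> 0" if "j \<in> {1..N}" for j
    using om_nz[of j] om_nz[of "j - 1"] gam0 that less_imp_diff_less[of j "Suc N" 1] unfolding wpar_om[OF that] wpar'_om[OF that] by auto
  \<comment> \<open>The point $-1$ makes all parameters vanish; the first union consists of resonances inside a site, the second of collisions of two sites.\<close>
  define Bad where "Bad = {-1} \<union> (\<Union>j\<in>{1..N}. {s. (1 + s) ^ 1 * (u j / v j) \<in> lat}) \<union>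
     (\<Union>(k, l)\<in>{(k, l). k < l \<and> l \<le> N}. {s. (1 + s) ^ (l - k) * (om l / om k) \<in> lat})"
  have "countable Bad"
  proof -
    have "countable {s. (1 + s) ^ 1 * (u j / v j) \<in> lat}" if "j \<in> {1..N}" for j
      by (rule countable_scaled_lat) (use uv0[OF that] in auto)
    moreover have "countable {s. (1 + s) ^ (l - k) * (om l / om k) \<in> lat}" if "k < l" "l \<le> N" for k l
      by (rule countable_scaled_lat) (use that om_nz[of k] om_nz[of l] in auto)
    moreover have "countable {(k, l). k < l \<and> l \<le> N}" by (rule countable_subset[of _ UNIV]) auto
    ultimately show ?thesis unfolding Bad_def by (intro countable_Un countable_UN) auto
  qed
  have good: "D s = 0" if s: "s \<notin> Bad" for s
  proof -
    have s1: "1 + s \<noteq> 0" using s by (auto simp: Bad_def add_eq_0_iff)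
    interpret P: mukade q t qh th N "us s" v w
    proof
      show "us s j / v j \<notin> lat" if "j \<in> {1..N}" for j using s that unfolding Bad_def us_def by (auto simp: mult.assoc)
      show "us s j \<noteq> 0 \<and> v j \<noteq> 0" if "j \<in> {1..N}" for j using s1 uv0[OF that] by (simp add: us_def)
    qed (rule N1 w0)+
    have oms: "P.om i = (1 + s) ^ i * om i" for i unfolding P.om_def om_def unfolding us_def wpar_scaled by (simp add: mult_ac)
    have "P.om l / P.om k \<notin> lat" if "k < l" "l \<le> N" for k l
    proof -
      have "P.om l / P.om k = (1 + s) ^ (l - k) * (om l / om k)" unfolding oms using s1 that by (simp add: power_diff field_simps)
      then show ?thesis using s that unfolding Bad_def by auto
    qed
    note id = P.main_identity_generic[OF this M, where k = k and d = d and n = n]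
    have T_weight: "P.T_weight \<nu> = T_weight' s \<nu>" for \<nu> by (simp add: P.T_weight_def T_weight'_def)
    have V: "P.VC \<nu> = VC' s \<nu>" "P.VA \<nu> = VA' s \<nu>" for \<nu> by (simp_all add: P.VC_def VC'_def P.VA_def VA'_def)
    have X: "P.XTz \<nu> J M M' p = XT' s \<nu> J p" "P.TXz \<nu> J M M' p = TX' s \<nu> J p" for \<nu> J p
      by (simp_all add: P.XTs_def XT'_def P.TXs_def TX'_def V)
    show ?thesis using id unfolding T_weight X D_def by (simp only: right_minus_eq)
  qed
  have ctsV: "isCont (\<lambda>s. VC' s \<nu> k) 0" "isCont (\<lambda>s. VA' s \<nu> k) 0" if k: "k \<in> {1..N} \<times> {1..}" for \<nu> k
  proof -
    obtain j n where jn: "k = (j, n)" "j \<in> {1..N}" using k by auto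
    show "isCont (\<lambda>s. VC' s \<nu> k) 0" unfolding VC'_def jn prod.case ws[OF jn(2)] by (intro continuous_intros)
    show "isCont (\<lambda>s. VA' s \<nu> k) 0" unfolding VA'_def jn prod.case ws[OF jn(2)] using wnz[OF jn(2)] by (intro continuous_intros) auto
  qed
  have ctsvop: "isCont (\<lambda>s. vop kapN (VC' s \<nu>) (VA' s \<nu>) K L) 0" if "K \<in> fock_basis N" "L \<in> fock_basis N" for \<nu> K L
    by (rule isCont_vop) (use that in \<open>auto simp: fock_basis_def intro!: ctsV\<close>)
  have ctsX: "isCont (\<lambda>s. XT' s \<nu> J p) 0" "isCont (\<lambda>s. TX' s \<nu> J p) 0" for \<nu> J p
    unfolding XT'_def TX'_def using M by (cases "p \<ge> 0"; auto intro!: continuous_intros ctsvop)+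
  have ctsT: "isCont (\<lambda>s. T_weight' s \<nu>) 0" for \<nu>
  proof -
    have "isCont (\<lambda>s. contr_ratio (\<nu> j) (\<nu> (j - 1)) (v j / us s j)) 0" if j: "j \<in> {1..N}" for j
    proof (rule isCont_o2[where g = "contr_ratio (\<nu> j) (\<nu> (j - 1))"])
      show "isCont (\<lambda>s. v j / us s j) 0" unfolding us_def using uv0[OF j] by (intro continuous_intros) auto
      show "isCont (contr_ratio (\<nu> j) (\<nu> (j - 1))) (v j / us 0 j)"
        unfolding us0 using contr_ratio_off_lat(2) vu_off_lat[OF j] analytic_at_imp_isCont by blast
    qed
    then show ?thesis unfolding T_weight'_def site_weight_def Phi_coef_def us_def by (intro continuous_intros) auto
  qed
  have "isCont D 0"
    unfolding D_def[abs_def] case_prod_beta us_def by (intro continuous_intros ctsT ctsX)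
  have "D 0 = 0"
  proof (rule ccontr)
    assume "D 0 \<noteq> 0"
    from continuous_at_avoid[OF \<open>isCont D 0\<close> this] obtain e where e: "e > 0" "\<And>s. dist 0 s < e \<Longrightarrow> D s \<noteq> 0" by blast
    obtain s where "norm s < e" "s \<notin> Bad" using uncountable_good_parameter[OF \<open>countable Bad\<close> e(1)] by blast
    then show False using good e(2)[of s] by simp
  qed
  then show ?thesis unfolding D_def us0 at0 XT'_def TX'_def XTs_def TXs_def by simp
qed


section \<open>Normalization and matrix products\<close>

definition T_reduced :: fock_mat where
  "T_reduced M M' = Abs_fps (\<lambda>d. \<Sum>\<nu>\<in>configs N d. T_weight \<nu> * vop kapN (VC \<nu>) (VA \<nu>) M M')"

text \<open>
  The value 0 keeps the statement uniform: if the common scalar vanishes, so does the normalized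
  operator, since \<open>0 / 0 = 0\<close> for power series.
\<close>
definition vac_inv :: "complex fps" where
  "vac_inv = (if T_scalar = 0 then 0 else inverse (T_reduced {#} {#}))"

lemma T_reduced_vacuum_0: "fps_nth (T_reduced {#} {#}) 0 = 1"
proof -
  have "configs N 0 = {\<lambda>_. []}"
  proof (intro set_eqI iffI)
    fix \<nu> assume \<nu>: "\<nu> \<in> configs N 0"
    have "\<nu> i = []" for i
    proof (cases "i \<in> {1..<N}")
      case True
      then have "sum_list (\<nu> i) = 0" using \<nu> by (auto simp: configs_def)
      moreover have "0 \<notin> set (\<nu> i)" using \<nu> by (auto simp: configs_def is_partition_def)
      ultimately show ?thesis by (cases "\<nu> i") auto
    qed (use \<nu> in \<open>auto simp: configs_def\<close>)
    then show "\<nu> \<in> {\<lambda>_. []}" by auto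
  qed (auto simp: configs_def)
  moreover have "vop kapN A B {#} {#} = 1" for A B by (subst vop_eq_prod[of "{}"]) auto
  moreover have "T_weight (\<lambda>_. []) = 1"
    by (simp add: T_weight_def site_weight_def PhiS_coef_def Phi_coef_def f_fac_def c_fac_def c'_fac_def n_stat_def transp_def part_def contr_ratio_def)
  ultimately show ?thesis by (simp add: T_reduced_def)
qed

lemma TV_eq:
  assumes qt: "N \<ge> 2 \<Longrightarrow> norm q < 1 \<and> norm t > 1" and M: "M \<in> fock_basis N" "M' \<in> fock_basis N"
  shows "TV N u v w M M' = T_reduced M M' * vac_inv"
proof -
  have T: "T_op N u v w K L = fps_const T_scalar * T_reduced K L" if "K \<in> fock_basis N" "L \<in> fock_basis N" for K L
  proof (rule fps_ext)
    fix d
    have "(\<Sum>\<nu>\<in>configs N d. T_term N u v w \<nu> K L) = (\<Sum>\<nu>\<in>configs N d. T_scalar * (T_weight \<nu> * vop kapN (VC \<nu>) (VA \<nu>) K L))"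
      by (rule sum.cong[OF refl], rule T_term_eq) (use that qt in \<open>auto simp: configs_def\<close>)
    then show "fps_nth (T_op N u v w K L) d = fps_nth (fps_const T_scalar * T_reduced K L) d"
      by (simp add: T_op_def T_reduced_def sum_distrib_left)
  qed
  have vac: "{#} \<in> fock_basis N" by (simp add: fock_basis_def)
  show ?thesis
  proof (cases "T_scalar = 0")
    case True
    then show ?thesis unfolding TV_def T[OF M] vac_inv_def by simp
  next
    case False
    have "fps_nth (fps_const T_scalar * T_reduced {#} {#}) 0 \<noteq> 0" using False T_reduced_vacuum_0 by simp
    then have "TV N u v w M M' = fps_const T_scalar * T_reduced M M' * inverse (fps_const T_scalar * T_reduced {#} {#})"
      unfolding TV_def T[OF M] T[OF vac vac] by (rule fps_divide_unit)
    also have "\<dots> = T_reduced M M' * inverse (T_reduced {#} {#}) * (fps_const T_scalar * inverse (fps_const T_scalar))"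
      by (simp only: fps_inverse_mult mult_ac)
    also have "fps_const T_scalar * inverse (fps_const T_scalar) = 1" using False by (simp add: fps_const_inverse)
    finally show ?thesis using False by (simp add: vac_inv_def)
  qed
qed

text \<open>
  The powers of the bookkeeping variable from the parameters of the current and from the partitions
  add up, so a coefficient of the product is a sum over \<open>confs\<close>.
\<close>
lemma confs_coeff:
  "fps_nth (\<Sum>J | J \<subseteq> {1..N} \<and> card J = k. fps_const (a J) * fps_X ^ (\<Sum>j\<in>J. j - 1) * Abs_fps (\<lambda>d. \<Sum>\<nu>\<in>configs N d. b J \<nu>)) d =
   (\<Sum>(J, \<nu>)\<in>confs k d. a J * b J \<nu>)"
proof -
  let ?S = "{J. J \<subseteq> {1..N} \<and> card J = k}" and ?w = "\<lambda>J :: nat set. \<Sum>j\<in>J. j - 1"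
  have fin: "finite ?S" by (rule finite_subset[of _ "Pow {1..N}"]) auto
  have "fps_nth (\<Sum>J\<in>?S. fps_const (a J) * fps_X ^ ?w J * Abs_fps (\<lambda>d. \<Sum>\<nu>\<in>configs N d. b J \<nu>)) d =
      (\<Sum>J\<in>?S. if ?w J \<le> d then \<Sum>\<nu>\<in>configs N (d - ?w J). a J * b J \<nu> else 0)"
    unfolding fps_sum_nth by (rule sum.cong) (auto simp: mult.assoc fps_X_power_mult_nth sum_distrib_left)
  also have "\<dots> = (\<Sum>J\<in>{J\<in>?S. ?w J \<le> d}. \<Sum>\<nu>\<in>configs N (d - ?w J). a J * b J \<nu>)"
    by (rule sum.mono_neutral_cong_right) (use fin in auto)
  also have "\<dots> = (\<Sum>(J, \<nu>)\<in>(SIGMA J:{J\<in>?S. ?w J \<le> d}. configs N (d - ?w J)). a J * b J \<nu>)"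
    by (rule sum.Sigma) (use fin finite_configs in auto)
  also have "(SIGMA J:{J\<in>?S. ?w J \<le> d}. configs N (d - ?w J)) = confs k d"
    unfolding confs_def configs_def by auto
  finally show ?thesis .
qed

lemma mat_comp_XT:
  assumes qt: "N \<ge> 2 \<Longrightarrow> norm q < 1 \<and> norm t > 1" and M: "M \<in> fock_basis N" "M' \<in> fock_basis N"
  shows "mat_comp N (X_mode N k v n) (TV N u v w) M M' =
    Abs_fps (\<lambda>d. \<Sum>(J, \<nu>)\<in>confs k d. (\<Prod>j\<in>J. v j) * T_weight \<nu> * XTz \<nu> J M M' (int (mwt snd M) + n)) * vac_inv"
proof -
  let ?p = "int (mwt snd M) + n" and ?S = "{J. J \<subseteq> {1..N} \<and> card J = k}" and ?X = "X_mode N k v n" and ?T = "TV N u v w"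
  let ?L = "\<lambda>J. vop kapN (LamC (js J)) (LamA (js J)) M"
  show ?thesis
  proof (cases "?p \<ge> 0")
    case False
    then have "?X M K = 0" for K unfolding X_mode_eq by simp
    then show ?thesis unfolding mat_comp_def if_not_P[OF False] by (simp add: case_prod_beta fps_zero_def[symmetric])
  next
    case True
    let ?K = "{K. K \<in> fock_basis N \<and> mwt snd K = nat ?p}"
    have finK: "finite ?K" using finite_fock_weight[of N "nat ?p"] by simp
    have "mat_comp N ?X ?T M M' = (\<Sum>K\<in>?K. ?X M K * ?T K M')"
      unfolding mat_comp_def
    proof (rule sum.mono_neutral_left[OF finK])
      show "{K \<in> fock_basis N. ?X M K * ?T K M' \<noteq> 0} \<subseteq> ?K"
      proof
        fix K assume "K \<in> {K \<in> fock_basis N. ?X M K * ?T K M' \<noteq> 0}"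
        then have "K \<in> fock_basis N" "?X M K \<noteq> 0" by auto
        moreover from this(2) have "int (mwt snd K) = ?p" unfolding X_mode_eq by (simp split: if_splits)
        ultimately show "K \<in> ?K" by auto
      qed
    qed auto
    also have "\<dots> = (\<Sum>K\<in>?K. (\<Sum>J\<in>?S. fps_const ((\<Prod>j\<in>J. v j) * ?L J K) * fps_X ^ (\<Sum>j\<in>J. j - 1)) * (T_reduced K M' * vac_inv))"
      by (rule sum.cong[OF refl]) (use True M in \<open>simp add: TV_eq[OF qt] X_mode_eq\<close>)
    also have "\<dots> = (\<Sum>J\<in>?S. fps_const (\<Prod>j\<in>J. v j) * fps_X ^ (\<Sum>j\<in>J. j - 1) * (\<Sum>K\<in>?K. fps_const (?L J K) * T_reduced K M')) * vac_inv"
      unfolding sum_distrib_right sum_distrib_left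
      by (subst sum.swap) (simp add: fps_const_mult[symmetric] mult_ac del: fps_const_mult)
    finally have eq1: "mat_comp N ?X ?T M M' = (\<Sum>J\<in>?S. fps_const (\<Prod>j\<in>J. v j) * fps_X ^ (\<Sum>j\<in>J. j - 1) *
        (\<Sum>K\<in>?K. fps_const (?L J K) * T_reduced K M')) * vac_inv" .
    have inner: "(\<Sum>K\<in>?K. fps_const (?L J K) * T_reduced K M') = Abs_fps (\<lambda>d. \<Sum>\<nu>\<in>configs N d. T_weight \<nu> * XTs \<nu> J M M' (nat ?p))" for J
    proof (rule fps_ext)
      fix d
      show "fps_nth (\<Sum>K\<in>?K. fps_const (?L J K) * T_reduced K M') d = fps_nth (Abs_fps (\<lambda>d. \<Sum>\<nu>\<in>configs N d. T_weight \<nu> * XTs \<nu> J M M' (nat ?p))) d"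
        unfolding fps_sum_nth fps_mult_left_const_nth T_reduced_def fps_nth_Abs_fps XTs_def sum_distrib_left
        by (subst sum.swap) (intro sum.cong refl mult.left_commute)
    qed
    show ?thesis unfolding eq1 inner if_P[OF True]
      by (rule arg_cong2[of _ _ _ _ times, OF _ refl], rule fps_ext, unfold confs_coeff fps_nth_Abs_fps) (simp only: mult.assoc)
  qed
qed

lemma mat_comp_TX:
  assumes qt: "N \<ge> 2 \<Longrightarrow> norm q < 1 \<and> norm t > 1" and M: "M \<in> fock_basis N" "M' \<in> fock_basis N"
  shows "mat_comp N (TV N u v w) (X_mode N k u n) M M' =
    Abs_fps (\<lambda>d. \<Sum>(J, \<nu>)\<in>confs k d. (\<Prod>j\<in>J. u j) * T_weight \<nu> * TXz \<nu> J M M' (int (mwt snd M') - n)) * vac_inv"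
proof -
  let ?p = "int (mwt snd M') - n" and ?S = "{J. J \<subseteq> {1..N} \<and> card J = k}" and ?X = "X_mode N k u n" and ?T = "TV N u v w"
  let ?L = "\<lambda>J K. vop kapN (LamC (js J)) (LamA (js J)) K M'"
  have swap: "a * (b * c) = b * (c * a)" for a b c :: complex by (simp only: mult_ac)
  have X: "?X K M' = (if int (mwt snd K) = ?p then \<Sum>J\<in>?S. fps_const ((\<Prod>j\<in>J. u j) * ?L J K) * fps_X ^ (\<Sum>j\<in>J. j - 1) else 0)" for K
    unfolding X_mode_eq by (rule if_cong) auto
  show ?thesis
  proof (cases "?p \<ge> 0")
    case False
    then have "?X K M' = 0" for K unfolding X by simp
    then show ?thesis unfolding mat_comp_def if_not_P[OF False] by (simp add: case_prod_beta fps_zero_def[symmetric])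
  next
    case True
    let ?K = "{K. K \<in> fock_basis N \<and> mwt snd K = nat ?p}"
    have finK: "finite ?K" using finite_fock_weight[of N "nat ?p"] by simp
    have "mat_comp N ?T ?X M M' = (\<Sum>K\<in>?K. ?T M K * ?X K M')"
      unfolding mat_comp_def
    proof (rule sum.mono_neutral_left[OF finK])
      show "{K \<in> fock_basis N. ?T M K * ?X K M' \<noteq> 0} \<subseteq> ?K"
      proof
        fix K assume "K \<in> {K \<in> fock_basis N. ?T M K * ?X K M' \<noteq> 0}"
        then have "K \<in> fock_basis N" "?X K M' \<noteq> 0" by auto
        moreover from this(2) have "int (mwt snd K) = ?p" unfolding X by (simp split: if_splits)
        ultimately show "K \<in> ?K" by auto
      qed
    qed auto
    also have "\<dots> = (\<Sum>K\<in>?K. (T_reduced M K * vac_inv) * (\<Sum>J\<in>?S. fps_const ((\<Prod>j\<in>J. u j) * ?L J K) * fps_X ^ (\<Sum>j\<in>J. j - 1)))"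
      by (rule sum.cong[OF refl]) (use True M in \<open>simp add: TV_eq[OF qt] X\<close>)
    also have "\<dots> = (\<Sum>J\<in>?S. fps_const (\<Prod>j\<in>J. u j) * fps_X ^ (\<Sum>j\<in>J. j - 1) * (\<Sum>K\<in>?K. fps_const (?L J K) * T_reduced M K)) * vac_inv"
      unfolding sum_distrib_right sum_distrib_left
      by (subst sum.swap) (simp add: fps_const_mult[symmetric] mult_ac del: fps_const_mult)
    finally have eq1: "mat_comp N ?T ?X M M' = (\<Sum>J\<in>?S. fps_const (\<Prod>j\<in>J. u j) * fps_X ^ (\<Sum>j\<in>J. j - 1) *
        (\<Sum>K\<in>?K. fps_const (?L J K) * T_reduced M K)) * vac_inv" .
    have inner: "(\<Sum>K\<in>?K. fps_const (?L J K) * T_reduced M K) = Abs_fps (\<lambda>d. \<Sum>\<nu>\<in>configs N d. T_weight \<nu> * TXs \<nu> J M M' (nat ?p))" for J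
    proof (rule fps_ext)
      fix d
      show "fps_nth (\<Sum>K\<in>?K. fps_const (?L J K) * T_reduced M K) d = fps_nth (Abs_fps (\<lambda>d. \<Sum>\<nu>\<in>configs N d. T_weight \<nu> * TXs \<nu> J M M' (nat ?p))) d"
        unfolding fps_sum_nth fps_mult_left_const_nth T_reduced_def fps_nth_Abs_fps TXs_def sum_distrib_left
        by (subst sum.swap) (intro sum.cong refl swap)
    qed
    show ?thesis unfolding eq1 inner if_P[OF True]
      by (rule arg_cong2[of _ _ _ _ times, OF _ refl], rule fps_ext, unfold confs_coeff fps_nth_Abs_fps) (simp only: mult.assoc)
  qed
qed

text \<open>
  The weights and the vacuum factor are the same on both sides, so the relation is the identity of
  modes, coefficient by coefficient.
\<close>
theorem intertwining:
  assumes qt: "N \<ge> 2 \<Longrightarrow> norm q < 1 \<and> norm t > 1" and M: "M \<in> fock_basis N" "M' \<in> fock_basis N"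
  shows "one_minus_over_z w (\<lambda>m. mat_comp N (X_mode N k v m) (TV N u v w)) n M M' =
    fps_const (inverse gam ^ k) * one_minus_over_z (gam ^ (2 * k) * w) (\<lambda>m. mat_comp N (TV N u v w) (X_mode N k u m)) n M M'"
proof -
  let ?A = "\<lambda>p. Abs_fps (\<lambda>d. \<Sum>(J, \<nu>)\<in>confs k d. (\<Prod>j\<in>J. v j) * T_weight \<nu> * XTz \<nu> J M M' p)"
  let ?B = "\<lambda>p. Abs_fps (\<lambda>d. \<Sum>(J, \<nu>)\<in>confs k d. (\<Prod>j\<in>J. u j) * T_weight \<nu> * TXz \<nu> J M M' p)"
  let ?m = "int (mwt snd M) + n" and ?m' = "int (mwt snd M') - n"
  have idx: "int (mwt snd M) + (n - 1) = ?m - 1" "int (mwt snd M') - (n - 1) = ?m' + 1" by simp_all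
  have g: "inverse gam ^ k * (gam ^ (2 * k) * w) = w * gam ^ k"
    using gam0 by (simp add: mult_2 power_add power_inverse)
  have "?A ?m - fps_const w * ?A (?m - 1) =
    fps_const (inverse gam ^ k) * ?B ?m' - fps_const (inverse gam ^ k * (gam ^ (2 * k) * w)) * ?B (?m' + 1)"
  proof (rule fps_ext)
    fix d
    have "fps_nth (?A ?m - fps_const w * ?A (?m - 1)) d =
        (\<Sum>(J, \<nu>)\<in>confs k d. (\<Prod>j\<in>J. v j) * T_weight \<nu> * (XTz \<nu> J M M' ?m - w * XTz \<nu> J M M' (?m - 1)))"
      unfolding fps_sub_nth fps_mult_left_const_nth fps_nth_Abs_fps sum_distrib_left sum_subtractf[symmetric]
      by (rule sum.cong) (simp_all only: case_prod_beta right_diff_distrib mult_ac)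
    also have "\<dots> = (\<Sum>(J, \<nu>)\<in>confs k d. (\<Prod>j\<in>J. u j) * T_weight \<nu> * (inverse gam ^ k * TXz \<nu> J M M' ?m' - w * gam ^ k * TXz \<nu> J M M' (?m' + 1)))"
      by (rule main_identity[OF M])
    also have "\<dots> = fps_nth (fps_const (inverse gam ^ k) * ?B ?m' - fps_const (inverse gam ^ k * (gam ^ (2 * k) * w)) * ?B (?m' + 1)) d"
      unfolding g fps_sub_nth fps_mult_left_const_nth fps_nth_Abs_fps sum_distrib_left sum_subtractf[symmetric]
      by (rule sum.cong) (simp_all only: case_prod_beta right_diff_distrib mult_ac)
    finally show "fps_nth (?A ?m - fps_const w * ?A (?m - 1)) d =
        fps_nth (fps_const (inverse gam ^ k) * ?B ?m' - fps_const (inverse gam ^ k * (gam ^ (2 * k) * w)) * ?B (?m' + 1)) d" .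
  qed
  note e = arg_cong[OF this, of "\<lambda>x. x * vac_inv"]
  have "mat_comp N (X_mode N k v m) (TV N u v w) M M' = ?A (int (mwt snd M) + m) * vac_inv"
    and "mat_comp N (TV N u v w) (X_mode N k u m) M M' = ?B (int (mwt snd M') - m) * vac_inv" for m
    using mat_comp_XT mat_comp_TX qt M by blast+
  note comp = this
  show ?thesis
    unfolding one_minus_over_z_def comp idx
    using e by (simp only: left_diff_distrib right_diff_distrib mult.assoc fps_const_mult[symmetric])
qed

end

theorem proposition5p9:
  fixes N i :: nat
    and q t qh th w :: complex
    and u v :: "nat \<Rightarrow> complex"
    and n :: int
    and M M' :: "(nat \<times> nat) multiset"
  defines "\<gamma> \<equiv> qt_setup.gam qh th"
    and "X \<equiv> qt_setup.X_mode q t qh th N"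
    and "\<T> \<equiv> qt_setup.TV q t qh th N u v w"
  assumes N: "N \<ge> 1"
    and qt_nonzero: "q \<noteq> 0" "t \<noteq> 0"
    and roots: "qh ^ 2 = q" "th ^ 2 = t"
    and q_norm: "norm q < 1"
    and qt_generic: "\<And>a b :: int. (a, b) \<noteq> (0, 0) \<Longrightarrow> qh powi a * th powi b \<noteq> 1"
    and t_norm: "norm (inverse t) < norm (q powi (int N - 2))"
    and nonzero: "w \<noteq> 0" "\<And>j. j \<in> {1..N} \<Longrightarrow> u j \<noteq> 0 \<and> v j \<noteq> 0"
    and uv_generic: "\<And>j (a :: int) (b :: int). j \<in> {1..N} \<Longrightarrow> u j / v j \<noteq> qh powi a * th powi b"
    and i: "i \<in> {1..N}"
    and basis: "M \<in> fock_basis N" "M' \<in> fock_basis N"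
  shows "one_minus_over_z w (\<lambda>m. mat_comp N (X i v m) \<T>) n M M' =
         fps_const (inverse \<gamma> ^ i) *
         one_minus_over_z (\<gamma> ^ (2 * i) * w) (\<lambda>m. mat_comp N \<T> (X i u m)) n M M'"
proof -
  interpret generic_qt q t qh th
    by unfold_locales (use qt_nonzero roots qt_generic in auto)
  interpret mukade q t qh th N u v w
  proof
    show "u j / v j \<notin> lat" if "j \<in> {1..N}" for j
      using uv_generic[OF that] unfolding lat_def by blast
  qed (use N nonzero in auto)
  have "norm q < 1 \<and> norm t > 1" if "N \<ge> 2"
  proof -
    have "q powi (int N - 2) = q ^ (N - 2)" using that by (simp add: power_int_def nat_diff_distrib)
    moreover have "norm (q ^ (N - 2)) \<le> 1" using q_norm by (simp add: norm_power power_le_one)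
    ultimately have "inverse (norm t) < 1" using t_norm by (simp add: norm_inverse)
    then show ?thesis using q_norm qt_nonzero by (simp add: inverse_less_1_iff)
  qed
  from intertwining[OF this basis] show ?thesis unfolding \<gamma>_def X_def \<T>_def .
qed

end
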